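(* There exists a continuous process $X=\{X(t):0\le t<\infty\}$ such that $X_{2n+1}$ converges weakly to $X$ as $n\to\infty$ (i.e. converges in law as $C[0,\infty)$-valued random variables). Moreover, $X$ is a centered Gaussian process, which is locally H\"older continuous with exponent $\gamma$ for every $\gamma\in(0,1/4)$, and has covariance function $$E[X(s)X(t)]=\sqrt{st}\,\sin^{-1}\left(\frac{s\wedge t}{\sqrt{st}}\right),\qquad s,t\ge 0,$$ where $\sin^{-1}(\cdot)$ takes values in $[-\pi/2,\pi/2]$ and the right-hand side is interpreted as $0$ when $st=0$.
   Context: Let $\{B_j(t)\}_{j=1}^\infty$ be a sequence of independent, standard, one-dimensional Brownian motions (started at the origin). Define the median function $\mathcal{M}_n:\mathbb{R}^n\to\mathbb{R}$ as follows: if $(x_1,\ldots,x_n)\in\mathbb{R}^n$ and $\tau$ is a permutation of $\{1,\ldots,n\}$ with $x_{\tau(1)}\le\cdots\le x_{\tau(n)}$, then $\mathcal{M}_n(x_1,\ldots,x_n)=x_{\tau(k)}$, where $k=\lfloor (n+1)/2\rfloor$. Define the (continuous) median process $M_n(t)=\mathcal{M}_n(B_1(t),\ldots,B_n(t))$ and the scaled median process $X_n(t)=\sqrt{n}\,M_n(t)$, $0\le t<\infty$. The random variables $X_n$ take values in $C[0,\infty)$, endowed with the topology of uniform convergence on compact sets. *)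

theory Defs
  imports "HOL-Probability.Probability" "HOL-Combinatorics.Combinatorics"
begin

section \<open>The median\<close>

definition sorts_upto :: "nat \<Rightarrow> (nat \<Rightarrow> nat) \<Rightarrow> (nat \<Rightarrow> real) \<Rightarrow> bool" where
  "sorts_upto n \<tau> x \<longleftrightarrow>
     \<tau> permutes {1..n} \<and> (\<forall>i j. 1 \<le> i \<and> i \<le> j \<and> j \<le> n \<longrightarrow> x (\<tau> i) \<le> x (\<tau> j))"

text \<open>
  Only the coordinates \<open>x 1, \<dots>, x n\<close> matter. The lemmas below show that a sorting permutation
  exists and that the value does not depend on its choice.
\<close>
definition median :: "nat \<Rightarrow> (nat \<Rightarrow> real) \<Rightarrow> real" where
  "median n x = (THE y. \<exists>\<tau>. sorts_upto n \<tau> x \<and> y = x (\<tau> ((n + 1) div 2)))"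

lemma sorts_upto_sort:
  assumes "sorts_upto n \<tau> x"
  shows "map (x \<circ> \<tau>) [1..<Suc n] = sort (map x [1..<Suc n])"
proof (rule properties_for_sort[symmetric])
  have p: "\<tau> permutes {1..n}" using assms by (simp add: sorts_upto_def)
  have "mset (map \<tau> [1..<Suc n]) = mset [1..<Suc n]"
  proof -
    have "distinct (map \<tau> [1..<Suc n])"
      using permutes_inj_on[OF p] by (simp add: distinct_map del: upt_Suc)
    moreover have "set (map \<tau> [1..<Suc n]) = set [1..<Suc n]"
      using permutes_image[OF p] by (simp add: atLeastLessThanSuc_atLeastAtMost del: upt_Suc)
    ultimately show ?thesis using distinct_upt set_eq_iff_mset_eq_distinct by blast
  qed
  then have "image_mset x (mset (map \<tau> [1..<Suc n])) = image_mset x (mset [1..<Suc n])"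
    by (rule arg_cong)
  then show "mset (map (x \<circ> \<tau>) [1..<Suc n]) = mset (map x [1..<Suc n])"
    by (simp only: mset_map map_map[symmetric])
  show "sorted (map (x \<circ> \<tau>) [1..<Suc n])"
    using assms by (auto simp: sorted_iff_nth_mono sorts_upto_def simp del: upt_Suc)
qed

lemma sorts_upto_exists: "\<exists>\<tau>. sorts_upto n \<tau> x"
proof -
  let ?l = "sort_key x [1..<Suc n]"
  define \<tau> where "\<tau> i = (if i \<in> {1..n} then ?l ! (i - 1) else i)" for i
  have len: "length ?l = n" by (simp del: upt_Suc)
  have set: "set ?l = {1..n}" by (auto simp del: upt_Suc)
  have dist: "distinct ?l" by (simp del: upt_Suc)
  have inj: "inj_on \<tau> {1..n}"
    by (rule inj_onI) (use dist len in \<open>auto simp: \<tau>_def nth_eq_iff_index_eq simp del: upt_Suc\<close>)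
  have "\<tau> ` {1..n} \<subseteq> {1..n}"
  proof
    fix y assume "y \<in> \<tau> ` {1..n}"
    then obtain i where i: "i \<in> {1..n}" "y = ?l ! (i - 1)" by (auto simp: \<tau>_def)
    then have "?l ! (i - 1) \<in> set ?l" by (intro nth_mem) (use len in auto)
    then show "y \<in> {1..n}" using set i by metis
  qed
  then have "\<tau> ` {1..n} = {1..n}" using inj by (simp add: endo_inj_surj)
  then have "\<tau> permutes {1..n}"
    using inj by (intro bij_imp_permutes) (auto simp: bij_betw_def \<tau>_def)
  moreover have "x (\<tau> i) \<le> x (\<tau> j)" if "1 \<le> i" "i \<le> j" "j \<le> n" for i j
  proof -
    have "sorted (map x ?l)" by simp
    then have "map x ?l ! (i - 1) \<le> map x ?l ! (j - 1)"
      using that len by (intro sorted_nth_mono) (auto simp del: upt_Suc)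
    then show ?thesis using that len by (simp add: \<tau>_def del: upt_Suc)
  qed
  ultimately show ?thesis unfolding sorts_upto_def by blast
qed

lemma median_eq:
  assumes "sorts_upto n \<tau> x" "n \<ge> 1"
  shows "median n x = x (\<tau> ((n + 1) div 2))"
  unfolding median_def
proof (rule the_equality)
  let ?k = "(n + 1) div 2"
  have *: "x (\<sigma> ?k) = sort (map x [1..<Suc n]) ! (?k - 1)" if "sorts_upto n \<sigma> x" for \<sigma>
  proof -
    have k: "?k - 1 < length [1..<Suc n]" "1 + (?k - 1) = ?k"
      using assms(2) by auto
    then have "map (x \<circ> \<sigma>) [1..<Suc n] ! (?k - 1) = x (\<sigma> ?k)"
      by (simp only: nth_map nth_upt comp_apply length_upt less_diff_conv add.commute)
    then show ?thesis
      by (simp only: sorts_upto_sort[OF that])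
  qed
  show "y = x (\<tau> ((n + 1) div 2))"
    if "\<exists>\<sigma>. sorts_upto n \<sigma> x \<and> y = x (\<sigma> ((n + 1) div 2))" for y
    using that *[OF assms(1)] * by auto
qed (use assms in auto)


section \<open>The path space \<open>C[0,\<infinity>)\<close>\<close>

typedef cpath = "{f :: real \<Rightarrow> real. f \<in> extensional {0..} \<and> continuous_on {0..} f}"
  by (rule exI[of _ "restrict (\<lambda>_. 0) {0..}"]) (auto intro: continuous_on_eq[of _ "\<lambda>_. 0"])

text \<open>The topology of uniform convergence on compact subsets of \<open>[0,\<infinity>)\<close>.\<close>

instantiation cpath :: topological_space
begin

definition open_cpath :: "cpath set \<Rightarrow> bool" where
  "open_cpath U \<longleftrightarrow>
     (\<forall>f\<in>U. \<exists>K \<epsilon>. compact K \<and> K \<subseteq> {0..} \<and> \<epsilon> > 0 \<and>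
        (\<forall>g. (\<forall>t\<in>K. \<bar>Rep_cpath g t - Rep_cpath f t\<bar> < \<epsilon>) \<longrightarrow> g \<in> U))"

instance
proof
  show "open (UNIV :: cpath set)"
    unfolding open_cpath_def by (auto intro!: exI[of _ "{}"] exI[of _ "1::real"])
next
  fix S T :: "cpath set"
  assume S: "open S" and T: "open T"
  show "open (S \<inter> T)"
    unfolding open_cpath_def
  proof
    fix f assume f: "f \<in> S \<inter> T"
    from S f obtain K a where K: "compact K" "K \<subseteq> {0..}" "a > 0"
      "\<And>g. (\<forall>t\<in>K. \<bar>Rep_cpath g t - Rep_cpath f t\<bar> < a) \<Longrightarrow> g \<in> S"
      unfolding open_cpath_def by (metis IntE)
    from T f obtain L b where L: "compact L" "L \<subseteq> {0..}" "b > 0"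
      "\<And>g. (\<forall>t\<in>L. \<bar>Rep_cpath g t - Rep_cpath f t\<bar> < b) \<Longrightarrow> g \<in> T"
      unfolding open_cpath_def by (metis IntE)
    show "\<exists>K \<epsilon>. compact K \<and> K \<subseteq> {0..} \<and> \<epsilon> > 0 \<and>
        (\<forall>g. (\<forall>t\<in>K. \<bar>Rep_cpath g t - Rep_cpath f t\<bar> < \<epsilon>) \<longrightarrow> g \<in> S \<inter> T)"
      by (rule exI[of _ "K \<union> L"], rule exI[of _ "min a b"])
         (use K L in \<open>auto intro: compact_Un\<close>)
  qed
next
  fix \<U> :: "cpath set set"
  assume *: "\<forall>U\<in>\<U>. open U"
  show "open (\<Union>\<U>)"
    unfolding open_cpath_def
  proof
    fix f assume "f \<in> \<Union>\<U>"
    then obtain U where U: "U \<in> \<U>" "f \<in> U" by blast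
    with * have "open U" by blast
    then show "\<exists>K \<epsilon>. compact K \<and> K \<subseteq> {0..} \<and> \<epsilon> > 0 \<and>
        (\<forall>g. (\<forall>t\<in>K. \<bar>Rep_cpath g t - Rep_cpath f t\<bar> < \<epsilon>) \<longrightarrow> g \<in> \<Union>\<U>)"
      using U unfolding open_cpath_def by (meson UnionI)
  qed
qed

end


section \<open>Stochastic processes indexed by \<open>[0,\<infinity>)\<close>\<close>

text \<open>
  A process is a function \<open>X :: real \<Rightarrow> 'a \<Rightarrow> real\<close> (time first); its values at negative times
  are irrelevant.
\<close>

definition continuous_process :: "'a measure \<Rightarrow> (real \<Rightarrow> 'a \<Rightarrow> real) \<Rightarrow> bool" where
  "continuous_process M X \<longleftrightarrow>
     (\<forall>t\<ge>0. X t \<in> borel_measurable M) \<and> (\<forall>\<omega>\<in>space M. continuous_on {0..} (\<lambda>t. X t \<omega>))"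

text \<open>Meaningful only where the path of \<open>\<omega>\<close> is continuous on \<open>[0,\<infinity>)\<close>.\<close>
definition path_of :: "(real \<Rightarrow> 'a \<Rightarrow> real) \<Rightarrow> 'a \<Rightarrow> cpath" where
  "path_of X \<omega> = Abs_cpath (\<lambda>t\<in>{0..}. X t \<omega>)"

definition brownian_motion :: "'a measure \<Rightarrow> (real \<Rightarrow> 'a \<Rightarrow> real) \<Rightarrow> bool" where
  "brownian_motion M B \<longleftrightarrow>
     continuous_process M B \<and>
     (AE \<omega> in M. B 0 \<omega> = 0) \<and>
     (\<forall>s t. 0 \<le> s \<and> s < t \<longrightarrow>
        distributed M lborel (\<lambda>\<omega>. B t \<omega> - B s \<omega>) (normal_density 0 (sqrt (t - s)))) \<and>
     (\<forall>(k::nat) t. 0 \<le> t 0 \<and> (\<forall>i<k. t i \<le> t (Suc i)) \<longrightarrow>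
        prob_space.indep_vars M (\<lambda>_. borel) (\<lambda>i \<omega>. B (t (Suc i)) \<omega> - B (t i) \<omega>) {..<k})"

text \<open>Independence of whole processes, as random elements of the product space over \<open>[0,\<infinity>)\<close>.\<close>
definition independent_processes ::
    "'a measure \<Rightarrow> (nat \<Rightarrow> real \<Rightarrow> 'a \<Rightarrow> real) \<Rightarrow> nat set \<Rightarrow> bool" where
  "independent_processes M B I \<longleftrightarrow>
     prob_space.indep_vars M (\<lambda>_. Pi\<^sub>M {0..} (\<lambda>_. borel)) (\<lambda>j \<omega>. \<lambda>t\<in>{0..}. B j t \<omega>) I"

definition median_process :: "(nat \<Rightarrow> real \<Rightarrow> 'a \<Rightarrow> real) \<Rightarrow> nat \<Rightarrow> real \<Rightarrow> 'a \<Rightarrow> real" where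
  "median_process B n t \<omega> = median n (\<lambda>j. B j t \<omega>)"

definition scaled_median_process ::
    "(nat \<Rightarrow> real \<Rightarrow> 'a \<Rightarrow> real) \<Rightarrow> nat \<Rightarrow> real \<Rightarrow> 'a \<Rightarrow> real" where
  "scaled_median_process B n t \<omega> = sqrt (real n) * median_process B n t \<omega>"

text \<open>
  Weak convergence of random elements of a topological space; the measurability conditions
  ensure that all expectations below are genuine ones.
\<close>
definition converges_in_law ::
    "'a measure \<Rightarrow> (nat \<Rightarrow> 'a \<Rightarrow> 'c::topological_space) \<Rightarrow> 'b measure \<Rightarrow> ('b \<Rightarrow> 'c) \<Rightarrow> bool" where
  "converges_in_law M Y N Z \<longleftrightarrow>
     (\<forall>n. Y n \<in> measurable M borel) \<and> Z \<in> measurable N borel \<and>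
     (\<forall>F :: 'c \<Rightarrow> real. continuous_on UNIV F \<and> bounded (range F) \<longrightarrow>
        (\<lambda>n. \<integral>\<omega>. F (Y n \<omega>) \<partial>M) \<longlonglongrightarrow> (\<integral>\<omega>. F (Z \<omega>) \<partial>N))"

text \<open>Normal distribution with mean \<open>\<mu>\<close> and variance \<open>v\<close>, including the degenerate case \<open>v = 0\<close>.\<close>
definition normal_rv :: "'a measure \<Rightarrow> ('a \<Rightarrow> real) \<Rightarrow> real \<Rightarrow> real \<Rightarrow> bool" where
  "normal_rv M Y \<mu> v \<longleftrightarrow>
     Y \<in> borel_measurable M \<and>
     ((v = 0 \<and> (AE \<omega> in M. Y \<omega> = \<mu>)) \<or>
      (v > 0 \<and> distributed M lborel Y (normal_density \<mu> (sqrt v))))"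

definition gaussian_process :: "'a measure \<Rightarrow> (real \<Rightarrow> 'a \<Rightarrow> real) \<Rightarrow> bool" where
  "gaussian_process M X \<longleftrightarrow>
     (\<forall>J c. finite J \<and> J \<subseteq> {0..} \<longrightarrow> (\<exists>\<mu> v. normal_rv M (\<lambda>\<omega>. \<Sum>t\<in>J. c t * X t \<omega>) \<mu> v))"

definition centered_process :: "'a measure \<Rightarrow> (real \<Rightarrow> 'a \<Rightarrow> real) \<Rightarrow> bool" where
  "centered_process M X \<longleftrightarrow> (\<forall>t\<ge>0. integrable M (X t) \<and> (\<integral>\<omega>. X t \<omega> \<partial>M) = 0)"

definition locally_holder :: "real \<Rightarrow> (real \<Rightarrow> real) \<Rightarrow> bool" where
  "locally_holder \<gamma> f \<longleftrightarrow>
     (\<forall>T\<ge>0. \<exists>C. \<forall>s\<in>{0..T}. \<forall>t\<in>{0..T}. \<bar>f t - f s\<bar> \<le> C * \<bar>t - s\<bar> powr \<gamma>)"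

end

theory Submission
  imports Defs
begin

text \<open>
  The median of an odd number of reals is at most \<open>y\<close> iff the majority of them is, so events about
  the median are events about sums of independent indicators.

  Finite-dimensional limits: after division by \<open>sqrt t\<close>, the median at time \<open>t\<close> is asymptotically
  linear in the centred number of nonpositive particles. The multivariate central limit theorem for
  these indicators, the orthant probability \<open>1/4 + arctan (sqrt (s / (t - s))) / (2 pi)\<close> of two
  Brownian values and Levy's continuity theorem on sequences then give the Gaussian limit with the
  arcsine covariance.

  Tightness: if the rescaled median jumps by more than \<open>2 y\<close>, then it crosses a cell of a grid of
  mesh \<open>y\<close>, and then a sum of \<open>n\<close> bounded independent variables with mean at most \<open>- c y\<close> and second
  moment of order \<open>sqrt (h / t) + y\<close> is nonnegative, which is exponentially unlikely. With
  \<open>y\<close> slightly larger than \<open>(h / t) powr (1 / 4) / sqrt n\<close> this bounds all dyadic increments by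
  \<open>h powr (1 / 4 - d)\<close>, up to probability \<open>O(h ^ 3)\<close> uniformly in \<open>n\<close>, and chaining turns this into
  a uniform Hoelder modulus. Increments over \<open>h < n powr - 2\<close> are controlled by the largest
  increment of a single particle.

  The limit process is built from a Cholesky decomposition of its covariance at the dyadic times
  and inherits its Hoelder modulus from the prelimits.
\<close>

section \<open>The path space as a metric space\<close>

text \<open>Weak convergence on the path space is reduced to bounded Lipschitz functionals. A path
  is then replaced by its piecewise linear interpolant, a continuous function of a sequence of grid
  values. Two inputs remain: weak convergence of such sequences, and an interpolation error that is
  small in probability uniformly in the number of particles. The median is divided by
  \<open>sqrt t\<close> so that one distribution function \<open>Phi\<close> governs all positive
  times; time 0 is lost by this, so increments from 0 are treated apart. All levels are kept in
  \<open>[-2, 2]\<close>, where the density is bounded below. The Lipschitz bound on the median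
  costs \<open>sqrt n * sqrt h\<close>, which is below \<open>h powr (1 / 4)\<close> exactly when
  \<open>h < n powr - 2\<close>. For larger \<open>h\<close> only few particles change sides of a
  level, and it is this small second moment, not just the mean, that yields the exponent 1/4. The
  space \<open>M\<close> already carries independent standard normals \<open>Z j 1\<close>, so the
  limit is constructed on \<open>M\<close> itself and moved to the path space only at the
  end.\<close>

lemma continuous_on_Rep_cpath: "continuous_on {0..} (Rep_cpath f)"
  using Rep_cpath[of f] by auto

lemma continuous_on_Rep_cpath_subset: "S \<subseteq> {0..} \<Longrightarrow> continuous_on S (Rep_cpath f)"
  using continuous_on_Rep_cpath continuous_on_subset by blast

lemma cpath_eqI:
  assumes "\<And>t. 0 \<le> t \<Longrightarrow> Rep_cpath f t = Rep_cpath g t"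
  shows "f = g"
proof -
  have "Rep_cpath f = Rep_cpath g"
    using Rep_cpath[of f] Rep_cpath[of g] assms by (intro extensionalityI[of _ "{0..}"]) auto
  then show ?thesis by (simp add: Rep_cpath_inject)
qed

lemma Rep_Abs_cpath:
  assumes "continuous_on {0..} f" "0 \<le> t"
  shows "Rep_cpath (Abs_cpath (restrict f {0..})) t = f t"
proof -
  have "continuous_on {0..} (restrict f {0..})"
    using assms(1) by (rule continuous_on_eq) auto
  then show ?thesis using assms(2) by (subst Abs_cpath_inverse) auto
qed

lemma Rep_path_of:
  assumes "continuous_on {0..} (\<lambda>t. X t \<omega>)" "0 \<le> t"
  shows "Rep_cpath (path_of X \<omega>) t = X t \<omega>"
  unfolding path_of_def using Rep_Abs_cpath[OF assms] by simp

instantiation cpath :: metric_space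
begin

text \<open>The weight \<open>1 / (1 + t)\<close> caps the distance at time \<open>t\<close>, so that closeness only controls
  the paths on compact time intervals.\<close>

definition dist_cpath :: "cpath \<Rightarrow> cpath \<Rightarrow> real" where
  "dist_cpath f g = (SUP t\<in>{0..}. min \<bar>Rep_cpath f t - Rep_cpath g t\<bar> (1 / (1 + t)))"

definition uniformity_cpath :: "(cpath \<times> cpath) filter" where
  "uniformity_cpath = (INF e\<in>{0<..}. principal {(x, y). dist x y < e})"

lemma dist_cpath_le_iff:
  "dist (f::cpath) g \<le> e \<longleftrightarrow> (\<forall>t\<ge>0. min \<bar>Rep_cpath f t - Rep_cpath g t\<bar> (1 / (1 + t)) \<le> e)"
proof -
  have "bdd_above ((\<lambda>t. min \<bar>Rep_cpath f t - Rep_cpath g t\<bar> (1 / (1 + t))) ` {0..})"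
    by (rule bdd_aboveI2[of _ _ 1]) (auto simp: min_le_iff_disj field_simps)
  then show ?thesis unfolding dist_cpath_def
    by (subst cSUP_le_iff) auto
qed

lemma dist_cpath_ge: "0 \<le> t \<Longrightarrow> min \<bar>Rep_cpath f t - Rep_cpath g t\<bar> (1 / (1 + t)) \<le> dist f g"
  using dist_cpath_le_iff[of f g "dist f g"] by simp

lemma dist_cpath_leI:
  assumes "\<And>t. 0 \<le> t \<Longrightarrow> t \<le> T \<Longrightarrow> \<bar>Rep_cpath f t - Rep_cpath g t\<bar> \<le> e" "1 / (1 + T) \<le> e" "0 \<le> T"
  shows "dist f g \<le> e"
  unfolding dist_cpath_le_iff
proof (intro allI impI)
  fix t :: real assume t: "0 \<le> t"
  show "min \<bar>Rep_cpath f t - Rep_cpath g t\<bar> (1 / (1 + t)) \<le> e"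
  proof (cases "t \<le> T")
    case False
    then have "1 / (1 + t) \<le> 1 / (1 + T)" using assms(3) by (intro divide_left_mono) auto
    then show ?thesis using assms(2) by linarith
  qed (use assms(1)[OF t] in auto)
qed

lemma dist_cpathD:
  assumes "dist f g < e" "e \<le> 1 / (1 + T)" "0 \<le> t" "t \<le> T"
  shows "\<bar>Rep_cpath f t - Rep_cpath g t\<bar> < e"
proof -
  have "1 / (1 + T) \<le> 1 / (1 + t)" using assms(3,4) by (intro divide_left_mono) auto
  then show ?thesis using dist_cpath_ge[OF assms(3), of f g] assms(1,2) by linarith
qed

instance
proof
  show "uniformity = (INF e\<in>{0<..}. principal {(x::cpath, y). dist x y < e})"
    by (rule uniformity_cpath_def)
next
  fix x y z :: cpath
  have "dist x y = 0 \<Longrightarrow> x = y"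
  proof (rule cpath_eqI)
    fix t :: real assume "dist x y = 0" "0 \<le> t"
    then show "Rep_cpath x t = Rep_cpath y t"
      using dist_cpath_ge[of t x y] by (auto simp: min_le_iff_disj field_simps)
  qed
  moreover have "dist x x = 0"
    by (simp add: dist_cpath_def min_def)
  ultimately show "(dist x y = 0) = (x = y)" by blast
  show "dist x y \<le> dist x z + dist y z"
    unfolding dist_cpath_le_iff
  proof (intro allI impI)
    fix t :: real assume t: "0 \<le> t"
    then have "0 \<le> 1 / (1 + t)" by simp
    then show "min \<bar>Rep_cpath x t - Rep_cpath y t\<bar> (1 / (1 + t)) \<le> dist x z + dist y z"
      using dist_cpath_ge[OF t, of x z] dist_cpath_ge[OF t, of y z] by linarith
  qed
next
  fix U :: "cpath set"
  have ev: "(\<forall>x\<in>U. \<forall>\<^sub>F (x', y) in uniformity. x' = x \<longrightarrow> y \<in> U) \<longleftrightarrow>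
      (\<forall>x\<in>U. \<exists>e>0. \<forall>y. dist x y < e \<longrightarrow> y \<in> U)"
    unfolding uniformity_cpath_def
    apply (subst eventually_INF_base)
      apply (auto simp: eventually_principal Bex_def subset_iff intro: exI[of _ "min _ _"])
    done
  \<comment> \<open>The topology was fixed beforehand by uniform closeness on compacta, so the
    metric must be shown to induce it. A compact \<open>K\<close> lies in some
    \<open>[0, T]\<close>, where balls of radius at most \<open>1 / (1 + T)\<close> control
    uniformly; conversely closeness on \<open>[0, 2 / e]\<close> suffices, since the cap beyond is
    at most \<open>e / 2\<close>.\<close>
  have "open U \<longleftrightarrow> (\<forall>x\<in>U. \<exists>e>0. \<forall>y. dist x y < e \<longrightarrow> y \<in> U)"
    unfolding open_cpath_def
  proof (intro ball_cong refl iffI)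
    fix f assume "\<exists>K e. compact K \<and> K \<subseteq> {0..} \<and> 0 < e \<and>
      (\<forall>g. (\<forall>t\<in>K. \<bar>Rep_cpath g t - Rep_cpath f t\<bar> < e) \<longrightarrow> g \<in> U)"
    then obtain K e where K: "compact K" "K \<subseteq> {0..}" "e > 0"
      "\<And>g. (\<forall>t\<in>K. \<bar>Rep_cpath g t - Rep_cpath f t\<bar> < e) \<Longrightarrow> g \<in> U" by blast
    obtain T where T: "\<And>t. t \<in> K \<Longrightarrow> t \<le> T" "0 \<le> T"
    proof -
      obtain b where "\<forall>x\<in>K. norm x \<le> b" using compact_imp_bounded[OF K(1)] bounded_iff by blast
      then show ?thesis by (intro that[of "max b 0"]) fastforce+
    qed
    show "\<exists>e>0. \<forall>y. dist f y < e \<longrightarrow> y \<in> U"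
    proof (intro exI[of _ "min e (1 / (1 + T))"] conjI allI impI K(4) ballI)
      fix g t assume g: "dist f g < min e (1 / (1 + T))" "t \<in> K"
      have "\<bar>Rep_cpath f t - Rep_cpath g t\<bar> < min e (1 / (1 + T))"
        by (rule dist_cpathD[OF g(1), where T = T]) (use K(2) T g in auto)
      then show "\<bar>Rep_cpath g t - Rep_cpath f t\<bar> < e" by linarith
    qed (use K T in auto)
  next
    fix f assume "\<exists>e>0. \<forall>y. dist f y < e \<longrightarrow> y \<in> U"
    then obtain e where e: "e > 0" "\<And>g. dist f g < e \<Longrightarrow> g \<in> U" by blast
    show "\<exists>K e. compact K \<and> K \<subseteq> {0..} \<and> 0 < e \<and>
      (\<forall>g. (\<forall>t\<in>K. \<bar>Rep_cpath g t - Rep_cpath f t\<bar> < e) \<longrightarrow> g \<in> U)"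
    proof (intro exI[of _ "{0..2/e}"] exI[of _ "e/2"] conjI allI impI e(2))
      fix g assume g: "\<forall>t\<in>{0..2/e}. \<bar>Rep_cpath g t - Rep_cpath f t\<bar> < e/2"
      have "dist f g \<le> e/2"
      proof (rule dist_cpath_leI[of "2/e"])
        show "\<bar>Rep_cpath f t - Rep_cpath g t\<bar> \<le> e / 2" if "0 \<le> t" "t \<le> 2 / e" for t
          using g[rule_format, of t] that by (auto simp: abs_minus_commute)
        show "1 / (1 + 2 / e) \<le> e / 2" "0 \<le> 2 / e" using e(1) by (simp_all add: field_simps)
      qed
      then show "dist f g < e" using e(1) by linarith
    qed (use e(1) in auto)
  qed
  then show "open U \<longleftrightarrow> (\<forall>x\<in>U. \<forall>\<^sub>F (x', y) in uniformity. x' = x \<longrightarrow> y \<in> U)"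
    unfolding ev .
qed

end

section \<open>Evaluation maps and piecewise linear interpolation of paths\<close>

lemma continuous_on_eval_cpath:
  assumes "0 \<le> t"
  shows "continuous_on UNIV (\<lambda>f. Rep_cpath f t)"
  unfolding continuous_on_iff
proof (intro ballI allI impI)
  fix f :: cpath and e :: real assume e: "e > 0"
  show "\<exists>d>0. \<forall>g\<in>UNIV. dist g f < d \<longrightarrow> dist (Rep_cpath g t) (Rep_cpath f t) < e"
  proof (intro exI[of _ "min e (1 / (1 + t))"] conjI ballI impI)
    fix g assume "dist g f < min e (1 / (1 + t))"
    from dist_cpathD[OF this _ assms order_refl]
    show "dist (Rep_cpath g t) (Rep_cpath f t) < e" by (simp add: dist_real_def)
  qed (use e assms in auto)
qed

lemma borel_measurable_eval_cpath: "0 \<le> t \<Longrightarrow> (\<lambda>f. Rep_cpath f t) \<in> borel_measurable borel"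
  by (intro borel_measurable_continuous_onI continuous_on_eval_cpath)

text \<open>A sum of hat functions: piecewise linear interpolation of \<open>x\<close> on the grid
  \<open>k / 2 ^ m\<close> up to time \<open>m\<close>, so that mesh and horizon improve together.
  The data are a whole sequence, which makes this a continuous map on
  \<open>nat \<Rightarrow> real\<close> to which weak convergence of sequences applies.\<close>

definition interp_cpath :: "nat \<Rightarrow> (nat \<Rightarrow> real) \<Rightarrow> cpath" where
  "interp_cpath m x =
     Abs_cpath (\<lambda>t\<in>{0..}. \<Sum>k\<le>m * 2 ^ m. x k * max 0 (1 - \<bar>2 ^ m * t - real k\<bar>))"

lemma Rep_interp_cpath:
  "0 \<le> t \<Longrightarrow> Rep_cpath (interp_cpath m x) t =
     (\<Sum>k\<le>m * 2 ^ m. x k * max 0 (1 - \<bar>2 ^ m * t - real k\<bar>))"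
  unfolding interp_cpath_def by (rule Rep_Abs_cpath) (auto intro!: continuous_intros)

text \<open>Each hat takes values in \<open>[0, 1]\<close>, so two interpolants differ by at most
  the sum of finitely many coordinate differences.\<close>

lemma continuous_on_interp_cpath: "continuous_on UNIV (interp_cpath m)"
proof -
  have "(interp_cpath m \<longlongrightarrow> interp_cpath m x) (at x)" for x
  proof (rule metric_tendsto_imp_tendsto)
    have "continuous_on UNIV (\<lambda>y. \<Sum>k\<le>m * 2 ^ m. \<bar>y k - x k\<bar>)"
      by (intro continuous_intros continuous_on_product_coordinates)
    then show "((\<lambda>y. \<Sum>k\<le>m * 2 ^ m. \<bar>y k - x k\<bar>) \<longlongrightarrow> 0) (at x)"
      by (auto simp: continuous_on_def dest!: spec[of _ x])
    have "dist (interp_cpath m y) (interp_cpath m x) \<le> (\<Sum>k\<le>m * 2 ^ m. \<bar>y k - x k\<bar>)" for y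
      unfolding dist_cpath_le_iff
    proof (intro allI impI)
      fix t :: real assume t: "0 \<le> t"
      have "\<bar>Rep_cpath (interp_cpath m y) t - Rep_cpath (interp_cpath m x) t\<bar>
          = \<bar>\<Sum>k\<le>m * 2 ^ m. (y k - x k) * max 0 (1 - \<bar>2 ^ m * t - real k\<bar>)\<bar>"
        using t by (simp add: Rep_interp_cpath sum_subtractf left_diff_distrib)
      also have "\<dots> \<le> (\<Sum>k\<le>m * 2 ^ m. \<bar>(y k - x k) * max 0 (1 - \<bar>2 ^ m * t - real k\<bar>)\<bar>)"
        by (rule sum_abs)
      also have "\<dots> \<le> (\<Sum>k\<le>m * 2 ^ m. \<bar>y k - x k\<bar>)"
        by (intro sum_mono) (auto simp: abs_mult intro!: mult_left_le)
      finally show "min \<bar>Rep_cpath (interp_cpath m y) t - Rep_cpath (interp_cpath m x) t\<bar> (1 / (1 + t))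
          \<le> (\<Sum>k\<le>m * 2 ^ m. \<bar>y k - x k\<bar>)" by linarith
    qed
    then show "\<forall>\<^sub>F y in at x. dist (interp_cpath m y) (interp_cpath m x)
        \<le> dist (\<Sum>k\<le>m * 2 ^ m. \<bar>y k - x k\<bar>) 0"
      by (intro always_eventually) (auto simp: abs_of_nonneg sum_nonneg)
  qed
  then show ?thesis by (simp add: continuous_on_def)
qed

text \<open>Only the two hats around \<open>t\<close> are nonzero; with weights \<open>1 - r\<close>
  and \<open>r\<close> the interpolant is a convex combination of two nearby values of
  \<open>f\<close>. The room \<open>t + 1 \<le> real m\<close> keeps the right neighbour on the
  grid.\<close>

lemma interp_cpath_close:
  fixes f :: "real \<Rightarrow> real"
  assumes t: "0 \<le> t" "t + 1 \<le> real m"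
    and osc: "\<And>s. 0 \<le> s \<Longrightarrow> s \<le> t + 1 \<Longrightarrow> \<bar>s - t\<bar> \<le> 1 / 2 ^ m \<Longrightarrow> \<bar>f s - f t\<bar> \<le> e"
  shows "\<bar>Rep_cpath (interp_cpath m (\<lambda>k. f (real k / 2 ^ m))) t - f t\<bar> \<le> e"
proof -
  define j where "j = nat \<lfloor>2 ^ m * t\<rfloor>"
  define r where "r = 2 ^ m * t - real j"
  have r: "0 \<le> r" "r < 1" "2 ^ m * t = real j + r"
    using t unfolding r_def j_def by (auto simp: of_nat_nat) linarith+
  have p1: "(1::real) \<le> 2 ^ m" by simp
  have jN: "j + 1 \<le> m * 2 ^ m"
  proof -
    have "real j + 1 \<le> 2 ^ m * t + 2 ^ m" using r p1 by linarith
    also have "\<dots> = 2 ^ m * (t + 1)" by (simp add: algebra_simps)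
    also have "\<dots> \<le> 2 ^ m * real m" using t by (intro mult_left_mono) auto
    finally have "real (j + 1) \<le> real (m * 2 ^ m)" by (simp add: mult.commute)
    then show ?thesis by linarith
  qed
  define x where "x k = f (real k / 2 ^ m)" for k
  have "Rep_cpath (interp_cpath m x) t = (\<Sum>k\<le>m * 2 ^ m. x k * max 0 (1 - \<bar>real j + r - real k\<bar>))"
    using t r by (simp add: Rep_interp_cpath)
  also have "\<dots> = (\<Sum>k\<in>{j, j + 1}. x k * max 0 (1 - \<bar>real j + r - real k\<bar>))"
  proof (rule sum.mono_neutral_right)
    show "\<forall>k\<in>{..m * 2 ^ m} - {j, j + 1}. x k * max 0 (1 - \<bar>real j + r - real k\<bar>) = 0"
    proof
      fix k assume "k \<in> {..m * 2 ^ m} - {j, j + 1}"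
      then have "k < j \<or> k \<ge> j + 2" by auto
      then have "real k \<le> real j - 1 \<or> real k \<ge> real j + 2" by linarith
      then have "1 - \<bar>real j + r - real k\<bar> \<le> 0" using r by linarith
      then show "x k * max 0 (1 - \<bar>real j + r - real k\<bar>) = 0" by simp
    qed
  qed (use jN in auto)
  also have "\<dots> = x j * (1 - r) + x (j + 1) * r" using r by simp
  finally have eq: "Rep_cpath (interp_cpath m x) t = x j * (1 - r) + x (j + 1) * r" .
  have t_eq: "t = (real j + r) / 2 ^ m" using r(3) by (simp add: field_simps)
  have inv: "1 / 2 ^ m \<le> (1::real)" by simp
  have A: "\<bar>x j - f t\<bar> \<le> e" unfolding x_def
  proof (rule osc)
    show "real j / 2 ^ m \<le> t + 1" using t_eq r(1) inv by (simp add: add_divide_distrib)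
    show "\<bar>real j / 2 ^ m - t\<bar> \<le> 1 / 2 ^ m" unfolding t_eq using r by (simp add: field_simps)
  qed auto
  have B: "\<bar>x (j + 1) - f t\<bar> \<le> e" unfolding x_def
  proof (rule osc)
    have "real (j + 1) / 2 ^ m - t = (1 - r) / 2 ^ m" unfolding t_eq by (simp add: field_simps)
    moreover have "(1 - r) / 2 ^ m \<le> 1 / 2 ^ m" using r by (intro divide_right_mono) auto
    moreover have "0 \<le> (1 - r) / 2 ^ m" using r by simp
    ultimately show "\<bar>real (j + 1) / 2 ^ m - t\<bar> \<le> 1 / 2 ^ m" "real (j + 1) / 2 ^ m \<le> t + 1"
      using inv by linarith+
  qed auto
  have "\<bar>x j * (1 - r) + x (j + 1) * r - f t\<bar> = \<bar>(x j - f t) * (1 - r) + (x (j + 1) - f t) * r\<bar>"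
    by (simp add: algebra_simps)
  also have "\<dots> \<le> \<bar>x j - f t\<bar> * (1 - r) + \<bar>x (j + 1) - f t\<bar> * r"
    using r by (intro order_trans[OF abs_triangle_ineq]) (simp add: abs_mult)
  also have "\<dots> \<le> e * (1 - r) + e * r"
    using A B r by (intro add_mono mult_right_mono) auto
  also have "\<dots> = e" by (simp add: algebra_simps)
  finally show ?thesis using eq unfolding x_def by simp
qed

lemma dist_interp_cpath_le:
  assumes "0 \<le> T" "T + 1 \<le> real m" "1 / (1 + T) \<le> e"
    and osc: "\<And>s t. 0 \<le> s \<Longrightarrow> 0 \<le> t \<Longrightarrow> s \<le> T + 1 \<Longrightarrow> t \<le> T + 1 \<Longrightarrow> \<bar>s - t\<bar> \<le> 1 / 2 ^ m \<Longrightarrow>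
      \<bar>Rep_cpath f s - Rep_cpath f t\<bar> \<le> e"
  shows "dist (interp_cpath m (\<lambda>k. Rep_cpath f (real k / 2 ^ m))) f \<le> e"
proof (rule dist_cpath_leI[OF _ assms(3,1)])
  fix t assume "0 \<le> t" "t \<le> T"
  then show "\<bar>Rep_cpath (interp_cpath m (\<lambda>k. Rep_cpath f (real k / 2 ^ m))) t - Rep_cpath f t\<bar> \<le> e"
    using assms(2) by (intro interp_cpath_close osc) auto
qed

lemma interp_cpath_tendsto:
  "(\<lambda>m. interp_cpath m (\<lambda>k. Rep_cpath f (real k / 2 ^ m))) \<longlonglongrightarrow> f"
proof (rule metric_LIMSEQ_I)
  fix e :: real assume e: "e > 0"
  define T where "T = 2 / e"
  have T: "0 \<le> T" "1 / (1 + T) \<le> e / 2" using e by (auto simp: T_def field_simps)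
  have "uniformly_continuous_on {0..T + 1} (Rep_cpath f)"
    by (intro compact_uniformly_continuous continuous_on_Rep_cpath_subset) auto
  then obtain d where d: "d > 0" "\<And>s t. s \<in> {0..T + 1} \<Longrightarrow> t \<in> {0..T + 1} \<Longrightarrow> dist s t < d \<Longrightarrow>
      dist (Rep_cpath f s) (Rep_cpath f t) < e / 2"
    unfolding uniformly_continuous_on_def using e by (meson half_gt_zero)
  obtain m1 where m1: "(1 / 2) ^ m1 < d" using real_arch_pow_inv[OF d(1), of "1 / 2"] by auto
  define M where "M = max m1 (nat \<lceil>T + 1\<rceil>)"
  show "\<exists>M. \<forall>m\<ge>M. dist (interp_cpath m (\<lambda>k. Rep_cpath f (real k / 2 ^ m))) f < e"
  proof (intro exI[of _ M] allI impI)
    fix m assume m: "m \<ge> M"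
    have "dist (interp_cpath m (\<lambda>k. Rep_cpath f (real k / 2 ^ m))) f \<le> e / 2"
    proof (rule dist_interp_cpath_le[OF T(1) _ T(2)])
      show "T + 1 \<le> real m" using m unfolding M_def by linarith
      fix s t :: real assume st: "0 \<le> s" "0 \<le> t" "s \<le> T + 1" "t \<le> T + 1" "\<bar>s - t\<bar> \<le> 1 / 2 ^ m"
      have "1 / 2 ^ m \<le> (1 / 2 :: real) ^ m1"
        using m by (simp add: M_def power_one_over[symmetric] power_decreasing)
      then have "dist s t < d" using st(5) m1 by (simp add: dist_real_def)
      then show "\<bar>Rep_cpath f s - Rep_cpath f t\<bar> \<le> e / 2"
        using d(2)[of s t] st by (simp add: dist_real_def)
    qed
    then show "dist (interp_cpath m (\<lambda>k. Rep_cpath f (real k / 2 ^ m))) f < e" using e by linarith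
  qed
qed

text \<open>The Borel sets of the path space come from open sets, whereas only single values
  \<open>X t\<close> are known to be measurable. The path is the pointwise limit of its
  interpolants, and these are continuous images of measurable sequences.\<close>

lemma measurable_path_of:
  assumes "continuous_process M X"
  shows "path_of X \<in> measurable M borel"
proof (rule borel_measurable_LIMSEQ_metric)
  let ?f = "\<lambda>m \<omega>. interp_cpath m (\<lambda>k. X (real k / 2 ^ m) \<omega>)"
  show "?f m \<in> measurable M borel" for m
  proof (rule measurable_compose[OF _ borel_measurable_continuous_onI[OF continuous_on_interp_cpath]])
    show "(\<lambda>\<omega> k. X (real k / 2 ^ m) \<omega>) \<in> borel_measurable M"
      by (rule measurable_coordinatewise_then_product)
        (use assms in \<open>auto simp: continuous_process_def\<close>)
  qed
  fix \<omega> assume "\<omega> \<in> space M"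
  then have "\<And>t. 0 \<le> t \<Longrightarrow> Rep_cpath (path_of X \<omega>) t = X t \<omega>"
    using assms by (intro Rep_path_of) (auto simp: continuous_process_def)
  then show "(\<lambda>m. ?f m \<omega>) \<longlonglongrightarrow> path_of X \<omega>"
    using interp_cpath_tendsto[of "path_of X \<omega>"] by simp
qed

section \<open>The median of an odd number of reals\<close>

lemma median_le_iff:
  "median (2 * m + 1) x \<le> y \<longleftrightarrow> m + 1 \<le> card {j \<in> {1..2 * m + 1}. x j \<le> y}"
proof -
  let ?n = "2 * m + 1"
  obtain \<tau> where \<tau>: "sorts_upto ?n \<tau> x" using sorts_upto_exists by blast
  have perm: "\<tau> permutes {1..?n}" and mono: "\<And>i j. 1 \<le> i \<Longrightarrow> i \<le> j \<Longrightarrow> j \<le> ?n \<Longrightarrow> x (\<tau> i) \<le> x (\<tau> j)"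
    using \<tau> by (auto simp: sorts_upto_def)
  have med: "median ?n x = x (\<tau> (m + 1))" using median_eq[OF \<tau>] by simp
  have inj: "inj_on \<tau> A" for A using permutes_inj[OF perm] inj_on_subset by blast
  show ?thesis
  proof
    assume "median ?n x \<le> y"
    then have le: "x (\<tau> i) \<le> y" if "i \<in> {1..m + 1}" for i
      using mono[of i "m + 1"] that med by force
    have "\<tau> i \<in> {1..?n}" if "i \<in> {1..m + 1}" for i
      using that permutes_in_image[OF perm, of i] by auto
    then have "\<tau> ` {1..m + 1} \<subseteq> {j \<in> {1..?n}. x j \<le> y}" using le by blast
    then have "card (\<tau> ` {1..m + 1}) \<le> card {j \<in> {1..?n}. x j \<le> y}" by (intro card_mono) auto
    then show "m + 1 \<le> card {j \<in> {1..?n}. x j \<le> y}" using card_image[OF inj] by simp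
  next
    assume c: "m + 1 \<le> card {j \<in> {1..?n}. x j \<le> y}"
    show "median ?n x \<le> y"
    proof (rule ccontr)
      assume "\<not> median ?n x \<le> y"
      then have gt: "y < x (\<tau> i)" if "m + 1 \<le> i" "i \<le> ?n" for i
        using mono[of "m + 1" i] that med by force
      have "{j \<in> {1..?n}. x j \<le> y} \<subseteq> \<tau> ` {1..m}"
      proof
        fix j assume j: "j \<in> {j \<in> {1..?n}. x j \<le> y}"
        then obtain i where i: "j = \<tau> i" "i \<in> {1..?n}"
          using permutes_image[OF perm] by blast
        then have "\<not> m + 1 \<le> i" using gt[of i] j by auto
        then show "j \<in> \<tau> ` {1..m}" using i by auto
      qed
      then have "card {j \<in> {1..?n}. x j \<le> y} \<le> card (\<tau> ` {1..m})" by (intro card_mono) auto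
      also have "\<dots> = m" using card_image[OF inj] by simp
      finally show False using c by simp
    qed
  qed
qed

text \<open>An odd number of terms \<open>1 / 2\<close> and \<open>- 1 / 2\<close> never sums to 0,
  so the two strict inequalities decide the event without ties. They turn median events into tail
  events for sums of independent variables.\<close>

lemma median_le_iff_sum:
  "median (2 * m + 1) x \<le> y \<longleftrightarrow> (\<Sum>j = 1..2 * m + 1. 1 / 2 - of_bool (x j \<le> y)) < (0::real)"
  "y < median (2 * m + 1) x \<longleftrightarrow> 0 < (\<Sum>j = 1..2 * m + 1. 1 / 2 - of_bool (x j \<le> y) :: real)"
proof -
  let ?c = "card {j \<in> {1..2 * m + 1}. x j \<le> y}"
  have "(\<Sum>j = 1..2 * m + 1. of_bool (x j \<le> y) :: real) = real ?c"
    by (subst sum_of_bool_eq) (auto intro: arg_cong[of _ _ card])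
  then have s: "(\<Sum>j = 1..2 * m + 1. 1 / 2 - of_bool (x j \<le> y) :: real) = (real m + 1 / 2) - real ?c"
    by (subst sum_subtractf) simp
  show "median (2 * m + 1) x \<le> y \<longleftrightarrow> (\<Sum>j = 1..2 * m + 1. 1 / 2 - of_bool (x j \<le> y)) < (0::real)"
    unfolding median_le_iff s by linarith
  show "y < median (2 * m + 1) x \<longleftrightarrow> 0 < (\<Sum>j = 1..2 * m + 1. 1 / 2 - of_bool (x j \<le> y) :: real)"
    unfolding less_le_not_le[of y "median (2 * m + 1) x"]
    using median_le_iff[of m x y] s by linarith
qed

lemma median_le_add:
  assumes "\<And>j. j \<in> {1..2 * m + 1} \<Longrightarrow> y j \<le> x j + e"
  shows "median (2 * m + 1) y \<le> median (2 * m + 1) x + e"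
proof -
  have "m + 1 \<le> card {j \<in> {1..2 * m + 1}. x j \<le> median (2 * m + 1) x}"
    using median_le_iff[of m x "median (2 * m + 1) x"] by simp
  also have "\<dots> \<le> card {j \<in> {1..2 * m + 1}. y j \<le> median (2 * m + 1) x + e}"
    using assms by (intro card_mono) force+
  finally show ?thesis unfolding median_le_iff .
qed

text \<open>For very short times this bounds the increment of the median by the largest increment of
  a particle.\<close>

lemma median_Lipschitz:
  assumes "\<And>j. j \<in> {1..2 * m + 1} \<Longrightarrow> \<bar>x j - y j\<bar> \<le> e"
  shows "\<bar>median (2 * m + 1) x - median (2 * m + 1) y\<bar> \<le> e"
  using median_le_add[of m x y e] median_le_add[of m y x e] assms by (force simp: abs_le_iff)

lemma median_divide:
  assumes "0 < c"
  shows "median (2 * m + 1) (\<lambda>j. x j / c) = median (2 * m + 1) x / c"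
proof -
  have *: "median (2 * m + 1) (\<lambda>j. x j / c) \<le> y \<longleftrightarrow> median (2 * m + 1) x / c \<le> y" for y
    using assms by (simp only: median_le_iff pos_divide_le_eq)
  show ?thesis by (rule antisym) (use * in auto)
qed

lemma borel_measurable_median:
  assumes "\<And>j. j \<in> {1..2 * m + 1} \<Longrightarrow> f j \<in> borel_measurable M"
  shows "(\<lambda>\<omega>. median (2 * m + 1) (\<lambda>j. f j \<omega>)) \<in> borel_measurable M"
proof (rule borel_measurableI_le)
  fix y
  have [measurable]: "f j \<in> borel_measurable M" if "j \<in> {1..2 * m + 1}" for j using assms that .
  have "(\<lambda>\<omega>. \<Sum>j = 1..2 * m + 1. 1 / 2 - of_bool (f j \<omega> \<le> y) :: real) \<in> borel_measurable M"
    by (intro borel_measurable_sum) measurable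
  then show "{\<omega> \<in> space M. median (2 * m + 1) (\<lambda>j. f j \<omega>) \<le> y} \<in> sets M"
    unfolding median_le_iff_sum by measurable
qed

lemma continuous_on_median:
  fixes f :: "nat \<Rightarrow> 'b::metric_space \<Rightarrow> real"
  assumes "\<And>j. j \<in> {1..2 * m + 1} \<Longrightarrow> continuous_on S (f j)"
  shows "continuous_on S (\<lambda>t. median (2 * m + 1) (\<lambda>j. f j t))"
  unfolding continuous_on_iff
proof (intro ballI allI impI)
  fix t and e :: real assume t: "t \<in> S" and e: "e > 0"
  have "\<exists>d>0. \<forall>s\<in>S. dist s t < d \<longrightarrow> dist (f j s) (f j t) < e" if "j \<in> {1..2 * m + 1}" for j
    using assms[OF that] t e unfolding continuous_on_iff by blast
  then obtain d where d: "\<And>j. j \<in> {1..2 * m + 1} \<Longrightarrow> d j > 0"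
    "\<And>j s. j \<in> {1..2 * m + 1} \<Longrightarrow> s \<in> S \<Longrightarrow> dist s t < d j \<Longrightarrow> dist (f j s) (f j t) < e"
    by metis
  define D where "D = Min (d ` {1..2 * m + 1})"
  have D: "D > 0" "\<And>j. j \<in> {1..2 * m + 1} \<Longrightarrow> D \<le> d j"
    using d(1) by (auto simp: D_def)
  have ne: "1 \<in> {1..2 * m + 1}" by simp
  show "\<exists>d>0. \<forall>s\<in>S. dist s t < d \<longrightarrow>
      dist (median (2 * m + 1) (\<lambda>j. f j s)) (median (2 * m + 1) (\<lambda>j. f j t)) < e"
  proof (intro exI[of _ D] conjI ballI impI D(1))
    fix s assume s: "s \<in> S" "dist s t < D"
    define E where "E = Max ((\<lambda>j. \<bar>f j s - f j t\<bar>) ` {1..2 * m + 1})"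
    have "E < e" unfolding E_def
    proof (subst Max_less_iff)
      show "\<forall>a\<in>(\<lambda>j. \<bar>f j s - f j t\<bar>) ` {1..2 * m + 1}. a < e"
      proof safe
        fix j assume j: "j \<in> {1..2 * m + 1}"
        have "dist s t < d j" using D(2)[OF j] s(2) by linarith
        then show "\<bar>f j s - f j t\<bar> < e" using d(2)[OF j s(1)] by (simp add: dist_real_def)
      qed
    qed auto
    moreover have "\<bar>median (2 * m + 1) (\<lambda>j. f j s) - median (2 * m + 1) (\<lambda>j. f j t)\<bar> \<le> E"
      by (rule median_Lipschitz) (auto simp: E_def intro!: Max_ge)
    ultimately show "dist (median (2 * m + 1) (\<lambda>j. f j s)) (median (2 * m + 1) (\<lambda>j. f j t)) < e"
      by (simp add: dist_real_def)
  qed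
qed

section \<open>Dyadic chaining\<close>

definition dyadic_floor :: "nat \<Rightarrow> real \<Rightarrow> real" where
  "dyadic_floor m t = real (nat \<lfloor>2 ^ m * t\<rfloor>) / 2 ^ m"

lemma dyadic_floor_bounds:
  assumes "0 \<le> t"
  shows "0 \<le> dyadic_floor m t" "dyadic_floor m t \<le> t" "t < dyadic_floor m t + 1 / 2 ^ m"
proof -
  have "0 \<le> 2 ^ m * t" using assms by simp
  then have "real (nat \<lfloor>2 ^ m * t\<rfloor>) \<le> 2 ^ m * t" "2 ^ m * t < real (nat \<lfloor>2 ^ m * t\<rfloor>) + 1"
    by linarith+
  then show "0 \<le> dyadic_floor m t" "dyadic_floor m t \<le> t" "t < dyadic_floor m t + 1 / 2 ^ m"
    unfolding dyadic_floor_def by (simp_all add: field_simps)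
qed

lemma dyadic_floor_dyadic:
  assumes "l \<le> m"
  shows "dyadic_floor m (real k / 2 ^ l) = real k / 2 ^ l"
proof -
  obtain i where i: "m = l + i" using assms le_Suc_ex by blast
  have "2 ^ m * (real k / 2 ^ l) = real (k * 2 ^ i)" by (simp add: i power_add)
  then have "nat \<lfloor>2 ^ m * (real k / 2 ^ l)\<rfloor> = k * 2 ^ i" by (simp only: floor_of_nat nat_int)
  then show ?thesis by (simp add: dyadic_floor_def i power_add)
qed

text \<open>Only the values of \<open>x\<close> at dyadic times are constrained, so the locale
  serves both the median paths and a limit that is known merely at dyadic times. With
  \<open>r = 2 powr - \<gamma>\<close> it encodes the Hoelder exponent \<open>\<gamma>\<close> from
  level \<open>m0\<close> on.\<close>

locale dyadic_increments =
  fixes x :: "real \<Rightarrow> real" and C r :: real and m0 T :: nat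
  assumes C: "0 \<le> C" and r: "0 < r" "r < 1"
    and incr: "\<And>m k. m0 \<le> m \<Longrightarrow> k + 1 \<le> T * 2 ^ m \<Longrightarrow>
      \<bar>x (real (k + 1) / 2 ^ m) - x (real k / 2 ^ m)\<bar> \<le> C * r ^ m"
begin

lemma floor_index_le:
  assumes "0 \<le> t" "t \<le> real T"
  shows "nat \<lfloor>2 ^ m * t\<rfloor> \<le> T * 2 ^ m"
proof -
  have "2 ^ m * t \<le> 2 ^ m * real T" using assms by (intro mult_left_mono) auto
  also have "\<dots> = real (T * 2 ^ m)" by simp
  finally show ?thesis by linarith
qed

text \<open>One refinement keeps the dyadic floor or moves it by one cell of level
  \<open>Suc m\<close>, because the new index is \<open>2 * j\<close> or
  \<open>2 * j + 1\<close>.\<close>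

lemma step_le:
  assumes "0 \<le> t" "t \<le> real T" "m0 \<le> m"
  shows "\<bar>x (dyadic_floor (Suc m) t) - x (dyadic_floor m t)\<bar> \<le> C * r ^ Suc m"
proof -
  define j where "j = nat \<lfloor>2 ^ m * t\<rfloor>"
  define i where "i = nat \<lfloor>2 ^ Suc m * t\<rfloor>"
  have "0 \<le> 2 ^ m * t" using assms by simp
  then have "real j \<le> 2 ^ m * t" "2 ^ m * t < real j + 1" unfolding j_def by linarith+
  moreover have "real i \<le> 2 * (2 ^ m * t)" "2 * (2 ^ m * t) < real i + 1"
    using \<open>0 \<le> 2 ^ m * t\<close> unfolding i_def by (simp_all add: mult.assoc)
  ultimately have "real i < 2 * real j + 2" "2 * real j < real i + 1" by linarith+
  then have "i = 2 * j \<or> i = 2 * j + 1" by linarith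
  moreover have j: "x (dyadic_floor m t) = x (real (2 * j) / 2 ^ Suc m)"
    unfolding dyadic_floor_def j_def[symmetric] by simp
  moreover have i: "x (dyadic_floor (Suc m) t) = x (real i / 2 ^ Suc m)"
    unfolding dyadic_floor_def i_def[symmetric] ..
  moreover have "i \<le> T * 2 ^ Suc m" unfolding i_def by (rule floor_index_le) (use assms in auto)
  ultimately show ?thesis using incr[of "Suc m" "2 * j"] assms(3) C r by auto
qed

lemma steps_le:
  assumes "0 \<le> t" "t \<le> real T" "m0 \<le> m"
  shows "\<bar>x (dyadic_floor (m + l) t) - x (dyadic_floor m t)\<bar> \<le> C * r ^ m * (1 - r ^ l) / (1 - r)"
proof (induction l)
  case (Suc l)
  have "\<bar>x (dyadic_floor (m + Suc l) t) - x (dyadic_floor m t)\<bar>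
      \<le> C * r ^ Suc (m + l) + C * r ^ m * (1 - r ^ l) / (1 - r)"
    using Suc step_le[OF assms(1,2), of "m + l"] assms(3) by fastforce
  \<comment> \<open>Lowering the exponent by one makes the new term fit the partial geometric
    sum.\<close>
  also have "\<dots> \<le> C * r ^ (m + l) + C * r ^ m * (1 - r ^ l) / (1 - r)"
    using C r by (intro add_mono mult_left_mono power_decreasing) auto
  also have "\<dots> = C * r ^ m * (1 - r ^ Suc l) / (1 - r)"
    using r by (simp add: field_simps power_add)
  finally show ?case .
qed simp

lemma steps_le':
  assumes "0 \<le> t" "t \<le> real T" "m0 \<le> m" "m \<le> l"
  shows "\<bar>x (dyadic_floor l t) - x (dyadic_floor m t)\<bar> \<le> C * r ^ m / (1 - r)"
proof -
  obtain i where i: "l = m + i" using assms(4) le_Suc_ex by blast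
  have "C * r ^ m * (1 - r ^ i) / (1 - r) \<le> C * r ^ m / (1 - r)"
    using C r by (intro divide_right_mono mult_left_le) (auto intro!: mult_nonneg_nonneg)
  then show ?thesis using steps_le[OF assms(1-3), of i] i by simp
qed

lemma convergent_dyadic:
  assumes "0 \<le> t" "t \<le> real T"
  shows "convergent (\<lambda>m. x (dyadic_floor m t))"
  unfolding Cauchy_convergent_iff[symmetric]
proof (rule metric_CauchyI)
  fix e :: real assume e: "e > 0"
  have "(\<lambda>m. C * r ^ m / (1 - r)) \<longlonglongrightarrow> C * 0 / (1 - r)"
    using r by (intro tendsto_intros LIMSEQ_power_zero) auto
  then have "\<forall>\<^sub>F m in sequentially. C * r ^ m / (1 - r) < e / 2"
    by (rule order_tendstoD) (use e in auto)
  then obtain M where M: "\<And>m. m \<ge> M \<Longrightarrow> C * r ^ m / (1 - r) < e / 2"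
    unfolding eventually_sequentially by blast
  show "\<exists>M. \<forall>m\<ge>M. \<forall>n\<ge>M. dist (x (dyadic_floor m t)) (x (dyadic_floor n t)) < e"
  proof (intro exI[of _ "max M m0"] allI impI)
    fix m n assume mn: "m \<ge> max M m0" "n \<ge> max M m0"
    let ?b = "x (dyadic_floor (max M m0) t)"
    have "\<bar>x (dyadic_floor l t) - ?b\<bar> < e / 2" if "l \<ge> max M m0" for l
      using steps_le'[OF assms _ that] M[of "max M m0"] by (meson max.cobounded1 max.cobounded2 le_less_trans)
    from this[OF mn(1)] this[OF mn(2)] show "dist (x (dyadic_floor m t)) (x (dyadic_floor n t)) < e"
      unfolding dist_real_def by linarith
  qed
qed

lemma limit_close:
  assumes f: "(\<lambda>m. x (dyadic_floor m t)) \<longlonglongrightarrow> f" and t: "0 \<le> t" "t \<le> real T" "m0 \<le> m"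
  shows "\<bar>f - x (dyadic_floor m t)\<bar> \<le> C * r ^ m / (1 - r)"
proof (rule tendsto_upperbound)
  show "(\<lambda>l. \<bar>x (dyadic_floor l t) - x (dyadic_floor m t)\<bar>) \<longlonglongrightarrow> \<bar>f - x (dyadic_floor m t)\<bar>"
    by (intro tendsto_intros f)
  show "\<forall>\<^sub>F l in sequentially. \<bar>x (dyadic_floor l t) - x (dyadic_floor m t)\<bar> \<le> C * r ^ m / (1 - r)"
    using eventually_ge_at_top[of m] by eventually_elim (use steps_le'[OF t] in auto)
qed simp

lemma neighbours_close:
  assumes st: "0 \<le> s" "s \<le> t" "t \<le> real T" "t - s \<le> 1 / 2 ^ m" "m0 \<le> m"
  shows "\<bar>x (dyadic_floor m t) - x (dyadic_floor m s)\<bar> \<le> C * r ^ m"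
proof -
  define j where "j = nat \<lfloor>2 ^ m * s\<rfloor>"
  define i where "i = nat \<lfloor>2 ^ m * t\<rfloor>"
  have "0 \<le> 2 ^ m * s" "0 \<le> 2 ^ m * t" using st by simp_all
  then have "real j \<le> 2 ^ m * s" "2 ^ m * s < real j + 1" "real i \<le> 2 ^ m * t" "2 ^ m * t < real i + 1"
    unfolding j_def i_def by linarith+
  moreover have "2 ^ m * t \<le> 2 ^ m * s + 1" using st(4) by (simp add: field_simps)
  moreover have "2 ^ m * s \<le> 2 ^ m * t" using st(2) by simp
  ultimately have "real i < real j + 2" "real j < real i + 1" by linarith+
  then have "i = j \<or> i = j + 1" by linarith
  moreover have "i \<le> T * 2 ^ m" unfolding i_def by (rule floor_index_le) (use st in auto)
  ultimately show ?thesis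
    using incr[of m j] st(5) C r unfolding dyadic_floor_def i_def[symmetric] j_def[symmetric] by auto
qed

text \<open>The constant counts one step between adjacent dyadic floors and two geometric tails
  \<open>C * r ^ m / (1 - r)\<close> from the floors to the limits.\<close>

lemma limit_modulus:
  assumes f: "\<And>t. 0 \<le> t \<Longrightarrow> t \<le> real T \<Longrightarrow> (\<lambda>m. x (dyadic_floor m t)) \<longlonglongrightarrow> f t"
    and st: "0 \<le> s" "0 \<le> t" "s \<le> real T" "t \<le> real T" "\<bar>t - s\<bar> \<le> 1 / 2 ^ m" "m0 \<le> m"
  shows "\<bar>f t - f s\<bar> \<le> C * (1 + 2 / (1 - r)) * r ^ m"
proof -
  have "\<bar>f t - x (dyadic_floor m t)\<bar> \<le> C * r ^ m / (1 - r)" "\<bar>f s - x (dyadic_floor m s)\<bar> \<le> C * r ^ m / (1 - r)"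
    using st by (auto intro!: limit_close f)
  moreover have "\<bar>x (dyadic_floor m t) - x (dyadic_floor m s)\<bar> \<le> C * r ^ m"
    using neighbours_close[of s t m] neighbours_close[of t s m] st by (cases "s \<le> t") auto
  moreover have "C * (1 + 2 / (1 - r)) * r ^ m = C * r ^ m / (1 - r) + C * r ^ m + C * r ^ m / (1 - r)"
    by (simp add: field_simps)
  ultimately show ?thesis by linarith
qed

lemma limit_continuous_on:
  assumes f: "\<And>t. 0 \<le> t \<Longrightarrow> t \<le> real T \<Longrightarrow> (\<lambda>m. x (dyadic_floor m t)) \<longlonglongrightarrow> f t"
  shows "continuous_on {0..real T} f"
  unfolding continuous_on_iff
proof (intro ballI allI impI)
  fix t and e :: real assume t: "t \<in> {0..real T}" and e: "e > 0"
  have "(\<lambda>m. C * (1 + 2 / (1 - r)) * r ^ m) \<longlonglongrightarrow> C * (1 + 2 / (1 - r)) * 0"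
    using r by (intro tendsto_intros LIMSEQ_power_zero) auto
  then have "\<forall>\<^sub>F m in sequentially. C * (1 + 2 / (1 - r)) * r ^ m < e"
    by (rule order_tendstoD) (use e in auto)
  then have "\<forall>\<^sub>F m in sequentially. m0 \<le> m \<and> C * (1 + 2 / (1 - r)) * r ^ m < e"
    using eventually_ge_at_top[of m0] by eventually_elim auto
  then obtain m where m: "m0 \<le> m" "C * (1 + 2 / (1 - r)) * r ^ m < e"
    by (auto simp: eventually_sequentially)
  show "\<exists>d>0. \<forall>s\<in>{0..real T}. dist s t < d \<longrightarrow> dist (f s) (f t) < e"
  proof (intro exI[of _ "1 / 2 ^ m"] conjI ballI impI)
    fix s assume "s \<in> {0..real T}" "dist s t < 1 / 2 ^ m"
    then have "\<bar>f s - f t\<bar> \<le> C * (1 + 2 / (1 - r)) * r ^ m"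
      using t m by (intro limit_modulus f) (auto simp: dist_real_def)
    then show "dist (f s) (f t) < e" using m by (simp add: dist_real_def)
  qed simp
qed

lemma limit_Holder:
  assumes f: "\<And>t. 0 \<le> t \<Longrightarrow> t \<le> real T \<Longrightarrow> (\<lambda>m. x (dyadic_floor m t)) \<longlonglongrightarrow> f t"
    and g: "0 < \<gamma>" "r = 2 powr - \<gamma>"
  shows "\<exists>K. \<forall>s\<in>{0..real T}. \<forall>t\<in>{0..real T}. \<bar>f t - f s\<bar> \<le> K * \<bar>t - s\<bar> powr \<gamma>"
proof -
  define D where "D = C * (1 + 2 / (1 - r))"
  have D: "0 \<le> D" using C r by (simp add: D_def)
  have rm: "r ^ m = (1 / 2 ^ m) powr \<gamma>" for m
  proof -
    have "r ^ m = (2 powr - \<gamma>) powr real m" using g(2) by (simp add: powr_realpow)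
    also have "\<dots> = (2 powr - real m) powr \<gamma>" by (simp add: powr_powr mult.commute)
    also have "2 powr - real m = (1 / 2 ^ m :: real)" by (simp add: powr_minus powr_realpow field_simps)
    finally show ?thesis .
  qed
  have "bounded (f ` {0..real T})"
    by (intro compact_imp_bounded compact_continuous_image limit_continuous_on f) auto
  then obtain b where "\<forall>t\<in>{0..real T}. \<bar>f t\<bar> \<le> b" by (auto simp: bounded_iff)
  then have b: "\<And>t. t \<in> {0..real T} \<Longrightarrow> \<bar>f t\<bar> \<le> b" by blast
  \<comment> \<open>The first term serves distances up to \<open>1 / 2 ^ m0\<close>, where rounding
    to a dyadic level loses one factor \<open>r\<close>; the second covers larger distances through
    the bound \<open>b\<close> on the path.\<close>
  define K where "K = D / r + 2 * \<bar>b\<bar> / r ^ m0"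
  have K: "D / r \<le> K" "2 * \<bar>b\<bar> / r ^ m0 \<le> K" using D r by (auto simp: K_def)
  have K0: "0 \<le> K" using K(1) D r by (meson divide_nonneg_pos order_trans)
  show ?thesis
  proof (intro exI[of _ K] ballI)
    fix s t assume st: "s \<in> {0..real T}" "t \<in> {0..real T}"
    define h where "h = \<bar>t - s\<bar>"
    consider "h = 0" | "h > 1 / 2 ^ m0" | "h > 0" "h \<le> 1 / 2 ^ m0" unfolding h_def by linarith
    then show "\<bar>f t - f s\<bar> \<le> K * \<bar>t - s\<bar> powr \<gamma>"
    proof cases
      case 1 then show ?thesis using g by (simp add: h_def)
    next
      case 2
      have "r ^ m0 \<le> h powr \<gamma>" unfolding rm using 2 g by (intro powr_mono2) auto
      then have "2 * \<bar>b\<bar> / r ^ m0 * r ^ m0 \<le> K * h powr \<gamma>" using K K0 r by (intro mult_mono) auto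
      moreover have "\<bar>f t - f s\<bar> \<le> 2 * \<bar>b\<bar>" using b[OF st(1)] b[OF st(2)] by linarith
      ultimately show ?thesis using r by (simp add: h_def)
    next
      case 3
      define P where "P = (\<lambda>m. 1 / 2 ^ m < h)"
      obtain m1 where "(1 / 2) ^ m1 < h" using real_arch_pow_inv[OF 3(1), of "1 / 2"] by auto
      then have Pm1: "P m1" by (simp add: P_def power_one_over)
      \<comment> \<open>The first level whose mesh is below \<open>h\<close>; its predecessor
        \<open>m\<close> satisfies \<open>1 / 2 ^ Suc m < h\<close> and
        \<open>h \<le> 1 / 2 ^ m\<close>.\<close>
      define l where "l = (LEAST m. P m)"
      have Pl: "P l" unfolding l_def by (rule LeastI[of P, OF Pm1])
      have "\<not> P m" if "m \<le> m0" for m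
      proof -
        have "(1::real) / 2 ^ m0 \<le> 1 / 2 ^ m" using that by (simp add: field_simps power_increasing)
        then show ?thesis using 3 unfolding P_def by linarith
      qed
      then have "l > m0" using Pl not_le_imp_less by blast
      then obtain m where m: "l = Suc m" "m0 \<le> m" by (metis Suc_less_eq2 less_Suc_eq_le lessE)
      have nP: "\<not> P m" using not_less_Least[of m P] m unfolding l_def[symmetric] by simp
      then have hm: "h \<le> 1 / 2 ^ m" by (simp add: P_def)
      have "\<bar>f t - f s\<bar> \<le> D * r ^ m" unfolding D_def
        using st m hm by (intro limit_modulus f) (auto simp: h_def)
      also have "\<dots> = D / r * r ^ Suc m" using r by simp
      also have "r ^ Suc m \<le> h powr \<gamma>" unfolding rm using Pl g m(1) by (intro powr_mono2) (auto simp: P_def)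
      then have "D / r * r ^ Suc m \<le> K * h powr \<gamma>" using K K0 r by (intro mult_mono) auto
      finally show ?thesis by (simp add: h_def)
    qed
  qed
qed

end

section \<open>Weak convergence\<close>

lemma (in prob_space) expectation_diff_le:
  fixes f g :: "'a \<Rightarrow> real"
  assumes [measurable]: "f \<in> borel_measurable M" "g \<in> borel_measurable M" "A \<in> events"
    and b: "\<And>\<omega>. \<omega> \<in> space M \<Longrightarrow> \<bar>f \<omega>\<bar> \<le> B" "\<And>\<omega>. \<omega> \<in> space M \<Longrightarrow> \<bar>g \<omega>\<bar> \<le> B"
    and e: "\<And>\<omega>. \<omega> \<in> space M - A \<Longrightarrow> \<bar>f \<omega> - g \<omega>\<bar> \<le> e" "0 \<le> e"
  shows "\<bar>expectation f - expectation g\<bar> \<le> e + 2 * B * prob A"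
proof -
  have int: "integrable M f" "integrable M g"
    using b by (auto intro!: integrable_const_bound[of _ B] AE_I2)
  have "\<bar>expectation f - expectation g\<bar> = \<bar>\<integral>\<omega>. f \<omega> - g \<omega> \<partial>M\<bar>" using int by simp
  also have "\<dots> \<le> (\<integral>\<omega>. \<bar>f \<omega> - g \<omega>\<bar> \<partial>M)" by (rule integral_abs_bound)
  also have "\<dots> \<le> (\<integral>\<omega>. e + 2 * B * indicator A \<omega> \<partial>M)"
  proof (rule integral_mono)
    fix \<omega> assume w: "\<omega> \<in> space M"
    show "\<bar>f \<omega> - g \<omega>\<bar> \<le> e + 2 * B * indicator A \<omega>"
    proof (cases "\<omega> \<in> A")
      case True then show ?thesis using b[OF w] e(2) by simp
    qed (use e(1) w in auto)
  qed (use int in \<open>auto simp: emeasure_eq_measure\<close>)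
  also have "\<dots> = e + 2 * B * prob A" by (simp add: prob_space emeasure_eq_measure)
  finally show ?thesis .
qed

lemma (in prob_space) tight_random_variable:
  fixes Y :: "'a \<Rightarrow> real"
  assumes [measurable]: "Y \<in> borel_measurable M" and "0 < e"
  shows "\<exists>R. prob {\<omega> \<in> space M. R < \<bar>Y \<omega>\<bar>} \<le> e"
proof -
  have "(\<lambda>n. prob {\<omega> \<in> space M. real n < \<bar>Y \<omega>\<bar>}) \<longlonglongrightarrow> prob (\<Inter>n. {\<omega> \<in> space M. real n < \<bar>Y \<omega>\<bar>})"
    by (rule finite_Lim_measure_decseq) (auto simp: decseq_def)
  also have "(\<Inter>n. {\<omega> \<in> space M. real n < \<bar>Y \<omega>\<bar>}) = {}"
  proof -
    have "\<omega> \<notin> (\<Inter>n. {\<omega> \<in> space M. real n < \<bar>Y \<omega>\<bar>})" for \<omega>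
    proof -
      obtain n where "\<bar>Y \<omega>\<bar> < real n" using reals_Archimedean2 by blast
      then have "\<omega> \<notin> {\<omega> \<in> space M. real n < \<bar>Y \<omega>\<bar>}" by simp
      then show ?thesis by blast
    qed
    then show ?thesis by blast
  qed
  finally have "(\<lambda>n. prob {\<omega> \<in> space M. real n < \<bar>Y \<omega>\<bar>}) \<longlonglongrightarrow> 0" by simp
  from eventually_happens'[OF sequentially_bot order_tendstoD(2)[OF this \<open>0 < e\<close>]]
  obtain n :: nat where "prob {\<omega> \<in> space M. real n < \<bar>Y \<omega>\<bar>} < e" ..
  then show ?thesis by (intro exI[of _ "real n"]) simp
qed

text \<open>The finitely many early variables are tight one by one and only enlarge the
  bound.\<close>

lemma (in prob_space) tight_eventually_imp_tight:
  fixes Y :: "nat \<Rightarrow> 'a \<Rightarrow> real"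
  assumes [measurable]: "\<And>n. Y n \<in> borel_measurable M" and "0 < e"
    and ev: "\<forall>\<^sub>F n in sequentially. prob {\<omega> \<in> space M. R0 < \<bar>Y n \<omega>\<bar>} \<le> e"
  shows "\<exists>R. \<forall>n. prob {\<omega> \<in> space M. R < \<bar>Y n \<omega>\<bar>} \<le> e"
proof -
  obtain n0 where n0: "\<And>n. n \<ge> n0 \<Longrightarrow> prob {\<omega> \<in> space M. R0 < \<bar>Y n \<omega>\<bar>} \<le> e"
    using ev by (auto simp: eventually_sequentially)
  obtain R where R: "\<And>n. prob {\<omega> \<in> space M. R n < \<bar>Y n \<omega>\<bar>} \<le> e"
    using tight_random_variable[OF assms(1,2)] by metis
  define R' where "R' = Max (insert R0 (R ` {..<n0}))"
  have mono: "prob {\<omega> \<in> space M. R' < \<bar>Y n \<omega>\<bar>} \<le> prob {\<omega> \<in> space M. r < \<bar>Y n \<omega>\<bar>}" if "r \<le> R'" for n r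
    using that by (intro finite_measure_mono) auto
  show ?thesis
  proof (rule exI[of _ R'], rule allI)
    fix n
    show "prob {\<omega> \<in> space M. R' < \<bar>Y n \<omega>\<bar>} \<le> e"
    proof (cases "n < n0")
      case True
      then have "R n \<le> R'" by (auto simp: R'_def)
      then show ?thesis using mono[of "R n" n] R[of n] by linarith
    next
      case False
      have "R0 \<le> R'" by (auto simp: R'_def)
      from mono[OF this, of n] n0[of n] False show ?thesis by linarith
    qed
  qed
qed

section \<open>Trigonometric polynomials on real sequences\<close>

inductive trig_poly :: "((nat \<Rightarrow> real) \<Rightarrow> real) \<Rightarrow> bool" where
  cosine: "trig_poly (\<lambda>x. cos (b + (\<Sum>k<K. c k * x k)))"
| add: "trig_poly f \<Longrightarrow> trig_poly g \<Longrightarrow> trig_poly (\<lambda>x. f x + g x)"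
| scale: "trig_poly f \<Longrightarrow> trig_poly (\<lambda>x. a * f x)"

lemma trig_poly_const: "trig_poly (\<lambda>_. a)"
  using trig_poly.scale[OF trig_poly.cosine[of 0 "\<lambda>_. 0" 0], of a] by simp

text \<open>The phases make sines available, so the product formula stays within cosines; both
  linear forms are first padded with zeros to a common length.\<close>

lemma trig_poly_cosine_mult:
  "trig_poly (\<lambda>x. cos (b + (\<Sum>k<K. c k * x k)) * cos (b' + (\<Sum>k<K'. c' k * x k)))"
proof -
  define L where "L = max K K'"
  define d where "d k = (if k < K then c k else 0)" for k
  define d' where "d' k = (if k < K' then c' k else 0)" for k
  have s: "(\<Sum>k<K. c k * x k) = (\<Sum>k<L. d k * x k)" for x :: "nat \<Rightarrow> real"
    by (intro sum.mono_neutral_cong_left) (auto simp: L_def d_def)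
  have s': "(\<Sum>k<K'. c' k * x k) = (\<Sum>k<L. d' k * x k)" for x :: "nat \<Rightarrow> real"
    by (intro sum.mono_neutral_cong_left) (auto simp: L_def d'_def)
  have "trig_poly (\<lambda>x. 1 / 2 * (cos ((b - b') + (\<Sum>k<L. (d k - d' k) * x k))
      + cos ((b + b') + (\<Sum>k<L. (d k + d' k) * x k))))"
    by (intro trig_poly.intros)
  also have "(\<lambda>x. 1 / 2 * (cos ((b - b') + (\<Sum>k<L. (d k - d' k) * x k))
      + cos ((b + b') + (\<Sum>k<L. (d k + d' k) * x k)))) =
      (\<lambda>x. cos (b + (\<Sum>k<K. c k * x k)) * cos (b' + (\<Sum>k<K'. c' k * x k)))"
    unfolding s s' cos_times_cos
    by (simp add: sum.distrib sum_subtractf left_diff_distrib distrib_right algebra_simps add_divide_distrib)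
  finally show ?thesis .
qed

lemma trig_poly_mult:
  assumes f: "trig_poly f" and g: "trig_poly g"
  shows "trig_poly (\<lambda>x. f x * g x)"
  using f
proof induction
  case (cosine b K c)
  show ?case using g
  proof induction
    case (add f g)
    then show ?case by (auto simp: distrib_left intro: trig_poly.add)
  next
    case (scale f a)
    then show ?case by (auto simp: mult.left_commute[of _ a] intro: trig_poly.scale)
  qed (rule trig_poly_cosine_mult)
next
  case (add f g)
  then show ?case by (auto simp: distrib_right intro: trig_poly.add)
next
  case (scale f a)
  then show ?case by (auto simp: mult.assoc intro: trig_poly.scale)
qed

lemma continuous_on_trig_poly: "trig_poly f \<Longrightarrow> continuous_on S f"
proof (induction rule: trig_poly.induct)
  case (cosine b K c)
  show ?case
    by (intro continuous_intros continuous_on_subset[OF continuous_on_product_coordinates]) auto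
qed (auto intro: continuous_intros)

lemma trig_poly_bounded: "trig_poly f \<Longrightarrow> \<exists>B. \<forall>x. \<bar>f x\<bar> \<le> B"
proof (induction rule: trig_poly.induct)
  case (add f g)
  then obtain A B where "\<forall>x. \<bar>f x\<bar> \<le> A" "\<forall>x. \<bar>g x\<bar> \<le> B" by blast
  then have "\<forall>x. \<bar>f x + g x\<bar> \<le> A + B" by (meson abs_triangle_ineq add_mono order_trans)
  then show ?case by blast
next
  case (scale f a)
  then obtain A where "\<forall>x. \<bar>f x\<bar> \<le> A" by blast
  then have "\<forall>x. \<bar>a * f x\<bar> \<le> \<bar>a\<bar> * A" by (simp add: abs_mult mult_left_mono)
  then show ?case by blast
qed (auto intro: exI[of _ 1])

lemma trig_poly_compose_polynomial:
  fixes p :: "real \<Rightarrow> real"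
  assumes p: "real_polynomial_function p" and f: "trig_poly f"
  shows "trig_poly (\<lambda>x. p (f x))"
  using p
proof induction
  case (linear h)
  interpret bounded_linear h by fact
  have "h y = h 1 * y" for y using scaleR[of y 1] by (simp add: mult.commute)
  then have "(\<lambda>x. h (f x)) = (\<lambda>x. h 1 * f x)" by (intro ext)
  then show ?case using trig_poly.scale[OF f] by simp
qed (auto intro: trig_poly_const trig_poly.add trig_poly_mult)

text \<open>Tychonoff's theorem for a product of closed intervals.\<close>

lemma compact_PiE_intervals: "compact {x :: nat \<Rightarrow> real. \<forall>k. \<bar>x k\<bar> \<le> R k}"
proof -
  have "{x :: nat \<Rightarrow> real. \<forall>k. \<bar>x k\<bar> \<le> R k} = (\<Pi>\<^sub>E k\<in>UNIV. {- R k..R k})"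
    by (auto simp: PiE_iff abs_le_iff minus_le_iff)
  moreover have "compactin (product_topology (\<lambda>_. euclidean) UNIV) (\<Pi>\<^sub>E k\<in>UNIV. {- R k..R k :: real})"
    by (subst compactin_PiE) (auto simp: compactin_euclidean_iff)
  ultimately show ?thesis by (simp add: euclidean_product_topology compactin_euclidean_iff)
qed

text \<open>A trigonometric polynomial that is close to \<open>G\<close> on a compact set can be huge off that set;
  composing it with a polynomial that approximates truncation at the bound of \<open>G\<close> repairs this.\<close>

lemma trig_poly_approx:
  assumes S: "compact S" and G: "continuous_on S G" "\<And>x. x \<in> S \<Longrightarrow> \<bar>G x\<bar> \<le> b" and e: "0 < e"
  obtains Q where "trig_poly Q" "\<And>x. x \<in> S \<Longrightarrow> \<bar>Q x - G x\<bar> \<le> e" "\<And>x. \<bar>Q x\<bar> \<le> \<bar>b\<bar> + e"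
proof -
  have "\<exists>g. trig_poly g \<and> (\<forall>x\<in>S. \<bar>G x - g x\<bar> < e / 2)"
  proof (rule Stone_Weierstrass_HOL[OF S])
    fix x y :: "nat \<Rightarrow> real" assume xy: "x \<in> S \<and> y \<in> S \<and> x \<noteq> y"
    then obtain k where k: "x k \<noteq> y k" by auto
    \<comment> \<open>Scaling puts both coordinates into \<open>[-1, 1]\<close>, inside the interval
      where the sine is injective; the phase \<open>- (pi / 2)\<close> below turns the cosine into
      that sine.\<close>
    define a where "a = 1 / (1 + \<bar>x k\<bar> + \<bar>y k\<bar>)"
    have a: "a > 0" by (simp add: a_def add_pos_nonneg)
    have ab: "\<bar>a * z\<bar> \<le> 1" if "\<bar>z\<bar> \<le> 1 + \<bar>x k\<bar> + \<bar>y k\<bar>" for z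
      using that unfolding a_def by (simp add: abs_mult field_simps)
    let ?f = "\<lambda>z :: nat \<Rightarrow> real. cos (- (pi / 2) + (\<Sum>i<Suc k. (if i = k then a else 0) * z i))"
    have f: "?f z = sin (a * z k)" for z
    proof -
      have "(\<Sum>i<Suc k. (if i = k then a else 0) * z i) = a * z k"
        by (simp add: if_distrib[of "\<lambda>c. c * _"] cong: if_cong)
      moreover have "cos (- (pi / 2) + y) = sin y" for y by (subst cos_add) simp
      ultimately show ?thesis by simp
    qed
    have "?f x \<noteq> ?f y"
    proof
      assume "?f x = ?f y"
      then have "sin (a * x k) = sin (a * y k)" using f by simp
      moreover have p: "1 \<le> pi / 2" using pi_ge_two by simp
      moreover have q: "\<bar>a * x k\<bar> \<le> 1" "\<bar>a * y k\<bar> \<le> 1" using ab[of "x k"] ab[of "y k"] by auto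
      ultimately have "a * x k = a * y k"
        by (rule_tac sin_inj_pi) (use p q in linarith)+
      then show False using a k by simp
    qed
    then show "\<exists>f. trig_poly f \<and> f x \<noteq> f y" by (intro exI[of _ ?f] conjI trig_poly.cosine)
  qed (use G e in \<open>auto intro: trig_poly_const continuous_on_trig_poly trig_poly.add trig_poly_mult\<close>)
  then obtain g where g: "trig_poly g" "\<And>x. x \<in> S \<Longrightarrow> \<bar>G x - g x\<bar> < e / 2" by blast
  obtain B where "\<forall>x. \<bar>g x\<bar> \<le> B" using trig_poly_bounded[OF g(1)] ..
  then have B: "\<bar>g x\<bar> \<le> B" for x ..
  \<comment> \<open>The polynomial has to imitate truncation only on \<open>{-B..B}\<close>, which
    contains all values of \<open>g\<close>.\<close>
  define clip where "clip y = max (- \<bar>b\<bar>) (min \<bar>b\<bar> y)" for y :: real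
  have "continuous_on {-B..B} clip" unfolding clip_def by (intro continuous_intros)
  note approx = Stone_Weierstrass_real_polynomial_function[OF compact_Icc this half_gt_zero[OF e]]
  obtain p where p: "real_polynomial_function p" "\<And>y. y \<in> {-B..B} \<Longrightarrow> \<bar>clip y - p y\<bar> < e / 2"
    by (rule approx) (rule that)
  have pg: "\<bar>clip (g x) - p (g x)\<bar> < e / 2" for x using B[of x] by (intro p(2)) auto
  show ?thesis
  proof (rule that[of "\<lambda>x. p (g x)"])
    show "trig_poly (\<lambda>x. p (g x))" by (rule trig_poly_compose_polynomial[OF p(1) g(1)])
    show "\<bar>p (g x)\<bar> \<le> \<bar>b\<bar> + e" for x using pg[of x] e unfolding clip_def by linarith
    show "\<bar>p (g x) - G x\<bar> \<le> e" if "x \<in> S" for x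
      using pg[of x] g(2)[OF that] G(2)[OF that] unfolding clip_def by linarith
  qed
qed

lemma (in prob_space) prob_Union_geometric_le:
  assumes [measurable]: "\<And>k. A k \<in> events" and "\<And>k. prob (A k) \<le> e * (1 / 2) ^ Suc k"
  shows "prob (\<Union>k::nat. A k) \<le> e"
proof -
  have s: "(\<lambda>k. e * (1 / 2) ^ Suc k) sums e" using sums_mult[OF power_half_series, of e] by simp
  have s': "summable (\<lambda>k. prob (A k))"
    by (rule summable_comparison_test'[OF sums_summable[OF s], of 0]) (use assms(2) in auto)
  have "prob (\<Union>k. A k) \<le> (\<Sum>k. prob (A k))"
    by (rule finite_measure_subadditive_countably) (use s' in auto)
  also have "\<dots> \<le> (\<Sum>k. e * (1 / 2) ^ Suc k)"
    by (rule suminf_le[OF assms(2) s' sums_summable[OF s]])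
  finally show ?thesis using sums_unique[OF s] by simp
qed

text \<open>Convergence of all cosines passes to trigonometric polynomials by linearity. Granting
  coordinate \<open>k\<close> the failure probability \<open>e' * (1 / 2) ^ Suc k\<close> produces
  one compact box that carries all the laws up to \<open>e'\<close>; on it \<open>G\<close> is close
  to such a polynomial, whose global bound controls the rest.\<close>

lemma weak_convergence_of_cosines:
  fixes V :: "nat \<Rightarrow> 'a \<Rightarrow> nat \<Rightarrow> real" and W :: "'b \<Rightarrow> nat \<Rightarrow> real" and G :: "(nat \<Rightarrow> real) \<Rightarrow> real"
  assumes M: "prob_space M" and N: "prob_space N"
    and V[measurable]: "\<And>n k. (\<lambda>\<omega>. V n \<omega> k) \<in> borel_measurable M"
    and W[measurable]: "\<And>k. (\<lambda>\<omega>. W \<omega> k) \<in> borel_measurable N"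
    and cosines: "\<And>b c K. (\<lambda>n. \<integral>\<omega>. cos (b + (\<Sum>k<K. c k * V n \<omega> k)) \<partial>M) \<longlonglongrightarrow>
      (\<integral>\<omega>. cos (b + (\<Sum>k<K. c k * W \<omega> k)) \<partial>N)"
    and tight: "\<And>k e. 0 < e \<Longrightarrow> \<exists>R. \<forall>n. measure M {\<omega> \<in> space M. R < \<bar>V n \<omega> k\<bar>} \<le> e"
    and G: "continuous_on UNIV G" "\<And>x. \<bar>G x\<bar> \<le> b"
  shows "(\<lambda>n. \<integral>\<omega>. G (V n \<omega>) \<partial>M) \<longlonglongrightarrow> (\<integral>\<omega>. G (W \<omega>) \<partial>N)"
proof (rule tendstoI)
  interpret M: prob_space M by fact
  interpret N: prob_space N by fact
  have Vm: "V n \<in> borel_measurable M" for n by (rule measurable_coordinatewise_then_product) measurable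
  have Wm: "W \<in> borel_measurable N" by (rule measurable_coordinatewise_then_product) measurable
  have Gm: "G \<in> borel_measurable borel" using G(1) by (rule borel_measurable_continuous_onI)
  fix r :: real assume r: "0 < r"
  \<comment> \<open>Two of the three errors \<open>r / 3\<close> come from replacing
    \<open>G\<close> by \<open>Q\<close>. The choice gives
    \<open>2 * (\<bar>b\<bar> + 2) * e = r / 4\<close>, and the cap at 1 in \<open>e'\<close> bounds
    \<open>Q\<close> by \<open>\<bar>b\<bar> + 1\<close>.\<close>
  define e where "e = r / (4 * (\<bar>b\<bar> + 2)) / 2"
  define e' where "e' = min 1 e"
  have e': "0 < e'" "e' \<le> 1" using r by (auto simp: e'_def e_def)
  have small: "e' + 2 * (\<bar>b\<bar> + 1) * e' \<le> r / 3"
  proof -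
    have "e' + 2 * (\<bar>b\<bar> + 1) * e' \<le> 2 * (\<bar>b\<bar> + 2) * e'" using e' by (simp add: algebra_simps)
    also have "\<dots> \<le> 2 * (\<bar>b\<bar> + 2) * e" by (intro mult_left_mono) (auto simp: e'_def)
    also have "\<dots> = r / 4"
    proof -
      have "\<bar>b\<bar> + 2 \<noteq> 0" by linarith
      then show ?thesis unfolding e_def by (simp add: divide_simps)
    qed
    finally show ?thesis using r by linarith
  qed
  have "\<exists>R. \<forall>n. measure M {\<omega> \<in> space M. R < \<bar>V n \<omega> k\<bar>} \<le> e' * (1 / 2) ^ Suc k" for k
    by (rule tight) (use e' in auto)
  then obtain RV where RV: "\<And>k n. measure M {\<omega> \<in> space M. RV k < \<bar>V n \<omega> k\<bar>} \<le> e' * (1 / 2) ^ Suc k"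
    by metis
  have "\<exists>R. measure N {\<omega> \<in> space N. R < \<bar>W \<omega> k\<bar>} \<le> e' * (1 / 2) ^ Suc k" for k
    by (rule N.tight_random_variable) (use e' in auto)
  then obtain RW where RW: "\<And>k. measure N {\<omega> \<in> space N. RW k < \<bar>W \<omega> k\<bar>} \<le> e' * (1 / 2) ^ Suc k"
    by metis
  define R where "R k = max (RV k) (RW k)" for k
  define S where "S = {x :: nat \<Rightarrow> real. \<forall>k. \<bar>x k\<bar> \<le> R k}"
  obtain Q where Q: "trig_poly Q" "\<And>x. x \<in> S \<Longrightarrow> \<bar>Q x - G x\<bar> \<le> e'" "\<And>x. \<bar>Q x\<bar> \<le> \<bar>b\<bar> + e'"
  proof (rule trig_poly_approx[of S G b e'])
    show "compact S" unfolding S_def by (rule compact_PiE_intervals)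
  qed (use G e' in \<open>auto intro: continuous_on_subset\<close>)
  have Q1: "\<bar>Q x\<bar> \<le> \<bar>b\<bar> + 1" "\<bar>G x\<bar> \<le> \<bar>b\<bar> + 1" for x using Q(3)[of x] G(2)[of x] e' by linarith+
  have Qm: "Q \<in> borel_measurable borel"
    using continuous_on_trig_poly[OF Q(1)] by (rule borel_measurable_continuous_onI)
  have QV: "\<bar>(\<integral>\<omega>. G (V n \<omega>) \<partial>M) - (\<integral>\<omega>. Q (V n \<omega>) \<partial>M)\<bar> \<le> r / 3" for n
  proof -
    let ?A = "\<Union>k. {\<omega> \<in> space M. RV k < \<bar>V n \<omega> k\<bar>}"
    have "\<bar>(\<integral>\<omega>. G (V n \<omega>) \<partial>M) - (\<integral>\<omega>. Q (V n \<omega>) \<partial>M)\<bar> \<le> e' + 2 * (\<bar>b\<bar> + 1) * measure M ?A"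
    proof (rule M.expectation_diff_le)
      fix \<omega> assume "\<omega> \<in> space M - ?A"
      then have "\<forall>k. \<bar>V n \<omega> k\<bar> \<le> RV k" by (auto simp: not_less)
      then have "V n \<omega> \<in> S" unfolding S_def R_def by (auto simp: le_max_iff_disj)
      then show "\<bar>G (V n \<omega>) - Q (V n \<omega>)\<bar> \<le> e'" using Q(2) by (simp add: abs_minus_commute)
    qed (use Q1 e' measurable_compose[OF Vm Gm] measurable_compose[OF Vm Qm] in simp_all)
    also have "\<dots> \<le> e' + 2 * (\<bar>b\<bar> + 1) * e'"
      by (intro add_mono mult_left_mono M.prob_Union_geometric_le RV) auto
    finally show ?thesis using small by linarith
  qed
  have QW: "\<bar>(\<integral>\<omega>. G (W \<omega>) \<partial>N) - (\<integral>\<omega>. Q (W \<omega>) \<partial>N)\<bar> \<le> r / 3"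
  proof -
    let ?A = "\<Union>k. {\<omega> \<in> space N. RW k < \<bar>W \<omega> k\<bar>}"
    have "\<bar>(\<integral>\<omega>. G (W \<omega>) \<partial>N) - (\<integral>\<omega>. Q (W \<omega>) \<partial>N)\<bar> \<le> e' + 2 * (\<bar>b\<bar> + 1) * measure N ?A"
    proof (rule N.expectation_diff_le)
      fix \<omega> assume "\<omega> \<in> space N - ?A"
      then have "\<forall>k. \<bar>W \<omega> k\<bar> \<le> RW k" by (auto simp: not_less)
      then have "W \<omega> \<in> S" unfolding S_def R_def by (auto simp: le_max_iff_disj)
      then show "\<bar>G (W \<omega>) - Q (W \<omega>)\<bar> \<le> e'" using Q(2) by (simp add: abs_minus_commute)
    qed (use Q1 e' measurable_compose[OF Wm Gm] measurable_compose[OF Wm Qm] in simp_all)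
    also have "\<dots> \<le> e' + 2 * (\<bar>b\<bar> + 1) * e'"
      by (intro add_mono mult_left_mono N.prob_Union_geometric_le RW) auto
    finally show ?thesis using small by linarith
  qed
  have int: "integrable M (\<lambda>\<omega>. f (V n \<omega>))" "integrable N (\<lambda>\<omega>. f (W \<omega>))" if f: "trig_poly f" for f n
  proof -
    obtain B where "\<forall>x. \<bar>f x\<bar> \<le> B" using trig_poly_bounded[OF f] ..
    then have B: "\<bar>f x\<bar> \<le> B" for x ..
    have f: "f \<in> borel_measurable borel"
      using continuous_on_trig_poly[OF f] by (rule borel_measurable_continuous_onI)
    show "integrable M (\<lambda>\<omega>. f (V n \<omega>))"
      by (rule M.integrable_const_bound[of _ B]) (use B measurable_compose[OF Vm f] in simp_all)
    show "integrable N (\<lambda>\<omega>. f (W \<omega>))"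
      by (rule N.integrable_const_bound[of _ B]) (use B measurable_compose[OF Wm f] in simp_all)
  qed
  have "(\<lambda>n. \<integral>\<omega>. Q (V n \<omega>) \<partial>M) \<longlonglongrightarrow> (\<integral>\<omega>. Q (W \<omega>) \<partial>N)"
    using Q(1)
  proof (induction rule: trig_poly.induct)
    case (add f g)
    then show ?case using int by (simp add: tendsto_add)
  qed (auto intro: cosines tendsto_mult)
  from tendstoD[OF this, of "r / 3"] r
  have "\<forall>\<^sub>F n in sequentially. dist (\<integral>\<omega>. Q (V n \<omega>) \<partial>M) (\<integral>\<omega>. Q (W \<omega>) \<partial>N) < r / 3" by simp
  then show "\<forall>\<^sub>F n in sequentially. dist (\<integral>\<omega>. G (V n \<omega>) \<partial>M) (\<integral>\<omega>. G (W \<omega>) \<partial>N) < r"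
  proof eventually_elim
    case (elim n)
    then show ?case using QV[of n] QW unfolding dist_real_def by linarith
  qed
qed

text \<open>The Pasch-Hausdorff envelope: for bounded \<open>F\<close> the largest minorant with
  Lipschitz constant \<open>k\<close>. It tends to a continuous \<open>F\<close> pointwise, so
  Lipschitz test functions reach all continuous ones.\<close>

definition inf_conv :: "('c::metric_space \<Rightarrow> real) \<Rightarrow> nat \<Rightarrow> 'c \<Rightarrow> real" where
  "inf_conv F k x = (INF y. F y + real k * dist x y)"

context
  fixes F :: "'c::metric_space \<Rightarrow> real" and B :: real
  assumes B: "\<And>x. \<bar>F x\<bar> \<le> B"
begin

lemma inf_conv_bdd: "bdd_below (range (\<lambda>y. F y + real k * dist x y))"
proof (rule bdd_belowI2[of _ "- B"])
  fix y show "- B \<le> F y + real k * dist x y"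
    using abs_le_D2[OF B[of y]] mult_nonneg_nonneg[OF of_nat_0_le_iff[of k] zero_le_dist[of x y]] by linarith
qed

lemma inf_conv_le: "inf_conv F k x \<le> F y + real k * dist x y"
  unfolding inf_conv_def by (rule cINF_lower[OF inf_conv_bdd]) auto

lemma inf_conv_le': "inf_conv F k x \<le> F x"
  using inf_conv_le[of k x x] by simp

lemma inf_conv_ge:
  assumes "\<And>y. c \<le> F y + real k * dist x y"
  shows "c \<le> inf_conv F k x"
  unfolding inf_conv_def using assms by (intro cINF_greatest) auto

lemma inf_conv_abs_le: "\<bar>inf_conv F k x\<bar> \<le> B"
proof -
  have "- B \<le> F y + real k * dist x y" for y
    using abs_le_D2[OF B[of y]] mult_nonneg_nonneg[OF of_nat_0_le_iff[of k] zero_le_dist[of x y]] by linarith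
  then have "- B \<le> inf_conv F k x" by (rule inf_conv_ge)
  then show ?thesis using inf_conv_le'[of k x] B[of x] by (auto simp: abs_le_iff)
qed

lemma inf_conv_Lipschitz: "\<bar>inf_conv F k x - inf_conv F k x'\<bar> \<le> real k * dist x x'"
proof -
  have *: "inf_conv F k x - real k * dist x x' \<le> inf_conv F k x'" for x x'
  proof (rule inf_conv_ge)
    fix y
    have "real k * dist x y \<le> real k * (dist x x' + dist x' y)"
      by (intro mult_left_mono dist_triangle) auto
    then show "inf_conv F k x - real k * dist x x' \<le> F y + real k * dist x' y"
      using inf_conv_le[of k x y] by (simp add: distrib_left)
  qed
  from *[of x x'] *[of x' x] show ?thesis by (simp add: dist_commute)
qed

text \<open>A competitor at distance at least \<open>d\<close> pays at least \<open>2 * B\<close>,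
  the largest possible oscillation of \<open>F\<close>; nearby competitors are handled by continuity
  at \<open>x\<close>.\<close>

lemma inf_conv_tendsto:
  assumes F: "continuous_on UNIV F"
  shows "(\<lambda>k. inf_conv F k x) \<longlonglongrightarrow> F x"
proof (rule LIMSEQ_I)
  fix e :: real assume e: "0 < e"
  obtain d where d: "d > 0" "\<And>y. dist y x < d \<Longrightarrow> \<bar>F y - F x\<bar> < e / 2"
    using F e unfolding continuous_on_iff dist_real_def
    by (metis UNIV_I half_gt_zero)
  obtain k0 :: nat where k0: "2 * B / d < real k0" using reals_Archimedean2 by blast
  have "norm (inf_conv F k x - F x) < e" if k: "k \<ge> k0" for k
  proof -
    have "F x - e / 2 \<le> inf_conv F k x"
    proof (rule inf_conv_ge)
      fix y
      show "F x - e / 2 \<le> F y + real k * dist x y"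
      proof (cases "dist y x < d")
        case True
        then show ?thesis using d(2)[OF True] mult_nonneg_nonneg[OF of_nat_0_le_iff[of k] zero_le_dist[of x y]] by linarith
      next
        case False
        have "2 * B / d \<le> real k" using k0 k by linarith
        then have "2 * B \<le> real k * d" using d(1) by (simp add: field_simps)
        also have "\<dots> \<le> real k * dist x y" using False by (intro mult_left_mono) (auto simp: dist_commute)
        finally show ?thesis using B[of x] B[of y] e by linarith
      qed
    qed
    then show ?thesis using inf_conv_le'[of k x] e unfolding real_norm_def by linarith
  qed
  then show "\<exists>k0. \<forall>k\<ge>k0. norm (inf_conv F k x - F x) < e" by blast
qed

end

text \<open>A Lipschitz minorant whose integral against the limit law is almost that of
  \<open>F\<close> gives a lower bound for the integrals along the sequence; the same bound for
  \<open>- F\<close> closes the gap.\<close>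

lemma weak_convergence_of_Lipschitz:
  fixes Y :: "nat \<Rightarrow> 'a \<Rightarrow> 'c::metric_space" and Z :: "'b \<Rightarrow> 'c"
  assumes M: "prob_space M" and N: "prob_space N"
    and Y: "\<And>n. Y n \<in> measurable M borel" and Z: "Z \<in> measurable N borel"
    and Lip: "\<And>F L B. (\<And>x y. \<bar>F x - F y\<bar> \<le> L * dist x y) \<Longrightarrow> 0 \<le> L \<Longrightarrow> (\<And>x. \<bar>F x\<bar> \<le> B) \<Longrightarrow>
      (\<lambda>n. \<integral>\<omega>. F (Y n \<omega>) \<partial>M) \<longlonglongrightarrow> (\<integral>\<omega>. F (Z \<omega>) \<partial>N)"
  shows "converges_in_law M Y N Z"
  unfolding converges_in_law_def
proof (intro conjI allI impI Y Z)
  interpret M: prob_space M by fact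
  interpret N: prob_space N by fact
  have lower: "\<forall>\<^sub>F n in sequentially. (\<integral>\<omega>. F (Z \<omega>) \<partial>N) - e < (\<integral>\<omega>. F (Y n \<omega>) \<partial>M)"
    if F: "continuous_on UNIV F" and B: "\<And>x. \<bar>F x\<bar> \<le> B" and e: "0 < e" for F B and e :: real
  proof -
    have Fm: "F \<in> borel_measurable borel" using F by (rule borel_measurable_continuous_onI)
    have cont: "continuous_on UNIV (inf_conv F k)" for k
      unfolding continuous_on_iff
    proof (intro ballI allI impI)
      fix x and a :: real assume a: "0 < a"
      show "\<exists>d>0. \<forall>y\<in>UNIV. dist y x < d \<longrightarrow> dist (inf_conv F k y) (inf_conv F k x) < a"
      proof (intro exI[of _ "a / (1 + real k)"] conjI ballI impI)
        fix y assume y: "dist y x < a / (1 + real k)"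
        have "dist (inf_conv F k y) (inf_conv F k x) \<le> real k * dist y x"
          using inf_conv_Lipschitz[of F B, OF B, where k = k and x = y and x' = x] by (simp add: dist_real_def)
        also have "\<dots> \<le> (1 + real k) * dist y x" by (simp add: distrib_right)
        also have "\<dots> < a" using y by (simp add: field_simps)
        finally show "dist (inf_conv F k y) (inf_conv F k x) < a" .
      qed (use a in auto)
    qed
    have km: "inf_conv F k \<in> borel_measurable borel" for k
      using cont by (rule borel_measurable_continuous_onI)
    have "(\<lambda>k. \<integral>\<omega>. inf_conv F k (Z \<omega>) \<partial>N) \<longlonglongrightarrow> (\<integral>\<omega>. F (Z \<omega>) \<partial>N)"
      by (rule integral_dominated_convergence[where w = "\<lambda>_. B"])
        (use inf_conv_abs_le[of F B, OF B] inf_conv_tendsto[of F B, OF B F] measurable_compose[OF Z Fm]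
          measurable_compose[OF Z km] in simp_all)
    from order_tendstoD(1)[OF this, of "(\<integral>\<omega>. F (Z \<omega>) \<partial>N) - e / 2"] e
    have "\<forall>\<^sub>F k in sequentially. (\<integral>\<omega>. F (Z \<omega>) \<partial>N) - e / 2 < (\<integral>\<omega>. inf_conv F k (Z \<omega>) \<partial>N)" by simp
    from eventually_happens'[OF sequentially_bot this]
    obtain k where k: "(\<integral>\<omega>. F (Z \<omega>) \<partial>N) - e / 2 < (\<integral>\<omega>. inf_conv F k (Z \<omega>) \<partial>N)" ..
    have "(\<lambda>n. \<integral>\<omega>. inf_conv F k (Y n \<omega>) \<partial>M) \<longlonglongrightarrow> (\<integral>\<omega>. inf_conv F k (Z \<omega>) \<partial>N)"
      by (rule Lip[of _ "real k" B]) (use inf_conv_Lipschitz[of F B, OF B] inf_conv_abs_le[of F B, OF B] in auto)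
    from order_tendstoD(1)[OF this, of "(\<integral>\<omega>. inf_conv F k (Z \<omega>) \<partial>N) - e / 2"] e
    have "\<forall>\<^sub>F n in sequentially. (\<integral>\<omega>. inf_conv F k (Z \<omega>) \<partial>N) - e / 2 < (\<integral>\<omega>. inf_conv F k (Y n \<omega>) \<partial>M)"
      by auto
    then show ?thesis
    proof eventually_elim
      case (elim n)
      have "(\<integral>\<omega>. inf_conv F k (Y n \<omega>) \<partial>M) \<le> (\<integral>\<omega>. F (Y n \<omega>) \<partial>M)"
      proof (rule integral_mono)
        show "integrable M (\<lambda>\<omega>. inf_conv F k (Y n \<omega>))" "integrable M (\<lambda>\<omega>. F (Y n \<omega>))"
          by (rule M.integrable_const_bound[of _ B],
            use B inf_conv_abs_le[of F B, OF B] measurable_compose[OF Y km] measurable_compose[OF Y Fm] in simp_all)+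
      qed (rule inf_conv_le'[of F B, OF B])
      then show ?case using elim k by linarith
    qed
  qed
  fix F :: "'c \<Rightarrow> real" assume F: "continuous_on UNIV F \<and> bounded (range F)"
  then obtain B where B: "\<And>x. \<bar>F x\<bar> \<le> B" by (auto simp: bounded_iff)
  show "(\<lambda>n. \<integral>\<omega>. F (Y n \<omega>) \<partial>M) \<longlonglongrightarrow> (\<integral>\<omega>. F (Z \<omega>) \<partial>N)"
  proof (rule tendstoI)
    fix e :: real assume e: "0 < e"
    have "\<forall>\<^sub>F n in sequentially. (\<integral>\<omega>. F (Z \<omega>) \<partial>N) - e < (\<integral>\<omega>. F (Y n \<omega>) \<partial>M)"
      by (rule lower[of F B]) (use F B e in auto)
    moreover have "\<forall>\<^sub>F n in sequentially. (\<integral>\<omega>. - F (Z \<omega>) \<partial>N) - e < (\<integral>\<omega>. - F (Y n \<omega>) \<partial>M)"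
      by (rule lower[of _ B]) (use F B e in \<open>auto intro: continuous_intros\<close>)
    ultimately show "\<forall>\<^sub>F n in sequentially. dist (\<integral>\<omega>. F (Y n \<omega>) \<partial>M) (\<integral>\<omega>. F (Z \<omega>) \<partial>N) < e"
    proof eventually_elim
      case (elim n)
      then show ?case unfolding dist_real_def Bochner_Integration.integral_minus by linarith
    qed
  qed
qed

text \<open>Three errors: from \<open>Y n\<close> to its interpolant (small off an event, uniformly
  in \<open>n\<close>), between the interpolants (continuous functions of grid values, hence
  \<open>fdd\<close>), and from the interpolant of \<open>Z\<close> back to \<open>Z\<close>
  (dominated convergence). \<open>tight\<close> speaks of all large \<open>m\<close> because the
  last error asks for a large \<open>m\<close> too.\<close>

lemma cpath_converges_in_law:
  fixes Y :: "nat \<Rightarrow> 'a \<Rightarrow> cpath" and Z :: "'b \<Rightarrow> cpath"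
  assumes M: "prob_space M" and N: "prob_space N"
    and Y: "\<And>n. Y n \<in> measurable M borel" and Z: "Z \<in> measurable N borel"
    and fdd: "\<And>(G :: (nat \<Rightarrow> real) \<Rightarrow> real) b m. continuous_on UNIV G \<Longrightarrow> (\<And>x. \<bar>G x\<bar> \<le> b) \<Longrightarrow>
      (\<lambda>n. \<integral>\<omega>. G (\<lambda>k. Rep_cpath (Y n \<omega>) (real k / 2 ^ m)) \<partial>M) \<longlonglongrightarrow>
      (\<integral>\<omega>. G (\<lambda>k. Rep_cpath (Z \<omega>) (real k / 2 ^ m)) \<partial>N)"
    and tight: "\<And>e. 0 < e \<Longrightarrow> \<exists>m0. \<forall>m\<ge>m0. \<forall>n. \<exists>A\<in>sets M. measure M A \<le> e \<and>
      (\<forall>\<omega>\<in>space M - A. dist (interp_cpath m (\<lambda>k. Rep_cpath (Y n \<omega>) (real k / 2 ^ m))) (Y n \<omega>) \<le> e)"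
  shows "converges_in_law M Y N Z"
proof (rule weak_convergence_of_Lipschitz[OF M N Y Z])
  interpret M: prob_space M by fact
  interpret N: prob_space N by fact
  fix F :: "cpath \<Rightarrow> real" and L B
  assume L: "\<And>x y. \<bar>F x - F y\<bar> \<le> L * dist x y" "0 \<le> L" and B: "\<And>x. \<bar>F x\<bar> \<le> B"
  have F: "continuous_on UNIV F"
    unfolding continuous_on_iff
  proof (intro ballI allI impI)
    fix x and a :: real assume a: "0 < a"
    show "\<exists>d>0. \<forall>y\<in>UNIV. dist y x < d \<longrightarrow> dist (F y) (F x) < a"
    proof (intro exI[of _ "a / (1 + L)"] conjI ballI impI)
      fix y assume y: "dist y x < a / (1 + L)"
      have "dist (F y) (F x) \<le> L * dist y x" using L(1)[of y x] by (simp add: dist_real_def)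
      also have "\<dots> \<le> (1 + L) * dist y x" by (simp add: distrib_right)
      also have "\<dots> < a" using y L(2) by (simp add: field_simps)
      finally show "dist (F y) (F x) < a" .
    qed (use a L(2) in auto)
  qed
  have Fm: "F \<in> borel_measurable borel" using F by (rule borel_measurable_continuous_onI)
  let ?I = "\<lambda>m f. interp_cpath m (\<lambda>k. Rep_cpath f (real k / 2 ^ m))"
  have Im: "?I m \<in> measurable borel borel" for m
  proof (rule measurable_compose[OF _ borel_measurable_continuous_onI[OF continuous_on_interp_cpath]])
    show "(\<lambda>f k. Rep_cpath f (real k / 2 ^ m)) \<in> borel_measurable borel"
      by (intro measurable_coordinatewise_then_product borel_measurable_eval_cpath) auto
  qed
  have FI: "(\<lambda>f. F (?I m f)) \<in> borel_measurable borel" for m by (rule measurable_compose[OF Im Fm])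
  have lim_Z: "(\<lambda>m. \<integral>\<omega>. F (?I m (Z \<omega>)) \<partial>N) \<longlonglongrightarrow> (\<integral>\<omega>. F (Z \<omega>) \<partial>N)"
  proof (rule integral_dominated_convergence[where w = "\<lambda>_. B"])
    show "AE \<omega> in N. (\<lambda>m. F (?I m (Z \<omega>))) \<longlonglongrightarrow> F (Z \<omega>)"
      by (intro AE_I2 continuous_on_tendsto_compose[OF F] interp_cpath_tendsto) auto
  qed (use B measurable_compose[OF Z FI] measurable_compose[OF Z Fm] in simp_all)
  have B0: "0 \<le> B" using B[of undefined] by linarith
  show "(\<lambda>n. \<integral>\<omega>. F (Y n \<omega>) \<partial>M) \<longlonglongrightarrow> (\<integral>\<omega>. F (Z \<omega>) \<partial>N)"
  proof (rule tendstoI)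
    fix r :: real assume r: "0 < r"
    \<comment> \<open>The Lipschitz part \<open>L * e\<close> and the exceptional event
      \<open>2 * B * e\<close> together must cost less than one third of \<open>r\<close>.\<close>
    define e where "e = r / (3 * (1 + L + 2 * B))"
    have e: "0 < e" using r L(2) B0 by (simp add: e_def)
    have small: "L * e + 2 * B * e < r / 3"
    proof -
      have "L * e + 2 * B * e < (1 + L + 2 * B) * e" using e by (simp add: algebra_simps)
      also have "\<dots> = r / 3"
      proof -
        have "1 + L + 2 * B \<noteq> 0" using L(2) B0 by linarith
        then show ?thesis unfolding e_def by (simp add: divide_simps)
      qed
      finally show ?thesis .
    qed
    obtain m0 where m0: "\<And>m n. m \<ge> m0 \<Longrightarrow> \<exists>A\<in>sets M. measure M A \<le> e \<and>
        (\<forall>\<omega>\<in>space M - A. dist (?I m (Y n \<omega>)) (Y n \<omega>) \<le> e)"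
      using tight[OF e] by blast
    have "\<forall>\<^sub>F m in sequentially. dist (\<integral>\<omega>. F (?I m (Z \<omega>)) \<partial>N) (\<integral>\<omega>. F (Z \<omega>) \<partial>N) < r / 3"
      using tendstoD[OF lim_Z, of "r / 3"] r by simp
    then obtain m1 where m1: "\<And>m. m \<ge> m1 \<Longrightarrow> \<bar>(\<integral>\<omega>. F (?I m (Z \<omega>)) \<partial>N) - (\<integral>\<omega>. F (Z \<omega>) \<partial>N)\<bar> < r / 3"
      unfolding eventually_sequentially dist_real_def by metis
    define m where "m = max m0 m1"
    have near: "\<bar>(\<integral>\<omega>. F (Y n \<omega>) \<partial>M) - (\<integral>\<omega>. F (?I m (Y n \<omega>)) \<partial>M)\<bar> < r / 3" for n
    proof -
      obtain A where A: "A \<in> sets M" "measure M A \<le> e"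
        "\<And>\<omega>. \<omega> \<in> space M - A \<Longrightarrow> dist (?I m (Y n \<omega>)) (Y n \<omega>) \<le> e"
        using m0[of m n] by (auto simp: m_def)
      have "\<bar>(\<integral>\<omega>. F (Y n \<omega>) \<partial>M) - (\<integral>\<omega>. F (?I m (Y n \<omega>)) \<partial>M)\<bar> \<le> L * e + 2 * B * measure M A"
      proof (rule M.expectation_diff_le)
        fix \<omega> assume "\<omega> \<in> space M - A"
        then have "L * dist (Y n \<omega>) (?I m (Y n \<omega>)) \<le> L * e"
          using A(3) L(2) by (intro mult_left_mono) (auto simp: dist_commute)
        then show "\<bar>F (Y n \<omega>) - F (?I m (Y n \<omega>))\<bar> \<le> L * e" using L(1) order_trans by blast
      qed (use A B e L measurable_compose[OF Y Fm] measurable_compose[OF Y FI] in simp_all)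
      also have "\<dots> \<le> L * e + 2 * B * e" using A(2) B0 by (intro add_mono[OF order_refl] mult_left_mono) auto
      finally show ?thesis using small by linarith
    qed
    have "(\<lambda>n. \<integral>\<omega>. F (?I m (Y n \<omega>)) \<partial>M) \<longlonglongrightarrow> (\<integral>\<omega>. F (?I m (Z \<omega>)) \<partial>N)"
    proof (rule fdd[of "\<lambda>x. F (interp_cpath m x)" B])
      show "continuous_on UNIV (\<lambda>x. F (interp_cpath m x))"
        by (rule continuous_on_compose2[OF F continuous_on_interp_cpath]) auto
    qed (rule B)
    from tendstoD[OF this, of "r / 3"] r
    have "\<forall>\<^sub>F n in sequentially. dist (\<integral>\<omega>. F (?I m (Y n \<omega>)) \<partial>M) (\<integral>\<omega>. F (?I m (Z \<omega>)) \<partial>N) < r / 3"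
      by simp
    then show "\<forall>\<^sub>F n in sequentially. dist (\<integral>\<omega>. F (Y n \<omega>) \<partial>M) (\<integral>\<omega>. F (Z \<omega>) \<partial>N) < r"
    proof eventually_elim
      case (elim n)
      have "m1 \<le> m" by (simp add: m_def)
      from elim near[of n] m1[OF this] show ?case unfolding dist_real_def by linarith
    qed
  qed
qed

section \<open>Exponential bounds for sums of independent variables\<close>

lemma exp_le_quadratic:
  fixes x :: real
  assumes "\<bar>x\<bar> \<le> 1"
  shows "exp x \<le> 1 + x + x\<^sup>2"
proof (cases "0 \<le> x")
  case True
  then show ?thesis using assms by (intro exp_bound) auto
next
  case False
  define y where "y = - x"
  have y: "0 \<le> y" using False by (simp add: y_def)
  \<comment> \<open>At the negative argument \<open>- y\<close> the claim reads
    \<open>1 \<le> (1 - y + y\<^sup>2) * exp y\<close>, and the quadratic Taylor minorant of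
    \<open>exp y\<close> already gives it.\<close>
  have "1 \<le> (1 - y + y\<^sup>2) * (1 + y + y\<^sup>2 / 2)"
  proof -
    have "(1 - y + y\<^sup>2) * (1 + y + y\<^sup>2 / 2) = 1 + (y ^ 2 + y ^ 3 + y ^ 4) / 2"
      by (simp add: field_simps power2_eq_square power3_eq_cube power4_eq_xxxx)
    then show ?thesis using y by simp
  qed
  also have "\<dots> \<le> (1 - y + y\<^sup>2) * exp y"
  proof (intro mult_left_mono exp_lower_Taylor_quadratic y)
    have "0 \<le> (y - 1 / 2)\<^sup>2" by simp
    then show "0 \<le> 1 - y + y\<^sup>2" by (simp add: power2_eq_square algebra_simps)
  qed
  finally have "exp (- y) \<le> 1 - y + y\<^sup>2" by (simp add: exp_minus field_simps)
  then show ?thesis by (simp add: y_def)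
qed

text \<open>Chernoff's bound with \<open>\<theta> = d / (2 * w)\<close>, the minimiser of
  \<open>1 - \<theta> * d + \<theta>\<^sup>2 * w\<close>; \<open>d \<le> 2 * w\<close> keeps
  \<open>\<theta> \<le> 1\<close>, so that the quadratic bound on \<open>exp\<close> applies. The
  second moment \<open>w\<close> in the denominator is the source of the exponent 1/4.\<close>

lemma (in prob_space) prob_sum_nonneg_le:
  fixes \<xi> :: "'i \<Rightarrow> 'a \<Rightarrow> real"
  assumes indep: "indep_vars (\<lambda>_. borel) \<xi> I" and I: "finite I"
    and b: "\<And>i \<omega>. i \<in> I \<Longrightarrow> \<omega> \<in> space M \<Longrightarrow> \<bar>\<xi> i \<omega>\<bar> \<le> 1"
    and mean: "\<And>i. i \<in> I \<Longrightarrow> expectation (\<xi> i) \<le> - d"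
    and second: "\<And>i. i \<in> I \<Longrightarrow> expectation (\<lambda>\<omega>. (\<xi> i \<omega>)\<^sup>2) \<le> w"
    and d: "0 \<le> d" "d \<le> 2 * w" "0 < w"
  shows "prob {\<omega> \<in> space M. 0 \<le> (\<Sum>i\<in>I. \<xi> i \<omega>)} \<le> exp (- (real (card I) * d\<^sup>2 / (4 * w)))"
proof -
  define \<theta> where "\<theta> = d / (2 * w)"
  have \<theta>: "0 \<le> \<theta>" "\<theta> \<le> 1" using d by (auto simp: \<theta>_def field_simps)
  have \<xi>[measurable]: "\<xi> i \<in> borel_measurable M" if "i \<in> I" for i
    using indep that by (auto simp: indep_vars_def)
  have one: "expectation (\<lambda>\<omega>. exp (\<theta> * \<xi> i \<omega>)) \<le> exp (- (d\<^sup>2 / (4 * w)))" if i: "i \<in> I" for i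
  proof -
    note m[measurable] = \<xi>[OF i]
    have le: "exp (\<theta> * \<xi> i \<omega>) \<le> 1 + \<theta> * \<xi> i \<omega> + \<theta>\<^sup>2 * (\<xi> i \<omega>)\<^sup>2" if "\<omega> \<in> space M" for \<omega>
    proof -
      have "\<bar>\<theta> * \<xi> i \<omega>\<bar> \<le> 1" using b[OF i that] \<theta> by (simp add: abs_mult mult_le_one)
      from exp_le_quadratic[OF this] show ?thesis by (simp add: power_mult_distrib)
    qed
    have int: "integrable M (\<xi> i)" "integrable M (\<lambda>\<omega>. (\<xi> i \<omega>)\<^sup>2)" "integrable M (\<lambda>\<omega>. exp (\<theta> * \<xi> i \<omega>))"
    proof -
      show "integrable M (\<xi> i)"
        by (rule integrable_const_bound[of _ 1]) (use b[OF i] in auto)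
      show "integrable M (\<lambda>\<omega>. (\<xi> i \<omega>)\<^sup>2)"
        by (rule integrable_const_bound[of _ 1])
          (use b[OF i] in \<open>auto simp: abs_square_le_1\<close>)
      show "integrable M (\<lambda>\<omega>. exp (\<theta> * \<xi> i \<omega>))"
      proof (rule integrable_const_bound[of _ "exp 1"])
        show "AE \<omega> in M. norm (exp (\<theta> * \<xi> i \<omega>)) \<le> exp 1"
        proof (rule AE_I2)
          fix \<omega> assume "\<omega> \<in> space M"
          from b[OF i this] have "\<bar>\<theta> * \<xi> i \<omega>\<bar> \<le> 1" using \<theta> by (simp add: abs_mult mult_le_one)
          then show "norm (exp (\<theta> * \<xi> i \<omega>)) \<le> exp 1" by simp
        qed
      qed measurable
    qed
    have "expectation (\<lambda>\<omega>. exp (\<theta> * \<xi> i \<omega>)) \<le> expectation (\<lambda>\<omega>. 1 + \<theta> * \<xi> i \<omega> + \<theta>\<^sup>2 * (\<xi> i \<omega>)\<^sup>2)"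
      by (rule integral_mono) (use int le in auto)
    also have "\<dots> = 1 + \<theta> * expectation (\<xi> i) + \<theta>\<^sup>2 * expectation (\<lambda>\<omega>. (\<xi> i \<omega>)\<^sup>2)"
      using int by (simp add: prob_space)
    also have "\<dots> \<le> 1 + \<theta> * (- d) + \<theta>\<^sup>2 * w"
      using mean[OF i] second[OF i] \<theta> by (intro add_mono mult_left_mono order_refl) auto
    also have "\<dots> = 1 + - (d\<^sup>2 / (4 * w))"
      using d by (simp add: \<theta>_def field_simps power2_eq_square)
    also have "\<dots> \<le> exp (- (d\<^sup>2 / (4 * w)))" by (rule exp_ge_add_one_self)
    finally show ?thesis .
  qed
  have ind': "indep_vars (\<lambda>_. borel) (\<lambda>i \<omega>. exp (\<theta> * \<xi> i \<omega>)) I"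
    by (rule indep_vars_compose2[OF indep]) measurable
  have int': "integrable M (\<lambda>\<omega>. exp (\<theta> * \<xi> i \<omega>))" if i: "i \<in> I" for i
  proof (rule integrable_const_bound[of _ "exp 1"])
    show "AE \<omega> in M. norm (exp (\<theta> * \<xi> i \<omega>)) \<le> exp 1"
    proof (rule AE_I2)
      fix \<omega> assume "\<omega> \<in> space M"
      from b[OF i this] have "\<bar>\<theta> * \<xi> i \<omega>\<bar> \<le> 1" using \<theta> by (simp add: abs_mult mult_le_one)
      then show "norm (exp (\<theta> * \<xi> i \<omega>)) \<le> exp 1" by simp
    qed
    show "(\<lambda>\<omega>. exp (\<theta> * \<xi> i \<omega>)) \<in> borel_measurable M" using \<xi>[OF i] by measurable
  qed
  have int_prod: "integrable M (\<lambda>\<omega>. \<Prod>i\<in>I. exp (\<theta> * \<xi> i \<omega>))"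
    by (rule indep_vars_integrable[OF I ind' int'])
  have "prob {\<omega> \<in> space M. 0 \<le> (\<Sum>i\<in>I. \<xi> i \<omega>)} \<le> prob {\<omega> \<in> space M. 1 \<le> (\<Prod>i\<in>I. exp (\<theta> * \<xi> i \<omega>))}"
  proof (rule finite_measure_mono)
    show "{\<omega> \<in> space M. 0 \<le> (\<Sum>i\<in>I. \<xi> i \<omega>)} \<subseteq> {\<omega> \<in> space M. 1 \<le> (\<Prod>i\<in>I. exp (\<theta> * \<xi> i \<omega>))}"
      using \<theta> by (auto simp: exp_sum[OF I, symmetric] sum_distrib_left[symmetric])
    show "{\<omega> \<in> space M. 1 \<le> (\<Prod>i\<in>I. exp (\<theta> * \<xi> i \<omega>))} \<in> events"
      using borel_measurable_integrable[OF int_prod] by measurable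
  qed
  also have "\<dots> \<le> expectation (\<lambda>\<omega>. \<Prod>i\<in>I. exp (\<theta> * \<xi> i \<omega>)) / 1"
    by (rule integral_Markov_inequality_measure[OF int_prod, of "{}"]) (auto intro!: AE_I2 prod_nonneg)
  also have "\<dots> = (\<Prod>i\<in>I. expectation (\<lambda>\<omega>. exp (\<theta> * \<xi> i \<omega>)))"
    using indep_vars_lebesgue_integral[OF I ind' int'] by simp
  also have "\<dots> \<le> (\<Prod>i\<in>I. exp (- (d\<^sup>2 / (4 * w))))"
    using one by (intro prod_mono) (auto intro!: integral_nonneg_AE AE_I2)
  also have "\<dots> = exp (- (real (card I) * d\<^sup>2 / (4 * w)))"
    by (simp add: exp_of_nat_mult[symmetric])
  finally show ?thesis .
qed

section \<open>The standard normal distribution\<close>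

definition Phi :: "real \<Rightarrow> real" where
  "Phi u = measure std_normal_distribution {..u}"

interpretation std_normal: prob_space std_normal_distribution
  by (rule prob_space_normal_density) simp

text \<open>The smallest value of the density on \<open>[-2, 2]\<close>, hence a lower bound for the
  slope of \<open>Phi\<close> there; the tail and crossing estimates keep their levels in this
  interval.\<close>

abbreviation normal_lower :: real where
  "normal_lower \<equiv> std_normal_density 2"

lemma std_normal_density_mono:
  assumes "\<bar>x\<bar> \<le> \<bar>y\<bar>"
  shows "std_normal_density y \<le> std_normal_density x"
proof -
  have "x\<^sup>2 \<le> y\<^sup>2" using assms by (simp add: abs_le_square_iff)
  then show ?thesis by (simp add: std_normal_density_def divide_right_mono)
qed

lemma std_normal_density_le_1: "std_normal_density x \<le> 1"
proof -
  have "std_normal_density x \<le> std_normal_density 0" by (rule std_normal_density_mono) simp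
  also have "\<dots> = 1 / sqrt (2 * pi)" by (simp add: std_normal_density_def)
  also have "\<dots> \<le> 1" using pi_ge_two by (simp add: field_simps)
  finally show ?thesis .
qed

lemma normal_lower: "0 < normal_lower" "normal_lower \<le> 1"
  by (auto intro: std_normal_density_le_1 normal_density_pos)

lemma Phi_diff: "u \<le> v \<Longrightarrow> Phi v - Phi u = measure std_normal_distribution {u<..v}"
proof -
  assume "u \<le> v"
  then have "{u<..v} = {..v} - {..u}" by auto
  then show ?thesis unfolding Phi_def using \<open>u \<le> v\<close>
    by (simp add: std_normal.finite_measure_Diff)
qed

lemma Phi_mono: "u \<le> v \<Longrightarrow> Phi u \<le> Phi v"
  unfolding Phi_def by (rule std_normal.finite_measure_mono) auto

lemma Phi_diff_bounds:
  assumes "u \<le> v"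
  shows "(\<And>x. u < x \<Longrightarrow> x \<le> v \<Longrightarrow> std_normal_density x \<le> b) \<Longrightarrow> Phi v - Phi u \<le> b * (v - u)"
    and "(\<And>x. u < x \<Longrightarrow> x \<le> v \<Longrightarrow> a \<le> std_normal_density x) \<Longrightarrow> 0 \<le> a \<Longrightarrow> a * (v - u) \<le> Phi v - Phi u"
proof -
  have em: "ennreal (Phi v - Phi u) = (\<integral>\<^sup>+x. ennreal (std_normal_density x) * indicator {u<..v} x \<partial>lborel)"
    unfolding Phi_diff[OF assms] std_normal.emeasure_eq_measure[symmetric] by (simp add: emeasure_density)
  have const: "(\<integral>\<^sup>+x. ennreal c * indicator {u<..v} x \<partial>lborel) = ennreal (c * (v - u))" if "0 \<le> c" for c
    using assms that by (simp add: nn_integral_cmult_indicator ennreal_mult)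
  show "Phi v - Phi u \<le> b * (v - u)" if b: "\<And>x. u < x \<Longrightarrow> x \<le> v \<Longrightarrow> std_normal_density x \<le> b"
  proof (cases "u = v")
    case False
    then have "0 \<le> b" using b[of v] assms normal_density_nonneg[of 0 1 v] by linarith
    have "ennreal (Phi v - Phi u) \<le> (\<integral>\<^sup>+x. ennreal b * indicator {u<..v} x \<partial>lborel)"
      unfolding em by (rule nn_integral_mono) (use b in \<open>auto split: split_indicator intro!: ennreal_leI\<close>)
    then show ?thesis unfolding const[OF \<open>0 \<le> b\<close>] using assms \<open>0 \<le> b\<close> by (simp add: ennreal_le_iff)
  qed simp
  show "a * (v - u) \<le> Phi v - Phi u" if a: "\<And>x. u < x \<Longrightarrow> x \<le> v \<Longrightarrow> a \<le> std_normal_density x" "0 \<le> a"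
  proof -
    have "ennreal (a * (v - u)) \<le> ennreal (Phi v - Phi u)"
      unfolding em const[OF a(2), symmetric]
      by (rule nn_integral_mono) (use a in \<open>auto split: split_indicator intro!: ennreal_leI\<close>)
    then show ?thesis using Phi_mono[OF assms] by (simp add: ennreal_le_iff)
  qed
qed

lemma Phi_diff_le: "u \<le> v \<Longrightarrow> Phi v - Phi u \<le> v - u"
  using Phi_diff_bounds(1)[of u v 1] std_normal_density_le_1 by simp

lemma Phi_diff_ge:
  assumes "- 2 \<le> u" "u \<le> v" "v \<le> 2"
  shows "normal_lower * (v - u) \<le> Phi v - Phi u"
  by (rule Phi_diff_bounds(2)) (use assms in \<open>auto intro!: std_normal_density_mono\<close>)

lemma Phi_0: "Phi 0 = 1 / 2"
proof -
  have "(\<integral>\<^sup>+x. ennreal (std_normal_density x) * indicator {..0} x \<partial>lborel)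
      = (\<integral>\<^sup>+x. ennreal (std_normal_density (- x)) * indicator {..0} (- x) \<partial>lborel)"
    by (subst nn_integral_real_affine[where c = "-1" and t = 0]) auto
  also have "\<dots> = (\<integral>\<^sup>+x. ennreal (std_normal_density x) * indicator {0<..} x \<partial>lborel)"
    using AE_lborel_singleton[of 0]
    by (intro nn_integral_cong_AE) (auto simp: std_normal_density_def split: split_indicator)
  finally have "emeasure std_normal_distribution {..0} = emeasure std_normal_distribution {0<..}"
    by (simp add: emeasure_density)
  then have "measure std_normal_distribution {..0} = measure std_normal_distribution {0<..}"
    by (simp add: measure_def)
  moreover have "measure std_normal_distribution ({..0} \<union> {0<..}) =
      measure std_normal_distribution {..0} + measure std_normal_distribution {0<..}"
    by (rule std_normal.finite_measure_Union) auto
  moreover have "{..0} \<union> {0<..} = (UNIV :: real set)" by auto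
  moreover have "measure std_normal_distribution UNIV = 1" using std_normal.prob_space by simp
  ultimately show ?thesis by (simp add: Phi_def)
qed

text \<open>Between 0 and \<open>v\<close> the density lies between its values at these two points,
  so the linearisation error is at most \<open>\<bar>v\<bar>\<close> times their difference.\<close>

lemma Phi_near_0: "\<bar>Phi v - 1 / 2 - v / sqrt (2 * pi)\<bar> \<le> (1 / sqrt (2 * pi) - std_normal_density v) * \<bar>v\<bar>"
proof -
  define a b where "a = std_normal_density 0" and "b = std_normal_density v"
  have a: "1 / sqrt (2 * pi) = a" "v / sqrt (2 * pi) = a * v"
    by (simp_all add: a_def std_normal_density_def)
  have up: "std_normal_density x \<le> a" for x unfolding a_def by (rule std_normal_density_mono) simp
  have lo: "b \<le> std_normal_density x" if "\<bar>x\<bar> \<le> \<bar>v\<bar>" for x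
    unfolding b_def by (rule std_normal_density_mono[OF that])
  have b0: "0 \<le> b" by (simp add: b_def)
  have "\<bar>Phi v - 1 / 2 - a * v\<bar> \<le> (a - b) * \<bar>v\<bar>"
  proof (cases "0 \<le> v")
    case True
    have "Phi v - Phi 0 \<le> a * (v - 0)" using True up by (intro Phi_diff_bounds(1)) auto
    moreover have "b * (v - 0) \<le> Phi v - Phi 0"
      using True lo b0 by (intro Phi_diff_bounds(2)) auto
    moreover have "(a - b) * \<bar>v\<bar> = a * v - b * v" using True by (simp add: left_diff_distrib)
    ultimately show ?thesis unfolding Phi_0 by simp
  next
    case False
    have "Phi 0 - Phi v \<le> a * (0 - v)" using False up by (intro Phi_diff_bounds(1)) auto
    moreover have "b * (0 - v) \<le> Phi 0 - Phi v"
      using False lo b0 by (intro Phi_diff_bounds(2)) auto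
    moreover have "(a - b) * \<bar>v\<bar> = b * v - a * v" using False by (simp add: left_diff_distrib)
    ultimately show ?thesis unfolding Phi_0 by simp
  qed
  then show ?thesis unfolding a b_def .
qed

lemma Phi_scaled_tendsto: "(\<lambda>n. sqrt (real n) * (Phi (x / sqrt (real n)) - 1 / 2)) \<longlonglongrightarrow> x / sqrt (2 * pi)"
proof -
  let ?v = "\<lambda>n. x / sqrt (real n)"
  have v: "?v \<longlonglongrightarrow> 0"
    by (intro real_tendsto_divide_at_top[OF tendsto_const] filterlim_compose[OF sqrt_at_top]
        filterlim_real_sequentially)
  have "(\<lambda>n. (1 / sqrt (2 * pi) - std_normal_density (?v n)) * \<bar>x\<bar>) \<longlonglongrightarrow>
      (1 / sqrt (2 * pi) - std_normal_density 0) * \<bar>x\<bar>"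
    unfolding std_normal_density_def by (intro tendsto_intros v) auto
  then have lim: "(\<lambda>n. (1 / sqrt (2 * pi) - std_normal_density (?v n)) * \<bar>x\<bar>) \<longlonglongrightarrow> 0"
    by (simp add: std_normal_density_def)
  have "(\<lambda>n. sqrt (real n) * (Phi (?v n) - 1 / 2) - x / sqrt (2 * pi)) \<longlonglongrightarrow> 0"
  proof (rule Lim_null_comparison[OF _ lim])
    show "\<forall>\<^sub>F n in sequentially. norm (sqrt (real n) * (Phi (?v n) - 1 / 2) - x / sqrt (2 * pi))
        \<le> (1 / sqrt (2 * pi) - std_normal_density (?v n)) * \<bar>x\<bar>"
      using eventually_gt_at_top[of 0]
    proof eventually_elim
      case (elim n)
      have s: "sqrt (real n) > 0" using elim by simp
      have "sqrt (real n) * (Phi (?v n) - 1 / 2) - x / sqrt (2 * pi)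
          = sqrt (real n) * (Phi (?v n) - 1 / 2 - ?v n / sqrt (2 * pi))"
        using s by (simp add: algebra_simps)
      also have "norm \<dots> = sqrt (real n) * \<bar>Phi (?v n) - 1 / 2 - ?v n / sqrt (2 * pi)\<bar>"
        using s by (simp add: abs_mult)
      also have "\<dots> \<le> sqrt (real n) * ((1 / sqrt (2 * pi) - std_normal_density (?v n)) * \<bar>?v n\<bar>)"
        using s by (intro mult_left_mono Phi_near_0) auto
      also have "\<dots> = (1 / sqrt (2 * pi) - std_normal_density (?v n)) * \<bar>x\<bar>"
        using s by (simp add: abs_divide)
      finally show ?case .
    qed
  qed
  then show ?thesis by (simp add: LIM_zero_iff)
qed

section \<open>Tails and exponentials at thresholds that grow like a negative power of
  \<open>h\<close>\<close>

lemma std_normal_tail_power: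
  "\<exists>C\<ge>0. \<forall>x>0. measure std_normal_distribution {z. x < \<bar>z\<bar>} \<le> C / x ^ (2 * k)"
proof -
  define C where "C = (\<integral>z. z ^ (2 * k) \<partial>std_normal_distribution)"
  have C0: "0 \<le> C" unfolding C_def by (intro integral_nonneg_AE) simp
  have "measure std_normal_distribution {z. x < \<bar>z\<bar>} \<le> C / x ^ (2 * k)" if x: "0 < x" for x :: real
  proof -
    have "measure std_normal_distribution {z. x < \<bar>z\<bar>}
        \<le> measure std_normal_distribution {z \<in> space std_normal_distribution. x ^ (2 * k) \<le> z ^ (2 * k)}"
    proof (rule std_normal.finite_measure_mono)
      show "{z. x < \<bar>z\<bar>} \<subseteq> {z \<in> space std_normal_distribution. x ^ (2 * k) \<le> z ^ (2 * k)}"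
      proof
        fix z assume "z \<in> {z. x < \<bar>z\<bar>}"
        then have "x ^ (2 * k) \<le> \<bar>z\<bar> ^ (2 * k)" using x by (intro power_mono) auto
        then show "z \<in> {z \<in> space std_normal_distribution. x ^ (2 * k) \<le> z ^ (2 * k)}"
          by (simp add: power_even_abs)
      qed
    qed measurable
    also have "\<dots> \<le> (\<integral>z. z ^ (2 * k) \<partial>std_normal_distribution) / x ^ (2 * k)"
      by (rule integral_Markov_inequality_measure[of _ _ "{}"])
        (use x in \<open>auto intro!: integrable_std_normal_distribution_moment\<close>)
    finally show ?thesis by (simp add: C_def)
  qed
  with C0 show ?thesis by blast
qed

lemma powr_uminus_power_le:
  assumes "0 < h" "h \<le> 1" "real p \<le> real k * \<delta>"
  shows "1 / (h powr - \<delta>) ^ k \<le> h ^ p"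
proof -
  have "1 / (h powr - \<delta>) ^ k = h powr (real k * \<delta>)"
    using assms(1) by (simp add: powr_realpow[symmetric] powr_powr powr_minus field_simps)
  also have "\<dots> \<le> h powr real p" using assms by (intro powr_mono') auto
  also have "\<dots> = h ^ p" using assms(1) by (simp add: powr_realpow)
  finally show ?thesis .
qed

text \<open>Markov's inequality with a high even moment suffices: for
  \<open>k > p / \<delta>\<close> the inverse of \<open>(h powr - \<delta>) ^ (2 * k)\<close> is at
  most \<open>h ^ p\<close>.\<close>

lemma std_normal_tail_powr:
  assumes "0 < \<delta>"
  shows "\<exists>C\<ge>0. \<forall>h. 0 < h \<longrightarrow> h \<le> 1 \<longrightarrow> measure std_normal_distribution {z. h powr - \<delta> < \<bar>z\<bar>} \<le> C * h ^ p"
proof -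
  obtain k :: nat where k: "real p / \<delta> < real k" using reals_Archimedean2 by blast
  obtain C where C: "0 \<le> C" "\<And>x. 0 < x \<Longrightarrow> measure std_normal_distribution {z. x < \<bar>z\<bar>} \<le> C / x ^ (2 * k)"
    using std_normal_tail_power[of k] by blast
  show ?thesis
  proof (intro exI[of _ C] conjI allI impI C(1))
    fix h :: real assume h: "0 < h" "h \<le> 1"
    have "real p \<le> real k * \<delta>" using k assms by (simp add: field_simps)
    also have "\<dots> \<le> real (2 * k) * \<delta>" using assms by simp
    finally have p: "1 / (h powr - \<delta>) ^ (2 * k) \<le> h ^ p" by (rule powr_uminus_power_le[OF h])
    have "measure std_normal_distribution {z. h powr - \<delta> < \<bar>z\<bar>} \<le> C * (1 / (h powr - \<delta>) ^ (2 * k))"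
      using C(2)[of "h powr - \<delta>"] h by simp
    also have "\<dots> \<le> C * h ^ p" using p C(1) by (rule mult_left_mono)
    finally show "measure std_normal_distribution {z. h powr - \<delta> < \<bar>z\<bar>} \<le> C * h ^ p" .
  qed
qed

lemma exp_powr_decay:
  fixes c \<delta> :: real
  assumes "0 < \<delta>" "0 < c"
  shows "\<exists>C\<ge>0. \<forall>h. 0 < h \<longrightarrow> h \<le> 1 \<longrightarrow> exp (- (c * h powr - \<delta>)) \<le> C * h ^ p"
proof -
  obtain k :: nat where k: "real p / \<delta> < real k" using reals_Archimedean2 by blast
  have k0: "0 < real k" using k assms by (smt (verit) divide_nonneg_pos of_nat_0_le_iff)
  show ?thesis
  proof (intro exI[of _ "(real k / c) ^ k"] conjI allI impI)
    fix h :: real assume h: "0 < h" "h \<le> 1"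
    define x where "x = c * h powr - \<delta>"
    have x: "0 < x" using assms h by (simp add: x_def)
    have "real p \<le> real k * \<delta>" using k assms by (simp add: field_simps)
    then have p: "1 / (h powr - \<delta>) ^ k \<le> h ^ p" by (rule powr_uminus_power_le[OF h])
    \<comment> \<open>The elementary bound \<open>x / k \<le> exp (x / k)\<close>, raised to the
      power \<open>k\<close>, turns exponential decay into decay of any prescribed order.\<close>
    have "(x / real k) ^ k \<le> exp (x / real k) ^ k"
    proof (intro power_mono)
      show "x / real k \<le> exp (x / real k)" using exp_ge_add_one_self[of "x / real k"] by linarith
    qed (use x k0 in auto)
    also have "\<dots> = exp x" using k0 by (simp add: exp_of_nat_mult[symmetric])
    finally have "exp (- x) \<le> 1 / (x / real k) ^ k" using x k0 by (simp add: exp_minus field_simps)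
    also have "\<dots> = (real k / c) ^ k * (1 / (h powr - \<delta>) ^ k)"
      by (simp add: x_def power_divide power_mult_distrib)
    also have "\<dots> \<le> (real k / c) ^ k * h ^ p" using p assms by (intro mult_left_mono) auto
    finally show "exp (- (c * h powr - \<delta>)) \<le> (real k / c) ^ k * h ^ p" by (simp add: x_def)
  qed (use assms in auto)
qed

lemma (in prob_space) std_normal_prob:
  assumes "distributed M lborel Z std_normal_density"
  shows "A \<in> sets borel \<Longrightarrow> prob {\<omega> \<in> space M. Z \<omega> \<in> A} = measure std_normal_distribution A"
    and "Z \<in> borel_measurable M"
proof -
  have d: "distr M lborel Z = std_normal_distribution" and m: "Z \<in> measurable M lborel"
    using assms by (auto simp: distributed_def)
  then show m': "Z \<in> borel_measurable M" by simp
  assume A: "A \<in> sets borel"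
  have "measure std_normal_distribution A = prob (Z -` A \<inter> space M)"
    unfolding d[symmetric] by (rule measure_distr[OF m]) (use A in simp)
  moreover have "Z -` A \<inter> space M = {\<omega> \<in> space M. Z \<omega> \<in> A}" by auto
  ultimately show "prob {\<omega> \<in> space M. Z \<omega> \<in> A} = measure std_normal_distribution A" by simp
qed

section \<open>Orthant probability of a pair of correlated normal variables\<close>

lemma nn_integral_halfline_Gaussian:
  assumes "0 < k"
  shows "(\<integral>\<^sup>+x. ennreal (x * exp (- (k * x\<^sup>2 / 2))) * indicator {0..} x \<partial>lborel) = ennreal (1 / k)"
proof -
  let ?F = "\<lambda>x. - (exp (- (k * x\<^sup>2 / 2)) / k)"
  have "(\<integral>\<^sup>+x. ennreal (x * exp (- (k * x\<^sup>2 / 2))) * indicator {0..} x \<partial>lborel) = ennreal (0 - ?F 0)"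
  proof (rule nn_integral_FTC_atLeast)
    show "(?F has_real_derivative x * exp (- (k * x\<^sup>2 / 2))) (at x)" for x
      using assms by (auto intro!: derivative_eq_intros simp: field_simps)
    have "filterlim (\<lambda>x. k / 2 * x\<^sup>2) at_top at_top"
      by (rule filterlim_tendsto_pos_mult_at_top[OF tendsto_const _ filterlim_pow_at_top])
        (use assms in \<open>auto intro: filterlim_ident\<close>)
    then have "filterlim (\<lambda>x. k * x\<^sup>2 / 2) at_top at_top" by simp
    then have "((\<lambda>x. exp (- (k * x\<^sup>2 / 2))) \<longlongrightarrow> 0) at_top"
      by (intro filterlim_compose[OF exp_at_bot]) (simp add: filterlim_uminus_at_top)
    from tendsto_minus[OF tendsto_divide[OF this tendsto_const[of k]]]
    show "(?F \<longlongrightarrow> 0) at_top" using assms by simp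
  qed (use assms in auto)
  then show ?thesis using assms by simp
qed

text \<open>After the substitution \<open>y = - x u\<close> the inner integral over the sector becomes explicit.\<close>

lemma nn_integral_sector:
  assumes "0 \<le> c"
  shows "(\<integral>\<^sup>+x. ennreal (std_normal_density x) * indicator {..0} x *
      (\<integral>\<^sup>+y. ennreal (std_normal_density y) * indicator {0<..- c * x} y \<partial>lborel) \<partial>lborel)
    = ennreal (arctan c / (2 * pi))"
proof -
  have inner: "(\<integral>\<^sup>+y. ennreal (std_normal_density y) * indicator {0<..c * x} y \<partial>lborel)
      = (\<integral>\<^sup>+u. ennreal (x * std_normal_density (x * u)) * indicator {0<..c} u \<partial>lborel)" if x: "0 < x" for x
  proof -
    have "(\<integral>\<^sup>+y. ennreal (std_normal_density y) * indicator {0<..c * x} y \<partial>lborel)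
        = ennreal \<bar>x\<bar> * (\<integral>\<^sup>+u. ennreal (std_normal_density (0 + x * u)) * indicator {0<..c * x} (0 + x * u) \<partial>lborel)"
      by (rule nn_integral_real_affine) (use x in auto)
    also have "\<dots> = (\<integral>\<^sup>+u. ennreal \<bar>x\<bar> * (ennreal (std_normal_density (0 + x * u)) * indicator {0<..c * x} (0 + x * u)) \<partial>lborel)"
      by (subst nn_integral_cmult) auto
    also have "\<dots> = (\<integral>\<^sup>+u. ennreal (x * std_normal_density (x * u)) * indicator {0<..c} u \<partial>lborel)"
      using x by (intro nn_integral_cong)
        (auto simp: ennreal_mult mult.commute[of c] zero_less_mult_iff split: split_indicator)
    finally show ?thesis .
  qed
  have "(\<lambda>x. \<integral>\<^sup>+y. ennreal (std_normal_density y) * (if 0 < y \<and> y \<le> - c * x then 1 else 0) \<partial>lborel)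
      \<in> borel_measurable borel"
    by measurable
  moreover have "indicator {0<..- c * x} y = (if 0 < y \<and> y \<le> - c * x then 1 else 0 :: ennreal)" for x y
    by (simp add: indicator_def)
  ultimately have [measurable]: "(\<lambda>x. \<integral>\<^sup>+y. ennreal (std_normal_density y) * indicator {0<..- c * x} y \<partial>lborel)
      \<in> borel_measurable borel"
    by simp
  have "(\<integral>\<^sup>+x. ennreal (std_normal_density x) * indicator {..0} x *
      (\<integral>\<^sup>+y. ennreal (std_normal_density y) * indicator {0<..- c * x} y \<partial>lborel) \<partial>lborel)
    = (\<integral>\<^sup>+x. ennreal (std_normal_density x) * indicator {0..} x *
      (\<integral>\<^sup>+y. ennreal (std_normal_density y) * indicator {0<..c * x} y \<partial>lborel) \<partial>lborel)"
  proof (subst nn_integral_real_affine[where c = "-1" and t = 0])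
    show "(\<lambda>x. ennreal (std_normal_density x) * indicator {..0} x *
      (\<integral>\<^sup>+y. ennreal (std_normal_density y) * indicator {0<..- c * x} y \<partial>lborel)) \<in> borel_measurable borel"
      by measurable
  qed (auto intro!: nn_integral_cong simp: std_normal_density_def split: split_indicator)
  also have "\<dots> = (\<integral>\<^sup>+x. (\<integral>\<^sup>+u. ennreal (x * std_normal_density x * std_normal_density (x * u))
      * indicator {0..} x * indicator {0<..c} u \<partial>lborel) \<partial>lborel)"
  proof (rule nn_integral_cong_AE)
    show "AE x in lborel. ennreal (std_normal_density x) * indicator {0..} x *
        (\<integral>\<^sup>+y. ennreal (std_normal_density y) * indicator {0<..c * x} y \<partial>lborel)
      = (\<integral>\<^sup>+u. ennreal (x * std_normal_density x * std_normal_density (x * u)) * indicator {0..} x * indicator {0<..c} u \<partial>lborel)"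
      using AE_lborel_singleton[of 0]
    proof eventually_elim
      case (elim x)
      show ?case
      proof (cases "0 < x")
        case True
        have "ennreal (std_normal_density x) * indicator {0..} x *
            (\<integral>\<^sup>+u. ennreal (x * std_normal_density (x * u)) * indicator {0<..c} u \<partial>lborel)
          = (\<integral>\<^sup>+u. ennreal (std_normal_density x) * indicator {0..} x *
              (ennreal (x * std_normal_density (x * u)) * indicator {0<..c} u) \<partial>lborel)"
          by (subst nn_integral_cmult) auto
        also have "\<dots> = (\<integral>\<^sup>+u. ennreal (x * std_normal_density x * std_normal_density (x * u))
            * indicator {0..} x * indicator {0<..c} u \<partial>lborel)"
          using True by (intro nn_integral_cong) (auto simp: ennreal_mult[symmetric] ac_simps split: split_indicator)
        finally show ?thesis using inner[OF True] by simp
      qed (use elim in auto)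
    qed
  qed
  \<comment> \<open>After the exchange the \<open>x\<close>-integral is a Rayleigh integral with
    value \<open>1 / (2 * pi * (1 + u\<^sup>2))\<close>, the derivative of
    \<open>arctan u / (2 * pi)\<close>.\<close>
  also have "\<dots> = (\<integral>\<^sup>+u. (\<integral>\<^sup>+x. ennreal (x * std_normal_density x * std_normal_density (x * u))
      * indicator {0..} x * indicator {0<..c} u \<partial>lborel) \<partial>lborel)"
    by (rule lborel_pair.Fubini') measurable
  also have "\<dots> = (\<integral>\<^sup>+u. ennreal (1 / (2 * pi * (1 + u\<^sup>2))) * indicator {0..c} u \<partial>lborel)"
  proof (rule nn_integral_cong_AE)
    have fact: "x * std_normal_density x * std_normal_density (x * u)
        = 1 / (2 * pi) * (x * exp (- ((1 + u\<^sup>2) * x\<^sup>2 / 2)))" for x u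
      by (simp add: std_normal_density_def exp_add[symmetric] field_simps)
    have val: "(\<integral>\<^sup>+x. ennreal (x * std_normal_density x * std_normal_density (x * u)) * indicator {0..} x \<partial>lborel)
        = ennreal (1 / (2 * pi * (1 + u\<^sup>2)))" for u
    proof -
      have k: "0 < 1 + u\<^sup>2" by (simp add: add_pos_nonneg)
      have "(\<integral>\<^sup>+x. ennreal (x * std_normal_density x * std_normal_density (x * u)) * indicator {0..} x \<partial>lborel)
        = (\<integral>\<^sup>+x. ennreal (1 / (2 * pi)) * (ennreal (x * exp (- ((1 + u\<^sup>2) * x\<^sup>2 / 2))) * indicator {0..} x) \<partial>lborel)"
        unfolding fact by (intro nn_integral_cong) (auto simp: ennreal_mult[symmetric] split: split_indicator)
      also have "\<dots> = ennreal (1 / (2 * pi)) * ennreal (1 / (1 + u\<^sup>2))"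
        by (subst nn_integral_cmult) (auto simp: nn_integral_halfline_Gaussian[OF k])
      also have "\<dots> = ennreal (1 / (2 * pi * (1 + u\<^sup>2)))"
        using k by (simp add: ennreal_mult[symmetric])
      finally show ?thesis .
    qed
    show "AE u in lborel. (\<integral>\<^sup>+x. ennreal (x * std_normal_density x * std_normal_density (x * u))
      * indicator {0..} x * indicator {0<..c} u \<partial>lborel) = ennreal (1 / (2 * pi * (1 + u\<^sup>2))) * indicator {0..c} u"
      using AE_lborel_singleton[of 0]
    proof eventually_elim
      case (elim u)
      then show ?case by (subst nn_integral_multc) (auto simp: val split: split_indicator)
    qed
  qed
  also have "\<dots> = ennreal (arctan c / (2 * pi) - arctan 0 / (2 * pi))"
  proof (rule nn_integral_FTC_Icc[OF _ _ _ assms])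
    show "(\<lambda>u::real. 1 / (2 * pi * (1 + u\<^sup>2))) \<in> borel_measurable borel" by measurable
    show "((\<lambda>x. arctan x / (2 * pi)) has_real_derivative 1 / (2 * pi * (1 + x\<^sup>2))) (at x)" for x
    proof -
      have "((\<lambda>x. arctan x / (2 * pi)) has_real_derivative inverse (1 + x\<^sup>2) / (2 * pi)) (at x)"
        by (intro DERIV_cdivide DERIV_arctan)
      moreover have "inverse (1 + x\<^sup>2) / (2 * pi) = 1 / (2 * pi * (1 + x\<^sup>2))"
        unfolding inverse_eq_divide divide_divide_eq_left by (simp only: mult.commute)
      ultimately show ?thesis by (simp only:)
    qed
    show "0 \<le> 1 / (2 * pi * (1 + x\<^sup>2))" for x :: real
      by (intro divide_nonneg_nonneg mult_nonneg_nonneg add_nonneg_nonneg) simp_all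
  qed
  finally show ?thesis by simp
qed

text \<open>The wedge consists of the third quadrant, of probability 1/4 by independence, and a
  sector of the second quadrant with opening angle \<open>arctan c\<close>, whose probability is
  that angle over \<open>2 * pi\<close>.\<close>

lemma (in prob_space) std_normal_orthant:
  assumes Z: "distributed M lborel Z1 std_normal_density" "distributed M lborel Z2 std_normal_density"
    and indep: "indep_var borel Z1 borel Z2" and c: "0 \<le> c"
  shows "prob {\<omega> \<in> space M. Z1 \<omega> \<le> 0 \<and> Z2 \<omega> \<le> - c * Z1 \<omega>} = 1 / 4 + arctan c / (2 * pi)"
proof -
  note [measurable] = std_normal_prob(2)[OF Z(1)] std_normal_prob(2)[OF Z(2)]
  let ?D = "std_normal_distribution"
  have d: "distr M borel Z1 = ?D" "distr M borel Z2 = ?D"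
    using Z by (auto simp: distributed_def cong: distr_cong)
  have joint: "distr M (borel \<Otimes>\<^sub>M borel) (\<lambda>\<omega>. (Z1 \<omega>, Z2 \<omega>)) = ?D \<Otimes>\<^sub>M ?D"
    using indep unfolding indep_var_distribution_eq d by simp
  let ?S = "{p. fst p \<le> 0 \<and> 0 < snd p \<and> snd p \<le> - c * fst p} :: (real \<times> real) set"
  have "Measurable.pred (borel \<Otimes>\<^sub>M borel) (\<lambda>p :: real \<times> real. fst p \<le> 0 \<and> 0 < snd p \<and> snd p \<le> - c * fst p)"
    by measurable
  then have S: "?S \<in> sets (borel \<Otimes>\<^sub>M borel)" by (simp add: pred_def space_pair_measure)
  have S': "?S \<in> sets (?D \<Otimes>\<^sub>M ?D)" using S by (simp cong: sets_pair_measure_cong)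
  have "emeasure M {\<omega> \<in> space M. Z1 \<omega> \<le> 0 \<and> 0 < Z2 \<omega> \<and> Z2 \<omega> \<le> - c * Z1 \<omega>}
      = emeasure (distr M (borel \<Otimes>\<^sub>M borel) (\<lambda>\<omega>. (Z1 \<omega>, Z2 \<omega>))) ?S"
    by (subst emeasure_distr[OF _ S]) (auto intro!: arg_cong[of _ _ "emeasure M"])
  also have "\<dots> = (\<integral>\<^sup>+x. emeasure ?D (Pair x -` ?S) \<partial>?D)"
    unfolding joint by (rule std_normal.emeasure_pair_measure_alt[OF S'])
  also have "\<dots> = (\<integral>\<^sup>+x. indicator {..0} x * emeasure ?D {0<..- c * x} \<partial>?D)"
    by (rule nn_integral_cong)
      (auto split: split_indicator intro!: arg_cong[of _ _ "emeasure ?D"] simp: emeasure_eq_0_AE)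
  also have "\<dots> = (\<integral>\<^sup>+x. ennreal (std_normal_density x) * (indicator {..0} x * emeasure ?D {0<..- c * x}) \<partial>lborel)"
  proof (rule nn_integral_density)
    have "(\<lambda>x. emeasure ?D (Pair x -` ({p. 0 < snd p \<and> snd p \<le> - c * fst p} :: (real \<times> real) set)))
        \<in> borel_measurable borel"
    proof (rule std_normal.measurable_emeasure_Pair)
      have "Measurable.pred (borel \<Otimes>\<^sub>M borel) (\<lambda>p :: real \<times> real. 0 < snd p \<and> snd p \<le> - c * fst p)"
        by measurable
      then have "{p. 0 < snd p \<and> snd p \<le> - c * fst p} \<in> sets (borel \<Otimes>\<^sub>M borel :: (real \<times> real) measure)"
        by (simp add: pred_def space_pair_measure)
      then show "{p. 0 < snd p \<and> snd p \<le> - c * fst p} \<in> sets (borel \<Otimes>\<^sub>M ?D)"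
        by (simp cong: sets_pair_measure_cong)
    qed
    moreover have "Pair x -` {p. 0 < snd p \<and> snd p \<le> - c * fst p} = {0<..- c * x}" for x :: real by auto
    ultimately have [measurable]: "(\<lambda>x. emeasure ?D {0<..- c * x}) \<in> borel_measurable borel" by (simp only:)
    show "(\<lambda>x. indicator {..0} x * emeasure ?D {0<..- c * x}) \<in> borel_measurable lborel" by measurable
  qed simp
  also have "\<dots> = ennreal (arctan c / (2 * pi))"
    unfolding nn_integral_sector[OF c, symmetric]
    by (intro nn_integral_cong) (simp add: emeasure_density mult.assoc)
  finally have Q: "prob {\<omega> \<in> space M. Z1 \<omega> \<le> 0 \<and> 0 < Z2 \<omega> \<and> Z2 \<omega> \<le> - c * Z1 \<omega>} = arctan c / (2 * pi)"
    using c by (simp add: emeasure_eq_measure)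
  have "prob {\<omega> \<in> space M. Z1 \<omega> \<le> 0 \<and> Z2 \<omega> \<le> 0} = prob ((\<lambda>\<omega>. (Z1 \<omega>, Z2 \<omega>)) -` ({..0} \<times> {..0}) \<inter> space M)"
    by (rule arg_cong[of _ _ prob]) auto
  also have "\<dots> = prob (Z1 -` {..0} \<inter> space M) * prob (Z2 -` {..0} \<inter> space M)"
    by (rule indep_varD[OF indep]) auto
  also have "\<dots> = prob {\<omega> \<in> space M. Z1 \<omega> \<in> {..0}} * prob {\<omega> \<in> space M. Z2 \<omega> \<in> {..0}}"
    by (intro arg_cong2[of _ _ _ _ "(*)"] arg_cong[of _ _ prob]) auto
  also have "prob {\<omega> \<in> space M. Z1 \<omega> \<in> {..0}} = 1 / 2"
    by (subst std_normal_prob(1)[OF Z(1)]) (simp_all add: Phi_0[unfolded Phi_def])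
  also have "prob {\<omega> \<in> space M. Z2 \<omega> \<in> {..0}} = 1 / 2"
    by (subst std_normal_prob(1)[OF Z(2)]) (simp_all add: Phi_0[unfolded Phi_def])
  also have "1 / 2 * (1 / 2) = (1 / 4 :: real)" by simp
  finally have P: "prob {\<omega> \<in> space M. Z1 \<omega> \<le> 0 \<and> Z2 \<omega> \<le> 0} = 1 / 4" .
  have "prob ({\<omega> \<in> space M. Z1 \<omega> \<le> 0 \<and> Z2 \<omega> \<le> 0} \<union> {\<omega> \<in> space M. Z1 \<omega> \<le> 0 \<and> 0 < Z2 \<omega> \<and> Z2 \<omega> \<le> - c * Z1 \<omega>})
      = prob {\<omega> \<in> space M. Z1 \<omega> \<le> 0 \<and> Z2 \<omega> \<le> 0} + prob {\<omega> \<in> space M. Z1 \<omega> \<le> 0 \<and> 0 < Z2 \<omega> \<and> Z2 \<omega> \<le> - c * Z1 \<omega>}"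
    by (rule finite_measure_Union) auto
  moreover have "{\<omega> \<in> space M. Z1 \<omega> \<le> 0 \<and> Z2 \<omega> \<le> 0} \<union> {\<omega> \<in> space M. Z1 \<omega> \<le> 0 \<and> 0 < Z2 \<omega> \<and> Z2 \<omega> \<le> - c * Z1 \<omega>}
      = {\<omega> \<in> space M. Z1 \<omega> \<le> 0 \<and> Z2 \<omega> \<le> - c * Z1 \<omega>}"
    using c by (auto simp: mult_nonneg_nonpos intro: order_trans)
  ultimately show ?thesis using P Q by simp
qed

section \<open>Cholesky decomposition of a positive semidefinite kernel\<close>

text \<open>Iterated Schur complements: \<open>schur K k\<close> is the covariance that remains
  after regression on the indices below \<open>k\<close>. A zero pivot is passed over automatically,
  since division by zero gives 0.\<close>

fun schur :: "(nat \<Rightarrow> nat \<Rightarrow> real) \<Rightarrow> nat \<Rightarrow> nat \<Rightarrow> nat \<Rightarrow> real" where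
  "schur K 0 i j = K i j"
| "schur K (Suc k) i j = schur K k i j - schur K k i k * schur K k j k / schur K k k k"

definition psd :: "(nat \<Rightarrow> nat \<Rightarrow> real) \<Rightarrow> bool" where
  "psd K \<longleftrightarrow> (\<forall>i j. K i j = K j i) \<and> (\<forall>c n. 0 \<le> (\<Sum>i<n. \<Sum>j<n. c i * c j * K i j))"

lemma psdD:
  assumes "psd K"
  shows "K i j = K j i" "0 \<le> (\<Sum>i<n. \<Sum>j<n. c i * c j * K i j)"
  using assms unfolding psd_def by simp_all

text \<open>The form is expanded at \<open>c\<close> plus \<open>t\<close> times the
  \<open>k\<close>-th unit vector. Nonnegativity for every \<open>t\<close> then yields both pivot
  facts: a zero pivot has a zero column, and completing the square preserves positivity.\<close>

lemma psd_perturb: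
  assumes K: "psd K" and k: "k < n"
  shows "0 \<le> (\<Sum>i<n. \<Sum>j<n. c i * c j * K i j) + 2 * t * (\<Sum>i<n. c i * K i k) + t\<^sup>2 * K k k"
proof -
  define d where "d i = (if i = k then t else 0)" for i
  have sd: "(\<Sum>i<n. d i * f i) = t * f k" for f :: "nat \<Rightarrow> real"
    using k by (simp add: d_def if_distrib[of "\<lambda>x. x * _"] cong: if_cong)
  have "(\<Sum>i<n. \<Sum>j<n. (c i + d i) * (c j + d j) * K i j)
      = (\<Sum>i<n. \<Sum>j<n. c i * c j * K i j) + (\<Sum>i<n. c i * (\<Sum>j<n. d j * K i j))
        + (\<Sum>i<n. d i * (\<Sum>j<n. c j * K i j)) + (\<Sum>i<n. d i * (\<Sum>j<n. d j * K i j))"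
    by (simp add: sum.distrib sum_distrib_left algebra_simps)
  also have "\<dots> = (\<Sum>i<n. \<Sum>j<n. c i * c j * K i j) + (\<Sum>i<n. c i * (t * K i k))
        + t * (\<Sum>j<n. c j * K k j) + t * (t * K k k)"
    by (simp only: sd)
  also have "\<dots> = (\<Sum>i<n. \<Sum>j<n. c i * c j * K i j) + 2 * t * (\<Sum>i<n. c i * K i k) + t\<^sup>2 * K k k"
  proof -
    have "(\<Sum>j<n. c j * K k j) = (\<Sum>i<n. c i * K i k)" by (simp only: psdD(1)[OF K, of k])
    moreover have "(\<Sum>i<n. c i * (t * K i k)) = t * (\<Sum>i<n. c i * K i k)"
      by (simp add: sum_distrib_left algebra_simps)
    ultimately show ?thesis by (simp add: power2_eq_square)
  qed
  finally show ?thesis using psdD(2)[OF K, of "\<lambda>i. c i + d i" n] by linarith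
qed

lemma psd_diag_nonneg:
  assumes "psd K"
  shows "0 \<le> K k k"
  using psd_perturb[OF assms, of k "Suc k" "\<lambda>_. 0" 1] by simp

text \<open>With a zero pivot the expression of \<open>psd_perturb\<close> is affine in
  \<open>t\<close>, and an affine function bounded below has slope zero.\<close>

lemma psd_diag_zero:
  assumes K: "psd K" and 0: "K k k = 0"
  shows "K i k = 0"
proof (cases "i = k")
  case False
  define n where "n = Suc (max i k)"
  define c where "c l = (if l = i then 1 else 0 :: real)" for l
  have sc: "(\<Sum>l<n. c l * f l) = f i" for f :: "nat \<Rightarrow> real"
    by (simp add: c_def n_def if_distrib[of "\<lambda>x. x * _"] cong: if_cong)
  have "(\<Sum>l<n. \<Sum>j<n. c l * c j * K l j) = K i i"
  proof -
    have "(\<Sum>l<n. \<Sum>j<n. c l * c j * K l j) = (\<Sum>l<n. c l * (\<Sum>j<n. c j * K l j))"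
      by (simp add: sum_distrib_left mult.assoc)
    then show ?thesis by (simp only: sc)
  qed
  then have *: "0 \<le> K i i + 2 * t * K i k" for t
  proof -
    have "k < n" by (simp add: n_def)
    from psd_perturb[OF K this, of c t] show ?thesis
      by (simp only: \<open>(\<Sum>l<n. \<Sum>j<n. c l * c j * K l j) = K i i\<close> sc 0 mult_zero_right add_0_right)
  qed
  show ?thesis
  proof (rule ccontr)
    assume n: "K i k \<noteq> 0"
    have "0 \<le> K i i + 2 * (- (K i i + 1) / K i k) * K i k" by (rule *)
    also have "\<dots> = - K i i - 2" using n by simp
    finally show False using psd_diag_nonneg[OF K, of i] by simp
  qed
qed (use 0 in simp)

text \<open>The shift \<open>t = - s / K k k\<close> completes the square and leaves exactly the
  form of the Schur complement; at a zero pivot all correction terms are 0.\<close>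

lemma psd_schur_step:
  assumes K: "psd K"
  shows "psd (\<lambda>i j. K i j - K i k * K j k / K k k)"
  unfolding psd_def
proof (intro conjI allI)
  show "K i j - K i k * K j k / K k k = K j i - K j k * K i k / K k k" for i j
    using psdD(1)[OF K, of i j] by (simp add: mult.commute)
  fix c :: "nat \<Rightarrow> real" and n
  define N where "N = max n (Suc k)"
  define c' where "c' i = (if i < n then c i else 0)" for i
  define s where "s = (\<Sum>i<N. c' i * K i k)"
  have pad: "(\<Sum>i<n. \<Sum>j<n. c i * c j * f i j) = (\<Sum>i<N. \<Sum>j<N. c' i * c' j * f i j)" for f :: "nat \<Rightarrow> nat \<Rightarrow> real"
  proof -
    have "(\<Sum>i<N. \<Sum>j<N. c' i * c' j * f i j) = (\<Sum>i<n. \<Sum>j<N. c' i * c' j * f i j)"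
      by (rule sum.mono_neutral_right) (auto simp: N_def c'_def)
    also have "\<dots> = (\<Sum>i<n. \<Sum>j<n. c' i * c' j * f i j)"
      by (intro sum.cong refl sum.mono_neutral_right) (auto simp: N_def c'_def)
    finally show ?thesis by (simp add: c'_def)
  qed
  have "(\<Sum>i<N. \<Sum>j<N. c' i * c' j * (K i j - K i k * K j k / K k k))
      = (\<Sum>i<N. \<Sum>j<N. c' i * c' j * K i j) - (\<Sum>i<N. \<Sum>j<N. (c' i * K i k) * (c' j * K j k)) / K k k"
    by (simp add: right_diff_distrib sum_subtractf sum_divide_distrib algebra_simps)
  also have "(\<Sum>i<N. \<Sum>j<N. (c' i * K i k) * (c' j * K j k)) = s\<^sup>2"
    by (simp add: s_def power2_eq_square sum_product)
  finally have eq: "(\<Sum>i<N. \<Sum>j<N. c' i * c' j * (K i j - K i k * K j k / K k k))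
      = (\<Sum>i<N. \<Sum>j<N. c' i * c' j * K i j) - s\<^sup>2 / K k k" .
  have "0 \<le> (\<Sum>i<N. \<Sum>j<N. c' i * c' j * K i j) + 2 * (- s / K k k) * s + (- s / K k k)\<^sup>2 * K k k"
    unfolding s_def by (rule psd_perturb[OF K]) (simp add: N_def)
  also have "\<dots> = (\<Sum>i<N. \<Sum>j<N. c' i * c' j * K i j) - s\<^sup>2 / K k k"
    by (cases "K k k = 0") (simp_all add: power2_eq_square field_simps)
  finally show "0 \<le> (\<Sum>i<n. \<Sum>j<n. c i * c j * (K i j - K i k * K j k / K k k))"
    unfolding pad eq .
qed

lemma schur_psd: "psd K \<Longrightarrow> psd (schur K k)"
proof (induction k)
  case 0
  moreover have "schur K 0 = K" by (intro ext) simp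
  ultimately show ?case by simp
next
  case (Suc k)
  moreover have "schur K (Suc k) = (\<lambda>i j. schur K k i j - schur K k i k * schur K k j k / schur K k k k)"
    by (intro ext) simp
  ultimately show ?case using psd_schur_step by simp
qed

text \<open>Row \<open>k\<close> is cancelled in step \<open>k\<close> by its pivot, or is zero
  already if the pivot vanishes; a zero row stays zero in all later steps.\<close>

lemma schur_zero:
  assumes K: "psd K"
  shows "i < k \<Longrightarrow> schur K k i j = 0"
proof (induction k arbitrary: j)
  case (Suc k)
  note S = schur_psd[OF K, of k]
  show ?case
  proof (cases "i = k")
    case True
    have sym: "schur K k k j = schur K k j k" by (rule psdD(1)[OF S])
    show ?thesis
    proof (cases "schur K k k k = 0")
      case True
      then show ?thesis using psd_diag_zero[OF S True, of j] sym \<open>i = k\<close> by simp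
    qed (use True sym in simp)
  qed (use Suc in auto)
qed simp

text \<open>Column \<open>k\<close> of \<open>L\<close> is column \<open>k\<close> of the
  \<open>k\<close>-th complement over the square root of its pivot, so \<open>K i j\<close> minus
  the partial sum of products is \<open>schur K n i j\<close>. Triangularity makes every row finite,
  which covers infinitely many indices at once.\<close>

lemma psd_cholesky:
  assumes K: "psd K"
  obtains L :: "nat \<Rightarrow> nat \<Rightarrow> real"
  where "\<And>i j n. i < n \<Longrightarrow> K i j = (\<Sum>k<n. L i k * L j k)" "\<And>i k. i < k \<Longrightarrow> L i k = 0"
proof
  define L where "L i k = schur K k i k / sqrt (schur K k k k)" for i k
  have prod: "L i k * L j k = schur K k i k * schur K k j k / schur K k k k" for i j k
    using psd_diag_nonneg[OF schur_psd[OF K, of k], of k] by (simp add: L_def)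
  have "schur K n i j = K i j - (\<Sum>k<n. L i k * L j k)" for n i j
    by (induction n arbitrary: i j) (simp_all add: prod)
  then show "K i j = (\<Sum>k<n. L i k * L j k)" if "i < n" for i j n
    using schur_zero[OF K that, of j] by (metis eq_iff_diff_eq_0)
  show "L i k = 0" if "i < k" for i k
    using schur_zero[OF K that] by (simp add: L_def)
qed

section \<open>Quantile estimates for the median of Brownian motions\<close>

lemma (in prob_space) expectation_of_bool:
  assumes "{\<omega> \<in> space M. P \<omega>} \<in> events"
  shows "integrable M (\<lambda>\<omega>. of_bool (P \<omega>) :: real)"
    and "expectation (\<lambda>\<omega>. of_bool (P \<omega>) :: real) = prob {\<omega> \<in> space M. P \<omega>}"
proof -
  have eq: "of_bool (P \<omega>) = (indicator {\<omega> \<in> space M. P \<omega>} \<omega> :: real)" if "\<omega> \<in> space M" for \<omega>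
    using that by (simp add: indicator_def)
  show "integrable M (\<lambda>\<omega>. of_bool (P \<omega>) :: real)"
    using assms by (subst Bochner_Integration.integrable_cong[OF refl eq]) (auto simp: emeasure_eq_measure)
  have "expectation (\<lambda>\<omega>. of_bool (P \<omega>) :: real) = expectation (\<lambda>\<omega>. indicator {\<omega> \<in> space M. P \<omega>} \<omega>)"
    by (intro Bochner_Integration.integral_cong refl eq)
  also have "\<dots> = prob {\<omega> \<in> space M. P \<omega>}" using assms by (simp add: Int_def cong: conj_cong)
  finally show "expectation (\<lambda>\<omega>. of_bool (P \<omega>) :: real) = prob {\<omega> \<in> space M. P \<omega>}" .
qed

locale brownian_family = prob_space M for M :: "'a measure" +
  fixes B :: "nat \<Rightarrow> real \<Rightarrow> 'a \<Rightarrow> real"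
  assumes bm: "\<And>j. 1 \<le> j \<Longrightarrow> brownian_motion M (B j)"
    and indep: "independent_processes M B {1..}"
begin

lemma B_measurable: "1 \<le> j \<Longrightarrow> 0 \<le> t \<Longrightarrow> B j t \<in> borel_measurable M"
  using bm[of j] by (simp add: brownian_motion_def continuous_process_def)

lemma B_continuous: "1 \<le> j \<Longrightarrow> \<omega> \<in> space M \<Longrightarrow> continuous_on {0..} (\<lambda>t. B j t \<omega>)"
  using bm[of j] by (simp add: brownian_motion_def continuous_process_def)

lemma B_0: "1 \<le> j \<Longrightarrow> AE \<omega> in M. B j 0 \<omega> = 0"
  using bm[of j] by (simp add: brownian_motion_def)

lemma increment_std_normal:
  assumes "1 \<le> j" "0 \<le> s" "s < t"
  shows "distributed M lborel (\<lambda>\<omega>. (B j t \<omega> - B j s \<omega>) / sqrt (t - s)) std_normal_density"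
proof -
  have "distributed M lborel (\<lambda>\<omega>. B j t \<omega> - B j s \<omega>) (normal_density 0 (sqrt (t - s)))"
    using bm[OF assms(1)] assms(2,3) unfolding brownian_motion_def by simp
  moreover have "0 < sqrt (t - s)" using assms by simp
  ultimately show ?thesis
    by (subst (asm) normal_standard_normal_convert) simp_all
qed

text \<open>Standard normal at every positive time, so that \<open>Phi\<close> is the common
  distribution function and levels at different times can be compared; at \<open>t = 0\<close> the
  quotient is 0.\<close>

definition Z :: "nat \<Rightarrow> real \<Rightarrow> 'a \<Rightarrow> real" where
  "Z j t \<omega> = B j t \<omega> / sqrt t"

lemma Z_measurable: "1 \<le> j \<Longrightarrow> 0 \<le> t \<Longrightarrow> Z j t \<in> borel_measurable M"
  unfolding Z_def using B_measurable[of j t] by measurable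

lemma Z_std_normal:
  assumes j: "1 \<le> j" and t: "0 < t"
  shows "distributed M lborel (Z j t) std_normal_density"
proof -
  let ?Y = "\<lambda>\<omega>. (B j t \<omega> - B j 0 \<omega>) / sqrt (t - 0)"
  have Y: "distributed M lborel ?Y std_normal_density"
    by (rule increment_std_normal) (use assms in auto)
  have m: "Z j t \<in> measurable M lborel" "?Y \<in> measurable M lborel"
    using Z_measurable[of j t] std_normal_prob(2)[OF Y] assms by simp_all
  have "AE \<omega> in M. Z j t \<omega> = ?Y \<omega>" using B_0[OF j] by eventually_elim (simp add: Z_def)
  then have "distr M lborel (Z j t) = distr M lborel ?Y"
    using m by (intro distr_cong_AE) auto
  then show ?thesis using Y m unfolding distributed_def by simp
qed

text \<open>Independence is given for whole paths only. Each statistic of a particle used later is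
  one measurable functional of its path, the same for all particles, and so inherits
  independence.\<close>

lemma indep_path_functionals:
  assumes "\<phi> \<in> borel_measurable (Pi\<^sub>M {0..} (\<lambda>_. borel))" "I \<subseteq> {1..}"
    and "\<And>j \<omega>. j \<in> I \<Longrightarrow> Y j \<omega> = \<phi> (\<lambda>t\<in>{0..}. B j t \<omega>)"
  shows "indep_vars (\<lambda>_. borel) Y I"
proof -
  have "indep_vars (\<lambda>_. Pi\<^sub>M {0..} (\<lambda>_. borel)) (\<lambda>j \<omega>. \<lambda>t\<in>{0..}. B j t \<omega>) I"
    using indep assms(2) unfolding independent_processes_def by (rule indep_vars_subset)
  then have "indep_vars (\<lambda>_. borel) (\<lambda>j \<omega>. \<phi> (\<lambda>t\<in>{0..}. B j t \<omega>)) I"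
    by (rule indep_vars_compose2) (rule assms(1))
  moreover have "Y j = (\<lambda>\<omega>. \<phi> (\<lambda>t\<in>{0..}. B j t \<omega>))" if "j \<in> I" for j
    using assms(3)[OF that] by (intro ext)
  ultimately show ?thesis by (subst indep_vars_cong[OF refl _ refl]) auto
qed

definition U :: "nat \<Rightarrow> real \<Rightarrow> 'a \<Rightarrow> real" where
  "U m t \<omega> = median (2 * m + 1) (\<lambda>j. Z j t \<omega>)"

lemma scaled_median_eq_U:
  assumes "0 < t"
  shows "scaled_median_process B (2 * m + 1) t \<omega> = sqrt (real (2 * m + 1)) * sqrt t * U m t \<omega>"
  using median_divide[of "sqrt t" m "\<lambda>j. B j t \<omega>"] assms
  by (simp only: scaled_median_process_def median_process_def U_def Z_def real_sqrt_gt_0_iff) simp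

lemma scaled_median_0: "AE \<omega> in M. scaled_median_process B (2 * m + 1) 0 \<omega> = 0"
proof -
  have "AE \<omega> in M. \<forall>j\<in>{1..2 * m + 1}. B j 0 \<omega> = 0"
    by (subst AE_ball_countable) (auto intro: B_0 countable_finite)
  then show ?thesis
  proof eventually_elim
    case (elim \<omega>)
    have "\<bar>median (2 * m + 1) (\<lambda>j. B j 0 \<omega>) - median (2 * m + 1) (\<lambda>j. 0)\<bar> \<le> 0"
      by (rule median_Lipschitz) (use elim in auto)
    moreover have "median (2 * m + 1) (\<lambda>j. 0) = 0"
    proof -
      obtain \<tau> where "sorts_upto (2 * m + 1) \<tau> (\<lambda>j. 0)" using sorts_upto_exists by blast
      from median_eq[OF this] show ?thesis by simp
    qed
    ultimately show ?case by (simp add: scaled_median_process_def median_process_def)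
  qed
qed

lemma U_measurable: "0 \<le> t \<Longrightarrow> U m t \<in> borel_measurable M"
  unfolding U_def by (rule borel_measurable_median) (simp add: Z_measurable)

lemma scaled_median_measurable: "0 \<le> t \<Longrightarrow> scaled_median_process B (2 * m + 1) t \<in> borel_measurable M"
  unfolding scaled_median_process_def median_process_def
  by (intro borel_measurable_times borel_measurable_const borel_measurable_median B_measurable) auto

lemma continuous_scaled_median: "continuous_process M (scaled_median_process B (2 * m + 1))"
  unfolding continuous_process_def
proof (intro conjI allI impI ballI scaled_median_measurable)
  fix \<omega> assume "\<omega> \<in> space M"
  then show "continuous_on {0..} (\<lambda>t. scaled_median_process B (2 * m + 1) t \<omega>)"
    unfolding scaled_median_process_def median_process_def
    by (intro continuous_on_mult continuous_on_const continuous_on_median B_continuous) auto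
qed

lemma expectation_Z_le:
  assumes "1 \<le> j" "0 < t"
  shows "expectation (\<lambda>\<omega>. of_bool (Z j t \<omega> \<le> u)) = Phi u" "integrable M (\<lambda>\<omega>. of_bool (Z j t \<omega> \<le> u) :: real)"
proof -
  have [measurable]: "Z j t \<in> borel_measurable M" using assms by (intro Z_measurable) auto
  have "prob {\<omega> \<in> space M. Z j t \<omega> \<in> {..u}} = Phi u"
    by (subst std_normal_prob(1)[OF Z_std_normal[OF assms]]) (auto simp: Phi_def)
  then show "expectation (\<lambda>\<omega>. of_bool (Z j t \<omega> \<le> u)) = Phi u"
    by (subst expectation_of_bool) auto
  show "integrable M (\<lambda>\<omega>. of_bool (Z j t \<omega> \<le> u) :: real)"
    by (rule expectation_of_bool) measurable
qed

text \<open>If the median exceeds \<open>u\<close>, the sum of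
  \<open>1 / 2 - of_bool (Z j t \<omega> \<le> u)\<close> is positive although each term has mean
  \<open>1 / 2 - Phi u \<le> - (normal_lower * u)\<close>. The lower tail uses the negated terms at
  level \<open>- u\<close>.\<close>

lemma U_tail:
  assumes t: "0 < t" and u: "0 \<le> u" "u \<le> 1"
  shows "prob {\<omega> \<in> space M. u < \<bar>U m t \<omega>\<bar>} \<le> 2 * exp (- (real (2 * m + 1) * (normal_lower * u)\<^sup>2 / 4))"
proof -
  note [measurable] = U_measurable[OF less_imp_le[OF t]]
  have Zm[measurable]: "1 \<le> j \<Longrightarrow> Z j t \<in> borel_measurable M" for j using t by (intro Z_measurable) auto
  let ?e = "exp (- (real (2 * m + 1) * (normal_lower * u)\<^sup>2 / 4))"
  have c: "0 \<le> normal_lower * u" "normal_lower * u \<le> 2 * 1"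
    using u normal_lower by (auto intro: mult_le_one order_trans[of _ 1])
  define \<xi> where "\<xi> j \<omega> = 1 / 2 - (of_bool (Z j t \<omega> \<le> u) :: real)" for j \<omega>
  have "prob {\<omega> \<in> space M. 0 \<le> (\<Sum>j\<in>{1..2 * m + 1}. \<xi> j \<omega>)}
      \<le> exp (- (real (card {1..2 * m + 1}) * (normal_lower * u)\<^sup>2 / (4 * 1)))"
  proof (rule prob_sum_nonneg_le[OF _ _ _ _ _ c])
    show "indep_vars (\<lambda>_. borel) \<xi> {1..2 * m + 1}"
      by (rule indep_path_functionals[of "\<lambda>x. 1 / 2 - of_bool (x t / sqrt t \<le> u)"])
        (use t in \<open>auto simp: \<xi>_def Z_def\<close>)
    show "expectation (\<xi> j) \<le> - (normal_lower * u)" if "j \<in> {1..2 * m + 1}" for j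
      unfolding \<xi>_def using that expectation_Z_le[of j t u] t Phi_diff_ge[of 0 u] u
      by (simp add: prob_space Phi_0)
    have "(\<lambda>\<omega>. (\<xi> j \<omega>)\<^sup>2) = (\<lambda>_. 1 / 4)" for j by (intro ext) (simp add: \<xi>_def power2_eq_square)
    then show "expectation (\<lambda>\<omega>. (\<xi> j \<omega>)\<^sup>2) \<le> 1" for j by (simp only:) (simp add: prob_space)
  qed (auto simp: \<xi>_def)
  moreover have "prob {\<omega> \<in> space M. u < U m t \<omega>} \<le> prob {\<omega> \<in> space M. 0 \<le> (\<Sum>j\<in>{1..2 * m + 1}. \<xi> j \<omega>)}"
  proof (rule finite_measure_mono)
    show "{\<omega> \<in> space M. u < U m t \<omega>} \<subseteq> {\<omega> \<in> space M. 0 \<le> (\<Sum>j\<in>{1..2 * m + 1}. \<xi> j \<omega>)}"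
      unfolding U_def median_le_iff_sum \<xi>_def by auto
    have "(\<lambda>\<omega>. \<Sum>j\<in>{1..2 * m + 1}. \<xi> j \<omega>) \<in> borel_measurable M"
      unfolding \<xi>_def by (intro borel_measurable_sum) measurable
    then show "{\<omega> \<in> space M. 0 \<le> (\<Sum>j\<in>{1..2 * m + 1}. \<xi> j \<omega>)} \<in> events" by measurable
  qed
  ultimately have upper: "prob {\<omega> \<in> space M. u < U m t \<omega>} \<le> ?e" by simp
  define \<eta> where "\<eta> j \<omega> = (of_bool (Z j t \<omega> \<le> - u) :: real) - 1 / 2" for j \<omega>
  have "prob {\<omega> \<in> space M. 0 \<le> (\<Sum>j\<in>{1..2 * m + 1}. \<eta> j \<omega>)}
      \<le> exp (- (real (card {1..2 * m + 1}) * (normal_lower * u)\<^sup>2 / (4 * 1)))"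
  proof (rule prob_sum_nonneg_le[OF _ _ _ _ _ c])
    show "indep_vars (\<lambda>_. borel) \<eta> {1..2 * m + 1}"
      by (rule indep_path_functionals[of "\<lambda>x. of_bool (x t / sqrt t \<le> - u) - 1 / 2"])
        (use t in \<open>auto simp: \<eta>_def Z_def\<close>)
    show "expectation (\<eta> j) \<le> - (normal_lower * u)" if "j \<in> {1..2 * m + 1}" for j
      unfolding \<eta>_def using that expectation_Z_le[of j t "- u"] t Phi_diff_ge[of "- u" 0] u
      by (simp add: prob_space Phi_0)
    have "(\<lambda>\<omega>. (\<eta> j \<omega>)\<^sup>2) = (\<lambda>_. 1 / 4)" for j by (intro ext) (simp add: \<eta>_def power2_eq_square)
    then show "expectation (\<lambda>\<omega>. (\<eta> j \<omega>)\<^sup>2) \<le> 1" for j by (simp only:) (simp add: prob_space)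
  qed (auto simp: \<eta>_def)
  moreover have "prob {\<omega> \<in> space M. U m t \<omega> < - u} \<le> prob {\<omega> \<in> space M. 0 \<le> (\<Sum>j\<in>{1..2 * m + 1}. \<eta> j \<omega>)}"
  proof (rule finite_measure_mono)
    show "{\<omega> \<in> space M. U m t \<omega> < - u} \<subseteq> {\<omega> \<in> space M. 0 \<le> (\<Sum>j\<in>{1..2 * m + 1}. \<eta> j \<omega>)}"
    proof
      fix \<omega> assume w: "\<omega> \<in> {\<omega> \<in> space M. U m t \<omega> < - u}"
      then have "median (2 * m + 1) (\<lambda>j. Z j t \<omega>) \<le> - u" by (simp add: U_def)
      then have "(\<Sum>j\<in>{1..2 * m + 1}. 1 / 2 - of_bool (Z j t \<omega> \<le> - u)) < (0::real)"
        unfolding median_le_iff_sum .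
      also have "(\<Sum>j\<in>{1..2 * m + 1}. 1 / 2 - of_bool (Z j t \<omega> \<le> - u)) = - (\<Sum>j\<in>{1..2 * m + 1}. \<eta> j \<omega>)"
        unfolding sum_negf[symmetric] \<eta>_def by (rule sum.cong) auto
      finally show "\<omega> \<in> {\<omega> \<in> space M. 0 \<le> (\<Sum>j\<in>{1..2 * m + 1}. \<eta> j \<omega>)}" using w by simp
    qed
    have "(\<lambda>\<omega>. \<Sum>j\<in>{1..2 * m + 1}. \<eta> j \<omega>) \<in> borel_measurable M"
      unfolding \<eta>_def by (intro borel_measurable_sum) measurable
    then show "{\<omega> \<in> space M. 0 \<le> (\<Sum>j\<in>{1..2 * m + 1}. \<eta> j \<omega>)} \<in> events" by measurable
  qed
  ultimately have lower: "prob {\<omega> \<in> space M. U m t \<omega> < - u} \<le> ?e" by simp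
  have "prob {\<omega> \<in> space M. u < \<bar>U m t \<omega>\<bar>} \<le> prob ({\<omega> \<in> space M. u < U m t \<omega>} \<union> {\<omega> \<in> space M. U m t \<omega> < - u})"
    by (rule finite_measure_mono) auto
  also have "\<dots> \<le> prob {\<omega> \<in> space M. u < U m t \<omega>} + prob {\<omega> \<in> space M. U m t \<omega> < - u}"
    by (rule measure_Un_le) measurable
  finally show ?thesis using upper lower by simp
qed

text \<open>The crossing makes the sum of the \<open>\<xi> j\<close> positive, while each has mean
  at most \<open>- (normal_lower * y)\<close>. A term is nonzero only if the particle moved by more
  than \<open>r\<close> or \<open>Z j p\<close> lies within \<open>r\<close> of the cell from
  \<open>u\<close> to \<open>u + y\<close>; this bounds its second moment by
  \<open>\<pi> + 2 * r + y\<close>.\<close>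

lemma U_crossing:
  assumes p: "0 < p" and q: "0 < q" and u: "- 2 \<le> u" "u + y \<le> 2" and y: "0 < y" and r: "0 \<le> r"
    and near: "\<And>j. 1 \<le> j \<Longrightarrow> prob {\<omega> \<in> space M. r < \<bar>Z j q \<omega> - Z j p \<omega>\<bar>} \<le> \<pi>"
    and w: "\<pi> + 2 * r + y \<le> w"
  shows "prob {\<omega> \<in> space M. U m p \<omega> \<le> u \<and> u + y < U m q \<omega>}
    \<le> exp (- (real (2 * m + 1) * (normal_lower * y)\<^sup>2 / (4 * w)))"
proof -
  note [measurable] = U_measurable[OF less_imp_le[OF p]] U_measurable[OF less_imp_le[OF q]]
  have Zp[measurable]: "1 \<le> j \<Longrightarrow> Z j p \<in> borel_measurable M" for j using p by (intro Z_measurable) auto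
  have Zq[measurable]: "1 \<le> j \<Longrightarrow> Z j q \<in> borel_measurable M" for j using q by (intro Z_measurable) auto
  have \<pi>: "0 \<le> \<pi>" by (rule order_trans[OF measure_nonneg near[of 1]]) simp
  have c: "0 \<le> normal_lower * y" "normal_lower * y \<le> 2 * w" "0 < w"
  proof -
    have "normal_lower * y \<le> 1 * y" using normal_lower y by (intro mult_right_mono) auto
    then show "normal_lower * y \<le> 2 * w" using w \<pi> r y by linarith
  qed (use normal_lower y w \<pi> r in auto)
  define \<xi> where "\<xi> j \<omega> = (of_bool (Z j p \<omega> \<le> u) - of_bool (Z j q \<omega> \<le> u + y) :: real)" for j \<omega>
  have "prob {\<omega> \<in> space M. 0 \<le> (\<Sum>j\<in>{1..2 * m + 1}. \<xi> j \<omega>)}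
      \<le> exp (- (real (card {1..2 * m + 1}) * (normal_lower * y)\<^sup>2 / (4 * w)))"
  proof (rule prob_sum_nonneg_le[OF _ _ _ _ _ c])
    show "indep_vars (\<lambda>_. borel) \<xi> {1..2 * m + 1}"
      by (rule indep_path_functionals[of "\<lambda>x. of_bool (x p / sqrt p \<le> u) - of_bool (x q / sqrt q \<le> u + y)"])
        (use p q in \<open>auto simp: \<xi>_def Z_def\<close>)
    show "expectation (\<xi> j) \<le> - (normal_lower * y)" if "j \<in> {1..2 * m + 1}" for j
      unfolding \<xi>_def using that expectation_Z_le[of j p u] expectation_Z_le[of j q "u + y"] p q
        Phi_diff_ge[of u "u + y"] u y by simp
    show "expectation (\<lambda>\<omega>. (\<xi> j \<omega>)\<^sup>2) \<le> w" if j: "j \<in> {1..2 * m + 1}" for j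
    proof -
      have [measurable]: "Z j p \<in> borel_measurable M" "Z j q \<in> borel_measurable M" using j by auto
      have "expectation (\<lambda>\<omega>. (\<xi> j \<omega>)\<^sup>2) \<le> expectation (\<lambda>\<omega>. of_bool (r < \<bar>Z j q \<omega> - Z j p \<omega>\<bar>) +
          (of_bool (Z j p \<omega> \<le> u + y + r) - of_bool (Z j p \<omega> \<le> u - r)))"
      proof (rule integral_mono)
        show "integrable M (\<lambda>\<omega>. (\<xi> j \<omega>)\<^sup>2)"
          by (rule integrable_const_bound[of _ 1]) (auto simp: \<xi>_def)
        show "integrable M (\<lambda>\<omega>. of_bool (r < \<bar>Z j q \<omega> - Z j p \<omega>\<bar>) +
          (of_bool (Z j p \<omega> \<le> u + y + r) - of_bool (Z j p \<omega> \<le> u - r)) :: real)"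
          by (intro Bochner_Integration.integrable_add Bochner_Integration.integrable_diff
              expectation_of_bool(1)) measurable
        show "(\<xi> j \<omega>)\<^sup>2 \<le> of_bool (r < \<bar>Z j q \<omega> - Z j p \<omega>\<bar>) +
          (of_bool (Z j p \<omega> \<le> u + y + r) - of_bool (Z j p \<omega> \<le> u - r))" for \<omega>
          using r y by (auto simp: \<xi>_def of_bool_def)
      qed
      also have "\<dots> = prob {\<omega> \<in> space M. r < \<bar>Z j q \<omega> - Z j p \<omega>\<bar>} + (Phi (u + y + r) - Phi (u - r))"
      proof -
        have "integrable M (\<lambda>\<omega>. of_bool (r < \<bar>Z j q \<omega> - Z j p \<omega>\<bar>) :: real)"
          by (rule expectation_of_bool) measurable
        moreover have "expectation (\<lambda>\<omega>. of_bool (r < \<bar>Z j q \<omega> - Z j p \<omega>\<bar>)) = prob {\<omega> \<in> space M. r < \<bar>Z j q \<omega> - Z j p \<omega>\<bar>}"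
          by (rule expectation_of_bool) measurable
        ultimately show ?thesis using expectation_Z_le[of j p] j p by simp
      qed
      also have "\<dots> \<le> \<pi> + ((u + y + r) - (u - r))"
        using near[of j] j y r by (intro add_mono Phi_diff_le) auto
      finally show ?thesis using w by simp
    qed
  qed (auto simp: \<xi>_def)
  moreover have "prob {\<omega> \<in> space M. U m p \<omega> \<le> u \<and> u + y < U m q \<omega>}
      \<le> prob {\<omega> \<in> space M. 0 \<le> (\<Sum>j\<in>{1..2 * m + 1}. \<xi> j \<omega>)}"
  proof (rule finite_measure_mono)
    show "{\<omega> \<in> space M. U m p \<omega> \<le> u \<and> u + y < U m q \<omega>} \<subseteq> {\<omega> \<in> space M. 0 \<le> (\<Sum>j\<in>{1..2 * m + 1}. \<xi> j \<omega>)}"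
    proof
      fix \<omega> assume w: "\<omega> \<in> {\<omega> \<in> space M. U m p \<omega> \<le> u \<and> u + y < U m q \<omega>}"
      then have "(\<Sum>j\<in>{1..2 * m + 1}. 1 / 2 - of_bool (Z j p \<omega> \<le> u)) < (0::real)"
        "0 < (\<Sum>j\<in>{1..2 * m + 1}. 1 / 2 - of_bool (Z j q \<omega> \<le> u + y) :: real)"
        unfolding U_def median_le_iff_sum by auto
      moreover have "(\<Sum>j\<in>{1..2 * m + 1}. \<xi> j \<omega>) = (\<Sum>j\<in>{1..2 * m + 1}. 1 / 2 - of_bool (Z j q \<omega> \<le> u + y))
          - (\<Sum>j\<in>{1..2 * m + 1}. 1 / 2 - of_bool (Z j p \<omega> \<le> u))"
        unfolding sum_subtractf[symmetric] \<xi>_def by (rule sum.cong) auto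
      ultimately show "\<omega> \<in> {\<omega> \<in> space M. 0 \<le> (\<Sum>j\<in>{1..2 * m + 1}. \<xi> j \<omega>)}" using w by simp
    qed
    have "(\<lambda>\<omega>. \<Sum>j\<in>{1..2 * m + 1}. \<xi> j \<omega>) \<in> borel_measurable M"
      unfolding \<xi>_def by (intro borel_measurable_sum) measurable
    then show "{\<omega> \<in> space M. 0 \<le> (\<Sum>j\<in>{1..2 * m + 1}. \<xi> j \<omega>)} \<in> events" by measurable
  qed
  ultimately show ?thesis by simp
qed

text \<open>A jump of \<open>U\<close> by more than \<open>2 * y\<close> crosses a whole cell of the grid of mesh \<open>y\<close>.\<close>

lemma U_jump:
  assumes p: "0 < p" and q: "0 < q" and y: "0 < y" "y \<le> 1 / 2" and k: "0 \<le> \<kappa>" "\<kappa> \<le> 1" and r: "0 \<le> r"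
    and near: "\<And>j. 1 \<le> j \<Longrightarrow> prob {\<omega> \<in> space M. r < \<bar>Z j q \<omega> - Z j p \<omega>\<bar>} \<le> \<pi>"
    and w: "\<pi> + 2 * r + y \<le> w"
  shows "prob {\<omega> \<in> space M. \<bar>U m p \<omega>\<bar> \<le> \<kappa> \<and> 2 * y < U m q \<omega> - U m p \<omega>}
    \<le> (2 * \<kappa> / y + 2) * exp (- (real (2 * m + 1) * (normal_lower * y)\<^sup>2 / (4 * w)))"
proof -
  note [measurable] = U_measurable[OF less_imp_le[OF p]] U_measurable[OF less_imp_le[OF q]]
  define e where "e = exp (- (real (2 * m + 1) * (normal_lower * y)\<^sup>2 / (4 * w)))"
  have e0: "0 \<le> e" by (simp add: e_def)
  define L where "L = \<lfloor>\<kappa> / y\<rfloor>"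
  have L: "0 \<le> L" "real_of_int L \<le> \<kappa> / y" using k y by (auto simp: L_def)
  have Ly: "real_of_int L * y \<le> \<kappa>" using L(2) y by (simp add: field_simps)
  define A where "A i = {\<omega> \<in> space M. U m p \<omega> \<le> real_of_int i * y \<and> real_of_int i * y + y < U m q \<omega>}" for i
  have A[measurable]: "A i \<in> events" for i unfolding A_def by measurable
  have "prob {\<omega> \<in> space M. \<bar>U m p \<omega>\<bar> \<le> \<kappa> \<and> 2 * y < U m q \<omega> - U m p \<omega>} \<le> prob (\<Union>i\<in>{- L..L + 1}. A i)"
  proof (rule finite_measure_mono)
    show "{\<omega> \<in> space M. \<bar>U m p \<omega>\<bar> \<le> \<kappa> \<and> 2 * y < U m q \<omega> - U m p \<omega>} \<subseteq> (\<Union>i\<in>{- L..L + 1}. A i)"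
    proof
      fix \<omega> assume w: "\<omega> \<in> {\<omega> \<in> space M. \<bar>U m p \<omega>\<bar> \<le> \<kappa> \<and> 2 * y < U m q \<omega> - U m p \<omega>}"
      \<comment> \<open>With \<open>i * y\<close> the least grid point not below
        \<open>U m p \<omega>\<close>, a jump by more than \<open>2 * y\<close> also passes
        \<open>i * y + y\<close>. Rounding up allows the index \<open>L + 1\<close>, hence
        \<open>2 * L + 2\<close> cells.\<close>
      define i where "i = \<lceil>U m p \<omega> / y\<rceil>"
      have "U m p \<omega> / y \<le> real_of_int i" "real_of_int i < U m p \<omega> / y + 1" unfolding i_def by linarith+
      then have i: "U m p \<omega> \<le> real_of_int i * y" "real_of_int i * y < U m p \<omega> + y"
        using y by (simp_all add: field_simps)
      have "U m p \<omega> / y \<le> \<kappa> / y" "- (\<kappa> / y) \<le> U m p \<omega> / y"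
        using w y by (auto simp: field_simps abs_le_iff)
      then have "i \<le> \<lceil>\<kappa> / y\<rceil>" "\<lceil>- (\<kappa> / y)\<rceil> \<le> i" unfolding i_def by (auto intro: ceiling_mono)
      moreover have "\<lceil>\<kappa> / y\<rceil> \<le> L + 1" unfolding L_def by linarith
      moreover have "\<lceil>- (\<kappa> / y)\<rceil> = - L" unfolding L_def by (simp add: ceiling_minus)
      ultimately have "i \<in> {- L..L + 1}" by simp
      moreover have "\<omega> \<in> A i" using i w by (simp add: A_def)
      ultimately show "\<omega> \<in> (\<Union>i\<in>{- L..L + 1}. A i)" by blast
    qed
  qed measurable
  also have "\<dots> \<le> (\<Sum>i\<in>{- L..L + 1}. prob (A i))"
    by (rule finite_measure_subadditive_finite) auto
  also have "\<dots> \<le> (\<Sum>i\<in>{- L..L + 1}. e)"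
  proof (rule sum_mono)
    fix i assume i: "i \<in> {- L..L + 1}"
    have "- real_of_int L \<le> real_of_int i" "real_of_int i \<le> real_of_int L + 1" using i by auto
    then have "- real_of_int L * y \<le> real_of_int i * y" "real_of_int i * y \<le> (real_of_int L + 1) * y"
      using y by (simp_all only: mult_right_mono less_imp_le)
    \<comment> \<open>Here \<open>\<kappa> \<le> 1\<close> and \<open>y \<le> 1 / 2\<close> enter:
      every cell ends at most at \<open>\<kappa> + 2 * y \<le> 2\<close>, within the range of the
      density bound.\<close>
    then have "- 2 \<le> real_of_int i * y" "real_of_int i * y + y \<le> 2"
      using Ly k y by (auto simp: distrib_right)
    then show "prob (A i) \<le> e"
      unfolding A_def e_def by (intro U_crossing[OF p q _ _ y(1) r near w]) auto
  qed
  also have "\<dots> = (2 * real_of_int L + 2) * e" using L(1) by (simp add: algebra_simps)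
  also have "\<dots> \<le> (2 * \<kappa> / y + 2) * e" using L(2) e0 by (intro mult_right_mono) auto
  finally show ?thesis unfolding e_def .
qed

lemma U_modulus:
  assumes p: "0 < p" and q: "0 < q" and y: "0 < y" "y \<le> 1 / 2" and k: "0 \<le> \<kappa>" "\<kappa> \<le> 1" and r: "0 \<le> r"
    and near: "\<And>j. 1 \<le> j \<Longrightarrow> prob {\<omega> \<in> space M. r < \<bar>Z j q \<omega> - Z j p \<omega>\<bar>} \<le> \<pi>"
    and w: "\<pi> + 2 * r + y \<le> w"
  shows "prob {\<omega> \<in> space M. \<kappa> < \<bar>U m p \<omega>\<bar> \<or> \<kappa> < \<bar>U m q \<omega>\<bar> \<or> 2 * y < \<bar>U m q \<omega> - U m p \<omega>\<bar>}
    \<le> 4 * exp (- (real (2 * m + 1) * (normal_lower * \<kappa>)\<^sup>2 / 4))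
      + (4 * \<kappa> / y + 4) * exp (- (real (2 * m + 1) * (normal_lower * y)\<^sup>2 / (4 * w)))"
proof -
  note [measurable] = U_measurable[OF less_imp_le[OF p]] U_measurable[OF less_imp_le[OF q]]
  let ?e = "exp (- (real (2 * m + 1) * (normal_lower * y)\<^sup>2 / (4 * w)))"
  let ?A = "{\<omega> \<in> space M. \<kappa> < \<bar>U m p \<omega>\<bar>}" and ?B = "{\<omega> \<in> space M. \<kappa> < \<bar>U m q \<omega>\<bar>}"
  let ?C = "{\<omega> \<in> space M. \<bar>U m p \<omega>\<bar> \<le> \<kappa> \<and> 2 * y < U m q \<omega> - U m p \<omega>}"
  let ?D = "{\<omega> \<in> space M. \<bar>U m q \<omega>\<bar> \<le> \<kappa> \<and> 2 * y < U m p \<omega> - U m q \<omega>}"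
  have "prob {\<omega> \<in> space M. \<kappa> < \<bar>U m p \<omega>\<bar> \<or> \<kappa> < \<bar>U m q \<omega>\<bar> \<or> 2 * y < \<bar>U m q \<omega> - U m p \<omega>\<bar>}
      \<le> prob ((?A \<union> ?B) \<union> (?C \<union> ?D))"
    by (rule finite_measure_mono) auto
  also have "\<dots> \<le> prob (?A \<union> ?B) + prob (?C \<union> ?D)" by (rule measure_Un_le) measurable
  also have "\<dots> \<le> (prob ?A + prob ?B) + (prob ?C + prob ?D)" by (intro add_mono measure_Un_le) measurable
  finally have "prob {\<omega> \<in> space M. \<kappa> < \<bar>U m p \<omega>\<bar> \<or> \<kappa> < \<bar>U m q \<omega>\<bar> \<or> 2 * y < \<bar>U m q \<omega> - U m p \<omega>\<bar>}
      \<le> (prob ?A + prob ?B) + (prob ?C + prob ?D)" .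
  moreover have "prob ?C \<le> (2 * \<kappa> / y + 2) * ?e" by (rule U_jump[OF p q y k r near w])
  \<comment> \<open>A downward jump from \<open>p\<close> to \<open>q\<close> is an upward jump from
    \<open>q\<close> to \<open>p\<close>; \<open>U_jump\<close> does not order the two
    times.\<close>
  moreover have "prob ?D \<le> (2 * \<kappa> / y + 2) * ?e"
  proof (rule U_jump[OF q p y k r _ w])
    show "prob {\<omega> \<in> space M. r < \<bar>Z j p \<omega> - Z j q \<omega>\<bar>} \<le> \<pi>" if "1 \<le> j" for j
      using near[OF that] by (subst abs_minus_commute)
  qed
  moreover have "prob ?A \<le> 2 * exp (- (real (2 * m + 1) * (normal_lower * \<kappa>)\<^sup>2 / 4))" by (rule U_tail[OF p k])
  moreover have "prob ?B \<le> 2 * exp (- (real (2 * m + 1) * (normal_lower * \<kappa>)\<^sup>2 / 4))" by (rule U_tail[OF q k])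
  moreover have "(4 * \<kappa> / y + 4) * ?e = (2 * \<kappa> / y + 2) * ?e + (2 * \<kappa> / y + 2) * ?e"
    by (simp only: distrib_right[symmetric]) simp
  ultimately show ?thesis by linarith
qed

text \<open>With \<open>x = sqrt (s / t)\<close> and \<open>q = sqrt ((t - s) / t)\<close> one has
  \<open>Z j t = q * g + x * Z j s\<close> for the standardised increment \<open>g\<close>, and
  \<open>1 - x \<le> q\<close>. A difference above \<open>2 * q * a\<close> therefore forces one of
  two standard normals above \<open>a\<close> in absolute value.\<close>

lemma Z_diff_tail:
  assumes j: "1 \<le> j" and st: "0 < s" "s < t" and a: "0 \<le> a"
  shows "prob {\<omega> \<in> space M. 2 * sqrt ((t - s) / t) * a < \<bar>Z j t \<omega> - Z j s \<omega>\<bar>}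
    \<le> 2 * measure std_normal_distribution {z. a < \<bar>z\<bar>}"
proof -
  define q where "q = sqrt ((t - s) / t)"
  have q: "0 \<le> q" using st by (simp add: q_def)
  let ?G = "\<lambda>\<omega>. (B j t \<omega> - B j s \<omega>) / sqrt (t - s)"
  have G: "distributed M lborel ?G std_normal_density"
    by (rule increment_std_normal) (use j st in auto)
  note Zs = Z_std_normal[OF j st(1)]
  note [measurable] = std_normal_prob(2)[OF G] std_normal_prob(2)[OF Zs]
  have s2: "{z::real. a < \<bar>z\<bar>} \<in> sets borel" by measurable
  have "prob {\<omega> \<in> space M. 2 * q * a < \<bar>Z j t \<omega> - Z j s \<omega>\<bar>}
      \<le> prob ({\<omega> \<in> space M. a < \<bar>?G \<omega>\<bar>} \<union> {\<omega> \<in> space M. a < \<bar>Z j s \<omega>\<bar>})"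
  proof (rule finite_measure_mono)
    show "{\<omega> \<in> space M. 2 * q * a < \<bar>Z j t \<omega> - Z j s \<omega>\<bar>}
        \<subseteq> {\<omega> \<in> space M. a < \<bar>?G \<omega>\<bar>} \<union> {\<omega> \<in> space M. a < \<bar>Z j s \<omega>\<bar>}"
    proof (rule subsetI, rule ccontr)
      fix \<omega> assume w: "\<omega> \<in> {\<omega> \<in> space M. 2 * q * a < \<bar>Z j t \<omega> - Z j s \<omega>\<bar>}"
        and "\<omega> \<notin> {\<omega> \<in> space M. a < \<bar>?G \<omega>\<bar>} \<union> {\<omega> \<in> space M. a < \<bar>Z j s \<omega>\<bar>}"
      then have le: "\<bar>?G \<omega>\<bar> \<le> a" "\<bar>Z j s \<omega>\<bar> \<le> a" by auto
      define x where "x = sqrt (s / t)"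
      have x: "0 \<le> x" "x \<le> 1" using st by (auto simp: x_def)
      have "1 - x \<le> q"
      proof (rule power2_le_imp_le[OF _ q])
        have "(1 - x)\<^sup>2 \<le> (1 - x) * (1 + x)"
          unfolding power2_eq_square using x by (intro mult_left_mono) auto
        also have "\<dots> = 1 - x\<^sup>2" by (simp add: algebra_simps power2_eq_square)
        also have "\<dots> = q\<^sup>2" using st by (simp add: x_def q_def field_simps)
        finally show "(1 - x)\<^sup>2 \<le> q\<^sup>2" .
      qed
      define g where "g = ?G \<omega>"
      define z where "z = Z j s \<omega>"
      have "B j t \<omega> = sqrt (t - s) * g + sqrt s * z" using st by (simp add: Z_def g_def z_def)
      then have "Z j t \<omega> = q * g + x * z"
        unfolding Z_def[of j t] q_def x_def by (simp add: real_sqrt_divide add_divide_distrib)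
      then have "Z j t \<omega> = q * ?G \<omega> + x * Z j s \<omega>" by (simp only: g_def z_def)
      then have "Z j t \<omega> - Z j s \<omega> = q * ?G \<omega> - (1 - x) * Z j s \<omega>" by (simp add: algebra_simps)
      also have "\<bar>\<dots>\<bar> \<le> q * \<bar>?G \<omega>\<bar> + (1 - x) * \<bar>Z j s \<omega>\<bar>"
        using q x by (intro order_trans[OF abs_triangle_ineq4]) (simp add: abs_mult)
      also have "\<dots> \<le> q * a + q * a"
        using le q x a \<open>1 - x \<le> q\<close> by (intro add_mono mult_mono) auto
      finally show False using w by (simp add: mult.assoc mult.commute)
    qed
  qed measurable
  also have "\<dots> \<le> prob {\<omega> \<in> space M. a < \<bar>?G \<omega>\<bar>} + prob {\<omega> \<in> space M. a < \<bar>Z j s \<omega>\<bar>}"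
    by (rule measure_Un_le) measurable
  also have "prob {\<omega> \<in> space M. a < \<bar>?G \<omega>\<bar>} = measure std_normal_distribution {z. a < \<bar>z\<bar>}"
    using std_normal_prob(1)[OF G s2] by simp
  also have "prob {\<omega> \<in> space M. a < \<bar>Z j s \<omega>\<bar>} = measure std_normal_distribution {z. a < \<bar>z\<bar>}"
    using std_normal_prob(1)[OF Zs s2] by simp
  finally show ?thesis by (simp add: q_def)
qed

section \<open>Increments of the scaled median in three regimes\<close>

abbreviation X :: "nat \<Rightarrow> real \<Rightarrow> 'a \<Rightarrow> real" where
  "X m t \<equiv> scaled_median_process B (2 * m + 1) t"

text \<open>Here \<open>b\<close> is the fourth root of \<open>h\<close>, and with
  \<open>n = 2 * m + 1\<close> the hypothesis \<open>few\<close> means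
  \<open>h < n powr - 2\<close>. If no particle moves by more than \<open>a * sqrt h\<close>, the
  scaled median moves by at most \<open>sqrt n * b * (a * b) \<le> a * b\<close>; the union bound
  costs a factor \<open>n \<le> 1 / h\<close>.\<close>

lemma X_increment_few:
  assumes h: "0 < h" "b ^ 4 = h" "0 < b" "b \<le> 1" and s: "0 \<le> s" and a: "1 \<le> a"
    and few: "sqrt (real (2 * m + 1)) * b < 1"
    and tail: "measure std_normal_distribution {z. a < \<bar>z\<bar>} \<le> p"
  shows "prob {\<omega> \<in> space M. a * b < \<bar>X m (s + h) \<omega> - X m s \<omega>\<bar>} \<le> p / h"
proof -
  define N where "N = real (2 * m + 1)"
  have N: "1 \<le> N" "sqrt N * b < 1" using few by (simp_all add: N_def)
  have sqh: "sqrt h = b\<^sup>2" using h by (simp add: power4_eq_xxxx power2_eq_square real_sqrt_unique flip: h(2))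
  let ?G = "\<lambda>j \<omega>. (B j (s + h) \<omega> - B j s \<omega>) / sqrt (s + h - s)"
  have G: "distributed M lborel (?G j) std_normal_density" if "1 \<le> j" for j
    by (rule increment_std_normal) (use that s h in auto)
  have Gm: "?G j \<in> borel_measurable M" if "1 \<le> j" for j by (rule std_normal_prob(2)[OF G[OF that]])
  have s2: "{z::real. a < \<bar>z\<bar>} \<in> sets borel" by measurable
  have ev: "{\<omega> \<in> space M. a < \<bar>?G j \<omega>\<bar>} \<in> events" if "j \<in> {1..2 * m + 1}" for j
  proof -
    have [measurable]: "?G j \<in> borel_measurable M" using that by (intro Gm) simp
    show ?thesis by measurable
  qed
  have "prob {\<omega> \<in> space M. a * b < \<bar>X m (s + h) \<omega> - X m s \<omega>\<bar>}
      \<le> prob (\<Union>j\<in>{1..2 * m + 1}. {\<omega> \<in> space M. a < \<bar>?G j \<omega>\<bar>})"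
  proof (rule finite_measure_mono)
    show "{\<omega> \<in> space M. a * b < \<bar>X m (s + h) \<omega> - X m s \<omega>\<bar>}
      \<subseteq> (\<Union>j\<in>{1..2 * m + 1}. {\<omega> \<in> space M. a < \<bar>?G j \<omega>\<bar>})"
    proof (rule subsetI, rule ccontr)
      fix \<omega> assume w: "\<omega> \<in> {\<omega> \<in> space M. a * b < \<bar>X m (s + h) \<omega> - X m s \<omega>\<bar>}"
        and "\<omega> \<notin> (\<Union>j\<in>{1..2 * m + 1}. {\<omega> \<in> space M. a < \<bar>?G j \<omega>\<bar>})"
      then have "\<bar>?G j \<omega>\<bar> \<le> a" if "j \<in> {1..2 * m + 1}" for j using that by (auto simp: not_less)
      then have "\<bar>B j (s + h) \<omega> - B j s \<omega>\<bar> \<le> a * sqrt h" if "j \<in> {1..2 * m + 1}" for j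
        using that h(1) by (simp add: abs_divide field_simps)
      then have "\<bar>median (2 * m + 1) (\<lambda>j. B j (s + h) \<omega>) - median (2 * m + 1) (\<lambda>j. B j s \<omega>)\<bar> \<le> a * sqrt h"
        by (rule median_Lipschitz)
      moreover have "\<bar>X m (s + h) \<omega> - X m s \<omega>\<bar> = sqrt N *
          \<bar>median (2 * m + 1) (\<lambda>j. B j (s + h) \<omega>) - median (2 * m + 1) (\<lambda>j. B j s \<omega>)\<bar>"
        unfolding scaled_median_process_def median_process_def N_def right_diff_distrib[symmetric] abs_mult
        by simp
      ultimately have "\<bar>X m (s + h) \<omega> - X m s \<omega>\<bar> \<le> sqrt N * (a * sqrt h)"
        using N(1) by (simp add: mult_left_mono)
      also have "\<dots> = (sqrt N * b) * (a * b)" by (simp add: sqh power2_eq_square)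
      also have "\<dots> \<le> 1 * (a * b)" using N a h by (intro mult_right_mono) auto
      finally show False using w by simp
    qed
    show "(\<Union>j\<in>{1..2 * m + 1}. {\<omega> \<in> space M. a < \<bar>?G j \<omega>\<bar>}) \<in> events"
      by (intro sets.finite_UN ev) auto
  qed
  also have "\<dots> \<le> (\<Sum>j\<in>{1..2 * m + 1}. prob {\<omega> \<in> space M. a < \<bar>?G j \<omega>\<bar>})"
    by (rule finite_measure_subadditive_finite) (use ev in auto)
  also have "\<dots> \<le> (\<Sum>j\<in>{1..2 * m + 1}. p)"
  proof (rule sum_mono)
    fix j assume "j \<in> {1..2 * m + 1}"
    then have "1 \<le> j" by simp
    from std_normal_prob(1)[OF G[OF this] s2] tail
    show "prob {\<omega> \<in> space M. a < \<bar>?G j \<omega>\<bar>} \<le> p" by simp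
  qed
  also have "\<dots> = N * p" by (simp add: N_def)
  also have "\<dots> \<le> p / h"
  proof -
    have "N * h = (sqrt N * b)\<^sup>2 * b\<^sup>2"
    proof -
      have "h = b\<^sup>2 * b\<^sup>2" using h(2) by (simp add: power4_eq_xxxx power2_eq_square)
      then show ?thesis using N(1) by (simp add: power_mult_distrib)
    qed
    also have "\<dots> \<le> 1 * 1" using N h by (intro mult_mono power_le_one) auto
    finally have "N * h \<le> 1" by simp
    then have "N \<le> 1 / h" using h(1) by (simp add: field_simps)
    moreover have "0 \<le> p" using order_trans[OF measure_nonneg tail] .
    ultimately have "N * p \<le> 1 / h * p" by (rule mult_right_mono)
    then show ?thesis by simp
  qed
  finally show ?thesis .
qed

text \<open>Since \<open>X m 0 = 0\<close> almost surely and \<open>X m h\<close> is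
  \<open>sqrt n * sqrt h * U m h\<close>, with \<open>n = 2 * m + 1\<close>, the tail of
  \<open>U\<close> at level \<open>a / sqrt n\<close> suffices. The hypotheses give
  \<open>a \<le> sqrt n\<close>, which keeps this level at most 1.\<close>

lemma X_increment_0:
  assumes h: "0 < h" "b ^ 4 = h" "0 < b" "b \<le> 1" and a: "1 \<le> a" "a * b \<le> 1"
    and many: "1 \<le> sqrt (real (2 * m + 1)) * b"
  shows "prob {\<omega> \<in> space M. a * b < \<bar>X m h \<omega> - X m 0 \<omega>\<bar>} \<le> 2 * exp (- (normal_lower\<^sup>2 / 4 * a))"
proof -
  define N where "N = real (2 * m + 1)"
  have N: "1 \<le> N" "1 \<le> sqrt N * b" using many by (simp_all add: N_def)
  have sN: "0 < sqrt N" using N by simp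
  have sqh: "sqrt h = b\<^sup>2" using h by (simp add: power4_eq_xxxx power2_eq_square real_sqrt_unique flip: h(2))
  define \<kappa> where "\<kappa> = a / sqrt N"
  have "a * b \<le> sqrt N * b" using a N by linarith
  then have aN: "a \<le> sqrt N" using h by simp
  then have k: "0 \<le> \<kappa>" "\<kappa> \<le> 1" using a sN by (auto simp: \<kappa>_def)
  have "prob {\<omega> \<in> space M. a * b < \<bar>X m h \<omega> - X m 0 \<omega>\<bar>} \<le> prob {\<omega> \<in> space M. \<kappa> < \<bar>U m h \<omega>\<bar>}"
  proof (rule finite_measure_mono_AE)
    show "AE \<omega> in M. \<omega> \<in> {\<omega> \<in> space M. a * b < \<bar>X m h \<omega> - X m 0 \<omega>\<bar>} \<longrightarrow> \<omega> \<in> {\<omega> \<in> space M. \<kappa> < \<bar>U m h \<omega>\<bar>}"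
      using scaled_median_0[of m]
    proof eventually_elim
      case (elim \<omega>)
      show ?case
      proof (rule impI, rule ccontr)
        assume w: "\<omega> \<in> {\<omega> \<in> space M. a * b < \<bar>X m h \<omega> - X m 0 \<omega>\<bar>}" and "\<omega> \<notin> {\<omega> \<in> space M. \<kappa> < \<bar>U m h \<omega>\<bar>}"
        then have "\<bar>U m h \<omega>\<bar> \<le> \<kappa>" by auto
        then have "sqrt N * b\<^sup>2 * \<bar>U m h \<omega>\<bar> \<le> sqrt N * b\<^sup>2 * \<kappa>" using sN by (intro mult_left_mono) auto
        also have "\<dots> = (a * b) * b" using sN by (simp add: \<kappa>_def power2_eq_square)
        also have "\<dots> \<le> a * b" using a h by (intro mult_left_le) auto
        finally have "\<bar>X m h \<omega>\<bar> \<le> a * b"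
          using scaled_median_eq_U[OF h(1), of m \<omega>] sN
          by (simp only: N_def[symmetric] sqh abs_mult) simp
        then show False using w elim by simp
      qed
    qed
    show "{\<omega> \<in> space M. \<kappa> < \<bar>U m h \<omega>\<bar>} \<in> events"
    proof -
      have [measurable]: "U m h \<in> borel_measurable M" using h(1) by (intro U_measurable) simp
      show ?thesis by measurable
    qed
  qed
  also have "\<dots> \<le> 2 * exp (- (N * (normal_lower * \<kappa>)\<^sup>2 / 4))"
    unfolding N_def by (rule U_tail[OF h(1) k])
  also have "N * (normal_lower * \<kappa>)\<^sup>2 = normal_lower\<^sup>2 * a\<^sup>2"
    using N(1) by (simp add: \<kappa>_def power_mult_distrib power_divide)
  also have "2 * exp (- (normal_lower\<^sup>2 * a\<^sup>2 / 4)) \<le> 2 * exp (- (normal_lower\<^sup>2 / 4 * a))"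
  proof -
    have "a \<le> a\<^sup>2" using a(1) by (simp add: power2_eq_square)
    then have "normal_lower\<^sup>2 / 4 * a \<le> normal_lower\<^sup>2 / 4 * a\<^sup>2" by (intro mult_left_mono) auto
    then show ?thesis by simp
  qed
  finally show ?thesis .
qed

text \<open>With \<open>n = 2 * m + 1\<close> and \<open>q = sqrt (h / t)\<close>, the jump
  threshold \<open>y = a * sqrt q / (2 * sqrt n)\<close> satisfies
  \<open>n * y\<^sup>2 = a\<^sup>2 * q / 4\<close>. The second moment is at most
  \<open>w = W * q * a + y\<close>, and both parts are small enough for the exponent
  \<open>n * y\<^sup>2 / w\<close> to be at least \<open>l * a\<close>. In the application
  \<open>a\<close> is a small negative power of \<open>h\<close>, so the exponential beats every
  power.\<close>

lemma X_increment_many: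
  assumes h: "0 < h" "b ^ 4 = h" "0 < b" "b \<le> 1" and s: "h \<le> s" "s + h \<le> T" and T: "1 \<le> T"
    and a: "1 \<le> a" "a * b \<le> 1"
    and many: "1 \<le> sqrt (real (2 * m + 1)) * b"
    and tail: "measure std_normal_distribution {z. a < \<bar>z\<bar>} \<le> C * h" and C: "0 \<le> C"
    and l: "0 < l" "l * (2 * C * T + 4) \<le> 1 / 8" "l \<le> 1 / (4 * T)"
  shows "prob {\<omega> \<in> space M. (T + 1) * (a * b) < \<bar>X m (s + h) \<omega> - X m s \<omega>\<bar>}
    \<le> 4 * exp (- (normal_lower\<^sup>2 / 4 * a)) + 12 * T / h * exp (- (normal_lower\<^sup>2 / 4 * l * a))"
proof -
  define N where "N = real (2 * m + 1)"
  have N: "1 \<le> N" "1 \<le> sqrt N * b" using many by (simp_all add: N_def)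
  have sN: "0 < sqrt N" "sqrt N * sqrt N = N" using N by simp_all
  have sqh: "sqrt h = b\<^sup>2" using h by (simp add: power4_eq_xxxx power2_eq_square real_sqrt_unique flip: h(2))
  define t where "t = s + h"
  have t: "0 < s" "s < t" "0 < t" "t \<le> T" "t - s = h" "h \<le> t" using s h by (auto simp: t_def)
  define q where "q = sqrt (h / t)"
  define v where "v = sqrt q"
  have q: "0 < q" "q \<le> 1" "q\<^sup>2 = h / t" using h t by (auto simp: q_def)
  have v: "0 < v" "v \<le> 1" "v\<^sup>2 = q" using q by (auto simp: v_def)
  have v4: "v ^ 4 = h / t" using v(3) q(3) by (metis numeral_Bit0 power_add power2_eq_square)
  define \<kappa> where "\<kappa> = a / sqrt N"
  define y where "y = a * v / (2 * sqrt N)"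
  have "a * b \<le> sqrt N * b" using a N by linarith
  then have aN: "a \<le> sqrt N" using h by simp
  have k: "0 \<le> \<kappa>" "\<kappa> \<le> 1" using a sN aN by (auto simp: \<kappa>_def)
  have y: "0 < y" "y \<le> 1 / 2"
  proof -
    have "a * v \<le> sqrt N * 1" using aN v a N by (intro mult_mono) auto
    then show "y \<le> 1 / 2" using sN by (simp add: y_def field_simps)
  qed (use a v sN in \<open>simp add: y_def\<close>)
  \<comment> \<open>\<open>2 * C * T\<close> absorbs the probability \<open>2 * (C * h)\<close> of a
    large particle move through \<open>h \<le> T * q\<close>, and 4 absorbs \<open>2 * r\<close> for
    \<open>r = 2 * q * a\<close>.\<close>
  define W where "W = 2 * C * T + 4"
  have W: "0 < W" using C T by (simp add: W_def add_nonneg_pos)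
  define w where "w = W * q * a + y"
  have w0: "0 < w" using W q a y by (simp add: w_def add_pos_pos)
  have hT: "h / T \<le> h / t" using h t by (intro divide_left_mono) auto
  have qT: "h \<le> T * q"
  proof -
    have "h / t \<le> q" using q by (metis mult_left_le power2_eq_square less_imp_le)
    then have "h / T \<le> q" using hT by linarith
    then show ?thesis using T by (simp add: field_simps)
  qed
  \<comment> \<open>Fourth powers are compared, since \<open>b ^ 4 = h\<close> and
    \<open>v ^ 4 = h / t\<close>.\<close>
  have vT: "b / T \<le> v"
  proof (rule power_le_imp_le_base[of _ 3])
    have "(b / T) ^ Suc 3 = h / T ^ 4" using h(2) by (simp add: power_divide)
    also have "\<dots> \<le> h / T ^ 1" using T h by (intro divide_left_mono power_increasing) auto
    also have "\<dots> \<le> v ^ Suc 3" using hT v4 by simp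
    finally show "(b / T) ^ Suc 3 \<le> v ^ Suc 3" .
  qed (use v in simp)
  have near: "prob {\<omega> \<in> space M. 2 * q * a < \<bar>Z j t \<omega> - Z j s \<omega>\<bar>} \<le> 2 * (C * h)" if "1 \<le> j" for j
    using Z_diff_tail[OF that t(1,2), of a] a tail by (simp add: q_def t(5))
  have wb: "2 * (C * h) + 2 * (2 * q * a) + y \<le> w"
  proof -
    have "C * h \<le> C * (T * q)" using qT C by (intro mult_left_mono) auto
    also have "\<dots> \<le> C * (T * q) * a" using mult_left_mono[OF a(1), of "C * (T * q)"] C T q by simp
    finally show ?thesis by (simp add: w_def W_def algebra_simps)
  qed
  have "prob {\<omega> \<in> space M. (T + 1) * (a * b) < \<bar>X m (s + h) \<omega> - X m s \<omega>\<bar>}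
      \<le> prob {\<omega> \<in> space M. \<kappa> < \<bar>U m s \<omega>\<bar> \<or> \<kappa> < \<bar>U m t \<omega>\<bar> \<or> 2 * y < \<bar>U m t \<omega> - U m s \<omega>\<bar>}"
  proof (rule finite_measure_mono)
    show "{\<omega> \<in> space M. (T + 1) * (a * b) < \<bar>X m (s + h) \<omega> - X m s \<omega>\<bar>}
      \<subseteq> {\<omega> \<in> space M. \<kappa> < \<bar>U m s \<omega>\<bar> \<or> \<kappa> < \<bar>U m t \<omega>\<bar> \<or> 2 * y < \<bar>U m t \<omega> - U m s \<omega>\<bar>}"
    proof (rule subsetI, rule ccontr)
      fix \<omega> assume e: "\<omega> \<in> {\<omega> \<in> space M. (T + 1) * (a * b) < \<bar>X m (s + h) \<omega> - X m s \<omega>\<bar>}"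
        and "\<omega> \<notin> {\<omega> \<in> space M. \<kappa> < \<bar>U m s \<omega>\<bar> \<or> \<kappa> < \<bar>U m t \<omega>\<bar> \<or> 2 * y < \<bar>U m t \<omega> - U m s \<omega>\<bar>}"
      then have le: "\<bar>U m s \<omega>\<bar> \<le> \<kappa>" "\<bar>U m t \<omega> - U m s \<omega>\<bar> \<le> 2 * y" by auto
      have sq: "0 \<le> sqrt t - sqrt s" "sqrt t - sqrt s \<le> sqrt h"
        using t sqrt_add_le_add_sqrt[of s h] h by (auto simp: t_def)
      \<comment> \<open>The normalisation changes along with \<open>U\<close>: the change of
        \<open>sqrt t\<close> is at most \<open>sqrt h\<close> and multiplies the value
        \<open>U m s \<omega>\<close>, which is small off the tail event.\<close>
      have "X m t \<omega> - X m s \<omega> = sqrt N * (sqrt t * (U m t \<omega> - U m s \<omega>) + (sqrt t - sqrt s) * U m s \<omega>)"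
        using scaled_median_eq_U[OF t(1), of m \<omega>] scaled_median_eq_U[OF t(3), of m \<omega>]
        by (simp only: N_def[symmetric]) (simp add: algebra_simps)
      also have "\<bar>\<dots>\<bar> \<le> sqrt N * (sqrt t * \<bar>U m t \<omega> - U m s \<omega>\<bar> + (sqrt t - sqrt s) * \<bar>U m s \<omega>\<bar>)"
        unfolding abs_mult using sN sq(1) t(3)
        by (intro mult_mono order_trans[OF abs_triangle_ineq]) (auto simp: abs_mult)
      also have "\<dots> \<le> sqrt N * (sqrt t * (2 * y) + sqrt h * \<kappa>)"
        using le sN sq t(3) k h(1) by (intro mult_left_mono add_mono mult_mono) auto
      also have "\<dots> = a * (sqrt t * v) + b\<^sup>2 * a"
        using sN by (simp add: y_def \<kappa>_def sqh field_simps)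
      also have "sqrt t * v \<le> T * b"
      proof (rule power_le_imp_le_base[of _ 3])
        have "sqrt t ^ 4 = t\<^sup>2" using t(3) by (metis numeral_Bit0 power_add power2_eq_square real_sqrt_pow2 less_imp_le)
        then have "(sqrt t * v) ^ Suc 3 = t * h" using t(3) v4 by (simp add: power_mult_distrib power2_eq_square)
        also have "\<dots> \<le> T ^ 1 * h" using t h by (intro mult_right_mono) auto
        also have "\<dots> \<le> T ^ 4 * h" using T h by (intro mult_right_mono power_increasing) auto
        also have "\<dots> = (T * b) ^ Suc 3" using h(2) by (simp add: power_mult_distrib)
        finally show "(sqrt t * v) ^ Suc 3 \<le> (T * b) ^ Suc 3" .
      qed (use T h in simp)
      also have "b\<^sup>2 * a \<le> b * a" using a h by (intro mult_right_mono) (auto simp: power2_eq_square mult_left_le)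
      finally have "\<bar>X m t \<omega> - X m s \<omega>\<bar> \<le> a * (T * b) + b * a" using a by (simp add: mult_left_mono)
      also have "\<dots> = (T + 1) * (a * b)" by (simp add: algebra_simps)
      finally show False using e by (simp add: t_def)
    qed
    show "{\<omega> \<in> space M. \<kappa> < \<bar>U m s \<omega>\<bar> \<or> \<kappa> < \<bar>U m t \<omega>\<bar> \<or> 2 * y < \<bar>U m t \<omega> - U m s \<omega>\<bar>} \<in> events"
    proof -
      have [measurable]: "U m s \<in> borel_measurable M" "U m t \<in> borel_measurable M"
        using t by (auto intro: U_measurable)
      show ?thesis by measurable
    qed
  qed
  also have "\<dots> \<le> 4 * exp (- (N * (normal_lower * \<kappa>)\<^sup>2 / 4))
      + (4 * \<kappa> / y + 4) * exp (- (N * (normal_lower * y)\<^sup>2 / (4 * w)))"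
    unfolding N_def by (rule U_modulus[OF t(1,3) y k _ near wb]) (use q a in auto)
  finally have main: "prob {\<omega> \<in> space M. (T + 1) * (a * b) < \<bar>X m (s + h) \<omega> - X m s \<omega>\<bar>}
      \<le> 4 * exp (- (N * (normal_lower * \<kappa>)\<^sup>2 / 4))
      + (4 * \<kappa> / y + 4) * exp (- (N * (normal_lower * y)\<^sup>2 / (4 * w)))" .
  have e1: "exp (- (N * (normal_lower * \<kappa>)\<^sup>2 / 4)) \<le> exp (- (normal_lower\<^sup>2 / 4 * a))"
  proof -
    have "N * (normal_lower * \<kappa>)\<^sup>2 = normal_lower\<^sup>2 * a\<^sup>2"
      using N(1) by (simp add: \<kappa>_def power_mult_distrib power_divide)
    moreover have "a \<le> a\<^sup>2" using a(1) by (simp add: power2_eq_square)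
    then have "normal_lower\<^sup>2 / 4 * a \<le> normal_lower\<^sup>2 / 4 * a\<^sup>2" by (intro mult_left_mono) auto
    ultimately show ?thesis by simp
  qed
  have e2: "exp (- (N * (normal_lower * y)\<^sup>2 / (4 * w))) \<le> exp (- (normal_lower\<^sup>2 / 4 * l * a))"
  proof -
    have Ny: "N * y\<^sup>2 = a\<^sup>2 * q / 4"
      using sN N v(3) by (simp add: y_def power_mult_distrib power_divide)
    have "l * a * (W * q * a) \<le> a\<^sup>2 * q / 8"
    proof -
      have "(l * W) * (a\<^sup>2 * q) \<le> 1 / 8 * (a\<^sup>2 * q)"
        using l(2) q by (intro mult_right_mono) (auto simp: W_def)
      then show ?thesis by (simp add: power2_eq_square algebra_simps)
    qed
    moreover have "l * a * y \<le> a\<^sup>2 * q / 8"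
    proof -
      \<comment> \<open>The part \<open>y\<close> of \<open>w\<close> is under control because
        \<open>sqrt N * v\<close> is at least \<open>sqrt N * b / T\<close>, hence at least
        \<open>1 / T\<close> by the hypothesis \<open>many\<close>.\<close>
      have "4 * l \<le> 1 / T" using l(3) T by (simp add: field_simps)
      also have "\<dots> \<le> (sqrt N * b) * (1 / T)" using N T by (simp add: field_simps)
      also have "\<dots> = sqrt N * (b / T)" by simp
      also have "\<dots> \<le> sqrt N * v" using vT sN by (intro mult_left_mono) auto
      finally have "4 * l * (a\<^sup>2 * v / (8 * sqrt N)) \<le> sqrt N * v * (a\<^sup>2 * v / (8 * sqrt N))"
        using v sN by (intro mult_right_mono) auto
      moreover have "4 * l * (a\<^sup>2 * v / (8 * sqrt N)) = l * a * y"
        by (simp add: y_def power2_eq_square)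
      moreover have "sqrt N * v * (a\<^sup>2 * v / (8 * sqrt N)) = a\<^sup>2 * q / 8"
        using sN v(3) by (simp add: power2_eq_square)
      ultimately show ?thesis by simp
    qed
    ultimately have "l * a * w \<le> N * y\<^sup>2" unfolding Ny w_def by (simp add: distrib_left)
    then have "l * a \<le> N * y\<^sup>2 / w" using w0 by (simp add: field_simps)
    then have "normal_lower\<^sup>2 / 4 * (l * a) \<le> normal_lower\<^sup>2 / 4 * (N * y\<^sup>2 / w)"
      by (intro mult_left_mono) auto
    also have "\<dots> = N * (normal_lower * y)\<^sup>2 / (4 * w)" by (simp add: power_mult_distrib)
    finally show ?thesis by (simp add: mult.assoc)
  qed
  \<comment> \<open>The number of cells grows only like a power of \<open>1 / h\<close>, which the
    exponential factor outweighs later.\<close>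
  have cnt: "4 * \<kappa> / y + 4 \<le> 12 * T / h"
  proof -
    have "4 * \<kappa> / y = 8 / v" using a sN v by (simp add: \<kappa>_def y_def)
    moreover have "4 \<le> 4 / v" using v by (simp add: field_simps)
    ultimately have "4 * \<kappa> / y + 4 \<le> 12 / v" by simp
    also have "\<dots> \<le> 12 / (b / T)" using vT v h T by (intro divide_left_mono) auto
    also have "\<dots> = 12 * T / b" by simp
    also have "\<dots> \<le> 12 * T / h"
    proof (rule divide_left_mono)
      show "h \<le> b" unfolding h(2)[symmetric] using h power_decreasing[of 1 4 b] by simp
    qed (use T h in auto)
    finally show ?thesis .
  qed
  have "(4 * \<kappa> / y + 4) * exp (- (N * (normal_lower * y)\<^sup>2 / (4 * w)))
      \<le> 12 * T / h * exp (- (normal_lower\<^sup>2 / 4 * l * a))"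
    using cnt e2 T h by (intro mult_mono) auto
  with main e1 show ?thesis by linarith
qed

text \<open>The exponent 3 makes the bad increments summable over all dyadic neighbours of all levels.\<close>

lemma X_increment:
  assumes \<delta>: "0 < \<delta>" "\<delta> < 1 / 4" and T: "1 \<le> T"
  shows "\<exists>C\<ge>0. \<exists>D\<ge>0. \<forall>m h s. 0 < h \<longrightarrow> h \<le> 1 \<longrightarrow> (s = 0 \<or> h \<le> s) \<longrightarrow> s + h \<le> T \<longrightarrow>
    prob {\<omega> \<in> space M. C * h powr (1 / 4 - \<delta>) < \<bar>X m (s + h) \<omega> - X m s \<omega>\<bar>} \<le> D * h ^ 3"
proof -
  \<comment> \<open>Order 4 rather than 3: the factor \<open>1 / h\<close> from the number of
    particles or of grid cells uses up one power of \<open>h\<close>.\<close>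
  obtain C4 where C4: "0 \<le> C4" "\<And>h. 0 < h \<Longrightarrow> h \<le> 1 \<Longrightarrow>
      measure std_normal_distribution {z. h powr - \<delta> < \<bar>z\<bar>} \<le> C4 * h ^ 4"
    using std_normal_tail_powr[OF \<delta>(1), of 4] by blast
  define W where "W = 2 * C4 * T + 4"
  have W: "0 < W" using C4 T by (simp add: W_def add_nonneg_pos)
  define l where "l = min (1 / (8 * W)) (1 / (4 * T))"
  have l: "0 < l" "l * W \<le> 1 / 8" "l \<le> 1 / (4 * T)"
  proof -
    show "0 < l" using W T by (simp add: l_def)
    have "l * W \<le> 1 / (8 * W) * W" using W by (intro mult_right_mono) (auto simp: l_def)
    then show "l * W \<le> 1 / 8" using W by simp
  qed (simp add: l_def)
  define c where "c = normal_lower\<^sup>2 / 4"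
  have c: "0 < c" using normal_lower by (simp add: c_def)
  obtain E1 where E1: "0 \<le> E1" "\<And>h. 0 < h \<Longrightarrow> h \<le> 1 \<Longrightarrow> exp (- (c * h powr - \<delta>)) \<le> E1 * h ^ 4"
    using exp_powr_decay[OF \<delta>(1) c, of 4] by blast
  have "0 < c * l" using c l by simp
  then obtain E2 where E2: "0 \<le> E2" "\<And>h. 0 < h \<Longrightarrow> h \<le> 1 \<Longrightarrow> exp (- (c * l * h powr - \<delta>)) \<le> E2 * h ^ 4"
    using exp_powr_decay[OF \<delta>(1), of "c * l" 4] by blast
  define D where "D = C4 + 4 * E1 + 12 * T * E2"
  have "prob {\<omega> \<in> space M. (T + 1) * h powr (1 / 4 - \<delta>) < \<bar>X m (s + h) \<omega> - X m s \<omega>\<bar>} \<le> D * h ^ 3"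
    if h: "0 < h" "h \<le> 1" and s: "s = 0 \<or> h \<le> s" "s + h \<le> T" for m h s
  proof -
    define a b where "a = h powr - \<delta>" and "b = h powr (1 / 4)"
    have a1: "1 \<le> a" using h \<delta> by (simp add: a_def ge_one_powr_ge_zero powr_minus one_le_inverse powr_le1)
    have b: "0 < b" "b \<le> 1" "b ^ 4 = h"
    proof -
      show "b ^ 4 = h" using h by (simp add: b_def powr_power)
    qed (use h in \<open>auto simp: b_def intro!: powr_le1\<close>)
    have ab: "a * b = h powr (1 / 4 - \<delta>)" by (simp add: a_def b_def powr_add[symmetric])
    have ab1: "a * b \<le> 1" unfolding ab using h \<delta> by (intro powr_le1) auto
    have p4: "measure std_normal_distribution {z. a < \<bar>z\<bar>} \<le> C4 * h ^ 4" unfolding a_def by (rule C4(2)[OF h])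
    have h43: "h ^ 4 \<le> h ^ 3" "h ^ 4 \<le> h" using h power_decreasing[of 3 4 h] power_decreasing[of 1 4 h] by auto
    have p1: "measure std_normal_distribution {z. a < \<bar>z\<bar>} \<le> C4 * h"
      using p4 mult_left_mono[OF h43(2) C4(1)] by linarith
    have e1: "exp (- (normal_lower\<^sup>2 / 4 * a)) \<le> E1 * h ^ 3"
      using E1(2)[OF h] mult_left_mono[OF h43(1) E1(1)] unfolding c_def a_def by linarith
    have e2: "exp (- (normal_lower\<^sup>2 / 4 * l * a)) \<le> E2 * h ^ 4"
      using E2(2)[OF h] unfolding c_def a_def .
    have n: "0 \<le> C4 * h ^ 3" "0 \<le> E1 * h ^ 3" "0 \<le> T * E2 * h ^ 3" using C4 E1 E2 h T by auto
    have D: "D * h ^ 3 = C4 * h ^ 3 + 4 * (E1 * h ^ 3) + 12 * (T * E2 * h ^ 3)"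
      by (simp add: D_def algebra_simps)
    have s0: "0 \<le> s" using s h by auto
    have mono: "prob {\<omega> \<in> space M. (T + 1) * (a * b) < \<bar>X m (s + h) \<omega> - X m s \<omega>\<bar>}
        \<le> prob {\<omega> \<in> space M. a * b < \<bar>X m (s + h) \<omega> - X m s \<omega>\<bar>}"
    proof (rule finite_measure_mono)
      have "a * b \<le> (T + 1) * (a * b)" using T a1 b by simp
      then show "{\<omega> \<in> space M. (T + 1) * (a * b) < \<bar>X m (s + h) \<omega> - X m s \<omega>\<bar>}
        \<subseteq> {\<omega> \<in> space M. a * b < \<bar>X m (s + h) \<omega> - X m s \<omega>\<bar>}" by auto
      show "{\<omega> \<in> space M. a * b < \<bar>X m (s + h) \<omega> - X m s \<omega>\<bar>} \<in> events"
      proof -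
        have [measurable]: "X m s \<in> borel_measurable M" "X m (s + h) \<in> borel_measurable M"
          using s0 h by (simp_all only: scaled_median_measurable add_nonneg_nonneg less_imp_le)
        show ?thesis by measurable
      qed
    qed
    \<comment> \<open>Three regimes: \<open>h\<close> below \<open>n powr - 2\<close>, where single
      particles are controlled; otherwise increments that start at 0, and increments that start at a
      positive time, where \<open>Z j s\<close> is standard normal.\<close>
    consider "sqrt (real (2 * m + 1)) * b < 1" | "1 \<le> sqrt (real (2 * m + 1)) * b" "s = 0"
      | "1 \<le> sqrt (real (2 * m + 1)) * b" "h \<le> s" using s by linarith
    then have "prob {\<omega> \<in> space M. (T + 1) * (a * b) < \<bar>X m (s + h) \<omega> - X m s \<omega>\<bar>} \<le> D * h ^ 3"
    proof cases
      case 1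
      have "prob {\<omega> \<in> space M. a * b < \<bar>X m (s + h) \<omega> - X m s \<omega>\<bar>} \<le> C4 * h ^ 4 / h"
        by (rule X_increment_few[OF h(1) b(3,1,2) s0 a1 1 p4])
      also have "\<dots> = C4 * h ^ 3" using h by (simp add: power4_eq_xxxx power3_eq_cube)
      finally show ?thesis using mono n D by linarith
    next
      case 2
      have "prob {\<omega> \<in> space M. a * b < \<bar>X m h \<omega> - X m 0 \<omega>\<bar>} \<le> 2 * exp (- (normal_lower\<^sup>2 / 4 * a))"
        by (rule X_increment_0[OF h(1) b(3,1,2) a1 ab1 2(1)])
      then show ?thesis using mono n D e1 2(2) by simp
    next
      case 3
      have "prob {\<omega> \<in> space M. (T + 1) * (a * b) < \<bar>X m (s + h) \<omega> - X m s \<omega>\<bar>}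
          \<le> 4 * exp (- (normal_lower\<^sup>2 / 4 * a)) + 12 * T / h * exp (- (normal_lower\<^sup>2 / 4 * l * a))"
        by (rule X_increment_many[OF h(1) b(3,1,2) 3(2) s(2) T a1 ab1 3(1) p1 C4(1) l(1) l(2)[unfolded W_def] l(3)])
      moreover have "12 * T / h * exp (- (normal_lower\<^sup>2 / 4 * l * a)) \<le> 12 * T / h * (E2 * h ^ 4)"
        using e2 T h by (intro mult_left_mono) auto
      moreover have "12 * T / h * (E2 * h ^ 4) = 12 * (T * E2 * h ^ 3)"
        using h by (simp add: power4_eq_xxxx power3_eq_cube)
      ultimately show ?thesis using n D e1 by linarith
    qed
    then show ?thesis unfolding ab .
  qed
  moreover have "0 \<le> D" using C4 E1 E2 T by (simp add: D_def)
  moreover have "0 \<le> T + 1" using T by simp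
  ultimately show ?thesis by blast
qed

end

section \<open>A central limit theorem for bounded variables\<close>

text \<open>Each characteristic function at \<open>1 / sqrt n\<close> is
  \<open>1 - v / (2 * n)\<close> up to \<open>A ^ 3 / (6 * n powr (3 / 2))\<close>, and a product of
  numbers of modulus at most 1 changes by at most the sum of the changes of its factors. The common
  bound \<open>A\<close> takes the place of identical distributions; \<open>v = 0\<close> is
  included for degenerate linear forms.\<close>

lemma (in prob_space) bounded_central_limit:
  fixes \<eta> :: "nat \<Rightarrow> 'a \<Rightarrow> real"
  assumes indep: "indep_vars (\<lambda>_. borel) \<eta> {1..}"
    and b: "\<And>j \<omega>. 1 \<le> j \<Longrightarrow> \<omega> \<in> space M \<Longrightarrow> \<bar>\<eta> j \<omega>\<bar> \<le> A"
    and mean: "\<And>j. 1 \<le> j \<Longrightarrow> expectation (\<eta> j) = 0"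
    and second: "\<And>j. 1 \<le> j \<Longrightarrow> expectation (\<lambda>\<omega>. (\<eta> j \<omega>)\<^sup>2) = v"
  shows "(\<lambda>n. expectation (\<lambda>\<omega>. iexp ((\<Sum>j\<in>{1..n}. \<eta> j \<omega>) / sqrt (real n)))) \<longlonglongrightarrow> complex_of_real (exp (- v / 2))"
proof -
  have \<eta>: "\<eta> j \<in> borel_measurable M" if "1 \<le> j" for j
    using indep that by (auto simp: indep_vars_def)
  obtain \<omega>0 where w0: "\<omega>0 \<in> space M" using not_empty by blast
  have A: "0 \<le> A" using b[OF order_refl w0] by linarith
  have int: "integrable M (\<eta> j)" "integrable M (\<lambda>\<omega>. (\<eta> j \<omega>)\<^sup>2)" if "1 \<le> j" for j
  proof -
    note [measurable] = \<eta>[OF that]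
    show "integrable M (\<eta> j)"
      by (rule integrable_const_bound[of _ A]) (use b[OF that] in auto)
    show "integrable M (\<lambda>\<omega>. (\<eta> j \<omega>)\<^sup>2)"
    proof (rule integrable_const_bound[of _ "A\<^sup>2"])
      show "AE \<omega> in M. norm ((\<eta> j \<omega>)\<^sup>2) \<le> A\<^sup>2"
        using b[OF that] A by (intro AE_I2) (simp add: abs_le_square_iff[symmetric])
    qed measurable
  qed
  have "0 \<le> expectation (\<lambda>\<omega>. (\<eta> 1 \<omega>)\<^sup>2)" by (intro integral_nonneg_AE AE_I2) simp
  then have v0: "0 \<le> v" unfolding second[OF order_refl] .
  define \<phi> where "\<phi> j n = char (distr M borel (\<eta> j)) (1 / sqrt (real n))" for j n
  define S where "S n = expectation (\<lambda>\<omega>. iexp ((\<Sum>j\<in>{1..n}. \<eta> j \<omega>) / sqrt (real n)))" for n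
  have S_prod: "S n = (\<Prod>j\<in>{1..n}. \<phi> j n)" for n
  proof -
    let ?Y = "\<lambda>j \<omega>. \<eta> j \<omega> / sqrt (real n)"
    have Y: "indep_vars (\<lambda>_. borel) ?Y {1..n}"
      by (rule indep_vars_compose2[OF indep_vars_subset[OF indep]]) auto
    have Ym: "?Y j \<in> borel_measurable M" if "1 \<le> j" for j using \<eta>[OF that] by measurable
    have "S n = char (distr M borel (\<lambda>\<omega>. \<Sum>j\<in>{1..n}. ?Y j \<omega>)) 1"
    proof -
      have "(\<lambda>\<omega>. \<Sum>j\<in>{1..n}. ?Y j \<omega>) \<in> borel_measurable M" by (intro borel_measurable_sum Ym) auto
      then show ?thesis unfolding S_def char_def by (subst integral_distr) (auto simp: sum_divide_distrib)
    qed
    also have "\<dots> = (\<Prod>j\<in>{1..n}. char (distr M borel (?Y j)) 1)" by (rule char_distr_sum[OF Y])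
    also have "\<dots> = (\<Prod>j\<in>{1..n}. \<phi> j n)"
    proof (rule prod.cong[OF refl])
      fix j assume "j \<in> {1..n}"
      then have "\<eta> j \<in> borel_measurable M" "?Y j \<in> borel_measurable M" using \<eta>[of j] Ym[of j] by auto
      then show "char (distr M borel (?Y j)) 1 = \<phi> j n"
        unfolding \<phi>_def char_def by (simp add: integral_distr)
    qed
    finally show ?thesis .
  qed
  have close: "norm (S n - complex_of_real ((1 + (- v / 2) / real n) ^ n)) \<le> A ^ 3 / 6 * (1 / sqrt (real n))"
    if n: "1 \<le> n" "v / 4 \<le> real n" for n
  proof -
    define t where "t = 1 / sqrt (real n)"
    have t: "0 < t" "t\<^sup>2 = 1 / real n" using n by (auto simp: t_def power_divide)
    have one: "norm (\<phi> j n - complex_of_real (1 + (- v / 2) / real n)) \<le> t ^ 3 * A ^ 3 / 6" if j: "1 \<le> j" for j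
    proof -
      have char: "norm (char (distr M borel (\<eta> j)) t - (1 - t^2 * v / 2))
          \<le> (t^2 / 6) * expectation (\<lambda>x. min (6 * (\<eta> j x)^2) (\<bar>t\<bar> * \<bar>\<eta> j x\<bar>^3))"
        by (rule char_approx3'[OF \<eta>[OF j] int[OF j] mean[OF j] _ refl])
          (simp add: mean[OF j] second[OF j])
      have "expectation (\<lambda>x. min (6 * (\<eta> j x)^2) (\<bar>t\<bar> * \<bar>\<eta> j x\<bar>^3)) \<le> expectation (\<lambda>x. t * A ^ 3)"
      proof (rule integral_mono)
        have m: "(\<lambda>x. min (6 * (\<eta> j x)^2) (\<bar>t\<bar> * \<bar>\<eta> j x\<bar>^3)) \<in> borel_measurable M" using \<eta>[OF j] by measurable
        have le: "min (6 * (\<eta> j x)^2) (\<bar>t\<bar> * \<bar>\<eta> j x\<bar>^3) \<le> t * A ^ 3" if "x \<in> space M" for x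
          using b[OF j that] t by (intro min.coboundedI2 mult_mono power_mono) auto
        then show "x \<in> space M \<Longrightarrow> min (6 * (\<eta> j x)^2) (\<bar>t\<bar> * \<bar>\<eta> j x\<bar>^3) \<le> t * A ^ 3" for x .
        show "integrable M (\<lambda>x. min (6 * (\<eta> j x)^2) (\<bar>t\<bar> * \<bar>\<eta> j x\<bar>^3))"
          by (rule integrable_const_bound[of _ "t * A ^ 3", OF AE_I2 m]) (use le t in auto)
      qed auto
      also have "expectation (\<lambda>x. t * A ^ 3) = t * A ^ 3" by (simp add: prob_space)
      finally have "t^2 / 6 * expectation (\<lambda>x. min (6 * (\<eta> j x)^2) (\<bar>t\<bar> * \<bar>\<eta> j x\<bar>^3)) \<le> t^2 / 6 * (t * A ^ 3)"
        by (rule mult_left_mono) simp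
      with char have "norm (char (distr M borel (\<eta> j)) t - (1 - t^2 * v / 2)) \<le> t^2 / 6 * (t * A ^ 3)"
        by (rule order_trans)
      moreover have "complex_of_real (1 + (- v / 2) / real n) = 1 - t^2 * v / 2"
        unfolding of_real_power[symmetric] t(2) by (simp add: field_simps)
      moreover have "t^2 / 6 * (t * A ^ 3) = t ^ 3 * A ^ 3 / 6"
        by (simp add: power2_eq_square power3_eq_cube)
      ultimately show ?thesis unfolding \<phi>_def t_def[symmetric] by (simp only:)
    qed
    have "S n - complex_of_real ((1 + (- v / 2) / real n) ^ n)
        = (\<Prod>j\<in>{1..n}. \<phi> j n) - (\<Prod>j\<in>{1..n}. complex_of_real (1 + (- v / 2) / real n))"
      by (simp add: S_prod)
    also have "norm \<dots> \<le> (\<Sum>j\<in>{1..n}. norm (\<phi> j n - complex_of_real (1 + (- v / 2) / real n)))"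
    proof (rule norm_prod_diff)
      show "norm (\<phi> j n) \<le> 1" if "j \<in> {1..n}" for j
      proof -
        have "real_distribution (distr M borel (\<eta> j))" using that by (intro real_distribution_distr \<eta>) simp
        then show ?thesis unfolding \<phi>_def by (rule real_distribution.cmod_char_le_1)
      qed
      \<comment> \<open>This is the purpose of \<open>v / 4 \<le> real n\<close>: the comparison of
        products requires factors of modulus at most 1.\<close>
      have "\<bar>1 + (- v / 2) / real n\<bar> \<le> 1" using n v0 by (auto simp: abs_le_iff field_simps)
      then show "norm (complex_of_real (1 + (- v / 2) / real n)) \<le> 1" by (simp only: norm_of_real)
    qed
    also have "\<dots> \<le> (\<Sum>j\<in>{1..n}. t ^ 3 * A ^ 3 / 6)" by (intro sum_mono one) auto
    also have "\<dots> = (real n * t\<^sup>2) * (A ^ 3 / 6 * t)" by (simp add: power2_eq_square power3_eq_cube)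
    also have "real n * t\<^sup>2 = 1" using n t by simp
    finally show ?thesis by (simp add: t_def)
  qed
  have "(\<lambda>n. complex_of_real ((1 + (- v / 2) / real n) ^ n)) \<longlonglongrightarrow> complex_of_real (exp (- v / 2))"
    by (intro tendsto_of_real tendsto_exp_limit_sequentially)
  moreover have "(\<lambda>n. S n - complex_of_real ((1 + (- v / 2) / real n) ^ n)) \<longlonglongrightarrow> 0"
  proof (rule Lim_null_comparison)
    show "\<forall>\<^sub>F n in sequentially. norm (S n - complex_of_real ((1 + (- v / 2) / real n) ^ n))
        \<le> A ^ 3 / 6 * (1 / sqrt (real n))"
      using eventually_ge_at_top[of "max 1 (nat \<lceil>v / 4\<rceil>)"]
      by eventually_elim (rule close, auto simp: nat_le_iff ceiling_le_iff)
    have "(\<lambda>n. 1 / sqrt (real n)) \<longlonglongrightarrow> 0"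
      by (intro real_tendsto_divide_at_top[OF tendsto_const] filterlim_compose[OF sqrt_at_top]
          filterlim_real_sequentially)
    then show "(\<lambda>n. A ^ 3 / 6 * (1 / sqrt (real n))) \<longlonglongrightarrow> 0" by (rule tendsto_mult_right_zero)
  qed
  ultimately have "(\<lambda>n. (S n - complex_of_real ((1 + (- v / 2) / real n) ^ n)) +
      complex_of_real ((1 + (- v / 2) / real n) ^ n)) \<longlonglongrightarrow> 0 + complex_of_real (exp (- v / 2))"
    by (intro tendsto_add)
  then show ?thesis by (simp add: S_def)
qed

definition median_cov :: "real \<Rightarrow> real \<Rightarrow> real" where
  "median_cov s t = (if s * t = 0 then 0 else sqrt (s * t) * arcsin (min s t / sqrt (s * t)))"

lemma median_cov_commute: "median_cov s t = median_cov t s"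
  by (simp add: median_cov_def mult.commute min.commute)

context brownian_family
begin

section \<open>The covariance of the indicators\<close>

text \<open>Up to normalisation \<open>Z j t \<le> 0\<close> says that the increment after
  \<open>s\<close> is at most \<open>- B j s\<close>. In terms of the two independent standardised
  increments this is the wedge of \<open>std_normal_orthant\<close> with
  \<open>c = sqrt (s / (t - s))\<close>.\<close>

lemma prob_both_nonpos:
  assumes j: "1 \<le> j" and st: "0 < s" "s < t"
  shows "prob {\<omega> \<in> space M. Z j s \<omega> \<le> 0 \<and> Z j t \<omega> \<le> 0} = 1 / 4 + arctan (sqrt (s / (t - s))) / (2 * pi)"
proof -
  define \<tau> where "\<tau> i = (if i = 0 then 0 else if i = Suc 0 then s else t)" for i :: nat
  have "indep_vars (\<lambda>_. borel) (\<lambda>i \<omega>. B j (\<tau> (Suc i)) \<omega> - B j (\<tau> i) \<omega>) {..<2}"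
    using bm[OF j] unfolding brownian_motion_def
    by (elim conjE allE[of _ 2] allE[of _ \<tau>]) (use st in \<open>auto simp: \<tau>_def\<close>)
  moreover have "{..<2} = insert 0 {1::nat}" by auto
  ultimately have "indep_vars (\<lambda>_. borel) (\<lambda>i \<omega>. B j (\<tau> (Suc i)) \<omega> - B j (\<tau> i) \<omega>) (insert 0 {1})" by simp
  then have "indep_var borel (\<lambda>\<omega>. B j (\<tau> (Suc 0)) \<omega> - B j (\<tau> 0) \<omega>)
      borel (\<lambda>\<omega>. \<Sum>i\<in>{1}. B j (\<tau> (Suc i)) \<omega> - B j (\<tau> i) \<omega>)"
    by (intro indep_vars_sum) auto
  then have "indep_var borel (\<lambda>\<omega>. B j s \<omega> - B j 0 \<omega>) borel (\<lambda>\<omega>. B j t \<omega> - B j s \<omega>)"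
    by (simp add: \<tau>_def)
  from indep_var_compose[OF this, of "\<lambda>x. x / sqrt (s - 0)" borel "\<lambda>x. x / sqrt (t - s)" borel]
  have ind: "indep_var borel (\<lambda>\<omega>. (B j s \<omega> - B j 0 \<omega>) / sqrt (s - 0)) borel (\<lambda>\<omega>. (B j t \<omega> - B j s \<omega>) / sqrt (t - s))"
    by (simp add: comp_def)
  define c where "c = sqrt (s / (t - s))"
  have c: "0 \<le> c" using st by (simp add: c_def)
  let ?Z1 = "\<lambda>\<omega>. (B j s \<omega> - B j 0 \<omega>) / sqrt (s - 0)" and ?Z2 = "\<lambda>\<omega>. (B j t \<omega> - B j s \<omega>) / sqrt (t - s)"
  have Z: "distributed M lborel ?Z1 std_normal_density" "distributed M lborel ?Z2 std_normal_density"
    using increment_std_normal[OF j, of 0 s] increment_std_normal[OF j, of s t] st by auto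
  note [measurable] = std_normal_prob(2)[OF Z(1)] std_normal_prob(2)[OF Z(2)]
  have m: "Z j s \<in> borel_measurable M" "Z j t \<in> borel_measurable M"
    using st j by (auto intro: Z_measurable)
  have "prob {\<omega> \<in> space M. Z j s \<omega> \<le> 0 \<and> Z j t \<omega> \<le> 0} = prob {\<omega> \<in> space M. ?Z1 \<omega> \<le> 0 \<and> ?Z2 \<omega> \<le> - c * ?Z1 \<omega>}"
  proof (rule measure_eq_AE)
    show "AE \<omega> in M. \<omega> \<in> {\<omega> \<in> space M. Z j s \<omega> \<le> 0 \<and> Z j t \<omega> \<le> 0} \<longleftrightarrow> \<omega> \<in> {\<omega> \<in> space M. ?Z1 \<omega> \<le> 0 \<and> ?Z2 \<omega> \<le> - c * ?Z1 \<omega>}"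
      using B_0[OF j]
    proof eventually_elim
      case (elim \<omega>)
      have "c * (B j s \<omega> / sqrt s) = B j s \<omega> / sqrt (t - s)" using st by (simp add: c_def real_sqrt_divide)
      then have "(?Z2 \<omega> \<le> - c * ?Z1 \<omega>) \<longleftrightarrow> (B j t \<omega> - B j s \<omega>) / sqrt (t - s) \<le> - (B j s \<omega> / sqrt (t - s))"
        using elim by simp
      also have "\<dots> \<longleftrightarrow> B j t \<omega> / sqrt (t - s) \<le> 0" by (simp add: diff_divide_distrib)
      also have "\<dots> \<longleftrightarrow> Z j t \<omega> \<le> 0" using st by (simp add: Z_def divide_le_0_iff)
      finally have "(?Z2 \<omega> \<le> - c * ?Z1 \<omega>) \<longleftrightarrow> Z j t \<omega> \<le> 0" .
      moreover have "?Z1 \<omega> = Z j s \<omega>" using elim by (simp add: Z_def)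
      ultimately show ?case by (simp only: mem_Collect_eq)
    qed
    show "{\<omega> \<in> space M. Z j s \<omega> \<le> 0 \<and> Z j t \<omega> \<le> 0} \<in> events" using m by measurable
    show "{\<omega> \<in> space M. ?Z1 \<omega> \<le> 0 \<and> ?Z2 \<omega> \<le> - c * ?Z1 \<omega>} \<in> events" by measurable
  qed
  also have "\<dots> = 1 / 4 + arctan c / (2 * pi)" by (rule std_normal_orthant[OF Z ind c])
  finally show ?thesis by (simp add: c_def)
qed

text \<open>The influence function of the median: the centred indicator divided by the density
  \<open>1 / sqrt (2 * pi)\<close> at the median, times \<open>sqrt t\<close> to undo the
  normalisation.\<close>

definition S :: "nat \<Rightarrow> real \<Rightarrow> 'a \<Rightarrow> real" where
  "S j t \<omega> = sqrt (2 * pi * t) * (1 / 2 - of_bool (Z j t \<omega> \<le> 0))"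

lemma S_abs_le: "0 \<le> t \<Longrightarrow> \<bar>S j t \<omega>\<bar> \<le> sqrt (2 * pi * t)"
  by (simp add: S_def abs_mult mult_left_le)

lemma S_measurable: "1 \<le> j \<Longrightarrow> 0 \<le> t \<Longrightarrow> S j t \<in> borel_measurable M"
  unfolding S_def using Z_measurable[of j t] by measurable

lemma S_integrable:
  assumes "1 \<le> j" "0 \<le> t"
  shows "integrable M (S j t)"
  using S_abs_le[OF assms(2), of j]
  by (intro integrable_const_bound[of _ "sqrt (2 * pi * t)"] AE_I2 S_measurable[OF assms]) auto

lemma S_mult_integrable:
  assumes "1 \<le> j" "0 \<le> s" "0 \<le> t"
  shows "integrable M (\<lambda>\<omega>. S j s \<omega> * S j t \<omega>)"
proof (rule integrable_const_bound[of _ "sqrt (2 * pi * s) * sqrt (2 * pi * t)"])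
  show "AE \<omega> in M. norm (S j s \<omega> * S j t \<omega>) \<le> sqrt (2 * pi * s) * sqrt (2 * pi * t)"
    unfolding real_norm_def abs_mult using assms by (intro AE_I2 mult_mono S_abs_le) auto
  show "(\<lambda>\<omega>. S j s \<omega> * S j t \<omega>) \<in> borel_measurable M"
    using assms by (intro borel_measurable_times S_measurable)
qed

lemma S_expectation:
  assumes "1 \<le> j" "0 \<le> t"
  shows "expectation (S j t) = 0"
proof (cases "t = 0")
  case False
  then have t: "0 < t" using assms by simp
  have "expectation (S j t) = sqrt (2 * pi * t) * (1 / 2 - Phi 0)"
    unfolding S_def using expectation_Z_le[OF assms(1) t, of 0] by (simp add: prob_space)
  then show ?thesis by (simp add: Phi_0)
next
  case True
  then have "S j t = (\<lambda>_. 0)" by (simp add: S_def fun_eq_iff)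
  then show ?thesis by simp
qed

text \<open>Multiplying out the indicators leaves the probability of \<open>prob_both_nonpos\<close>
  minus 1/4, and \<open>arctan (sqrt (s / (t - s)))\<close> equals
  \<open>arcsin (sqrt (s / t))\<close>. Equal times form a case of their own, where the product is
  the constant \<open>pi * s / 2\<close>.\<close>

lemma S_covariance:
  assumes j: "1 \<le> j" and st: "0 \<le> s" "0 \<le> t"
  shows "expectation (\<lambda>\<omega>. S j s \<omega> * S j t \<omega>) = median_cov s t"
proof -
  have less: "expectation (\<lambda>\<omega>. S j s \<omega> * S j t \<omega>) = median_cov s t" if st: "0 < s" "s < t" for s t
  proof -
    let ?a = "\<lambda>\<omega>. of_bool (Z j s \<omega> \<le> 0) :: real" and ?c = "\<lambda>\<omega>. of_bool (Z j t \<omega> \<le> 0) :: real"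
    have [measurable]: "Z j s \<in> borel_measurable M" "Z j t \<in> borel_measurable M"
      using st j by (auto intro: Z_measurable)
    have ac: "integrable M (\<lambda>\<omega>. of_bool (Z j s \<omega> \<le> 0 \<and> Z j t \<omega> \<le> 0) :: real)"
      "expectation (\<lambda>\<omega>. of_bool (Z j s \<omega> \<le> 0 \<and> Z j t \<omega> \<le> 0) :: real) = prob {\<omega> \<in> space M. Z j s \<omega> \<le> 0 \<and> Z j t \<omega> \<le> 0}"
      by (rule expectation_of_bool; measurable)+
    have ex: "S j s \<omega> * S j t \<omega> = sqrt (2 * pi * s) * sqrt (2 * pi * t) *
        (1 / 4 - ?a \<omega> / 2 - ?c \<omega> / 2 + of_bool (Z j s \<omega> \<le> 0 \<and> Z j t \<omega> \<le> 0))" for \<omega>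
      by (simp add: S_def algebra_simps)
    have t0: "0 < t" using st by simp
    have "expectation (\<lambda>\<omega>. S j s \<omega> * S j t \<omega>) = sqrt (2 * pi * s) * sqrt (2 * pi * t) *
        (1 / 4 - Phi 0 / 2 - Phi 0 / 2 + prob {\<omega> \<in> space M. Z j s \<omega> \<le> 0 \<and> Z j t \<omega> \<le> 0})"
      unfolding ex using expectation_Z_le[OF j st(1), of 0] expectation_Z_le[OF j t0, of 0] ac
      by (simp add: prob_space)
    also have "sqrt (2 * pi * s) * sqrt (2 * pi * t) = 2 * pi * sqrt (s * t)"
      by (simp add: real_sqrt_mult[symmetric] mult_ac flip: real_sqrt_mult) (simp add: real_sqrt_mult)
    also have "2 * pi * sqrt (s * t) * (1 / 4 - Phi 0 / 2 - Phi 0 / 2 + prob {\<omega> \<in> space M. Z j s \<omega> \<le> 0 \<and> Z j t \<omega> \<le> 0})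
        = sqrt (s * t) * arctan (sqrt (s / (t - s)))"
      unfolding prob_both_nonpos[OF j st] Phi_0 by simp
    also have "arctan (sqrt (s / (t - s))) = arcsin (min s t / sqrt (s * t))"
    proof -
      have eq: "min s t / sqrt (s * t) = sqrt (s / t)"
        using st by (simp add: real_sqrt_mult real_sqrt_divide min_def real_div_sqrt flip: divide_divide_eq_left)
      have "arcsin (sqrt (s / t)) = arctan (sqrt (s / t) / sqrt (1 - (sqrt (s / t))\<^sup>2))"
        using st by (intro arcsin_arctan) (auto intro: less_le_trans[of _ 0])
      also have "sqrt (s / t) / sqrt (1 - (sqrt (s / t))\<^sup>2) = sqrt (s / (t - s))"
      proof -
        have "1 - (sqrt (s / t))\<^sup>2 = (t - s) / t" using st by (simp add: field_simps)
        then show ?thesis using st by (simp add: real_sqrt_divide[symmetric])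
      qed
      finally show ?thesis using eq by simp
    qed
    finally show ?thesis using st by (simp add: median_cov_def)
  qed
  consider "s = 0 \<or> t = 0" | "0 < s" "s < t" | "0 < t" "t < s" | "0 < s" "s = t" using st by linarith
  then show ?thesis
  proof cases
    case 1 then show ?thesis by (auto simp: S_def median_cov_def)
  next
    case 2 then show ?thesis by (rule less)
  next
    case 3
    show ?thesis using less[OF 3] by (simp add: median_cov_commute[of s t] mult.commute)
  next
    case 4
    have "(\<lambda>\<omega>. S j s \<omega> * S j t \<omega>) = (\<lambda>_. pi * s / 2)"
      using 4 by (intro ext) (simp add: S_def of_bool_def)
    then have "expectation (\<lambda>\<omega>. S j s \<omega> * S j t \<omega>) = pi * s / 2" by (simp only:) (simp add: prob_space)
    also have "\<dots> = median_cov s t" using 4 by (simp add: median_cov_def)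
    finally show ?thesis .
  qed
qed

section \<open>Linearisation of the median\<close>

text \<open>The linear (Bahadur) approximation of \<open>X m t\<close>, a normalised sum of
  independent terms.\<close>

definition G :: "nat \<Rightarrow> real \<Rightarrow> 'a \<Rightarrow> real" where
  "G m t \<omega> = (\<Sum>j\<in>{1..2 * m + 1}. S j t \<omega>) / sqrt (real (2 * m + 1))"

lemma G_measurable: "0 \<le> t \<Longrightarrow> G m t \<in> borel_measurable M"
  unfolding G_def by (intro borel_measurable_divide borel_measurable_sum S_measurable borel_measurable_const) auto

definition odd_sqrt :: "nat \<Rightarrow> real" where
  "odd_sqrt m = sqrt (real (2 * m + 1))"

lemma odd_sqrt: "1 \<le> odd_sqrt m" "0 < odd_sqrt m" "(odd_sqrt m)\<^sup>2 = real (2 * m + 1)"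
  by (simp_all add: odd_sqrt_def)

lemma odd_tendsto:
  assumes "(\<lambda>n. f n) \<longlonglongrightarrow> l"
  shows "(\<lambda>m. f (2 * m + 1)) \<longlonglongrightarrow> l"
proof -
  have "strict_mono (\<lambda>m. 2 * m + 1 :: nat)" by (auto intro!: strict_monoI)
  from LIMSEQ_subseq_LIMSEQ[OF assms this] show ?thesis by (simp add: comp_def)
qed

lemma odd_sqrt_at_top: "filterlim odd_sqrt at_top sequentially"
  unfolding odd_sqrt_def
proof (rule filterlim_compose[OF sqrt_at_top])
  show "filterlim (\<lambda>m. real (2 * m + 1)) at_top sequentially"
    by (rule filterlim_at_top_mono[OF filterlim_real_sequentially]) (simp add: always_eventually)
qed

text \<open>The indicator terms have total mean close to
  \<open>- \<sigma> * x * odd_sqrt m / sqrt (2 * pi)\<close>, from the slope of \<open>Phi\<close>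
  at 0. The event is that they exceed this value by at least
  \<open>e * odd_sqrt m / sqrt (2 * pi)\<close>, for \<open>\<sigma>\<close> equal to 1 or -1; the
  sign treats both directions at once.\<close>

definition crossing_event :: "real \<Rightarrow> real \<Rightarrow> real \<Rightarrow> real \<Rightarrow> nat \<Rightarrow> 'a set" where
  "crossing_event \<sigma> e t x m = {\<omega> \<in> space M. 0 \<le> (\<Sum>j\<in>{1..2 * m + 1}.
     \<sigma> * (of_bool (Z j t \<omega> \<le> 0) - of_bool (Z j t \<omega> \<le> x / odd_sqrt m))
       + \<sigma> * (x - \<sigma> * e) / sqrt (2 * pi) / odd_sqrt m)}"

lemma crossing_event_measurable:
  assumes "0 < t"
  shows "crossing_event \<sigma> e t x m \<in> events"
proof -
  have [measurable]: "Z j t \<in> borel_measurable M" if "j \<in> {1..2 * m + 1}" for j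
    using that assms by (intro Z_measurable) auto
  have "(\<lambda>\<omega>. \<Sum>j\<in>{1..2 * m + 1}. \<sigma> * (of_bool (Z j t \<omega> \<le> 0) - of_bool (Z j t \<omega> \<le> x / odd_sqrt m))
       + \<sigma> * (x - \<sigma> * e) / sqrt (2 * pi) / odd_sqrt m) \<in> borel_measurable M"
    by (intro borel_measurable_sum) measurable
  then show ?thesis unfolding crossing_event_def by measurable
qed

text \<open>With \<open>r = odd_sqrt m\<close>, only particles between 0 and \<open>x / r\<close>
  have a nonzero indicator difference. So a term has second moment of order \<open>1 / r\<close> and
  negative mean of the same order, and with \<open>r\<^sup>2\<close> terms the Chernoff exponent is
  of order \<open>r\<close>.\<close>

lemma prob_crossing_event:
  assumes t: "0 < t" and e: "0 < e" and \<sigma>: "\<sigma> = 1 \<or> \<sigma> = - 1"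
  shows "(\<lambda>m. prob (crossing_event \<sigma> e t x m)) \<longlonglongrightarrow> 0"
proof -
  define \<beta> where "\<beta> = \<sigma> * (x - \<sigma> * e) / sqrt (2 * pi)"
  \<comment> \<open>The limit of the scaled mean is \<open>- (4 * d)\<close>; half of it is given up
    for the passage to large \<open>m\<close>, and half of the rest because \<open>\<xi>\<close> is
    halved to stay within \<open>[-1, 1]\<close>.\<close>
  define d where "d = e / (4 * sqrt (2 * pi))"
  have d: "0 < d" using e by (simp add: d_def)
  define W where "W = \<bar>x\<bar> + \<beta>\<^sup>2 + d + 1"
  have W: "0 < W" "d \<le> 2 * W" using d by (auto simp: W_def add_nonneg_pos intro: add_nonneg_nonneg)
  have "(\<lambda>n. sqrt (real n) * (Phi (x / sqrt (real n)) - 1 / 2)) \<longlonglongrightarrow> x / sqrt (2 * pi)"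
    by (rule Phi_scaled_tendsto)
  from odd_tendsto[OF this]
  have "(\<lambda>m. odd_sqrt m * (Phi (x / odd_sqrt m) - 1 / 2)) \<longlonglongrightarrow> x / sqrt (2 * pi)"
    by (simp add: odd_sqrt_def)
  then have "(\<lambda>m. - \<sigma> * (odd_sqrt m * (Phi (x / odd_sqrt m) - 1 / 2)) + \<beta>) \<longlonglongrightarrow> - \<sigma> * (x / sqrt (2 * pi)) + \<beta>"
    by (intro tendsto_intros)
  moreover have "- \<sigma> * (x / sqrt (2 * pi)) + \<beta> = - (4 * d)"
    using \<sigma> by (auto simp: \<beta>_def d_def algebra_simps diff_divide_distrib add_divide_distrib)
  moreover have "- (4 * d) < - (2 * d)" using d by simp
  ultimately have ev1: "\<forall>\<^sub>F m in sequentially. - \<sigma> * (odd_sqrt m * (Phi (x / odd_sqrt m) - 1 / 2)) + \<beta> < - (2 * d)"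
    by (metis order_tendstoD(2))
  have ev2: "\<forall>\<^sub>F m in sequentially. \<bar>\<beta>\<bar> \<le> odd_sqrt m"
    using odd_sqrt_at_top unfolding filterlim_at_top by blast
  have bound: "\<forall>\<^sub>F m in sequentially. prob (crossing_event \<sigma> e t x m) \<le> exp (- (d\<^sup>2 / (4 * W) * odd_sqrt m))"
    using ev1 ev2
  proof eventually_elim
    case (elim m)
    define r where "r = odd_sqrt m"
    have r: "1 \<le> r" "0 < r" "r\<^sup>2 = real (2 * m + 1)" unfolding r_def by (rule odd_sqrt)+
    note el = elim[folded r_def]
    define D where "D j \<omega> = (of_bool (Z j t \<omega> \<le> 0) - of_bool (Z j t \<omega> \<le> x / r) :: real)" for j \<omega>
    define \<xi> where "\<xi> j \<omega> = (\<sigma> * D j \<omega> + \<beta> / r) / 2" for j \<omega>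
    have br: "\<bar>\<beta> / r\<bar> \<le> 1" using el(2) r by (simp add: field_simps)
    have D1: "\<bar>D j \<omega>\<bar> \<le> 1" for j \<omega> by (simp add: D_def)
    have "prob {\<omega> \<in> space M. 0 \<le> (\<Sum>j\<in>{1..2 * m + 1}. \<xi> j \<omega>)}
        \<le> exp (- (real (card {1..2 * m + 1}) * (d / r)\<^sup>2 / (4 * (W / r))))"
    proof (rule prob_sum_nonneg_le)
      show "indep_vars (\<lambda>_. borel) \<xi> {1..2 * m + 1}"
        by (rule indep_path_functionals[of "\<lambda>y. (\<sigma> * (of_bool (y t / sqrt t \<le> 0) - of_bool (y t / sqrt t \<le> x / r)) + \<beta> / r) / 2"])
          (use t in \<open>auto simp: \<xi>_def D_def Z_def\<close>)
      show "\<bar>\<xi> j \<omega>\<bar> \<le> 1" for j \<omega>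
      proof -
        have "\<bar>\<sigma> * D j \<omega>\<bar> \<le> 1" using \<sigma> D1[of j \<omega>] by (auto simp: abs_mult)
        then have "\<bar>\<sigma> * D j \<omega> + \<beta> / r\<bar> \<le> 2" using abs_triangle_ineq[of "\<sigma> * D j \<omega>" "\<beta> / r"] br by linarith
        then show ?thesis unfolding \<xi>_def by simp
      qed
      note \<xi>1 = this
      fix j assume "j \<in> {1..2 * m + 1}"
      then have j: "1 \<le> j" by simp
      note Zi = expectation_Z_le[OF j t]
      have Di: "integrable M (D j)" "expectation (D j) = Phi 0 - Phi (x / r)"
        unfolding D_def using Zi by auto
      have "expectation (\<xi> j) = (\<sigma> * (Phi 0 - Phi (x / r)) + \<beta> / r) / 2"
        unfolding \<xi>_def using Di by (simp add: prob_space)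
      also have "\<dots> = (- \<sigma> * (r * (Phi (x / r) - 1 / 2)) + \<beta>) / r / 2"
        using r by (simp add: Phi_0 field_simps)
      also have "\<dots> \<le> - (2 * d) / r / 2" using el(1) r by (intro divide_right_mono) auto
      finally show "expectation (\<xi> j) \<le> - (d / r)" by simp
      \<comment> \<open>\<open>D j\<close> takes only the values 0 and \<open>s\<close>, so its
        square is \<open>s * D j\<close> and the second moment reduces to a difference of values of
        \<open>Phi\<close>.\<close>
      define s where "s = (if 0 \<le> x then - 1 else 1 :: real)"
      have sD: "(D j \<omega>)\<^sup>2 = s * D j \<omega>" for \<omega>
      proof (cases "0 \<le> x")
        case True
        then have "0 \<le> x / r" using r by simp
        then show ?thesis using True by (auto simp: D_def s_def of_bool_def)
      next
        case False
        then have "x / r < 0" using r by (simp add: divide_neg_pos)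
        then show ?thesis using False by (auto simp: D_def s_def of_bool_def)
      qed
      have "(\<xi> j \<omega>)\<^sup>2 \<le> s * D j \<omega> + (\<beta> / r)\<^sup>2" for \<omega>
      proof -
        have "(\<sigma> * D j \<omega>)\<^sup>2 = s * D j \<omega>" using \<sigma> sD by (auto simp: power_mult_distrib)
        moreover have "(\<xi> j \<omega>)\<^sup>2 \<le> (\<sigma> * D j \<omega>)\<^sup>2 + (\<beta> / r)\<^sup>2"
        proof -
          have "((p + q) / 2)\<^sup>2 \<le> p\<^sup>2 + q\<^sup>2" for p q :: real
          proof -
            have "((p + q) / 2)\<^sup>2 = (p\<^sup>2 + 2 * p * q + q\<^sup>2) / 4" by (simp add: power2_eq_square field_simps)
            also have "\<dots> \<le> (p\<^sup>2 + (p\<^sup>2 + q\<^sup>2) + q\<^sup>2) / 4"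
              by (intro divide_right_mono add_mono order_refl sum_squares_bound) simp
            also have "\<dots> \<le> p\<^sup>2 + q\<^sup>2" by simp
            finally show ?thesis .
          qed
          then show ?thesis unfolding \<xi>_def .
        qed
        ultimately show ?thesis by simp
      qed
      then have "expectation (\<lambda>\<omega>. (\<xi> j \<omega>)\<^sup>2) \<le> expectation (\<lambda>\<omega>. s * D j \<omega> + (\<beta> / r)\<^sup>2)"
      proof (intro integral_mono)
        have "Z j t \<in> borel_measurable M" using j t by (intro Z_measurable) auto
        then have "(\<lambda>\<omega>. (\<xi> j \<omega>)\<^sup>2) \<in> borel_measurable M" unfolding \<xi>_def D_def by measurable
        moreover have "(\<xi> j \<omega>)\<^sup>2 \<le> 1" for \<omega>
          using \<xi>1[of j \<omega>] by (simp add: abs_square_le_1)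
        ultimately show "integrable M (\<lambda>\<omega>. (\<xi> j \<omega>)\<^sup>2)" by (intro integrable_const_bound[of _ 1]) auto
      qed (use Di in auto)
      also have "\<dots> = s * (Phi 0 - Phi (x / r)) + (\<beta> / r)\<^sup>2" using Di by (simp add: prob_space)
      also have "\<dots> \<le> \<bar>x\<bar> / r + \<beta>\<^sup>2 / r"
      proof (rule add_mono)
        show "s * (Phi 0 - Phi (x / r)) \<le> \<bar>x\<bar> / r"
          using Phi_diff_le[of 0 "x / r"] Phi_diff_le[of "x / r" 0] r
          by (cases "0 \<le> x") (auto simp: s_def divide_nonpos_pos)
        have "r \<le> r\<^sup>2" using r(1,2) by (simp add: power2_eq_square)
        then have "\<beta>\<^sup>2 / r\<^sup>2 \<le> \<beta>\<^sup>2 / r" using r(2) by (intro divide_left_mono) auto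
        then show "(\<beta> / r)\<^sup>2 \<le> \<beta>\<^sup>2 / r" by (simp add: power_divide)
      qed
      also have "\<dots> \<le> W / r" using r d by (simp add: W_def divide_right_mono flip: add_divide_distrib)
      finally show "expectation (\<lambda>\<omega>. (\<xi> j \<omega>)\<^sup>2) \<le> W / r" .
    qed (use d W r in \<open>auto simp: divide_right_mono\<close>)
    also have "real (card {1..2 * m + 1}) * (d / r)\<^sup>2 / (4 * (W / r)) = d\<^sup>2 / (4 * W) * r"
      using r W by (simp add: power_divide flip: r(3))
    also have "{\<omega> \<in> space M. 0 \<le> (\<Sum>j\<in>{1..2 * m + 1}. \<xi> j \<omega>)} = crossing_event \<sigma> e t x m"
    proof -
      have "(\<Sum>j\<in>{1..2 * m + 1}. \<xi> j \<omega>) = (\<Sum>j\<in>{1..2 * m + 1}. \<sigma> * D j \<omega> + \<beta> / r) / 2" for \<omega>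
        by (simp add: \<xi>_def flip: sum_divide_distrib)
      then have "0 \<le> (\<Sum>j\<in>{1..2 * m + 1}. \<xi> j \<omega>) \<longleftrightarrow> 0 \<le> (\<Sum>j\<in>{1..2 * m + 1}. \<sigma> * D j \<omega> + \<beta> / r)" for \<omega>
        by (simp only: zero_le_divide_iff) simp
      then show ?thesis unfolding crossing_event_def D_def \<beta>_def r_def by (simp only:)
    qed
    finally show ?case by (simp add: r_def)
  qed
  have "(\<lambda>m. exp (- (d\<^sup>2 / (4 * W) * odd_sqrt m))) \<longlonglongrightarrow> 0"
  proof (rule filterlim_compose[OF exp_at_bot])
    have "filterlim (\<lambda>m. d\<^sup>2 / (4 * W) * odd_sqrt m) at_top sequentially"
      by (rule filterlim_tendsto_pos_mult_at_top[OF tendsto_const _ odd_sqrt_at_top]) (use d W in simp)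
    then show "filterlim (\<lambda>m. - (d\<^sup>2 / (4 * W) * odd_sqrt m)) at_bot sequentially"
      by (simp add: filterlim_uminus_at_top)
  qed
  then show ?thesis
    by (rule Lim_null_comparison[rotated]) (use bound in simp)
qed

text \<open>The sign of \<open>P\<close> decides whether \<open>odd_sqrt m * U\<close> exceeds
  \<open>x\<close>, and \<open>Q\<close> is \<open>G\<close> up to a positive factor. A disagreement
  of the two by the margin \<open>e\<close> thus forces \<open>P - Q\<close> away from its
  mean.\<close>

lemma U_G_crossing:
  assumes t: "0 < t" and w: "\<omega> \<in> space M"
  shows "x < odd_sqrt m * U m t \<omega> \<Longrightarrow> G m t \<omega> \<le> sqrt t * (x - e) \<Longrightarrow> \<omega> \<in> crossing_event 1 e t x m"
    and "odd_sqrt m * U m t \<omega> \<le> x \<Longrightarrow> sqrt t * (x + e) \<le> G m t \<omega> \<Longrightarrow> \<omega> \<in> crossing_event (- 1) e t x m"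
proof -
  define r where "r = odd_sqrt m"
  have r: "0 < r" "r\<^sup>2 = real (2 * m + 1)" unfolding r_def by (rule odd_sqrt)+
  let ?J = "{1..2 * m + 1}"
  define P where "P = (\<Sum>j\<in>?J. 1 / 2 - of_bool (Z j t \<omega> \<le> x / r) :: real)"
  define Q where "Q = (\<Sum>j\<in>?J. 1 / 2 - of_bool (Z j t \<omega> \<le> 0) :: real)"
  have G: "G m t \<omega> = sqrt t * (sqrt (2 * pi) * Q / r)"
  proof -
    have "(\<Sum>j\<in>?J. S j t \<omega>) = sqrt (2 * pi * t) * Q"
      unfolding S_def Q_def by (simp only: sum_distrib_left)
    also have "sqrt (2 * pi * t) = sqrt (2 * pi) * sqrt t" by (rule real_sqrt_mult)
    finally show ?thesis unfolding G_def r_def odd_sqrt_def by (simp only:) simp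
  qed
  have sum: "(\<Sum>j\<in>?J. \<sigma> * (of_bool (Z j t \<omega> \<le> 0) - of_bool (Z j t \<omega> \<le> x / r)) + b / r) = \<sigma> * (P - Q) + r * b" for \<sigma> b
  proof -
    have "(\<Sum>j\<in>?J. \<sigma> * (of_bool (Z j t \<omega> \<le> 0) - of_bool (Z j t \<omega> \<le> x / r)) + b / r)
        = \<sigma> * (\<Sum>j\<in>?J. of_bool (Z j t \<omega> \<le> 0) - of_bool (Z j t \<omega> \<le> x / r)) + real (2 * m + 1) * (b / r)"
      by (simp only: sum.distrib sum_distrib_left sum_constant card_atLeastAtMost) simp
    also have "(\<Sum>j\<in>?J. of_bool (Z j t \<omega> \<le> 0) - of_bool (Z j t \<omega> \<le> x / r)) = P - Q"
      unfolding P_def Q_def sum_subtractf[symmetric] by (rule sum.cong) auto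
    also have "real (2 * m + 1) * (b / r) = r * b"
      unfolding r(2)[symmetric] using r(1) by (simp add: power2_eq_square)
    finally show ?thesis .
  qed
  have Qy: "(G m t \<omega> \<le> sqrt t * y \<longleftrightarrow> Q \<le> r * (y / sqrt (2 * pi))) \<and> (sqrt t * y \<le> G m t \<omega> \<longleftrightarrow> r * (y / sqrt (2 * pi)) \<le> Q)" for y
    unfolding G using t r by (simp add: field_simps)
  show "\<omega> \<in> crossing_event 1 e t x m" if "x < odd_sqrt m * U m t \<omega>" "G m t \<omega> \<le> sqrt t * (x - e)"
  proof -
    have "x / r < U m t \<omega>" using that(1) r by (simp add: r_def field_simps)
    then have "0 < P" unfolding U_def median_le_iff_sum P_def .
    moreover have "Q \<le> r * ((x - e) / sqrt (2 * pi))" using that(2) Qy by blast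
    ultimately show ?thesis using w sum[of 1 "1 * (x - 1 * e) / sqrt (2 * pi)"]
      by (simp add: crossing_event_def r_def)
  qed
  show "\<omega> \<in> crossing_event (- 1) e t x m" if "odd_sqrt m * U m t \<omega> \<le> x" "sqrt t * (x + e) \<le> G m t \<omega>"
  proof -
    have "U m t \<omega> \<le> x / r" using that(1) r by (simp add: r_def field_simps)
    then have "P < 0" unfolding U_def median_le_iff_sum P_def .
    moreover have "r * ((x + e) / sqrt (2 * pi)) \<le> Q" using that(2) Qy by blast
    moreover have "(- 1) * (x - (- 1) * e) = - (x + e)" by simp
    then have "(- 1) * (x - (- 1) * e) / sqrt (2 * pi) = - ((x + e) / sqrt (2 * pi))"
      by (simp only: minus_divide_left)
    ultimately show ?thesis using w sum[of "- 1" "(- 1) * (x - (- 1) * e) / sqrt (2 * pi)"]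
      by (simp add: crossing_event_def r_def)
  qed
qed

text \<open>Unless \<open>\<bar>odd_sqrt m * U m t \<omega>\<bar>\<close> exceeds \<open>K\<close>,
  this value lies in one of finitely many cells of mesh \<open>\<eta>\<close>, whose number does not
  depend on \<open>m\<close>. A distance above \<open>3 * \<eta>\<close> from
  \<open>G m t \<omega> / sqrt t\<close> makes a crossing event happen at an end of the cell, and
  each such probability tends to 0.\<close>

lemma X_G_close:
  assumes t: "0 \<le> t" and e: "0 < e"
  shows "(\<lambda>m. prob {\<omega> \<in> space M. e < \<bar>X m t \<omega> - G m t \<omega>\<bar>}) \<longlonglongrightarrow> 0"
proof (cases "t = 0")
  case True
  have "prob {\<omega> \<in> space M. e < \<bar>X m t \<omega> - G m t \<omega>\<bar>} = 0" for m
  proof -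
    have "prob {\<omega> \<in> space M. e < \<bar>X m t \<omega> - G m t \<omega>\<bar>} \<le> prob {}"
    proof (rule finite_measure_mono_AE)
      show "AE \<omega> in M. \<omega> \<in> {\<omega> \<in> space M. e < \<bar>X m t \<omega> - G m t \<omega>\<bar>} \<longrightarrow> \<omega> \<in> {}"
        using scaled_median_0[of m] by eventually_elim (use e True in \<open>simp add: G_def S_def\<close>)
    qed simp
    then show ?thesis by (simp add: measure_le_0_iff)
  qed
  then show ?thesis by simp
next
  case False
  then have t: "0 < t" using t by simp
  define \<eta> where "\<eta> = e / sqrt t / 3"
  have \<eta>: "0 < \<eta>" using e t by (simp add: \<eta>_def)
  have main: "\<forall>\<^sub>F m in sequentially. prob {\<omega> \<in> space M. e < \<bar>X m t \<omega> - G m t \<omega>\<bar>} < r" if r: "0 < r" for r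
  proof -
    define c where "c = normal_lower\<^sup>2 / 4"
    have c: "0 < c" using normal_lower by (simp add: c_def)
    obtain K where K: "0 < K" "2 * exp (- (c * K\<^sup>2)) < r / 2"
    proof -
      \<comment> \<open>This makes \<open>exp (- (c * K\<^sup>2)) \<le> r / 5\<close>; the summand 1
        gives \<open>K \<le> K\<^sup>2\<close>.\<close>
      define K where "K = 1 + \<bar>ln (r / 5)\<bar> / c"
      have K1: "1 \<le> K" using c by (simp add: K_def)
      have "\<bar>ln (r / 5)\<bar> \<le> c * K" using c by (simp add: K_def distrib_left)
      also have "c * K \<le> c * K\<^sup>2" using K1 c by (intro mult_left_mono) (auto simp: power2_eq_square)
      finally have "exp (- (c * K\<^sup>2)) \<le> exp (ln (r / 5))" by simp
      then have "2 * exp (- (c * K\<^sup>2)) < r / 2" using r by simp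
      then show ?thesis using that[of K] K1 by simp
    qed
    define L where "L = \<lceil>K / \<eta>\<rceil>"
    define E where "E i m = crossing_event 1 \<eta> t (real_of_int i * \<eta>) m \<union> crossing_event (- 1) \<eta> t (real_of_int i * \<eta>) m" for i m
    have Em: "E i m \<in> events" for i m unfolding E_def using crossing_event_measurable[OF t] by auto
    have E0: "(\<lambda>m. \<Sum>i\<in>{- L - 1..L + 1}. prob (crossing_event 1 \<eta> t (real_of_int i * \<eta>) m)
        + prob (crossing_event (- 1) \<eta> t (real_of_int i * \<eta>) m)) \<longlonglongrightarrow> (\<Sum>i\<in>{- L - 1..L + 1}. 0 + 0)"
      by (intro tendsto_sum tendsto_add prob_crossing_event[OF t \<eta>]) auto
    have "\<forall>\<^sub>F m in sequentially. (\<Sum>i\<in>{- L - 1..L + 1}. prob (crossing_event 1 \<eta> t (real_of_int i * \<eta>) m)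
        + prob (crossing_event (- 1) \<eta> t (real_of_int i * \<eta>) m)) < r / 2"
      by (rule order_tendstoD(2)[OF E0]) (use r in simp)
    moreover have "\<forall>\<^sub>F m in sequentially. K \<le> odd_sqrt m"
      using odd_sqrt_at_top unfolding filterlim_at_top by blast
    ultimately show ?thesis
    proof eventually_elim
      case (elim m)
      define q where "q = odd_sqrt m"
      have q: "0 < q" "q\<^sup>2 = real (2 * m + 1)" "K \<le> q" unfolding q_def using odd_sqrt[of m] elim(2) by auto
      let ?T = "{\<omega> \<in> space M. K / q < \<bar>U m t \<omega>\<bar>}"
      have Um: "U m t \<in> borel_measurable M" using t by (intro U_measurable) simp
      have Tm: "?T \<in> events" using Um by measurable
      have "prob {\<omega> \<in> space M. e < \<bar>X m t \<omega> - G m t \<omega>\<bar>} \<le> prob (?T \<union> (\<Union>i\<in>{- L - 1..L + 1}. E i m))"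
      proof (rule finite_measure_mono)
        show "{\<omega> \<in> space M. e < \<bar>X m t \<omega> - G m t \<omega>\<bar>} \<subseteq> ?T \<union> (\<Union>i\<in>{- L - 1..L + 1}. E i m)"
        proof
          fix \<omega> assume w: "\<omega> \<in> {\<omega> \<in> space M. e < \<bar>X m t \<omega> - G m t \<omega>\<bar>}"
          define R where "R = q * U m t \<omega>"
          show "\<omega> \<in> ?T \<union> (\<Union>i\<in>{- L - 1..L + 1}. E i m)"
          proof (cases "\<bar>U m t \<omega>\<bar> \<le> K / q")
            case True
            then have "\<bar>R\<bar> \<le> K" using q by (simp add: R_def abs_mult field_simps)
            \<comment> \<open>The cell is \<open>(i - 1) * \<eta> < R \<le> i * \<eta>\<close>; its
              lower end may have the index \<open>- L - 1\<close>, hence the range of the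
              union.\<close>
            define i where "i = \<lceil>R / \<eta>\<rceil>"
            have "R / \<eta> \<le> real_of_int i" "real_of_int i < R / \<eta> + 1" unfolding i_def by linarith+
            then have i: "R \<le> real_of_int i * \<eta>" "real_of_int (i - 1) * \<eta> < R"
              using \<eta> by (simp_all add: field_simps)
            have "R / \<eta> \<le> K / \<eta>" "- (K / \<eta>) \<le> R / \<eta>"
              using \<open>\<bar>R\<bar> \<le> K\<close> \<eta> by (auto simp: field_simps abs_le_iff)
            then have iL: "i \<le> L" "- L \<le> i" unfolding i_def L_def
              by (auto intro: ceiling_mono simp: le_ceiling_iff) (linarith)+
            have "X m t \<omega> = sqrt t * R"
              using scaled_median_eq_U[OF t, of m \<omega>] by (simp add: R_def q_def odd_sqrt_def)
            then have ge: "e < \<bar>sqrt t * R - G m t \<omega>\<bar>" using w by simp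
            have e3: "e = sqrt t * (3 * \<eta>)" using t by (simp add: \<eta>_def)
            have idx: "real_of_int (i - 1) * \<eta> = real_of_int i * \<eta> - \<eta>" by (simp add: left_diff_distrib)
            consider "sqrt t * (R + 3 * \<eta>) < G m t \<omega>" | "G m t \<omega> < sqrt t * (R - 3 * \<eta>)"
              using ge unfolding e3 distrib_left right_diff_distrib by linarith
            then have "\<omega> \<in> E i m \<or> \<omega> \<in> E (i - 1) m"
            proof cases
              case 1
              have "sqrt t * (real_of_int i * \<eta> + \<eta>) \<le> sqrt t * (R + 3 * \<eta>)"
                using i idx \<eta> t by (intro mult_left_mono) auto
              then have "sqrt t * (real_of_int i * \<eta> + \<eta>) \<le> G m t \<omega>" using 1 by linarith
              then have "\<omega> \<in> crossing_event (- 1) \<eta> t (real_of_int i * \<eta>) m"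
                using U_G_crossing(2)[OF t, of \<omega> m "real_of_int i * \<eta>" \<eta>] i(1) w by (simp add: R_def q_def)
              then show ?thesis by (simp add: E_def)
            next
              case 2
              have "sqrt t * (R - 3 * \<eta>) \<le> sqrt t * (real_of_int (i - 1) * \<eta> - \<eta>)"
                using i idx \<eta> t by (intro mult_left_mono) auto
              then have "G m t \<omega> \<le> sqrt t * (real_of_int (i - 1) * \<eta> - \<eta>)" using 2 by linarith
              then have "\<omega> \<in> crossing_event 1 \<eta> t (real_of_int (i - 1) * \<eta>) m"
                using U_G_crossing(1)[OF t, of \<omega> "real_of_int (i - 1) * \<eta>" m \<eta>] i(2) w by (simp add: R_def q_def)
              then show ?thesis by (simp add: E_def)
            qed
            moreover have "i \<in> {- L - 1..L + 1}" "i - 1 \<in> {- L - 1..L + 1}" using iL by auto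
            ultimately show ?thesis by blast
          qed (use w in auto)
        qed
        show "?T \<union> (\<Union>i\<in>{- L - 1..L + 1}. E i m) \<in> events" using Tm Em by auto
      qed
      also have "\<dots> \<le> prob ?T + prob (\<Union>i\<in>{- L - 1..L + 1}. E i m)"
        by (rule measure_Un_le) (use Tm Em in auto)
      also have "prob (\<Union>i\<in>{- L - 1..L + 1}. E i m) \<le> (\<Sum>i\<in>{- L - 1..L + 1}. prob (E i m))"
        by (rule finite_measure_subadditive_finite) (use Em in auto)
      also have "(\<Sum>i\<in>{- L - 1..L + 1}. prob (E i m)) \<le> (\<Sum>i\<in>{- L - 1..L + 1}. prob (crossing_event 1 \<eta> t (real_of_int i * \<eta>) m)
          + prob (crossing_event (- 1) \<eta> t (real_of_int i * \<eta>) m))"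
        unfolding E_def by (intro sum_mono measure_Un_le crossing_event_measurable t)
      finally have 1: "prob {\<omega> \<in> space M. e < \<bar>X m t \<omega> - G m t \<omega>\<bar>} < prob ?T + r / 2" using elim(1) by linarith
      have "prob ?T \<le> 2 * exp (- (q\<^sup>2 * (normal_lower * (K / q))\<^sup>2 / 4))"
        unfolding q(2) by (rule U_tail[OF t]) (use K q in auto)
      also have "q\<^sup>2 * (normal_lower * (K / q))\<^sup>2 / 4 = c * K\<^sup>2"
        using q(1) by (simp add: c_def power_mult_distrib power_divide)
      finally show ?case using 1 K(2) by linarith
    qed
  qed
  show ?thesis
  proof (rule tendstoI)
    fix r :: real assume "0 < r"
    from main[OF this] show "\<forall>\<^sub>F m in sequentially. dist (prob {\<omega> \<in> space M. e < \<bar>X m t \<omega> - G m t \<omega>\<bar>}) 0 < r"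
      by eventually_elim simp
  qed
qed

end

lemma abs_cos_diff_le: "\<bar>cos a - cos b\<bar> \<le> \<bar>a - b :: real\<bar>"
proof -
  have "\<bar>cos a - cos b\<bar> = 2 * \<bar>sin ((a + b) / 2)\<bar> * \<bar>sin ((b - a) / 2)\<bar>"
    by (simp add: cos_diff_cos abs_mult)
  also have "\<dots> \<le> 2 * 1 * \<bar>(b - a) / 2\<bar>"
    by (intro mult_mono abs_sin_le_one abs_sin_x_le_abs_x) auto
  finally show ?thesis by (simp add: abs_minus_commute)
qed

lemma (in prob_space) expectation_cos_shift:
  assumes [measurable]: "Y \<in> borel_measurable M"
  shows "expectation (\<lambda>\<omega>. cos (b + Y \<omega>)) = Re (iexp b * expectation (\<lambda>\<omega>. iexp (Y \<omega>)))"
proof -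
  have int: "integrable M (\<lambda>\<omega>. iexp (Y \<omega>))" by (rule integrable_iexp) measurable
  have "iexp b * expectation (\<lambda>\<omega>. iexp (Y \<omega>)) = expectation (\<lambda>\<omega>. iexp b * iexp (Y \<omega>))"
    using int by simp
  also have "Re \<dots> = expectation (\<lambda>\<omega>. Re (iexp b * iexp (Y \<omega>)))"
    by (rule integral_Re[symmetric]) (use int in simp)
  also have "\<dots> = expectation (\<lambda>\<omega>. cos (b + Y \<omega>))"
    by (simp only: exp_add[symmetric] distrib_left[symmetric] of_real_add[symmetric] Re_exp) simp
  finally show ?thesis ..
qed

context brownian_family
begin

section \<open>Finite-dimensional limits\<close>

abbreviation form :: "nat \<Rightarrow> (nat \<Rightarrow> real) \<Rightarrow> (nat \<Rightarrow> real) \<Rightarrow> real" where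
  "form K c \<tau> \<equiv> \<Sum>k<K. \<Sum>l<K. c k * c l * median_cov (\<tau> k) (\<tau> l)"

lemma S_form:
  assumes \<tau>: "\<And>k. 0 \<le> \<tau> k" and j: "1 \<le> j"
  shows "expectation (\<lambda>\<omega>. (\<Sum>k<K. c k * S j (\<tau> k) \<omega>)\<^sup>2) = form K c \<tau>"
proof -
  have "(\<Sum>k<K. c k * S j (\<tau> k) \<omega>)\<^sup>2 = (\<Sum>k<K. \<Sum>l<K. c k * c l * (S j (\<tau> k) \<omega> * S j (\<tau> l) \<omega>))" for \<omega>
    by (simp add: power2_eq_square sum_product mult_ac)
  then have "expectation (\<lambda>\<omega>. (\<Sum>k<K. c k * S j (\<tau> k) \<omega>)\<^sup>2)
      = expectation (\<lambda>\<omega>. \<Sum>k<K. \<Sum>l<K. c k * c l * (S j (\<tau> k) \<omega> * S j (\<tau> l) \<omega>))" by (simp only:)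
  also have "\<dots> = form K c \<tau>"
    using S_mult_integrable[OF j \<tau> \<tau>] S_covariance[OF j \<tau> \<tau>] by (simp add: Bochner_Integration.integral_sum)
  finally show ?thesis .
qed

text \<open>The arcsine kernel is positive semidefinite because of its probabilistic meaning: the
  form is the second moment of a linear combination of values of \<open>S 1\<close>.\<close>

lemma form_nonneg:
  assumes "\<And>k. 0 \<le> \<tau> k"
  shows "0 \<le> form K c \<tau>"
  unfolding S_form[of \<tau> 1, OF assms order_refl, symmetric] by (intro integral_nonneg_AE AE_I2) simp

lemma psd_median_cov:
  assumes "\<And>k. 0 \<le> \<tau> k"
  shows "psd (\<lambda>i j. median_cov (\<tau> i) (\<tau> j))"
  unfolding psd_def using form_nonneg[of \<tau>, OF assms] median_cov_commute by simp

text \<open>The Cramer-Wold device: a linear combination of the \<open>G m (\<tau> k)\<close> is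
  itself a normalised sum of bounded independent variables, with second moment
  \<open>form K c \<tau>\<close>, along odd sample sizes.\<close>

lemma G_cosine:
  assumes \<tau>: "\<And>k. 0 \<le> \<tau> k"
  shows "(\<lambda>m. expectation (\<lambda>\<omega>. cos (b + (\<Sum>k<K. c k * G m (\<tau> k) \<omega>)))) \<longlonglongrightarrow> cos b * exp (- form K c \<tau> / 2)"
proof -
  define \<eta> where "\<eta> j \<omega> = (\<Sum>k<K. c k * S j (\<tau> k) \<omega>)" for j \<omega>
  have lim: "(\<lambda>n. expectation (\<lambda>\<omega>. iexp ((\<Sum>j\<in>{1..n}. \<eta> j \<omega>) / sqrt (real n)))) \<longlonglongrightarrow>
      complex_of_real (exp (- form K c \<tau> / 2))"
  proof (rule bounded_central_limit)
    show "indep_vars (\<lambda>_. borel) \<eta> {1..}"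
    proof (rule indep_path_functionals)
      show "(\<lambda>y. \<Sum>k<K. c k * (sqrt (2 * pi * \<tau> k) * (1 / 2 - of_bool (y (\<tau> k) / sqrt (\<tau> k) \<le> 0))))
          \<in> borel_measurable (Pi\<^sub>M {0..} (\<lambda>_. borel))"
        using \<tau> by (intro borel_measurable_sum) simp
      show "\<eta> j \<omega> = (\<Sum>k<K. c k * (sqrt (2 * pi * \<tau> k) * (1 / 2 - of_bool ((\<lambda>t\<in>{0..}. B j t \<omega>) (\<tau> k) / sqrt (\<tau> k) \<le> 0))))"
        for j \<omega>
        using \<tau> by (simp add: \<eta>_def S_def Z_def)
    qed simp
    show "\<bar>\<eta> j \<omega>\<bar> \<le> (\<Sum>k<K. \<bar>c k\<bar> * sqrt (2 * pi * \<tau> k))" for j \<omega>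
      unfolding \<eta>_def
    proof (rule order_trans[OF sum_abs sum_mono])
      show "\<bar>c k * S j (\<tau> k) \<omega>\<bar> \<le> \<bar>c k\<bar> * sqrt (2 * pi * \<tau> k)" for k
        unfolding abs_mult using S_abs_le[OF \<tau>] by (intro mult_left_mono) auto
    qed
    show "expectation (\<eta> j) = 0" if "1 \<le> j" for j
      unfolding \<eta>_def using S_integrable[OF that \<tau>] S_expectation[OF that \<tau>]
      by (simp add: Bochner_Integration.integral_sum)
    show "expectation (\<lambda>\<omega>. (\<eta> j \<omega>)\<^sup>2) = form K c \<tau>" if "1 \<le> j" for j
      unfolding \<eta>_def by (rule S_form[OF \<tau> that])
  qed
  have eq: "(\<Sum>j\<in>{1..2 * m + 1}. \<eta> j \<omega>) / sqrt (real (2 * m + 1)) = (\<Sum>k<K. c k * G m (\<tau> k) \<omega>)" for m \<omega>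
  proof -
    have "(\<Sum>j\<in>{1..2 * m + 1}. \<eta> j \<omega>) = (\<Sum>k<K. c k * (\<Sum>j\<in>{1..2 * m + 1}. S j (\<tau> k) \<omega>))"
      unfolding \<eta>_def sum_distrib_left by (rule sum.swap)
    moreover define T where "T k = (\<Sum>j\<in>{1..2 * m + 1}. S j (\<tau> k) \<omega>)" for k
    ultimately have "(\<Sum>j\<in>{1..2 * m + 1}. \<eta> j \<omega>) = (\<Sum>k<K. c k * T k)" by (simp only:)
    then show ?thesis unfolding G_def T_def[symmetric] by (simp add: sum_divide_distrib)
  qed
  have lim': "(\<lambda>m. expectation (\<lambda>\<omega>. iexp (\<Sum>k<K. c k * G m (\<tau> k) \<omega>))) \<longlonglongrightarrow> complex_of_real (exp (- form K c \<tau> / 2))"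
    using odd_tendsto[OF lim] unfolding eq .
  have "(\<lambda>m. Re (iexp b * expectation (\<lambda>\<omega>. iexp (\<Sum>k<K. c k * G m (\<tau> k) \<omega>)))) \<longlonglongrightarrow>
      Re (iexp b * complex_of_real (exp (- form K c \<tau> / 2)))"
    by (intro tendsto_intros lim')
  moreover have "Re (iexp b * complex_of_real (exp (- form K c \<tau> / 2))) = cos b * exp (- form K c \<tau> / 2)"
    by (simp add: Re_exp)
  moreover have "expectation (\<lambda>\<omega>. cos (b + (\<Sum>k<K. c k * G m (\<tau> k) \<omega>)))
      = Re (iexp b * expectation (\<lambda>\<omega>. iexp (\<Sum>k<K. c k * G m (\<tau> k) \<omega>)))" for m
    by (rule expectation_cos_shift) (intro borel_measurable_sum borel_measurable_times borel_measurable_const G_measurable \<tau>)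
  ultimately show ?thesis by simp
qed

text \<open>The cosine is bounded and 1-Lipschitz, so replacing \<open>X\<close> by \<open>G\<close>
  costs a multiple of \<open>e\<close> off the events of \<open>X_G_close\<close>.\<close>

lemma X_cosine:
  assumes \<tau>: "\<And>k. 0 \<le> \<tau> k"
  shows "(\<lambda>m. expectation (\<lambda>\<omega>. cos (b + (\<Sum>k<K. c k * X m (\<tau> k) \<omega>)))) \<longlonglongrightarrow> cos b * exp (- form K c \<tau> / 2)"
proof -
  let ?x = "\<lambda>m. expectation (\<lambda>\<omega>. cos (b + (\<Sum>k<K. c k * X m (\<tau> k) \<omega>)))"
  let ?g = "\<lambda>m. expectation (\<lambda>\<omega>. cos (b + (\<Sum>k<K. c k * G m (\<tau> k) \<omega>)))"
  have Xm[measurable]: "X m (\<tau> k) \<in> borel_measurable M" for m k by (rule scaled_median_measurable[OF \<tau>])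
  have Gm[measurable]: "G m (\<tau> k) \<in> borel_measurable M" for m k by (rule G_measurable[OF \<tau>])
  have "(\<lambda>m. ?x m - ?g m) \<longlonglongrightarrow> 0"
  proof (rule tendstoI)
    fix r :: real assume r: "0 < r"
    define A where "A = 1 + (\<Sum>k<K. \<bar>c k\<bar>)"
    have A: "1 \<le> A" unfolding A_def by (simp add: sum_nonneg)
    define e where "e = r / (2 * A)"
    have e: "0 < e" using r A by (simp add: e_def)
    have "(\<lambda>m. \<Sum>k<K. prob {\<omega> \<in> space M. e < \<bar>X m (\<tau> k) \<omega> - G m (\<tau> k) \<omega>\<bar>}) \<longlonglongrightarrow> (\<Sum>k<K. 0)"
      by (intro tendsto_sum X_G_close \<tau> e)
    then have "\<forall>\<^sub>F m in sequentially. (\<Sum>k<K. prob {\<omega> \<in> space M. e < \<bar>X m (\<tau> k) \<omega> - G m (\<tau> k) \<omega>\<bar>}) < r / 4"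
      by (rule order_tendstoD) (use r in simp)
    then show "\<forall>\<^sub>F m in sequentially. dist (?x m - ?g m) 0 < r"
    proof eventually_elim
      case (elim m)
      let ?E = "\<lambda>k. {\<omega> \<in> space M. e < \<bar>X m (\<tau> k) \<omega> - G m (\<tau> k) \<omega>\<bar>}"
      have Em: "?E k \<in> events" for k by measurable
      have U: "(\<Union>k<K. ?E k) \<in> events" using Em by auto
      have "\<bar>?x m - ?g m\<bar> \<le> e * (\<Sum>k<K. \<bar>c k\<bar>) + 2 * 1 * prob (\<Union>k<K. ?E k)"
      proof (rule expectation_diff_le[OF _ _ U])
        fix \<omega> assume w: "\<omega> \<in> space M - (\<Union>k<K. ?E k)"
        let ?a = "b + (\<Sum>k<K. c k * X m (\<tau> k) \<omega>)" and ?b = "b + (\<Sum>k<K. c k * G m (\<tau> k) \<omega>)"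
        have "\<bar>cos ?a - cos ?b\<bar> \<le> \<bar>?a - ?b\<bar>" by (rule abs_cos_diff_le)
        also have "?a - ?b = (\<Sum>k<K. c k * (X m (\<tau> k) \<omega> - G m (\<tau> k) \<omega>))"
          by (simp add: sum_subtractf right_diff_distrib)
        also have "\<bar>\<dots>\<bar> \<le> (\<Sum>k<K. \<bar>c k\<bar> * e)"
        proof (rule order_trans[OF sum_abs sum_mono])
          fix k assume "k \<in> {..<K}"
          then have "\<bar>X m (\<tau> k) \<omega> - G m (\<tau> k) \<omega>\<bar> \<le> e" using w by (auto simp: not_less)
          then show "\<bar>c k * (X m (\<tau> k) \<omega> - G m (\<tau> k) \<omega>)\<bar> \<le> \<bar>c k\<bar> * e"
            unfolding abs_mult by (rule mult_left_mono) simp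
        qed
        also have "\<dots> = e * (\<Sum>k<K. \<bar>c k\<bar>)" by (simp add: sum_distrib_left mult.commute)
        finally show "\<bar>cos ?a - cos ?b\<bar> \<le> e * (\<Sum>k<K. \<bar>c k\<bar>)" .
      next
        have cosm: "cos \<in> borel_measurable (borel :: real measure)" by measurable
        have "(\<lambda>\<omega>. b + (\<Sum>k<K. c k * X m (\<tau> k) \<omega>)) \<in> borel_measurable M"
          by (intro borel_measurable_add borel_measurable_const borel_measurable_sum borel_measurable_times Xm)
        then show "(\<lambda>\<omega>. cos (b + (\<Sum>k<K. c k * X m (\<tau> k) \<omega>))) \<in> borel_measurable M"
          by (rule measurable_compose[OF _ cosm])
        have "(\<lambda>\<omega>. b + (\<Sum>k<K. c k * G m (\<tau> k) \<omega>)) \<in> borel_measurable M"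
          by (intro borel_measurable_add borel_measurable_const borel_measurable_sum borel_measurable_times Gm)
        then show "(\<lambda>\<omega>. cos (b + (\<Sum>k<K. c k * G m (\<tau> k) \<omega>))) \<in> borel_measurable M"
          by (rule measurable_compose[OF _ cosm])
      qed (use e in \<open>simp_all add: sum_nonneg\<close>)
      also have "prob (\<Union>k<K. ?E k) \<le> (\<Sum>k<K. prob (?E k))"
        by (rule finite_measure_subadditive_finite) (use Em in auto)
      also have "e * (\<Sum>k<K. \<bar>c k\<bar>) \<le> e * A" unfolding A_def using e by (intro mult_left_mono) auto
      also have "e * A = r / 2" using A by (simp add: e_def)
      finally have "\<bar>?x m - ?g m\<bar> \<le> r / 2 + 2 * 1 * (\<Sum>k<K. prob (?E k))" by simp
      then show ?case using elim unfolding dist_real_def by linarith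
    qed
  qed
  from tendsto_add[OF this G_cosine[where \<tau> = \<tau> and b = b and K = K and c = c, OF \<tau>]] show ?thesis by simp
qed

text \<open>The threshold \<open>sqrt t * K\<close> for \<open>X\<close> is the level
  \<open>K / odd_sqrt m\<close> for \<open>U\<close>, where the bound of \<open>U_tail\<close> is
  the same for all \<open>m\<close>. That lemma wants a level of at most 1, so large
  \<open>m\<close> come first.\<close>

lemma X_tight:
  assumes t: "0 \<le> t" and e: "0 < e"
  shows "\<exists>R. \<forall>m. prob {\<omega> \<in> space M. R < \<bar>X m t \<omega>\<bar>} \<le> e"
proof -
  obtain R0 where "\<forall>\<^sub>F m in sequentially. prob {\<omega> \<in> space M. R0 < \<bar>X m t \<omega>\<bar>} \<le> e"
  proof (cases "t = 0")
    case True
    have "prob {\<omega> \<in> space M. 0 < \<bar>X m t \<omega>\<bar>} \<le> prob {}" for m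
      by (rule finite_measure_mono_AE) (use scaled_median_0[of m] True in auto)
    then have "prob {\<omega> \<in> space M. 0 < \<bar>X m t \<omega>\<bar>} \<le> e" for m
      by (rule order_trans) (use e in simp)
    then show ?thesis by (intro that[of 0] always_eventually allI)
  next
    case False
    then have t: "0 < t" using t by simp
    define c where "c = normal_lower\<^sup>2 / 4"
    have c: "0 < c" using normal_lower by (simp add: c_def)
    define K where "K = 1 + \<bar>ln (e / 2)\<bar> / c"
    have K1: "1 \<le> K" using c by (simp add: K_def)
    have "\<bar>ln (e / 2)\<bar> \<le> c * K" using c by (simp add: K_def distrib_left)
    also have "c * K \<le> c * K\<^sup>2" using K1 c by (intro mult_left_mono) (auto simp: power2_eq_square)
    finally have "exp (- (c * K\<^sup>2)) \<le> exp (ln (e / 2))" by simp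
    then have K: "2 * exp (- (c * K\<^sup>2)) \<le> e" using e by simp
    have "\<forall>\<^sub>F m in sequentially. K \<le> odd_sqrt m"
      using odd_sqrt_at_top unfolding filterlim_at_top by blast
    then have "\<forall>\<^sub>F m in sequentially. prob {\<omega> \<in> space M. sqrt t * K < \<bar>X m t \<omega>\<bar>} \<le> e"
    proof eventually_elim
      case (elim m)
      define q where "q = odd_sqrt m"
      have q: "0 < q" "q\<^sup>2 = real (2 * m + 1)" "K \<le> q" unfolding q_def using odd_sqrt[of m] elim by auto
      have "X m t \<omega> = sqrt t * (q * U m t \<omega>)" for \<omega>
        using scaled_median_eq_U[OF t, of m \<omega>] by (simp add: q_def odd_sqrt_def)
      then have "{\<omega> \<in> space M. sqrt t * K < \<bar>X m t \<omega>\<bar>} = {\<omega> \<in> space M. K / q < \<bar>U m t \<omega>\<bar>}"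
        using t q by (simp add: abs_mult field_simps)
      then have "prob {\<omega> \<in> space M. sqrt t * K < \<bar>X m t \<omega>\<bar>} = prob {\<omega> \<in> space M. K / q < \<bar>U m t \<omega>\<bar>}" by simp
      also have "\<dots> \<le> 2 * exp (- (q\<^sup>2 * (normal_lower * (K / q))\<^sup>2 / 4))"
        unfolding q(2) by (rule U_tail[OF t]) (use K1 q in auto)
      also have "q\<^sup>2 * (normal_lower * (K / q))\<^sup>2 / 4 = c * K\<^sup>2"
        using q(1) by (simp add: c_def power_mult_distrib power_divide)
      finally show ?case using K by linarith
    qed
    then show ?thesis by (rule that)
  qed
  then show ?thesis by (rule tight_eventually_imp_tight[OF scaled_median_measurable[OF t] e])
qed

section \<open>The Gaussian limit at dyadic times\<close>

definition dyadics :: "real set" where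
  "dyadics = (\<lambda>(k, l). real k / 2 ^ l) ` (UNIV :: (nat \<times> nat) set)"

lemma dyadics: "real k / 2 ^ l \<in> dyadics" "countable dyadics" "dyadics \<noteq> {}"
  by (auto simp: dyadics_def image_iff)

text \<open>Enumerating the dyadic times turns the process at all of them into one random sequence,
  the setting of \<open>weak_convergence_of_cosines\<close>.\<close>

definition dy :: "nat \<Rightarrow> real" where "dy = from_nat_into dyadics"

definition dy_index :: "real \<Rightarrow> nat" where "dy_index = to_nat_on dyadics"

lemma dy_nonneg: "0 \<le> dy k"
  using from_nat_into[OF dyadics(3), of k] by (auto simp: dy_def dyadics_def)

lemma dy_index: "dy (dy_index (real k / 2 ^ l)) = real k / 2 ^ l"
  unfolding dy_def dy_index_def by (rule from_nat_into_to_nat_on[OF dyadics(2,1)])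

text \<open>The normals \<open>Z (Suc i) 1\<close> are independent and already live on
  \<open>M\<close>; row \<open>k\<close> of the Cholesky factor combines the first
  \<open>k + 1\<close> of them into \<open>W k\<close>, with the prescribed covariances.\<close>

lemma dyadic_Gaussian_exists:
  obtains W :: "nat \<Rightarrow> 'a \<Rightarrow> real"
  where "\<And>k. W k \<in> borel_measurable M"
    and "\<And>b c K. expectation (\<lambda>\<omega>. cos (b + (\<Sum>k<K. c k * W k \<omega>))) = cos b * exp (- form K c dy / 2)"
proof -
  obtain L where L: "\<And>i j n. i < n \<Longrightarrow> median_cov (dy i) (dy j) = (\<Sum>k<n. L i k * L j k)"
    "\<And>i k. i < k \<Longrightarrow> L i k = (0::real)"
    using psd_cholesky[OF psd_median_cov[of dy, OF dy_nonneg]] by metis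
  define g where "g i = Z (Suc i) 1" for i
  have g: "distributed M lborel (g i) std_normal_density" "g i \<in> borel_measurable M" for i
    using Z_std_normal[of "Suc i" 1] Z_measurable[of "Suc i" 1] by (simp_all add: g_def)
  have ind: "indep_vars (\<lambda>_. borel) (\<lambda>j. Z j 1) {1..}"
    by (rule indep_path_functionals[of "\<lambda>y. y 1"]) (auto simp: Z_def)
  define W where "W k \<omega> = (\<Sum>i<Suc k. L k i * g i \<omega>)" for k \<omega>
  have Wm: "W k \<in> borel_measurable M" for k
    unfolding W_def by (intro borel_measurable_sum borel_measurable_times borel_measurable_const g)
  have Wn: "W k \<omega> = (\<Sum>i<n. L k i * g i \<omega>)" if "k < n" for k n \<omega>
    unfolding W_def by (rule sum.mono_neutral_left) (use that L(2) in auto)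
  have cosW: "expectation (\<lambda>\<omega>. cos (b + (\<Sum>k<K. c k * W k \<omega>))) = cos b * exp (- form K c dy / 2)" for b c K
  proof -
    define a where "a i = (\<Sum>k<K. c k * L k i)" for i
    have lin: "(\<Sum>k<K. c k * W k \<omega>) = (\<Sum>i<K. a i * g i \<omega>)" for \<omega>
    proof -
      have "(\<Sum>k<K. c k * W k \<omega>) = (\<Sum>k<K. \<Sum>i<K. c k * (L k i * g i \<omega>))"
        by (rule sum.cong) (auto simp: Wn[of _ K] sum_distrib_left)
      also have "\<dots> = (\<Sum>i<K. \<Sum>k<K. c k * (L k i * g i \<omega>))" by (rule sum.swap)
      also have "\<dots> = (\<Sum>i<K. a i * g i \<omega>)" by (simp add: a_def sum_distrib_right mult.assoc)
      finally show ?thesis .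
    qed
    have quad: "(\<Sum>i<K. (a i)\<^sup>2) = form K c dy"
    proof -
      have "(\<Sum>i<K. (a i)\<^sup>2) = (\<Sum>i<K. \<Sum>k<K. \<Sum>l<K. c k * c l * (L k i * L l i))"
        by (simp add: a_def power2_eq_square sum_product mult_ac)
      also have "\<dots> = (\<Sum>k<K. \<Sum>i<K. \<Sum>l<K. c k * c l * (L k i * L l i))" by (rule sum.swap)
      also have "\<dots> = (\<Sum>k<K. \<Sum>l<K. \<Sum>i<K. c k * c l * (L k i * L l i))"
        by (intro sum.cong refl sum.swap)
      also have "\<dots> = form K c dy"
        by (intro sum.cong refl) (simp add: L(1)[of _ K] sum_distrib_left)
      finally show ?thesis .
    qed
    have agm: "(\<lambda>\<omega>. a i * g i \<omega>) \<in> borel_measurable M" for i using g(2)[of i] by measurable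
    have sm: "(\<lambda>\<omega>. \<Sum>i<K. a i * g i \<omega>) \<in> borel_measurable M" by (intro borel_measurable_sum agm)
    have shift: "(\<lambda>\<omega>. \<Sum>i<K. a i * g i \<omega>) = (\<lambda>\<omega>. \<Sum>j\<in>{1..K}. a (j - 1) * Z j 1 \<omega>)"
      by (simp add: sum.atLeast1_atMost_eq g_def)
    have "expectation (\<lambda>\<omega>. iexp (\<Sum>i<K. a i * g i \<omega>)) = char (distr M borel (\<lambda>\<omega>. \<Sum>i<K. a i * g i \<omega>)) 1"
      unfolding char_def using sm by (subst integral_distr) auto
    also have "\<dots> = char (distr M borel (\<lambda>\<omega>. \<Sum>j\<in>{1..K}. a (j - 1) * Z j 1 \<omega>)) 1" by (simp only: shift)
    also have "\<dots> = (\<Prod>j\<in>{1..K}. char (distr M borel (\<lambda>\<omega>. a (j - 1) * Z j 1 \<omega>)) 1)"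
      by (rule char_distr_sum, rule indep_vars_compose2[OF indep_vars_subset[OF ind]]) auto
    also have "\<dots> = (\<Prod>i<K. char (distr M borel (\<lambda>\<omega>. a i * g i \<omega>)) 1)"
      by (simp add: prod.atLeast1_atMost_eq g_def)
    also have "\<dots> = (\<Prod>i<K. complex_of_real (exp (- (a i)\<^sup>2 / 2)))"
    proof (rule prod.cong[OF refl])
      fix i
      have "char (distr M borel (\<lambda>\<omega>. a i * g i \<omega>)) 1 = char (distr M borel (g i)) (a i)"
        unfolding char_def using agm[of i] g(2)[of i] by (simp add: integral_distr)
      also have "distr M borel (g i) = std_normal_distribution"
        using g(1)[of i] by (auto simp: distributed_def cong: distr_cong)
      finally show "char (distr M borel (\<lambda>\<omega>. a i * g i \<omega>)) 1 = complex_of_real (exp (- (a i)\<^sup>2 / 2))"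
        by (simp add: char_std_normal_distribution)
    qed
    also have "\<dots> = complex_of_real (exp (- form K c dy / 2))"
    proof -
      have "(\<Prod>i<K. exp (- (a i)\<^sup>2 / 2)) = exp (\<Sum>i<K. - (a i)\<^sup>2 / 2)" by (simp add: exp_sum)
      also have "(\<Sum>i<K. - (a i)\<^sup>2 / 2) = - form K c dy / 2"
        unfolding quad[symmetric] by (simp add: sum_negf sum_divide_distrib)
      finally show ?thesis by (simp only: of_real_prod[symmetric])
    qed
    finally have iexp: "expectation (\<lambda>\<omega>. iexp (\<Sum>i<K. a i * g i \<omega>)) = complex_of_real (exp (- form K c dy / 2))" .
    show ?thesis unfolding lin expectation_cos_shift[OF sm] iexp by (simp add: Re_exp)
  qed
  show ?thesis by (rule that[OF Wm cosW])
qed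

end

section \<open>Chaining events\<close>

text \<open>Level \<open>l\<close> has \<open>T * 2 ^ l\<close> increments, each bad with
  probability at most \<open>D / 8 ^ l\<close>, so it fails with probability at most
  \<open>T * D / 4 ^ l\<close>. Bounding \<open>(1 / 4) ^ i\<close> by \<open>(1 / 2) ^ i\<close> at
  the levels \<open>l0 + i\<close> produces the factor 2.\<close>

lemma (in prob_space) dyadic_chaining_event:
  fixes Y :: "real \<Rightarrow> 'a \<Rightarrow> real" and T l0 :: nat
  assumes m: "\<And>l k. Y (real k / 2 ^ l) \<in> borel_measurable M"
    and inc: "\<And>l k. k + 1 \<le> T * 2 ^ l \<Longrightarrow>
      prob {\<omega> \<in> space M. C * r ^ l < \<bar>Y (real (k + 1) / 2 ^ l) \<omega> - Y (real k / 2 ^ l) \<omega>\<bar>} \<le> D / 8 ^ l"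
    and C: "0 \<le> C" and r: "0 < r" "r < 1" and D: "0 \<le> D"
  shows "\<exists>A\<in>events. prob A \<le> 2 * real T * D * (1 / 4) ^ l0 \<and>
    (\<forall>\<omega>\<in>space M - A. dyadic_increments (\<lambda>d. Y d \<omega>) C r l0 T)"
proof -
  define E where "E l k = {\<omega> \<in> space M. C * r ^ l < \<bar>Y (real (k + 1) / 2 ^ l) \<omega> - Y (real k / 2 ^ l) \<omega>\<bar>}" for l k
  have E: "E l k \<in> events" for l k
  proof -
    have [measurable]: "Y (real k / 2 ^ l) \<in> borel_measurable M" "Y (real (k + 1) / 2 ^ l) \<in> borel_measurable M"
      by (rule m)+
    show ?thesis unfolding E_def by measurable
  qed
  define A where "A i = (\<Union>k<T * 2 ^ (l0 + i). E (l0 + i) k)" for i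
  have A: "A i \<in> events" for i unfolding A_def using E by auto
  have prob_A: "prob (A i) \<le> 2 * real T * D * (1 / 4) ^ l0 * (1 / 2) ^ Suc i" for i
  proof -
    define l where "l = l0 + i"
    have "prob (A i) \<le> (\<Sum>k<T * 2 ^ l. prob (E l k))"
      unfolding A_def l_def by (rule finite_measure_subadditive_finite) (use E in auto)
    also have "\<dots> \<le> (\<Sum>k<T * 2 ^ l. D / 8 ^ l)"
      unfolding E_def by (intro sum_mono inc) auto
    also have "\<dots> = real T * D * (2 ^ l / 8 ^ l)" by simp
    also have "2 ^ l / 8 ^ l = (1 / 4 :: real) ^ l" by (simp add: power_divide[symmetric])
    also have "real T * D * (1 / 4) ^ l = real T * D * (1 / 4) ^ l0 * (1 / 4) ^ i"
      by (simp add: l_def power_add)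
    also have "\<dots> \<le> real T * D * (1 / 4) ^ l0 * (1 / 2) ^ i"
      using D by (intro mult_left_mono power_mono) auto
    finally show ?thesis by simp
  qed
  have "dyadic_increments (\<lambda>d. Y d \<omega>) C r l0 T" if w: "\<omega> \<in> space M - (\<Union>i. A i)" for \<omega>
  proof
    fix l k assume l: "l0 \<le> l" "k + 1 \<le> T * 2 ^ l"
    obtain i where "l = l0 + i" using l(1) le_Suc_ex by blast
    then have "\<omega> \<notin> E l k" using w l(2) unfolding A_def by auto
    then show "\<bar>Y (real (k + 1) / 2 ^ l) \<omega> - Y (real k / 2 ^ l) \<omega>\<bar> \<le> C * r ^ l"
      using w unfolding E_def by (simp add: not_less)
  qed (use C r in auto)
  moreover have "prob (\<Union>i. A i) \<le> 2 * real T * D * (1 / 4) ^ l0"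
    by (rule prob_Union_geometric_le[OF A prob_A])
  moreover have "(\<Union>i. A i) \<in> events" using A by auto
  ultimately show ?thesis by (intro bexI[of _ "\<Union>i. A i"]) auto
qed

text \<open>The exceptional events for the starting levels \<open>l0\<close> have probabilities
  tending to 0, so their intersection is a null set.\<close>

lemma (in prob_space) dyadic_chaining_AE:
  fixes Y :: "real \<Rightarrow> 'a \<Rightarrow> real" and T :: nat
  assumes m: "\<And>l k. Y (real k / 2 ^ l) \<in> borel_measurable M"
    and inc: "\<And>l k. k + 1 \<le> T * 2 ^ l \<Longrightarrow>
      prob {\<omega> \<in> space M. C * r ^ l < \<bar>Y (real (k + 1) / 2 ^ l) \<omega> - Y (real k / 2 ^ l) \<omega>\<bar>} \<le> D / 8 ^ l"
    and C: "0 \<le> C" and r: "0 < r" "r < 1" and D: "0 \<le> D"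
  shows "AE \<omega> in M. \<exists>C l0. dyadic_increments (\<lambda>d. Y d \<omega>) C r l0 T"
proof -
  have "\<forall>l0. \<exists>A. A \<in> events \<and> prob A \<le> 2 * real T * D * (1 / 4) ^ l0 \<and>
    (\<forall>\<omega>\<in>space M - A. dyadic_increments (\<lambda>d. Y d \<omega>) C r l0 T)"
    using dyadic_chaining_event[of Y T C r D, OF m inc C r D] by (simp add: Bex_def)
  from choice[OF this] obtain A where A: "\<And>l0. A l0 \<in> events"
    "\<And>l0. prob (A l0) \<le> 2 * real T * D * (1 / 4) ^ l0"
    "\<And>l0 \<omega>. \<omega> \<in> space M - A l0 \<Longrightarrow> dyadic_increments (\<lambda>d. Y d \<omega>) C r l0 T"
    by auto
  have I: "(\<Inter>l0. A l0) \<in> events" using A(1) by auto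
  have "(\<lambda>l0. 2 * real T * D * (1 / 4) ^ l0) \<longlonglongrightarrow> 2 * real T * D * 0"
    by (intro tendsto_intros LIMSEQ_power_zero) auto
  moreover have "prob (\<Inter>l0. A l0) \<le> 2 * real T * D * (1 / 4) ^ l0" for l0
    by (rule order_trans[OF finite_measure_mono[OF _ A(1)] A(2)]) auto
  ultimately have "prob (\<Inter>l0. A l0) \<le> 0"
    by (intro LIMSEQ_le_const) auto
  then have z: "emeasure M (\<Inter>l0. A l0) = 0" by (simp add: emeasure_eq_measure measure_le_0_iff)
  show ?thesis
  proof (rule AE_I[OF _ z I])
    show "{\<omega> \<in> space M. \<not> (\<exists>C l0. dyadic_increments (\<lambda>d. Y d \<omega>) C r l0 T)} \<subseteq> (\<Inter>l0. A l0)"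
      using A(3) by blast
  qed
qed

lemma continuous_on_halfline:
  fixes f :: "real \<Rightarrow> real"
  assumes "\<And>T :: nat. continuous_on {0..real T} f"
  shows "continuous_on {0..} f"
  unfolding continuous_on_iff
proof (intro ballI allI impI)
  fix t e :: real assume t: "t \<in> {0..}" and e: "0 < e"
  obtain T :: nat where T: "t + 1 < real T" using reals_Archimedean2 by blast
  have "t \<in> {0..real T}" using t T by auto
  then obtain d where d: "0 < d" "\<And>s. s \<in> {0..real T} \<Longrightarrow> dist s t < d \<Longrightarrow> dist (f s) (f t) < e"
    using assms[of T] e unfolding continuous_on_iff by blast
  show "\<exists>d>0. \<forall>s\<in>{0..}. dist s t < d \<longrightarrow> dist (f s) (f t) < e"
  proof (intro exI[of _ "min d 1"] conjI ballI impI)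
    fix s assume s: "s \<in> {0..}" "dist s t < min d 1"
    then have "s \<in> {0..real T}" using T by (auto simp: dist_real_def)
    then show "dist (f s) (f t) < e" using d(2) s(2) by simp
  qed (use d in auto)
qed

lemma locally_holder_weaken:
  assumes hol: "\<And>T :: nat. \<exists>K. \<forall>s\<in>{0..real T}. \<forall>t\<in>{0..real T}. \<bar>f t - f s\<bar> \<le> K * \<bar>t - s\<bar> powr \<gamma>'"
    and g: "\<gamma> \<le> \<gamma>'"
  shows "locally_holder \<gamma> f"
  unfolding locally_holder_def
proof (intro allI impI)
  fix T :: real assume T: "0 \<le> T"
  obtain n :: nat where n: "T < real n" using reals_Archimedean2 by blast
  obtain K where K: "\<And>s t. s \<in> {0..real n} \<Longrightarrow> t \<in> {0..real n} \<Longrightarrow> \<bar>f t - f s\<bar> \<le> K * \<bar>t - s\<bar> powr \<gamma>'"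
    using hol[of n] by blast
  show "\<exists>C. \<forall>s\<in>{0..T}. \<forall>t\<in>{0..T}. \<bar>f t - f s\<bar> \<le> C * \<bar>t - s\<bar> powr \<gamma>"
  proof (intro exI[of _ "\<bar>K\<bar> * T powr (\<gamma>' - \<gamma>)"] ballI)
    fix s t assume st: "s \<in> {0..T}" "t \<in> {0..T}"
    have "\<bar>f t - f s\<bar> \<le> K * \<bar>t - s\<bar> powr \<gamma>'" using st n by (intro K) auto
    also have "\<dots> \<le> \<bar>K\<bar> * \<bar>t - s\<bar> powr \<gamma>'" by (intro mult_right_mono) auto
    also have "\<bar>t - s\<bar> powr \<gamma>' = \<bar>t - s\<bar> powr (\<gamma>' - \<gamma>) * \<bar>t - s\<bar> powr \<gamma>" by (simp add: powr_add[symmetric])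
    also have "\<bar>K\<bar> * (\<bar>t - s\<bar> powr (\<gamma>' - \<gamma>) * \<bar>t - s\<bar> powr \<gamma>) \<le> \<bar>K\<bar> * (T powr (\<gamma>' - \<gamma>) * \<bar>t - s\<bar> powr \<gamma>)"
      using st g by (intro mult_left_mono mult_right_mono powr_mono2) auto
    finally show "\<bar>f t - f s\<bar> \<le> \<bar>K\<bar> * T powr (\<gamma>' - \<gamma>) * \<bar>t - s\<bar> powr \<gamma>" by (simp add: mult.assoc)
  qed
qed

lemma dyadic_power_powr: "(1 / 2 ^ l :: real) powr \<gamma> = (2 powr - \<gamma>) ^ l"
proof -
  have "(2 powr - \<gamma>) ^ l = (2 powr - \<gamma>) powr real l" by (simp add: powr_realpow)
  also have "\<dots> = (2 powr - real l) powr \<gamma>" by (simp add: powr_powr mult.commute)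
  also have "2 powr - real l = (1 / 2 ^ l :: real)" by (simp add: powr_minus powr_realpow field_simps)
  finally show ?thesis ..
qed

section \<open>Uniform interpolation error of the scaled medians\<close>

context brownian_family
begin

lemma X_dyadic_increment:
  fixes T :: nat
  assumes \<delta>: "0 < \<delta>" "\<delta> < 1 / 4"
  obtains C D where "0 < C" "0 \<le> D"
    "\<And>m l k. k + 1 \<le> T * 2 ^ l \<Longrightarrow> prob {\<omega> \<in> space M. C * (2 powr - (1 / 4 - \<delta>)) ^ l
      < \<bar>X m (real (k + 1) / 2 ^ l) \<omega> - X m (real k / 2 ^ l) \<omega>\<bar>} \<le> D / 8 ^ l"
proof -
  have "1 \<le> real T + 1" by simp
  from X_increment[OF \<delta> this] obtain C D where C: "0 \<le> C" and D: "0 \<le> D"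
    and inc: "\<forall>m h s. 0 < h \<longrightarrow> h \<le> 1 \<longrightarrow> (s = 0 \<or> h \<le> s) \<longrightarrow> s + h \<le> real T + 1 \<longrightarrow>
      prob {\<omega> \<in> space M. C * h powr (1 / 4 - \<delta>) < \<bar>X m (s + h) \<omega> - X m s \<omega>\<bar>} \<le> D * h ^ 3"
    by (elim exE conjE)
  show ?thesis
  \<comment> \<open>\<open>C + 1\<close> makes the constant positive, as the threshold in
    \<open>W_increment\<close> requires.\<close>
  proof (rule that[of "C + 1" D])
    fix m l k assume k: "k + 1 \<le> T * 2 ^ l"
    define h s where "h = (1 / 2 ^ l :: real)" and "s = real k / 2 ^ l"
    have h: "0 < h" "h \<le> 1" by (simp_all add: h_def)
    have s: "s = 0 \<or> h \<le> s" by (cases "k = 0") (auto simp: s_def h_def divide_right_mono)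
    have sh: "real (k + 1) / 2 ^ l = s + h" by (simp add: s_def h_def add_divide_distrib)
    have "real (k + 1) \<le> real (T * 2 ^ l)" using k by (simp only: of_nat_le_iff)
    then have "real (k + 1) / 2 ^ l \<le> real T" by (simp add: divide_le_eq)
    then have shT: "s + h \<le> real T + 1" unfolding sh by simp
    have s0: "0 \<le> s" by (simp add: s_def)
    have [measurable]: "X m s \<in> borel_measurable M" "X m (s + h) \<in> borel_measurable M"
      using s0 h by (simp_all only: scaled_median_measurable add_nonneg_nonneg less_imp_le)
    have "prob {\<omega> \<in> space M. (C + 1) * h powr (1 / 4 - \<delta>) < \<bar>X m (s + h) \<omega> - X m s \<omega>\<bar>}
        \<le> prob {\<omega> \<in> space M. C * h powr (1 / 4 - \<delta>) < \<bar>X m (s + h) \<omega> - X m s \<omega>\<bar>}"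
    proof (rule finite_measure_mono)
      have "C * h powr (1 / 4 - \<delta>) \<le> (C + 1) * h powr (1 / 4 - \<delta>)" by (intro mult_right_mono) auto
      then show "{\<omega> \<in> space M. (C + 1) * h powr (1 / 4 - \<delta>) < \<bar>X m (s + h) \<omega> - X m s \<omega>\<bar>}
        \<subseteq> {\<omega> \<in> space M. C * h powr (1 / 4 - \<delta>) < \<bar>X m (s + h) \<omega> - X m s \<omega>\<bar>}" by auto
    qed measurable
    also have "\<dots> \<le> D * h ^ 3" by (rule inc[rule_format, OF h s shT])
    also have "D * h ^ 3 = D / 8 ^ l"
    proof -
      have "((2::real) ^ l) ^ 3 = 8 ^ l" by (simp flip: power_mult) (simp add: power_mult mult.commute[of l])
      then show ?thesis by (simp add: h_def power_divide)
    qed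
    also have "h powr (1 / 4 - \<delta>) = (2 powr - (1 / 4 - \<delta>)) ^ l" unfolding h_def by (rule dyadic_power_powr)
    finally show "prob {\<omega> \<in> space M. (C + 1) * (2 powr - (1 / 4 - \<delta>)) ^ l
      < \<bar>X m (real (k + 1) / 2 ^ l) \<omega> - X m (real k / 2 ^ l) \<omega>\<bar>} \<le> D / 8 ^ l"
      unfolding sh s_def .
  qed (use C D in auto)
qed

text \<open>The constants of \<open>X_dyadic_increment\<close> do not depend on the number of
  particles, so chaining gives a modulus of continuity uniform in \<open>n\<close>; continuity
  identifies the limit along dyadic floors with the path itself. Any positive Hoelder exponent
  serves here, and \<open>1 / 8\<close> is taken.\<close>

lemma X_tight_paths:
  assumes e: "0 < e"
  shows "\<exists>m0. \<forall>m\<ge>m0. \<forall>n. \<exists>A\<in>events. prob A \<le> e \<and> (\<forall>\<omega>\<in>space M - A.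
    dist (interp_cpath m (\<lambda>k. Rep_cpath (path_of (scaled_median_process B (2 * n + 1)) \<omega>) (real k / 2 ^ m)))
      (path_of (scaled_median_process B (2 * n + 1)) \<omega>) \<le> e)"
proof -
  obtain T0 :: nat where T0: "1 / e < real T0" using reals_Archimedean2 by blast
  have T1: "1 / (1 + real T0) \<le> e"
  proof -
    have "1 < e * real T0" using T0 e by (simp add: field_simps)
    then have "1 \<le> e * (1 + real T0)" using e by (simp add: distrib_left)
    then show ?thesis by (simp add: divide_le_eq add_pos_nonneg)
  qed
  \<comment> \<open>One unit beyond the horizon \<open>T0\<close> of the metric, because
    interpolation near \<open>T0\<close> uses grid points to its right.\<close>
  define T where "T = T0 + 1"
  define r :: real where "r = 2 powr - (1 / 4 - 1 / 8)"
  have r: "0 < r" "r < 1" by (simp_all add: r_def powr_less_one)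
  have d8: "0 < (1 / 8 :: real)" "(1 / 8 :: real) < 1 / 4" by simp_all
  obtain C D where C: "0 < C" and D: "0 \<le> D"
    and inc: "\<And>m l k. k + 1 \<le> T * 2 ^ l \<Longrightarrow> prob {\<omega> \<in> space M. C * r ^ l
      < \<bar>X m (real (k + 1) / 2 ^ l) \<omega> - X m (real k / 2 ^ l) \<omega>\<bar>} \<le> D / 8 ^ l"
    by (rule X_dyadic_increment[OF d8, of T, folded r_def]) (rule that)
  have "(\<lambda>l. 2 * real T * D * (1 / 4) ^ l) \<longlonglongrightarrow> 2 * real T * D * 0"
    by (intro tendsto_intros LIMSEQ_power_zero) auto
  then have "\<forall>\<^sub>F l in sequentially. 2 * real T * D * (1 / 4) ^ l < e"
    by (rule order_tendstoD) (use e in simp)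
  moreover have "(\<lambda>l. C * (1 + 2 / (1 - r)) * r ^ l) \<longlonglongrightarrow> C * (1 + 2 / (1 - r)) * 0"
    using r by (intro tendsto_intros LIMSEQ_power_zero) auto
  then have "\<forall>\<^sub>F l in sequentially. C * (1 + 2 / (1 - r)) * r ^ l < e"
    by (rule order_tendstoD) (use e in simp)
  moreover have "\<forall>\<^sub>F l in sequentially. T \<le> l" by (rule eventually_ge_at_top)
  ultimately have "\<forall>\<^sub>F l in sequentially. 2 * real T * D * (1 / 4) ^ l < e \<and>
      C * (1 + 2 / (1 - r)) * r ^ l < e \<and> T \<le> l"
    by eventually_elim simp
  from eventually_happens'[OF sequentially_bot this]
  obtain l0 where l0: "2 * real T * D * (1 / 4) ^ l0 < e" "C * (1 + 2 / (1 - r)) * r ^ l0 < e" "T \<le> l0"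
    by auto
  show ?thesis
  proof (intro exI[of _ l0] allI impI)
    fix m n assume m: "l0 \<le> m"
    let ?Y = "path_of (scaled_median_process B (2 * n + 1))"
    have "\<exists>A\<in>events. prob A \<le> 2 * real T * D * (1 / 4) ^ l0 \<and>
        (\<forall>\<omega>\<in>space M - A. dyadic_increments (\<lambda>d. X n d \<omega>) C r l0 T)"
      by (rule dyadic_chaining_event[OF scaled_median_measurable inc _ r D]) (use C in auto)
    then obtain A where A: "A \<in> events" "prob A \<le> 2 * real T * D * (1 / 4) ^ l0"
      "\<forall>\<omega>\<in>space M - A. dyadic_increments (\<lambda>d. X n d \<omega>) C r l0 T"
      by (elim bexE conjE)
    show "\<exists>A\<in>events. prob A \<le> e \<and>
        (\<forall>\<omega>\<in>space M - A. dist (interp_cpath m (\<lambda>k. Rep_cpath (?Y \<omega>) (real k / 2 ^ m))) (?Y \<omega>) \<le> e)"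
    proof (intro bexI[OF _ A(1)] conjI ballI)
      show "prob A \<le> e" using A(2) l0(1) by linarith
      fix \<omega> assume w: "\<omega> \<in> space M - A"
      interpret dyadic_increments "\<lambda>d. X n d \<omega>" C r l0 T by (rule A(3)[rule_format, OF w])
      have cont: "continuous_on {0..} (\<lambda>t. X n t \<omega>)"
        using continuous_scaled_median[of n] w by (simp add: continuous_process_def)
      have Rep: "Rep_cpath (?Y \<omega>) t = X n t \<omega>" if "0 \<le> t" for t
        by (rule Rep_path_of[where X = "X n" and \<omega> = \<omega>, OF cont that])
      have lim: "(\<lambda>i. X n (dyadic_floor i t) \<omega>) \<longlonglongrightarrow> X n t \<omega>" if t: "0 \<le> t" for t
      proof -
        have "(\<lambda>i. dyadic_floor i t) \<longlonglongrightarrow> t"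
        proof (rule tendsto_sandwich)
          show "\<forall>\<^sub>F i in sequentially. t - (1 / 2) ^ i \<le> dyadic_floor i t"
            using dyadic_floor_bounds(3)[OF t] by (intro always_eventually allI)
              (simp add: power_one_over diff_le_eq less_imp_le)
          show "\<forall>\<^sub>F i in sequentially. dyadic_floor i t \<le> t"
            using dyadic_floor_bounds(2)[OF t] by simp
          have "(\<lambda>i. t - (1 / 2) ^ i) \<longlonglongrightarrow> t - 0" by (intro tendsto_intros LIMSEQ_power_zero) auto
          then show "(\<lambda>i. t - (1 / 2) ^ i) \<longlonglongrightarrow> t" by simp
        qed simp
        then show ?thesis
          by (rule continuous_on_tendsto_compose[OF cont]) (use t dyadic_floor_bounds(1)[OF t] in auto)
      qed
      show "dist (interp_cpath m (\<lambda>k. Rep_cpath (?Y \<omega>) (real k / 2 ^ m))) (?Y \<omega>) \<le> e"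
      proof (rule dist_interp_cpath_le[of "real T0"])
        show "real T0 + 1 \<le> real m" using l0(3) m by (simp add: T_def)
        show "1 / (1 + real T0) \<le> e" by (rule T1)
        fix s t assume st: "0 \<le> s" "0 \<le> t" "s \<le> real T0 + 1" "t \<le> real T0 + 1" "\<bar>s - t\<bar> \<le> 1 / 2 ^ m"
        have "\<bar>X n s \<omega> - X n t \<omega>\<bar> \<le> C * (1 + 2 / (1 - r)) * r ^ m"
          by (rule limit_modulus[OF lim]) (use st m in \<open>auto simp: T_def\<close>)
        also have "\<dots> \<le> C * (1 + 2 / (1 - r)) * r ^ l0"
          using C r m by (intro mult_left_mono power_decreasing) auto
        finally show "\<bar>Rep_cpath (?Y \<omega>) s - Rep_cpath (?Y \<omega>) t\<bar> \<le> e" using l0(2) Rep st by simp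
      qed simp
    qed
  qed
qed

section \<open>Construction of the continuous limit process\<close>

context
  fixes W :: "nat \<Rightarrow> 'a \<Rightarrow> real"
  assumes W: "\<And>k. W k \<in> borel_measurable M"
    and W_cos: "\<And>b c K. expectation (\<lambda>\<omega>. cos (b + (\<Sum>k<K. c k * W k \<omega>))) = cos b * exp (- form K c dy / 2)"
begin

lemma X_dyadic_weak:
  fixes F :: "(nat \<Rightarrow> real) \<Rightarrow> real"
  assumes "continuous_on UNIV F" "\<And>x. \<bar>F x\<bar> \<le> b"
  shows "(\<lambda>m. expectation (\<lambda>\<omega>. F (\<lambda>k. X m (dy k) \<omega>))) \<longlonglongrightarrow> expectation (\<lambda>\<omega>. F (\<lambda>k. W k \<omega>))"
proof (rule weak_convergence_of_cosines[where G = F and V = "\<lambda>m \<omega> k. X m (dy k) \<omega>" and W = "\<lambda>\<omega> k. W k \<omega>",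
      OF prob_space_axioms prob_space_axioms])
  show "(\<lambda>\<omega>. X m (dy k) \<omega>) \<in> borel_measurable M" for m k by (rule scaled_median_measurable[OF dy_nonneg])
  show "(\<lambda>\<omega>. W k \<omega>) \<in> borel_measurable M" for k by (rule W)
  show "(\<lambda>m. expectation (\<lambda>\<omega>. cos (b + (\<Sum>k<K. c k * X m (dy k) \<omega>)))) \<longlonglongrightarrow>
      expectation (\<lambda>\<omega>. cos (b + (\<Sum>k<K. c k * W k \<omega>)))" for b c K
    unfolding W_cos by (rule X_cosine[OF dy_nonneg])
  show "\<exists>R. \<forall>m. prob {\<omega> \<in> space M. R < \<bar>X m (dy k) \<omega>\<bar>} \<le> e" if "0 < e" for k e
    by (rule X_tight[OF dy_nonneg that])
qed (use assms in auto)

text \<open>Weak convergence asks for a continuous test function, so \<open>\<psi>\<close> is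
  squeezed between the indicators of \<open>2 * a < \<bar>z\<bar>\<close> and
  \<open>a < \<bar>z\<bar>\<close>; this doubles the threshold and keeps the probability.\<close>

lemma W_increment:
  assumes a: "0 < a"
    and le: "\<And>m. prob {\<omega> \<in> space M. a < \<bar>X m (real k / 2 ^ l) \<omega> - X m (real k' / 2 ^ l') \<omega>\<bar>} \<le> p"
  shows "prob {\<omega> \<in> space M. 2 * a < \<bar>W (dy_index (real k / 2 ^ l)) \<omega> - W (dy_index (real k' / 2 ^ l')) \<omega>\<bar>} \<le> p"
proof -
  define \<psi> where "\<psi> z = min 1 (max 0 (\<bar>z\<bar> / a - 1))" for z :: real
  have \<psi>: "of_bool (2 * a < \<bar>z\<bar>) \<le> \<psi> z" "\<psi> z \<le> of_bool (a < \<bar>z\<bar>)" "\<bar>\<psi> z\<bar> \<le> 1" for z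
    using a by (auto simp: \<psi>_def field_simps)
  have \<psi>c: "continuous_on UNIV \<psi>" unfolding \<psi>_def using a by (intro continuous_intros) auto
  have \<psi>m: "\<psi> \<in> borel_measurable borel" by (rule borel_measurable_continuous_onI[OF \<psi>c])
  let ?i = "dy_index (real k / 2 ^ l)" and ?j = "dy_index (real k' / 2 ^ l')"
  define F where "F x = \<psi> (x ?i - x ?j)" for x :: "nat \<Rightarrow> real"
  have F: "continuous_on UNIV F"
    unfolding F_def
    by (rule continuous_on_compose2[OF \<psi>c])
      (auto intro!: continuous_on_diff continuous_on_product_coordinates)
  have lim: "(\<lambda>m. expectation (\<lambda>\<omega>. F (\<lambda>k. X m (dy k) \<omega>))) \<longlonglongrightarrow> expectation (\<lambda>\<omega>. F (\<lambda>k. W k \<omega>))"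
    by (rule X_dyadic_weak[OF F, of 1]) (simp add: F_def \<psi>(3))
  have "expectation (\<lambda>\<omega>. F (\<lambda>k. X m (dy k) \<omega>)) \<le> p" for m
  proof -
    let ?D = "\<lambda>\<omega>. X m (real k / 2 ^ l) \<omega> - X m (real k' / 2 ^ l') \<omega>"
    have Dm[measurable]: "?D \<in> borel_measurable M"
      by (intro borel_measurable_diff scaled_median_measurable) auto
    have "expectation (\<lambda>\<omega>. F (\<lambda>k. X m (dy k) \<omega>)) = expectation (\<lambda>\<omega>. \<psi> (?D \<omega>))"
      by (simp only: F_def dy_index)
    also have "\<dots> \<le> expectation (\<lambda>\<omega>. of_bool (a < \<bar>?D \<omega>\<bar>))"
    proof (rule integral_mono)
      show "integrable M (\<lambda>\<omega>. \<psi> (?D \<omega>))"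
        by (rule integrable_const_bound[of _ 1, OF _ measurable_compose[OF Dm \<psi>m]]) (use \<psi>(3) in simp)
      show "integrable M (\<lambda>\<omega>. of_bool (a < \<bar>?D \<omega>\<bar>) :: real)" by (rule expectation_of_bool) measurable
    qed (rule \<psi>(2))
    also have "\<dots> = prob {\<omega> \<in> space M. a < \<bar>?D \<omega>\<bar>}" by (rule expectation_of_bool) measurable
    also have "\<dots> \<le> p" by (rule le)
    finally show ?thesis .
  qed
  then have Fp: "expectation (\<lambda>\<omega>. F (\<lambda>k. W k \<omega>)) \<le> p" by (intro LIMSEQ_le_const2[OF lim]) auto
  let ?D = "\<lambda>\<omega>. W ?i \<omega> - W ?j \<omega>"
  have Dm[measurable]: "?D \<in> borel_measurable M" by (intro borel_measurable_diff W)
  have "prob {\<omega> \<in> space M. 2 * a < \<bar>?D \<omega>\<bar>} = expectation (\<lambda>\<omega>. of_bool (2 * a < \<bar>?D \<omega>\<bar>))"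
    by (rule expectation_of_bool(2)[symmetric]) measurable
  also have "\<dots> \<le> expectation (\<lambda>\<omega>. \<psi> (?D \<omega>))"
  proof (rule integral_mono)
    show "integrable M (\<lambda>\<omega>. \<psi> (?D \<omega>))"
      by (rule integrable_const_bound[of _ 1, OF _ measurable_compose[OF Dm \<psi>m]]) (use \<psi>(3) in simp)
    show "integrable M (\<lambda>\<omega>. of_bool (2 * a < \<bar>?D \<omega>\<bar>) :: real)" by (rule expectation_of_bool) measurable
  qed (rule \<psi>(1))
  also have "\<dots> \<le> p" using Fp by (simp only: F_def)
  finally show ?thesis .
qed

lemma W_dyadic_increments_AE:
  fixes T :: nat
  assumes \<delta>: "0 < \<delta>" "\<delta> < 1 / 4"
  shows "AE \<omega> in M. \<exists>C l0. dyadic_increments (\<lambda>d. W (dy_index d) \<omega>) C (2 powr - (1 / 4 - \<delta>)) l0 T"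
proof -
  obtain C D where C: "0 < C" and D: "0 \<le> D"
    and inc: "\<And>m l k. k + 1 \<le> T * 2 ^ l \<Longrightarrow> prob {\<omega> \<in> space M. C * (2 powr - (1 / 4 - \<delta>)) ^ l
      < \<bar>X m (real (k + 1) / 2 ^ l) \<omega> - X m (real k / 2 ^ l) \<omega>\<bar>} \<le> D / 8 ^ l"
    by (rule X_dyadic_increment[OF \<delta>, of T]) (rule that)
  show ?thesis
  proof (rule dyadic_chaining_AE[of "\<lambda>d. W (dy_index d)" T "2 * C" _ D])
    show "prob {\<omega> \<in> space M. 2 * C * (2 powr - (1 / 4 - \<delta>)) ^ l
        < \<bar>W (dy_index (real (k + 1) / 2 ^ l)) \<omega> - W (dy_index (real k / 2 ^ l)) \<omega>\<bar>} \<le> D / 8 ^ l"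
      if "k + 1 \<le> T * 2 ^ l" for l k
      using W_increment[of "C * (2 powr - (1 / 4 - \<delta>)) ^ l", OF _ inc[OF that]] C by (simp add: mult.assoc)
    show "2 powr - (1 / 4 - \<delta>) < 1" using \<delta> by (simp add: powr_less_one)
  qed (use W C D in auto)
qed

text \<open>Countably many exponents \<open>1 / 4 - \<delta> j\<close> and horizons \<open>T\<close>
  share one null set. Off it \<open>Y\<close> extends \<open>W\<close> along dyadic floors; on it
  \<open>Y\<close> is 0, so that every path, and not just almost every one, is continuous and
  Hoelder.\<close>

lemma limit_process_exists:
  obtains Y :: "real \<Rightarrow> 'a \<Rightarrow> real"
  where "continuous_process M Y"
    "\<And>\<omega> \<gamma>. 0 < \<gamma> \<Longrightarrow> \<gamma> < 1 / 4 \<Longrightarrow> locally_holder \<gamma> (\<lambda>t. Y t \<omega>)"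
    "AE \<omega> in M. \<forall>k l. Y (real k / 2 ^ l) \<omega> = W (dy_index (real k / 2 ^ l)) \<omega>"
proof -
  \<comment> \<open>Tends to 0, so that the exponents \<open>1 / 4 - \<delta> j\<close> exhaust the
    range below \<open>1 / 4\<close>; the index 0 serves where only convergence or continuity is at
    stake.\<close>
  define \<delta> where "\<delta> j = 1 / (4 * (real j + 2))" for j :: nat
  have \<delta>: "0 < \<delta> j" "\<delta> j < 1 / 4" for j by (simp_all add: \<delta>_def field_simps)
  define r where "r j = 2 powr - (1 / 4 - \<delta> j)" for j
  have "AE \<omega> in M. \<forall>j T. \<exists>C l0. dyadic_increments (\<lambda>d. W (dy_index d) \<omega>) C (r j) l0 T"
    unfolding AE_all_countable r_def using W_dyadic_increments_AE[OF \<delta>] by blast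
  then obtain N where N: "N \<in> null_sets M"
    "{\<omega> \<in> space M. \<not> (\<forall>j T. \<exists>C l0. dyadic_increments (\<lambda>d. W (dy_index d) \<omega>) C (r j) l0 T)} \<subseteq> N"
    by (auto simp: eventually_ae_filter)
  define Y where "Y t \<omega> = (if \<omega> \<in> space M - N then lim (\<lambda>m. W (dy_index (dyadic_floor m t)) \<omega>) else 0)" for t \<omega>
  have good: "\<exists>C l0. dyadic_increments (\<lambda>d. W (dy_index d) \<omega>) C (r j) l0 T" if "\<omega> \<in> space M - N" for \<omega> j T
    using N(2) that by blast
  have tends: "(\<lambda>m. W (dy_index (dyadic_floor m t)) \<omega>) \<longlonglongrightarrow> Y t \<omega>" if w: "\<omega> \<in> space M - N" and t: "0 \<le> t" for \<omega> t
  proof -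
    obtain T :: nat where T: "t < real T" using reals_Archimedean2 by blast
    obtain C l0 where "dyadic_increments (\<lambda>d. W (dy_index d) \<omega>) C (r 0) l0 T" using good[OF w] by blast
    from dyadic_increments.convergent_dyadic[OF this t] T
    have "convergent (\<lambda>m. W (dy_index (dyadic_floor m t)) \<omega>)" by simp
    then show ?thesis using w by (simp add: Y_def convergent_LIMSEQ_iff)
  qed
  have hol: "\<exists>K. \<forall>s\<in>{0..real T}. \<forall>t\<in>{0..real T}. \<bar>Y t \<omega> - Y s \<omega>\<bar> \<le> K * \<bar>t - s\<bar> powr (1 / 4 - \<delta> j)"
    if w: "\<omega> \<in> space M - N" for \<omega> j and T :: nat
  proof -
    obtain C l0 where "dyadic_increments (\<lambda>d. W (dy_index d) \<omega>) C (r j) l0 T" using good[OF w] by blast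
    from dyadic_increments.limit_Holder[OF this, of "\<lambda>t. Y t \<omega>" "1 / 4 - \<delta> j"] tends[OF w] \<delta>[of j]
    show ?thesis by (simp add: r_def)
  qed
  have Nm: "space M - N \<in> events" using N(1) by auto
  show ?thesis
  proof (rule that[of Y])
    show "continuous_process M Y"
      unfolding continuous_process_def
    proof (intro conjI allI impI ballI)
      fix t :: real assume "0 \<le> t"
      have "(\<lambda>\<omega>. lim (\<lambda>m. W (dy_index (dyadic_floor m t)) \<omega>)) \<in> borel_measurable M"
        by (rule borel_measurable_lim_metric) (rule W)
      then show "Y t \<in> borel_measurable M"
        unfolding Y_def using Nm by (intro measurable_If_set) auto
    next
      fix \<omega> assume "\<omega> \<in> space M"
      show "continuous_on {0..} (\<lambda>t. Y t \<omega>)"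
      proof (cases "\<omega> \<in> space M - N")
        case True
        show ?thesis
        proof (rule continuous_on_halfline)
          fix T :: nat
          obtain C l0 where "dyadic_increments (\<lambda>d. W (dy_index d) \<omega>) C (r 0) l0 T" using good[OF True] by blast
          from dyadic_increments.limit_continuous_on[OF this tends[OF True]]
          show "continuous_on {0..real T} (\<lambda>t. Y t \<omega>)" .
        qed
      next
        case False
        then have "Y t \<omega> = 0" for t by (simp only: Y_def if_False)
        then show ?thesis by simp
      qed
    qed
    show "locally_holder \<gamma> (\<lambda>t. Y t \<omega>)" if g: "0 < \<gamma>" "\<gamma> < 1 / 4" for \<omega> \<gamma>
    proof (cases "\<omega> \<in> space M - N")
      case True
      obtain j :: nat where j: "1 / (1 / 4 - \<gamma>) < real j" using reals_Archimedean2 by blast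
      have "\<delta> j \<le> 1 / 4 - \<gamma>"
      proof -
        have "1 < (1 / 4 - \<gamma>) * real j" using j g by (simp add: field_simps)
        also have "\<dots> \<le> (1 / 4 - \<gamma>) * (4 * (real j + 2))" using g by (intro mult_left_mono) auto
        finally show ?thesis by (simp add: \<delta>_def divide_le_eq add_nonneg_pos)
      qed
      then show ?thesis by (intro locally_holder_weaken[OF hol[OF True, of _ j]]) simp
    next
      case False
      then have "Y t \<omega> = 0" for t by (simp only: Y_def if_False)
      then show ?thesis by (auto simp: locally_holder_def intro!: exI[of _ 0])
    qed
    have "AE \<omega> in M. \<omega> \<notin> N" using N(1) by (rule AE_not_in)
    then show "AE \<omega> in M. \<forall>k l. Y (real k / 2 ^ l) \<omega> = W (dy_index (real k / 2 ^ l)) \<omega>"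
      using AE_space
    proof eventually_elim
      case (elim \<omega>)
      show ?case
      proof (intro allI)
        fix k l :: nat
        have "(\<lambda>m. W (dy_index (dyadic_floor m (real k / 2 ^ l))) \<omega>) \<longlonglongrightarrow> Y (real k / 2 ^ l) \<omega>"
          by (rule tends) (use elim in auto)
        moreover have "(\<lambda>m. W (dy_index (dyadic_floor m (real k / 2 ^ l))) \<omega>) \<longlonglongrightarrow> W (dy_index (real k / 2 ^ l)) \<omega>"
          by (rule tendsto_eventually)
            (use eventually_ge_at_top[of l] in eventually_elim, simp add: dyadic_floor_dyadic)
        ultimately show "Y (real k / 2 ^ l) \<omega> = W (dy_index (real k / 2 ^ l)) \<omega>" by (rule LIMSEQ_unique)
      qed
    qed
  qed
qed

end

text \<open>At dyadic times \<open>Y\<close> agrees almost surely with \<open>W\<close>, the weak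
  limit of the medians there; this and the uniform interpolation error are the two inputs of
  \<open>cpath_converges_in_law\<close>.\<close>

lemma converges_to_continuous_limit:
  obtains Y :: "real \<Rightarrow> 'a \<Rightarrow> real"
  where "continuous_process M Y"
    "\<And>\<omega> \<gamma>. 0 < \<gamma> \<Longrightarrow> \<gamma> < 1 / 4 \<Longrightarrow> locally_holder \<gamma> (\<lambda>t. Y t \<omega>)"
    "converges_in_law M (\<lambda>n. path_of (scaled_median_process B (2 * n + 1))) M (path_of Y)"
proof -
  obtain W where W: "\<And>k. W k \<in> borel_measurable M"
    "\<And>b c K. expectation (\<lambda>\<omega>. cos (b + (\<Sum>k<K. c k * W k \<omega>))) = cos b * exp (- form K c dy / 2)"
    by (rule dyadic_Gaussian_exists) (rule that)
  obtain Y where Y: "continuous_process M Y"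
    "\<And>\<omega> \<gamma>. 0 < \<gamma> \<Longrightarrow> \<gamma> < 1 / 4 \<Longrightarrow> locally_holder \<gamma> (\<lambda>t. Y t \<omega>)"
    "AE \<omega> in M. \<forall>k l. Y (real k / 2 ^ l) \<omega> = W (dy_index (real k / 2 ^ l)) \<omega>"
    by (rule limit_process_exists[OF W]) (rule that)
  have RepX: "Rep_cpath (path_of (scaled_median_process B (2 * n + 1)) \<omega>) t = X n t \<omega>"
    if "\<omega> \<in> space M" "0 \<le> t" for n \<omega> t
    using continuous_scaled_median[of n] that by (intro Rep_path_of) (simp_all add: continuous_process_def)
  have RepY: "Rep_cpath (path_of Y \<omega>) t = Y t \<omega>" if "\<omega> \<in> space M" "0 \<le> t" for \<omega> t
    using Y(1) that by (intro Rep_path_of) (simp_all add: continuous_process_def)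
  have conv: "converges_in_law M (\<lambda>n. path_of (scaled_median_process B (2 * n + 1))) M (path_of Y)"
  proof (rule cpath_converges_in_law[OF prob_space_axioms prob_space_axioms])
    show "path_of (scaled_median_process B (2 * n + 1)) \<in> measurable M borel" for n
      by (rule measurable_path_of[OF continuous_scaled_median])
    show "path_of Y \<in> measurable M borel" by (rule measurable_path_of[OF Y(1)])
  next
    fix F :: "(nat \<Rightarrow> real) \<Rightarrow> real" and b m
    assume F: "continuous_on UNIV F" and b: "\<And>x. \<bar>F x\<bar> \<le> b"
    have Fm: "F \<in> borel_measurable borel" using F by (rule borel_measurable_continuous_onI)
    define s where "s k = real k / 2 ^ m" for k
    have s: "0 \<le> s k" for k by (simp add: s_def)
    have cF: "continuous_on UNIV (\<lambda>x. F (\<lambda>k. x (dy_index (s k))))"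
      by (rule continuous_on_compose2[OF F])
        (auto intro!: continuous_on_coordinatewise_then_product continuous_on_product_coordinates)
    have lim: "(\<lambda>n. expectation (\<lambda>\<omega>. F (\<lambda>k. X n (dy (dy_index (s k))) \<omega>))) \<longlonglongrightarrow>
        expectation (\<lambda>\<omega>. F (\<lambda>k. W (dy_index (s k)) \<omega>))"
      by (rule X_dyadic_weak[OF W cF b])
    have X_eq: "expectation (\<lambda>\<omega>. F (\<lambda>k. Rep_cpath (path_of (scaled_median_process B (2 * n + 1)) \<omega>) (s k)))
        = expectation (\<lambda>\<omega>. F (\<lambda>k. X n (dy (dy_index (s k))) \<omega>))" for n
    proof (rule Bochner_Integration.integral_cong[OF refl])
      fix \<omega> assume "\<omega> \<in> space M"
      then have "Rep_cpath (path_of (scaled_median_process B (2 * n + 1)) \<omega>) (s k) = X n (dy (dy_index (s k))) \<omega>" for k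
        using RepX[OF _ s] by (simp only: s_def dy_index)
      then show "F (\<lambda>k. Rep_cpath (path_of (scaled_median_process B (2 * n + 1)) \<omega>) (s k))
        = F (\<lambda>k. X n (dy (dy_index (s k))) \<omega>)" by (simp only:)
    qed
    have "expectation (\<lambda>\<omega>. F (\<lambda>k. Y (s k) \<omega>)) = expectation (\<lambda>\<omega>. F (\<lambda>k. W (dy_index (s k)) \<omega>))"
    proof (rule integral_cong_AE)
      have "(\<lambda>\<omega> k. Y (s k) \<omega>) \<in> borel_measurable M"
        using Y(1) s by (intro measurable_coordinatewise_then_product) (simp add: continuous_process_def)
      then show "(\<lambda>\<omega>. F (\<lambda>k. Y (s k) \<omega>)) \<in> borel_measurable M" by (rule measurable_compose[OF _ Fm])
      have "(\<lambda>\<omega> k. W (dy_index (s k)) \<omega>) \<in> borel_measurable M"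
        by (intro measurable_coordinatewise_then_product W(1))
      then show "(\<lambda>\<omega>. F (\<lambda>k. W (dy_index (s k)) \<omega>)) \<in> borel_measurable M" by (rule measurable_compose[OF _ Fm])
      show "AE \<omega> in M. F (\<lambda>k. Y (s k) \<omega>) = F (\<lambda>k. W (dy_index (s k)) \<omega>)"
        using Y(3) by eventually_elim (simp add: s_def)
    qed
    moreover have "expectation (\<lambda>\<omega>. F (\<lambda>k. Rep_cpath (path_of Y \<omega>) (s k))) = expectation (\<lambda>\<omega>. F (\<lambda>k. Y (s k) \<omega>))"
      by (rule Bochner_Integration.integral_cong[OF refl]) (simp add: RepY s)
    ultimately have Y_eq: "expectation (\<lambda>\<omega>. F (\<lambda>k. Rep_cpath (path_of Y \<omega>) (s k)))
        = expectation (\<lambda>\<omega>. F (\<lambda>k. W (dy_index (s k)) \<omega>))" by simp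
    from lim show "(\<lambda>n. expectation (\<lambda>\<omega>. F (\<lambda>k. Rep_cpath (path_of (scaled_median_process B (2 * n + 1)) \<omega>) (real k / 2 ^ m))))
      \<longlonglongrightarrow> expectation (\<lambda>\<omega>. F (\<lambda>k. Rep_cpath (path_of Y \<omega>) (real k / 2 ^ m)))"
      unfolding X_eq[symmetric] Y_eq[symmetric] unfolding s_def .
  next
    fix e :: real assume "0 < e"
    then show "\<exists>m0. \<forall>m\<ge>m0. \<forall>n. \<exists>A\<in>events. prob A \<le> e \<and> (\<forall>\<omega>\<in>space M - A.
      dist (interp_cpath m (\<lambda>k. Rep_cpath (path_of (scaled_median_process B (2 * n + 1)) \<omega>) (real k / 2 ^ m)))
        (path_of (scaled_median_process B (2 * n + 1)) \<omega>) \<le> e)"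
      by (rule X_tight_paths)
  qed
  show ?thesis
  proof (rule that[of Y])
    show "locally_holder \<gamma> (\<lambda>t. Y t \<omega>)" if "0 < \<gamma>" "\<gamma> < 1 / 4" for \<omega> \<gamma> by (rule Y(2)[OF that])
  qed (rule Y(1) conv)+
qed

end

section \<open>Gaussian marginals of the limit\<close>

text \<open>The phases \<open>0\<close> and \<open>- (pi / 2)\<close> recover the real and imaginary
  part of the characteristic function, and Levy's uniqueness theorem identifies the law;
  \<open>v = 0\<close> gives the point mass at 0, which has no density.\<close>

lemma (in prob_space) normal_rv_of_cosines:
  fixes Y :: "'a \<Rightarrow> real"
  assumes Y: "Y \<in> borel_measurable M" and v: "0 \<le> v"
    and cosines: "\<And>b \<theta>. expectation (\<lambda>\<omega>. cos (b + \<theta> * Y \<omega>)) = cos b * exp (- (\<theta>\<^sup>2 * v / 2))"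
  shows "normal_rv M Y 0 v"
proof -
  note [measurable] = Y
  have char: "char (distr M borel Y) \<theta> = complex_of_real (exp (- (\<theta>\<^sup>2 * v / 2)))" for \<theta>
  proof -
    have "char (distr M borel Y) \<theta> = expectation (\<lambda>\<omega>. iexp (\<theta> * Y \<omega>))"
      unfolding char_def by (subst integral_distr) auto
    also have "\<dots> = Complex (expectation (\<lambda>\<omega>. cos (0 + \<theta> * Y \<omega>))) (expectation (\<lambda>\<omega>. cos (- (pi / 2) + \<theta> * Y \<omega>)))"
    proof -
      have int: "integrable M (\<lambda>\<omega>. iexp (\<theta> * Y \<omega>))" by (rule integrable_iexp) measurable
      have "Re (expectation (\<lambda>\<omega>. iexp (\<theta> * Y \<omega>))) = expectation (\<lambda>\<omega>. cos (0 + \<theta> * Y \<omega>))"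
        by (subst integral_Re[OF int, symmetric]) (simp add: Re_exp)
      moreover have "Im (expectation (\<lambda>\<omega>. iexp (\<theta> * Y \<omega>))) = expectation (\<lambda>\<omega>. cos (- (pi / 2) + \<theta> * Y \<omega>))"
      proof -
        have "cos (- (pi / 2) + y) = sin y" for y :: real by (subst cos_add) simp
        then show ?thesis by (subst integral_Im[OF int, symmetric]) (simp add: Im_exp)
      qed
      ultimately show ?thesis by (simp add: complex_eq_iff)
    qed
    also have "\<dots> = complex_of_real (exp (- (\<theta>\<^sup>2 * v / 2)))"
      unfolding cosines by (simp add: complex_eq_iff)
    finally show ?thesis .
  qed
  show ?thesis
  proof (cases "v = 0")
    case True
    have "distr M borel Y = return borel 0"
    proof (rule Levy_uniqueness)
      show "real_distribution (distr M borel Y)" by (rule real_distribution_distr[OF Y])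
      have "prob_space (return borel (0::real))" by (rule prob_space_return) simp
      then show "real_distribution (return borel (0::real))"
        by (simp add: real_distribution_def real_distribution_axioms_def)
      show "char (distr M borel Y) = char (return borel 0)"
      proof
        fix \<theta>
        have "char (return borel 0) \<theta> = 1" unfolding char_def by (subst integral_return) auto
        then show "char (distr M borel Y) \<theta> = char (return borel 0) \<theta>" by (simp add: char True)
      qed
    qed
    moreover have "AE x in return borel (0::real). x = 0" by (subst AE_return) auto
    ultimately have "AE x in distr M borel Y. x = 0" by (simp only:)
    then have "AE \<omega> in M. Y \<omega> = 0" by (subst (asm) AE_distr_iff) auto
    then show ?thesis using True Y by (simp add: normal_rv_def)
  next
    case False
    then have v: "0 < v" using v by simp
    have sv: "0 < sqrt v" using v by simp
    let ?Z = "\<lambda>\<omega>. (Y \<omega> - 0) / sqrt v"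
    have Zm: "?Z \<in> borel_measurable M" by measurable
    have "distr M borel ?Z = std_normal_distribution"
    proof (rule Levy_uniqueness)
      show "real_distribution (distr M borel ?Z)" by (rule real_distribution_distr[OF Zm])
      show "real_distribution std_normal_distribution" by (rule real_dist_normal_dist)
      show "char (distr M borel ?Z) = char std_normal_distribution"
      proof
        fix \<theta>
        have "char (distr M borel ?Z) \<theta> = char (distr M borel Y) (\<theta> / sqrt v)"
          unfolding char_def by (subst (1 2) integral_distr) auto
        also have "\<dots> = complex_of_real (exp (- (\<theta>\<^sup>2 / 2)))"
          unfolding char using v by (simp add: power_divide)
        finally show "char (distr M borel ?Z) \<theta> = char std_normal_distribution \<theta>"
          by (simp add: char_std_normal_distribution)
      qed
    qed
    then have "distributed M lborel ?Z std_normal_density"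
      unfolding distributed_def using Zm by (auto cong: distr_cong)
    then have "distributed M lborel Y (normal_density 0 (sqrt v))"
      by (subst normal_standard_normal_convert[OF sv])
    then show ?thesis using v Y by (simp add: normal_rv_def)
  qed
qed

lemma (in prob_space) normal_rv_moments:
  assumes "normal_rv M Y 0 v"
  shows "integrable M Y" "expectation Y = 0" "integrable M (\<lambda>\<omega>. (Y \<omega>)\<^sup>2)" "expectation (\<lambda>\<omega>. (Y \<omega>)\<^sup>2) = v"
proof -
  have Y[measurable]: "Y \<in> borel_measurable M" using assms by (simp add: normal_rv_def)
  have "integrable M Y \<and> expectation Y = 0 \<and> integrable M (\<lambda>\<omega>. (Y \<omega>)\<^sup>2) \<and> expectation (\<lambda>\<omega>. (Y \<omega>)\<^sup>2) = v"
  proof (cases "v = 0")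
    case True
    then have z: "AE \<omega> in M. Y \<omega> = 0" using assms by (simp add: normal_rv_def)
    then have z2: "AE \<omega> in M. (Y \<omega>)\<^sup>2 = 0" by eventually_elim simp
    have "integrable M Y" using integrable_cong_AE[of Y M "\<lambda>_. 0"] z by simp
    moreover have "integrable M (\<lambda>\<omega>. (Y \<omega>)\<^sup>2)"
      using integrable_cong_AE[of "\<lambda>\<omega>. (Y \<omega>)\<^sup>2" M "\<lambda>_. 0"] z2 by simp
    ultimately show ?thesis using True integral_eq_zero_AE[OF z] integral_eq_zero_AE[OF z2] by simp
  next
    case False
    then have v: "0 < v" and d: "distributed M lborel Y (normal_density 0 (sqrt v))"
      using assms by (auto simp: normal_rv_def)
    have sv: "0 < sqrt v" using v by simp
    have E: "expectation Y = 0" by (rule normal_distributed_expectation[OF sv d])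
    have i1: "integrable M Y"
      using distributed_integrable[OF d, of "\<lambda>x. x"] integrable_normal_moment[OF sv, of 0 1] by simp
    have i2: "integrable M (\<lambda>\<omega>. (Y \<omega>)\<^sup>2)"
      using distributed_integrable[OF d, of "\<lambda>x. x\<^sup>2"] integrable_normal_moment[OF sv, of 0 2] by simp
    have "variance Y = v" using normal_distributed_variance[OF sv d] v by simp
    then show ?thesis using E i1 i2 by simp
  qed
  then show "integrable M Y" "expectation Y = 0" "integrable M (\<lambda>\<omega>. (Y \<omega>)\<^sup>2)" "expectation (\<lambda>\<omega>. (Y \<omega>)\<^sup>2) = v"
    by auto
qed

context brownian_family
begin

text \<open>A linear combination of evaluations is continuous on the path space, so convergence in
  law together with \<open>X_cosine\<close> determines its cosines. This works for any limit in law
  and at arbitrary times, not only dyadic ones.\<close>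

lemma limit_normal_rv:
  assumes N: "prob_space N"
    and conv: "converges_in_law M (\<lambda>n. path_of (scaled_median_process B (2 * n + 1))) N P"
    and J: "finite J" "J \<subseteq> {0..}"
  shows "normal_rv N (\<lambda>\<omega>. \<Sum>t\<in>J. c t * Rep_cpath (P \<omega>) t) 0 (\<Sum>s\<in>J. \<Sum>t\<in>J. c s * c t * median_cov s t)"
proof -
  interpret N: prob_space N by fact
  obtain h where h: "bij_betw h {0..<card J} J" using ex_bij_betw_nat_finite[OF J(1)] by blast
  define K where "K = card J"
  \<comment> \<open>The value 0 from \<open>K\<close> on keeps all times nonnegative, as the lemmas
    on sequences of times require.\<close>
  define \<tau> where "\<tau> k = (if k < K then h k else 0)" for k
  have hJ: "bij_betw \<tau> {..<K} J"
    using h by (subst bij_betw_cong[of _ \<tau> h]) (auto simp: \<tau>_def K_def atLeast0LessThan)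
  have \<tau>: "0 \<le> \<tau> k" for k
  proof (cases "k < K")
    case True
    then have "\<tau> k \<in> J" using bij_betw_apply[OF hJ] by simp
    then show ?thesis using J(2) by auto
  qed (simp add: \<tau>_def)
  have sum_J: "(\<Sum>t\<in>J. f t) = (\<Sum>k<K. f (\<tau> k))" for f :: "real \<Rightarrow> real"
    using sum.reindex_bij_betw[OF hJ] by metis
  define v where "v = (\<Sum>s\<in>J. \<Sum>t\<in>J. c s * c t * median_cov s t)"
  have v: "v = form K (\<lambda>k. c (\<tau> k)) \<tau>" by (simp only: v_def sum_J)
  define f where "f p = (\<Sum>t\<in>J. c t * Rep_cpath p t)" for p
  have fc: "continuous_on UNIV f"
    unfolding f_def using J(2) by (intro continuous_on_sum continuous_on_mult continuous_on_const continuous_on_eval_cpath) auto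
  have Zm: "P \<in> measurable N borel" using conv by (simp add: converges_in_law_def)
  have fZ: "(\<lambda>\<omega>. f (P \<omega>)) \<in> borel_measurable N"
    by (rule measurable_compose[OF Zm borel_measurable_continuous_onI[OF fc]])
  have fX: "f (path_of (scaled_median_process B (2 * n + 1)) \<omega>) = (\<Sum>k<K. c (\<tau> k) * X n (\<tau> k) \<omega>)"
    if "\<omega> \<in> space M" for n \<omega>
  proof -
    have "Rep_cpath (path_of (scaled_median_process B (2 * n + 1)) \<omega>) (\<tau> k) = X n (\<tau> k) \<omega>" for k
      using continuous_scaled_median[of n] that \<tau> by (intro Rep_path_of) (simp_all add: continuous_process_def)
    then show ?thesis unfolding f_def sum_J by (simp only:)
  qed
  have "normal_rv N (\<lambda>\<omega>. f (P \<omega>)) 0 v"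
  proof (rule N.normal_rv_of_cosines[OF fZ])
    show "0 \<le> v" unfolding v by (rule form_nonneg[OF \<tau>])
    fix b \<theta>
    have "continuous_on UNIV (\<lambda>p. cos (b + \<theta> * f p))" by (intro continuous_intros fc)
    moreover have "bounded (range (\<lambda>p. cos (b + \<theta> * f p)))" by (auto simp: bounded_iff intro!: exI[of _ 1])
    ultimately have 1: "(\<lambda>n. expectation (\<lambda>\<omega>. cos (b + \<theta> * f (path_of (scaled_median_process B (2 * n + 1)) \<omega>))))
        \<longlonglongrightarrow> N.expectation (\<lambda>\<omega>. cos (b + \<theta> * f (P \<omega>)))"
      using conv unfolding converges_in_law_def by blast
    have eq: "expectation (\<lambda>\<omega>. cos (b + \<theta> * f (path_of (scaled_median_process B (2 * n + 1)) \<omega>)))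
        = expectation (\<lambda>\<omega>. cos (b + (\<Sum>k<K. (\<theta> * c (\<tau> k)) * X n (\<tau> k) \<omega>)))" for n
      by (rule Bochner_Integration.integral_cong[OF refl]) (simp only: fX sum_distrib_left mult.assoc)
    have 2: "(\<lambda>n. expectation (\<lambda>\<omega>. cos (b + \<theta> * f (path_of (scaled_median_process B (2 * n + 1)) \<omega>))))
        \<longlonglongrightarrow> cos b * exp (- form K (\<lambda>k. \<theta> * c (\<tau> k)) \<tau> / 2)"
      unfolding eq by (rule X_cosine[OF \<tau>])
    have "form K (\<lambda>k. \<theta> * c (\<tau> k)) \<tau> = \<theta>\<^sup>2 * v"
      unfolding v by (simp add: sum_distrib_left power2_eq_square mult_ac)
    then show "N.expectation (\<lambda>\<omega>. cos (b + \<theta> * f (P \<omega>))) = cos b * exp (- (\<theta>\<^sup>2 * v / 2))"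
      using LIMSEQ_unique[OF 1 2] by simp
  qed
  then show ?thesis by (simp only: f_def v_def)
qed

end

theorem theorem2p1:
  fixes M :: "'a measure" and B :: "nat \<Rightarrow> real \<Rightarrow> 'a \<Rightarrow> real"
  assumes "prob_space M"
    and "\<And>j. j \<ge> 1 \<Longrightarrow> brownian_motion M (B j)"
    and "independent_processes M B {1..}"
  shows "\<exists>(N :: cpath measure) (X :: real \<Rightarrow> cpath \<Rightarrow> real).
    prob_space N \<and>
    continuous_process N X \<and>
    converges_in_law M (\<lambda>n. path_of (scaled_median_process B (2 * n + 1))) N (path_of X) \<and>
    gaussian_process N X \<and>
    centered_process N X \<and>
    (\<forall>\<gamma>. 0 < \<gamma> \<and> \<gamma> < 1 / 4 \<longrightarrow> (\<forall>\<omega>\<in>space N. locally_holder \<gamma> (\<lambda>t. X t \<omega>))) \<and>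
    (\<forall>s\<ge>0. \<forall>t\<ge>0.
       integrable N (\<lambda>\<omega>. X s \<omega> * X t \<omega>) \<and>
       (\<integral>\<omega>. X s \<omega> * X t \<omega> \<partial>N) =
         (if s * t = 0 then 0 else sqrt (s * t) * arcsin (min s t / sqrt (s * t))))"
proof -
  interpret brownian_family M B
    using assms by (simp add: brownian_family_def brownian_family_axioms_def)
  obtain Y where Y: "continuous_process M Y"
    "\<And>\<omega> \<gamma>. 0 < \<gamma> \<Longrightarrow> \<gamma> < 1 / 4 \<Longrightarrow> locally_holder \<gamma> (\<lambda>t. Y t \<omega>)"
    "converges_in_law M (\<lambda>n. path_of (scaled_median_process B (2 * n + 1))) M (path_of Y)"
    by (rule converges_to_continuous_limit) (rule that)
  \<comment> \<open>The Hoelder property has to hold at every point of \<open>N\<close>, so the law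
    of \<open>path_of Y\<close> is placed on the set \<open>H\<close> of Hoelder paths with the
    trace of the Borel sets; every path of \<open>Y\<close> lies in \<open>H\<close>. The process is
    then the coordinate process \<open>E\<close>.\<close>
  define H where "H = {p. \<forall>\<gamma>. 0 < \<gamma> \<and> \<gamma> < 1 / 4 \<longrightarrow> locally_holder \<gamma> (Rep_cpath p)}"
  define N where "N = distr M (restrict_space borel H) (path_of Y)"
  define E where "E t p = Rep_cpath p t" for t and p :: cpath
  have holder_cong: "locally_holder \<gamma> f \<longleftrightarrow> locally_holder \<gamma> g" if "\<And>t. 0 \<le> t \<Longrightarrow> f t = g t" for \<gamma> f g
    unfolding locally_holder_def using that by (intro all_cong ex_cong1 ball_cong refl) auto
  have RepY: "Rep_cpath (path_of Y \<omega>) t = Y t \<omega>" if "\<omega> \<in> space M" "0 \<le> t" for \<omega> t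
    using Y(1) that by (intro Rep_path_of) (simp_all add: continuous_process_def)
  have Ym: "path_of Y \<in> measurable M borel" by (rule measurable_path_of[OF Y(1)])
  have YH: "path_of Y \<in> measurable M (restrict_space borel H)"
  proof (rule measurable_restrict_space2[OF _ Ym])
    show "path_of Y \<in> space M \<rightarrow> H"
    proof
      fix \<omega> assume w: "\<omega> \<in> space M"
      have "locally_holder \<gamma> (Rep_cpath (path_of Y \<omega>)) \<longleftrightarrow> locally_holder \<gamma> (\<lambda>t. Y t \<omega>)" for \<gamma>
        by (rule holder_cong) (rule RepY[OF w])
      then show "path_of Y \<omega> \<in> H" unfolding H_def using Y(2) by simp
    qed
  qed
  have N: "prob_space N" unfolding N_def by (rule prob_space_distr[OF YH])
  interpret N: prob_space N by (rule N)
  have meas_N: "f \<in> measurable N S" if "f \<in> measurable borel S" for f :: "cpath \<Rightarrow> 'z" and S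
    using measurable_restrict_space1[OF that, of H] by (simp add: N_def)
  have space_N: "space N = H" by (simp add: N_def space_restrict_space)
  have int_N: "(\<integral>p. f p \<partial>N) = (\<integral>\<omega>. f (path_of Y \<omega>) \<partial>M)" if "f \<in> borel_measurable borel" for f :: "cpath \<Rightarrow> real"
    unfolding N_def by (rule integral_distr[OF YH measurable_restrict_space1[OF that]])
  have path_E: "path_of E = (\<lambda>p. p)"
  proof
    fix p
    have "continuous_on {0..} (\<lambda>t. E t p)" unfolding E_def by (rule continuous_on_Rep_cpath)
    then show "path_of E p = p"
      by (intro cpath_eqI) (subst Rep_path_of, simp_all add: E_def)
  qed
  have cont: "continuous_process N E"
    unfolding continuous_process_def E_def
    by (intro conjI allI impI ballI meas_N borel_measurable_eval_cpath continuous_on_Rep_cpath)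
  have conv: "converges_in_law M (\<lambda>n. path_of (scaled_median_process B (2 * n + 1))) N (path_of E)"
    unfolding converges_in_law_def path_E
  proof (intro conjI allI impI)
    show "path_of (scaled_median_process B (2 * n + 1)) \<in> measurable M borel" for n
      by (rule measurable_path_of[OF continuous_scaled_median])
    show "(\<lambda>p. p) \<in> measurable N borel" by (rule meas_N) simp
    fix F :: "cpath \<Rightarrow> real" assume F: "continuous_on UNIV F \<and> bounded (range F)"
    then have "(\<integral>p. F p \<partial>N) = (\<integral>\<omega>. F (path_of Y \<omega>) \<partial>M)"
      by (intro int_N borel_measurable_continuous_onI) auto
    then show "(\<lambda>n. \<integral>\<omega>. F (path_of (scaled_median_process B (2 * n + 1)) \<omega>) \<partial>M) \<longlonglongrightarrow> (\<integral>p. F p \<partial>N)"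
      using Y(3) F unfolding converges_in_law_def by simp
  qed
  have normal: "normal_rv N (\<lambda>p. \<Sum>t\<in>J. c t * E t p) 0 (\<Sum>s\<in>J. \<Sum>t\<in>J. c s * c t * median_cov s t)"
    if "finite J" "J \<subseteq> {0..}" for J c
    using limit_normal_rv[OF N conv that, of c] by (simp add: path_E E_def)
  have single: "normal_rv N (E t) 0 (median_cov t t)" if "0 \<le> t" for t
    using normal[of "{t}" "\<lambda>_. 1"] that by simp
  have gauss: "gaussian_process N E"
    unfolding gaussian_process_def using normal by blast
  have centered: "centered_process N E"
    unfolding centered_process_def using N.normal_rv_moments[OF single] by simp
  have holder: "\<forall>\<gamma>. 0 < \<gamma> \<and> \<gamma> < 1 / 4 \<longrightarrow> (\<forall>p\<in>space N. locally_holder \<gamma> (\<lambda>t. E t p))"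
    unfolding space_N H_def E_def by simp
  have cov: "integrable N (\<lambda>p. E s p * E t p) \<and> (\<integral>p. E s p * E t p \<partial>N) = median_cov s t"
    if st: "0 \<le> s" "0 \<le> t" for s t
  proof (cases "s = t")
    case True
    then show ?thesis using N.normal_rv_moments(3,4)[OF single[OF st(1)]] by (simp add: power2_eq_square)
  next
    case False
    note ms = N.normal_rv_moments(3,4)[OF single[OF st(1)]] and mt = N.normal_rv_moments(3,4)[OF single[OF st(2)]]
    have "normal_rv N (\<lambda>p. E s p + E t p) 0 (median_cov s s + 2 * median_cov s t + median_cov t t)"
      using normal[of "{s, t}" "\<lambda>_. 1"] st False median_cov_commute[of t s] by (simp add: algebra_simps)
    note mst = N.normal_rv_moments(3,4)[OF this]
    \<comment> \<open>Polarisation: the second moments at single times and of the sum are known, all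
      three being normal.\<close>
    have eq: "E s p * E t p = ((E s p + E t p)\<^sup>2 - (E s p)\<^sup>2 - (E t p)\<^sup>2) / 2" for p
      by (simp add: power2_eq_square algebra_simps)
    show ?thesis unfolding eq using ms mt mst by simp
  qed
  show ?thesis
  proof (intro exI[of _ N] exI[of _ E] conjI N cont conv gauss centered holder allI impI)
    fix s t :: real assume "0 \<le> s" "0 \<le> t"
    note c = cov[OF this]
    show "integrable N (\<lambda>p. E s p * E t p)" using c ..
    show "(\<integral>p. E s p * E t p \<partial>N) = (if s * t = 0 then 0 else sqrt (s * t) * arcsin (min s t / sqrt (s * t)))"
      using c by (simp add: median_cov_def)
  qed
qed

end
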